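(* Let $m\ge 3$, let $M\subset\mathbb{R}^m$ be a closed submanifold of codimension $2$ with framing $\mathcal{F}=(v_1,v_2)$, and let $s:M\longrightarrow S^1$ be a map. Let $u\mathcal{F}=(-v_1,v_2)$, and let $M^{sh}$ be a small shift of $M$ along $v_1$, provided with the framing $s\mathcal{F}=(v_1',v_2')$. Then $$[(M\sqcup M^{sh}),(u\mathcal{F}\sqcup s\mathcal{F})]=\eta_*[Z,\mathcal{F},s]\in\pi_m(S^2),$$ where $M\sqcup M^{sh}$ is considered as a single framed submanifold of $\mathbb{R}^m$ (not as a link of two components).
   Context: All manifolds are smooth. A framing of a codimension-$k$ submanifold of $\mathbb{R}^m$ is an ordered set of $k$ linearly independent normal vector fields. A closed framed submanifold $(N,\mathcal{G})$ of codimension $k$ in $\mathbb{R}^m$ represents, by the Pontryagin-Thom construction, an element $[N,\mathcal{G}]\in\pi_m(S^k)$. $\eta:S^3\to S^2$ is the Hopf map. Reframing: given $s:M\to S^1\cong SO(2)$, represent $s(x)$ by an orthonormal matrix $(a_{ij}(x))$ and set $v_1'(x)=a_{11}(x)v_1(x)+a_{12}(x)v_2(x)$, $v_2'(x)=a_{21}(x)v_1(x)+a_{22}(x)v_2(x)$; then $s\mathcal{F}=(v_1',v_2')$ is a new framing of $M$. The identification $S^1\cong SO(2)$ is such that $e^{i\varphi}$ gives $v_1'=v_1\cos\varphi+v_2\sin\varphi$, $v_2'=-v_1\sin\varphi+v_2\cos\varphi$. The framing $s\mathcal{F}$ is transported to $M^{sh}$ via the natural identification of $M^{sh}$ with $M$.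 Definition of $[Z,\mathcal{F},s]$: up to homotopy $s$ is smooth with regular value $-1\in S^1$; let $Z=s^{-1}(-1)\subset M$, let $v_3$ be the normal vector field of $Z\subset M$ determined by the usual orientation of $S^1$ (via $s$), and put $[Z,\mathcal{F},s]=[Z,(v_1,v_2,v_3)]\in\pi_m(S^3)$. *)

theory Defs
  imports "HOL-Analysis.Analysis"
begin

section \<open>Smooth maps and closed submanifolds of Euclidean space\<close>

primrec Ck_on :: "nat \<Rightarrow> 'a::real_normed_vector set \<Rightarrow> ('a \<Rightarrow> 'b::real_normed_vector) \<Rightarrow> bool" where
  "Ck_on 0 U f \<longleftrightarrow> continuous_on U f"
| "Ck_on (Suc n) U f \<longleftrightarrow> (\<forall>x\<in>U. f differentiable (at x)) \<and>
     (\<forall>v. Ck_on n U (\<lambda>x. frechet_derivative f (at x) v))"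

text \<open>Used for open \<open>U\<close> only.\<close>

definition smooth_on :: "'a::real_normed_vector set \<Rightarrow> ('a \<Rightarrow> 'b::real_normed_vector) \<Rightarrow> bool" where
  "smooth_on U f \<longleftrightarrow> (\<forall>n. Ck_on n U f)"

text \<open>Smoothness of a map defined on a subset \<open>N\<close>: local smooth extendability.\<close>

definition smooth_map_on :: "'a::real_normed_vector set \<Rightarrow> ('a \<Rightarrow> 'b::real_normed_vector) \<Rightarrow> bool" where
  "smooth_map_on N f \<longleftrightarrow>
     (\<forall>p\<in>N. \<exists>U g. open U \<and> p \<in> U \<and> smooth_on U g \<and> (\<forall>x\<in>N \<inter> U. f x = g x))"

text \<open>\<open>closed_submanifold k N\<close>: \<open>N\<close> is a smooth submanifold of codimension \<open>k\<close> without boundary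
  (slice charts) that is compact. It may be empty or disconnected.\<close>

definition closed_submanifold :: "nat \<Rightarrow> 'a::euclidean_space set \<Rightarrow> bool" where
  "closed_submanifold k N \<longleftrightarrow> compact N \<and>
     (\<forall>p\<in>N. \<exists>U V \<phi> \<psi> L.
        open U \<and> p \<in> U \<and> open (V :: 'a set) \<and>
        homeomorphism U V \<phi> \<psi> \<and> smooth_on U \<phi> \<and> smooth_on V \<psi> \<and>
        subspace L \<and> dim L + k = DIM('a) \<and> \<phi> ` (N \<inter> U) = V \<inter> L)"

definition smooth_curve_at :: "'a::real_normed_vector set \<Rightarrow> 'a \<Rightarrow> 'a \<Rightarrow> (real \<Rightarrow> 'a) \<Rightarrow> bool" where
  "smooth_curve_at N p v \<gamma> \<longleftrightarrow> \<gamma> 0 = p \<and> (\<gamma> has_vector_derivative v) (at 0) \<and>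
     (\<exists>e>0. smooth_on {-e<..<e} \<gamma> \<and> \<gamma> ` {-e<..<e} \<subseteq> N)"

definition tangent_space :: "'a::real_normed_vector set \<Rightarrow> 'a \<Rightarrow> 'a set" where
  "tangent_space N p = {v. \<exists>\<gamma>. smooth_curve_at N p v \<gamma>}"

definition normal_space :: "'a::euclidean_space set \<Rightarrow> 'a \<Rightarrow> 'a set" where
  "normal_space N p = orthogonal_comp (tangent_space N p)"

text \<open>The differential at \<open>p\<close> of a smooth map \<open>f\<close> on the submanifold \<open>N\<close>, evaluated on a
  tangent vector \<open>v \<in> tangent_space N p\<close>.\<close>

definition differential ::
  "'a::real_normed_vector set \<Rightarrow> ('a \<Rightarrow> 'b::real_normed_vector) \<Rightarrow> 'a \<Rightarrow> 'a \<Rightarrow> 'b" where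
  "differential N f p v =
     (THE w. \<forall>\<gamma>. smooth_curve_at N p v \<gamma> \<longrightarrow> ((f \<circ> \<gamma>) has_vector_derivative w) (at 0))"


section \<open>Framings\<close>

text \<open>A framing assigns to \<open>p \<in> N\<close> an ordered tuple \<open>g p $ i\<close> of linearly independent normal
  vectors. Only continuity is required, because the reframing by a continuous map to the circle
  has to be a framing again.\<close>

definition framing :: "'a::euclidean_space set \<Rightarrow> ('a \<Rightarrow> 'a ^ 'k) \<Rightarrow> bool" where
  "framing N g \<longleftrightarrow> continuous_on N g \<and>
     (\<forall>p\<in>N. (\<forall>i. g p $ i \<in> normal_space N p) \<and>
            (\<forall>c :: real ^ 'k. (\<Sum>i\<in>UNIV. (c $ i) *\<^sub>R (g p $ i)) = 0 \<longrightarrow> c = 0))"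

definition framed_closed_submanifold :: "'a::euclidean_space set \<Rightarrow> ('a \<Rightarrow> 'a ^ 'k) \<Rightarrow> bool" where
  "framed_closed_submanifold N g \<longleftrightarrow> closed_submanifold CARD('k) N \<and> framing N g"


section \<open>Homotopy groups of spheres\<close>

text \<open>For a Euclidean space \<open>'a\<close> of dimension \<open>m\<close>, the sphere of dimension \<open>m\<close> is the unit sphere
  of \<open>'a \<times> real\<close>, with base point the north pole. It is identified with the one-point
  compactification of \<open>'a\<close> by stereographic projection from the north pole, so that the north pole
  is the point at infinity.\<close>

definition north :: "'a::euclidean_space \<times> real" where
  "north = (0, 1)"

definition stereo :: "'a::euclidean_space \<times> real \<Rightarrow> 'a" where
  "stereo z = fst z /\<^sub>R (1 - snd z)"

definition stereo_inv :: "'a::euclidean_space \<Rightarrow> 'a \<times> real" where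
  "stereo_inv x = ((2 / ((norm x)\<^sup>2 + 1)) *\<^sub>R x, ((norm x)\<^sup>2 - 1) / ((norm x)\<^sup>2 + 1))"

definition pointed_homotopic ::
  "('a::euclidean_space \<times> real \<Rightarrow> 'b::euclidean_space \<times> real) \<Rightarrow> ('a \<times> real \<Rightarrow> 'b \<times> real) \<Rightarrow> bool" where
  "pointed_homotopic =
     homotopic_with_canon (\<lambda>h. h north = north) (sphere 0 1) (sphere 0 1)"

definition homotopy_class ::
  "('a::euclidean_space \<times> real \<Rightarrow> 'b::euclidean_space \<times> real) \<Rightarrow> ('a \<times> real \<Rightarrow> 'b \<times> real) set" where
  "homotopy_class f = {g. pointed_homotopic f g}"

text \<open>The underlying set of the homotopy group of degree \<open>DIM('a)\<close> of the sphere of dimension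
  \<open>DIM('b)\<close>.\<close>

definition sphere_homotopy_group ::
  "('a::euclidean_space \<times> real \<Rightarrow> 'b::euclidean_space \<times> real) set set" where
  "sphere_homotopy_group =
     {homotopy_class f | f. continuous_on (sphere 0 1) f \<and> f ` sphere 0 1 \<subseteq> sphere 0 1 \<and> f north = north}"

definition induced_map ::
  "('b::euclidean_space \<times> real \<Rightarrow> 'c::euclidean_space \<times> real) \<Rightarrow>
   ('a::euclidean_space \<times> real \<Rightarrow> 'b \<times> real) set \<Rightarrow> ('a \<times> real \<Rightarrow> 'c \<times> real) set" where
  "induced_map h c = (THE d. \<exists>f\<in>c. d = homotopy_class (h \<circ> f))"

text \<open>The Hopf map \<open>(z, w) \<mapsto> [z : w]\<close> from the unit sphere of \<open>\<complex>\<^sup>2\<close> to the Riemann sphere; the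
  formula is \<open>stereo_inv (w / z)\<close> cleared of denominators. Stereographic projection from the north
  pole carries the boundary orientation of the unit sphere of
  \<open>\<real>\<^sup>3 \<times> \<real> = \<complex>\<^sup>2\<close> to the standard orientation of \<open>\<real>\<^sup>3\<close>, so this is the standard
  generator, of Hopf invariant \<open>+1\<close>; the sign matters, since precomposing with a reflection of the
  domain would negate it.\<close>

definition hopf :: "(real ^ 3) \<times> real \<Rightarrow> (real ^ 2) \<times> real" where
  "hopf = (\<lambda>(x, t). let z = Complex (x $ 1) (x $ 2); w = Complex (x $ 3) t; q = 2 * w * cnj z
                   in (vector [Re q, Im q], (cmod w)\<^sup>2 - (cmod z)\<^sup>2))"


section \<open>The Pontryagin--Thom construction\<close>

definition tubular_map :: "('a::euclidean_space \<Rightarrow> 'a ^ 'k) \<Rightarrow> 'a \<times> (real ^ 'k) \<Rightarrow> 'a" where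
  "tubular_map g = (\<lambda>(p, t). p + (\<Sum>i\<in>UNIV. (t $ i) *\<^sub>R (g p $ i)))"

definition tubular_radius :: "'a::euclidean_space set \<Rightarrow> ('a \<Rightarrow> 'a ^ 'k) \<Rightarrow> real \<Rightarrow> bool" where
  "tubular_radius N g r \<longleftrightarrow> r > 0 \<and> inj_on (tubular_map g) (N \<times> ball 0 r)"

text \<open>The collapse map: on the tube of radius \<open>r\<close>, the fibre coordinate \<open>t \<in> ball 0 r\<close> is sent to
  the point \<open>t /\<^sub>R (r - norm t)\<close> of \<open>\<real>\<^sup>k\<close>; everything else goes to infinity.\<close>

definition collapse_map ::
  "'a::euclidean_space set \<Rightarrow> ('a \<Rightarrow> 'a ^ 'k) \<Rightarrow> real \<Rightarrow> 'a \<times> real \<Rightarrow> (real ^ 'k) \<times> real" where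
  "collapse_map N g r z =
     (if z \<noteq> north \<and> stereo z \<in> tubular_map g ` (N \<times> ball 0 r)
      then let t = snd (inv_into (N \<times> ball 0 r) (tubular_map g) (stereo z))
           in stereo_inv (t /\<^sub>R (r - norm t))
      else north)"

text \<open>The class \<open>[N, g]\<close>, the common class of the collapse maps of all tubes. For a continuous
  normal framing of a closed submanifold, tubes exist, since the vectors \<open>g p $ i\<close> span the normal
  space.\<close>

definition pontryagin_class ::
  "'a::euclidean_space set \<Rightarrow> ('a \<Rightarrow> 'a ^ 'k) \<Rightarrow> ('a \<times> real \<Rightarrow> (real ^ 'k) \<times> real) set" where
  "pontryagin_class N g = (THE c. \<exists>r. tubular_radius N g r \<and> c = homotopy_class (collapse_map N g r))"


section \<open>Reframing and the shifted copy\<close>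

definition reflect_framing :: "('a::euclidean_space \<Rightarrow> 'a ^ 2) \<Rightarrow> 'a \<Rightarrow> 'a ^ 2" where
  "reflect_framing F x = vector [- (F x $ 1), F x $ 2]"

definition reframe :: "('a::euclidean_space \<Rightarrow> complex) \<Rightarrow> ('a \<Rightarrow> 'a ^ 2) \<Rightarrow> 'a \<Rightarrow> 'a ^ 2" where
  "reframe s F x = vector [  Re (s x) *\<^sub>R (F x $ 1) + Im (s x) *\<^sub>R (F x $ 2),
                           - Im (s x) *\<^sub>R (F x $ 1) + Re (s x) *\<^sub>R (F x $ 2)]"

definition shift :: "('a::euclidean_space \<Rightarrow> 'a ^ 2) \<Rightarrow> real \<Rightarrow> 'a \<Rightarrow> 'a" where
  "shift F \<epsilon> x = x + \<epsilon> *\<^sub>R (F x $ 1)"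

text \<open>Transport of normal fields along a diffeomorphism \<open>h : M \<rightarrow> h ` M\<close> close to the identity: the
  vectors at \<open>x\<close> need not be exactly normal to \<open>h ` M\<close> at \<open>h x\<close>, so they are projected
  orthogonally to its normal space.\<close>

definition transport_framing ::
  "('a::euclidean_space \<Rightarrow> 'a) \<Rightarrow> 'a set \<Rightarrow> ('a \<Rightarrow> 'a ^ 'k) \<Rightarrow> 'a \<Rightarrow> 'a ^ 'k" where
  "transport_framing h M g y =
     (\<chi> i. closest_point (normal_space (h ` M) y) (g (inv_into M h y) $ i))"

definition union_framing :: "'a set \<Rightarrow> ('a \<Rightarrow> 'a ^ 'k) \<Rightarrow> ('a \<Rightarrow> 'a ^ 'k) \<Rightarrow> 'a \<Rightarrow> 'a ^ 'k" where
  "union_framing M g g' y = (if y \<in> M then g y else g' y)"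


section \<open>The class of a framed submanifold with a map to the circle\<close>

definition regular_representative ::
  "'a::euclidean_space set \<Rightarrow> ('a \<Rightarrow> complex) \<Rightarrow> ('a \<Rightarrow> complex) \<Rightarrow> bool" where
  "regular_representative M s s' \<longleftrightarrow>
     homotopic_with_canon (\<lambda>_. True) M (sphere 0 1) s s' \<and> smooth_map_on M s' \<and>
     (\<forall>x\<in>M. s' x = -1 \<longrightarrow>
        differential M s' x ` tangent_space M x = tangent_space (sphere 0 1) (-1))"

definition preimage_of_minus_one :: "'a set \<Rightarrow> ('a \<Rightarrow> complex) \<Rightarrow> 'a set" where
  "preimage_of_minus_one M s = {x \<in> M. s x = -1}"

text \<open>The normal field of \<open>Z \<subset> M\<close>: the tangent vector of \<open>M\<close> normal to \<open>Z\<close> that \<open>s\<close> maps to the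
  counterclockwise unit tangent vector \<open>\<i> * s x\<close> of the circle.\<close>

definition circle_normal :: "'a::euclidean_space set \<Rightarrow> ('a \<Rightarrow> complex) \<Rightarrow> 'a \<Rightarrow> 'a" where
  "circle_normal M s x =
     (THE v. v \<in> tangent_space M x \<and> v \<in> normal_space (preimage_of_minus_one M s) x \<and>
             differential M s x v = \<i> * s x)"

text \<open>The class \<open>[Z, F, s]\<close>, the common value for all regular representatives \<open>s'\<close> of the
  homotopy class of \<open>s\<close>.\<close>

definition circle_class ::
  "'a::euclidean_space set \<Rightarrow> ('a \<Rightarrow> 'a ^ 2) \<Rightarrow> ('a \<Rightarrow> complex) \<Rightarrow>
   ('a \<times> real \<Rightarrow> (real ^ 3) \<times> real) set" where
  "circle_class M F s =
     (THE c. \<exists>s'. regular_representative M s s' \<and>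
        c = pontryagin_class (preimage_of_minus_one M s')
              (\<lambda>x. vector [F x $ 1, F x $ 2, circle_normal M s' x]))"

end

theory Submission imports Defs begin

text \<open>Both sides of the identity are computed from one map \<open>V\<close> of the sphere of dimension \<open>m\<close> to the three-sphere. The
  right-hand side is the class of \<open>\<eta> \<circ> V\<close> because \<open>V\<close> represents \<open>[Z, F, s]\<close>, and the left-hand side is the class of
  \<open>\<eta> \<circ> V\<close> because \<open>\<eta> \<circ> V\<close> is a collapse map of the double up to homotopy.

  Write the points of a tube around \<open>M\<close> as \<open>p + t\<^sub>1 v\<^sub>1(p) + t\<^sub>2 v\<^sub>2(p)\<close>, put \<open>u = t\<^sub>1 + \<i> t\<^sub>2 - h\<close> and let the distance of the two copies
  be \<open>2 h\<close>, so that \<open>u\<close> is \<open>-h\<close> on \<open>M\<close> and \<open>h\<close> on the shifted copy. Near these copies the map \<open>V\<close> is the normalisation of \<open>(\<i> z, \<i> w)\<close> with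
  \<open>w = cnj (u + h) (u - h)\<close> and \<open>z = (1 + s(p)) / 2 - (Re u / (2 h)) (1 - s(p))\<close>; away from them it is deformed to the
  constant map at the boundary of the tube. The horizontal part of \<open>\<eta> \<circ> V\<close> is a positive multiple of
  \<open>w cnj z\<close>, and the preimage of the south pole is \<open>w = 0\<close>. This consists of the two copies. At \<open>u = -h\<close> one has \<open>z = 1\<close> and
  \<open>w\<close> behaves like \<open>- 2 h cnj (u + h)\<close>, a positive multiple of the coordinate in the framing \<open>(-v\<^sub>1, v\<^sub>2)\<close>; at \<open>u = h\<close> one has
  \<open>z = s\<close> and \<open>w cnj z\<close> behaves like \<open>2 h cnj s (u - h)\<close>, a positive multiple of the coordinate in the framing rotated by \<open>s\<close> (\<open>double_collapse\<close>). On the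
  other hand, \<open>V\<close> itself is the south pole where \<open>z = 0\<close> and \<open>w < 0\<close>, that is, where \<open>u = 0\<close> and \<open>s = -1\<close>. If
  the centre \<open>u = 0\<close> is moved to \<open>M\<close>, this is the submanifold \<open>Z\<close>, and up to a rotation of the three-sphere the
  derivative of \<open>V\<close> across \<open>Z\<close> is that of the collapse of \<open>(v\<^sub>1, v\<^sub>2, v\<^sub>3)\<close> (\<open>level_set_collapse\<close>). Moving the centre and deforming
  \<open>s\<close> do not change the class of \<open>V\<close> (\<open>tube_lift_homotopic\<close>).

  Homotopies between maps of spheres are produced by a direct criterion: if two pointed maps have the same
  preimage of the south pole, and near it their horizontal parts point nowhere in opposite directions, then
  they are homotopic (\<open>pointed_homotopic_criterion\<close>, \<open>collapse_map_criterion\<close>). The directions are compared by first order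
  estimates in the fibre coordinates (\<open>fibre_comparison\<close>), which rest on one fact on a compact submanifold: it leaves its
  tangent planes to second order, and its normal spaces turn at a bounded rate (\<open>submanifold_estimates\<close>). The same estimates
  provide tubes (\<open>tubular_radius_exists\<close>) and show that the framing can be transported to the shifted
  copy (\<open>shifted_copy\<close>).

  It remains to see that a representative of \<open>s\<close> with regular value \<open>-1\<close> exists. A smooth approximation of
  \<open>s\<close> is multiplied by \<open>cis (a \<bullet> x)\<close> and a constant of modulus \<open>1\<close>; counting dimensions, the parameters
  for which \<open>-1\<close> is a critical value form a set of measure zero (\<open>regular_representative_exists\<close>).\<close>

section \<open>Pointed maps between spheres\<close>

definition pointed_map :: "('a::euclidean_space \<times> real \<Rightarrow> 'b::euclidean_space \<times> real) \<Rightarrow> bool" where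
  "pointed_map f \<longleftrightarrow>
     continuous_on (sphere 0 1) f \<and> f ` sphere 0 1 \<subseteq> sphere 0 1 \<and> f north = north"

definition south :: "'a::euclidean_space \<times> real" where
  "south = (0, -1)"

lemma north_in_sphere [simp]: "north \<in> sphere 0 1"
  by (simp add: north_def norm_Pair)

lemma pointed_map_in_sphere: "pointed_map f \<Longrightarrow> x \<in> sphere 0 1 \<Longrightarrow> f x \<in> sphere 0 1"
  unfolding pointed_map_def by blast

lemma norm_north [simp]: "norm north = 1"
  by (simp add: north_def norm_Pair)

lemma pointed_homotopicI:
  fixes f g :: "'a::euclidean_space \<times> real \<Rightarrow> 'b::euclidean_space \<times> real"
    and h :: "real \<times> 'a \<times> real \<Rightarrow> 'b \<times> real"
  assumes cont: "continuous_on ({0..1} \<times> sphere 0 1) h"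
    and sph: "\<And>\<tau> x. \<tau> \<in> {0..1} \<Longrightarrow> x \<in> sphere 0 1 \<Longrightarrow> h (\<tau>, x) \<in> sphere 0 1"
    and "\<And>\<tau>. \<tau> \<in> {0..1} \<Longrightarrow> h (\<tau>, north) = north"
    and "\<And>x. x \<in> sphere 0 1 \<Longrightarrow> h (0, x) = f x"
    and "\<And>x. x \<in> sphere 0 1 \<Longrightarrow> h (1, x) = g x"
  shows "pointed_homotopic f g"
  unfolding pointed_homotopic_def
proof (subst homotopic_with)
  show "\<exists>h. continuous_map (prod_topology (top_of_set {0..1::real}) (top_of_set (sphere 0 1))) (top_of_set (sphere 0 1)) h \<and>
        (\<forall>x\<in>topspace (top_of_set (sphere 0 1)). h (0, x) = f x) \<and>
        (\<forall>x\<in>topspace (top_of_set (sphere 0 1)). h (1, x) = g x) \<and>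
        (\<forall>t\<in>{0..1}. h (t, north) = north)"
    by (rule exI[of _ h]) (use assms in \<open>simp add: image_subset_iff Pi_iff\<close>)
qed (use north_in_sphere in \<open>metis topspace_euclidean_subtopology\<close>)

lemma pointed_homotopic_refl: "pointed_map f \<Longrightarrow> pointed_homotopic f f"
  by (auto simp: pointed_homotopic_def pointed_map_def)

lemma pointed_homotopic_sym: "pointed_homotopic f g \<Longrightarrow> pointed_homotopic g f"
  unfolding pointed_homotopic_def by (rule homotopic_with_symD)

lemma pointed_homotopic_trans:
  "pointed_homotopic f g \<Longrightarrow> pointed_homotopic g h \<Longrightarrow> pointed_homotopic f h"
  unfolding pointed_homotopic_def by (rule homotopic_with_trans)

lemma homotopy_class_eqI: "pointed_homotopic f g \<Longrightarrow> homotopy_class f = homotopy_class g"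
  unfolding homotopy_class_def using pointed_homotopic_sym pointed_homotopic_trans by blast

lemma pointed_homotopic_compose_left:
  assumes "pointed_homotopic f g" "pointed_map h"
  shows "pointed_homotopic (h \<circ> f) (h \<circ> g)"
proof -
  have "homotopic_with (\<lambda>k. k north = north) (top_of_set (sphere 0 1)) (top_of_set (sphere 0 1)) (h \<circ> f) (h \<circ> g)"
    by (rule homotopic_with_compose_continuous_map_left[where p = "\<lambda>k. k north = north"
          and ?X2.0 = "top_of_set (sphere 0 1)"])
      (use assms in \<open>auto simp: pointed_homotopic_def pointed_map_def\<close>)
  then show ?thesis by (simp add: pointed_homotopic_def)
qed

lemma induced_map_homotopy_class:
  assumes "pointed_map f" "pointed_map h"
  shows "induced_map h (homotopy_class f) = homotopy_class (h \<circ> f)"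
  unfolding induced_map_def
proof (rule the_equality)
  show "\<exists>g\<in>homotopy_class f. homotopy_class (h \<circ> f) = homotopy_class (h \<circ> g)"
    using pointed_homotopic_refl[OF assms(1)] by (auto simp: homotopy_class_def)
next
  fix d assume "\<exists>g\<in>homotopy_class f. d = homotopy_class (h \<circ> g)"
  then show "d = homotopy_class (h \<circ> f)"
    using homotopy_class_eqI pointed_homotopic_compose_left[OF _ assms(2)]
    by (auto simp: homotopy_class_def)
qed

text \<open>The values of a homotopy matter only up to positive factors, so a homotopy of maps
  into the complement of the origin suffices.\<close>

lemma pointed_homotopic_sgn:
  fixes h :: "real \<times> 'a::euclidean_space \<times> real \<Rightarrow> 'b::euclidean_space \<times> real"
  assumes cont: "continuous_on ({0..1} \<times> sphere 0 1) h"
    and nz: "\<And>\<tau> x. \<tau> \<in> {0..1} \<Longrightarrow> x \<in> sphere 0 1 \<Longrightarrow> h (\<tau>, x) \<noteq> 0"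
    and north: "\<And>\<tau>. \<tau> \<in> {0..1} \<Longrightarrow> \<exists>c>0. h (\<tau>, north) = c *\<^sub>R north"
    and "\<And>x. x \<in> sphere 0 1 \<Longrightarrow> sgn (h (0, x)) = f x"
    and "\<And>x. x \<in> sphere 0 1 \<Longrightarrow> sgn (h (1, x)) = g x"
  shows "pointed_homotopic f g"
proof (rule pointed_homotopicI[where h = "\<lambda>z. sgn (h z)"])
  show "continuous_on ({0..1} \<times> sphere 0 1) (\<lambda>z. sgn (h z))"
    by (intro continuous_intros cont) (use nz in auto)
  fix \<tau> :: real assume \<tau>: "\<tau> \<in> {0..1}"
  show "sgn (h (\<tau>, north)) = north"
    using north[OF \<tau>] by (auto simp: sgn_scaleR sgn_div_norm)
  show "sgn (h (\<tau>, x)) \<in> sphere 0 1" if "x \<in> sphere 0 1" for x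
    using nz[OF \<tau> that] by (simp add: norm_sgn)
qed (use assms in auto)

lemma sphere_eq_south_iff:
  assumes "z \<in> sphere 0 1" shows "z = south \<longleftrightarrow> snd z = -1" "z = south \<longleftrightarrow> fst z = 0 \<and> snd z < 0"
proof -
  have 1: "(norm (fst z))\<^sup>2 + (snd z)\<^sup>2 = 1"
    using assms by (cases z) (simp add: norm_Pair)
  show "z = south \<longleftrightarrow> snd z = -1"
    using 1 by (cases z) (auto simp: south_def)
  have "fst z = 0 \<Longrightarrow> snd z < 0 \<Longrightarrow> snd z = -1"
    using 1 by (auto simp: power2_eq_1_iff)
  then show "z = south \<longleftrightarrow> fst z = 0 \<and> snd z < 0"
    by (cases z) (auto simp: south_def)
qed

text \<open>Moving the unit sphere upwards by less than its radius does not make it meet the origin.\<close>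

lemma pointed_homotopic_raise:
  assumes f: "pointed_map f" and c: "0 \<le> c" "c < 1"
  shows "pointed_homotopic f (\<lambda>x. sgn (fst (f x), snd (f x) + c))"
proof (rule pointed_homotopic_sgn[where h = "\<lambda>(\<tau>, x). (fst (f x), snd (f x) + \<tau> * c)"])
  have cf: "continuous_on ({0..1} \<times> sphere 0 1) (\<lambda>z::real \<times> _. f (snd z))"
    using f by (intro continuous_on_compose2[where f = snd and g = f and t = "sphere 0 1"])
      (auto simp: pointed_map_def intro: continuous_intros)
  then show "continuous_on ({0..1} \<times> sphere 0 1) (\<lambda>(\<tau>, x). (fst (f x), snd (f x) + \<tau> * c))"
    unfolding case_prod_unfold by (intro continuous_intros)
next
  fix \<tau> :: real and x :: "'a \<times> real" assume \<tau>: "\<tau> \<in> {0..1}" and x: "x \<in> sphere 0 1"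
  have "norm (f x) = 1" using pointed_map_in_sphere[OF f x] by simp
  then have n: "(norm (fst (f x)))\<^sup>2 + (snd (f x))\<^sup>2 = 1" by (cases "f x") (simp add: norm_Pair)
  have "\<tau> * c \<le> 1 * c" using \<tau> c by (intro mult_right_mono) auto
  then have "\<tau> * c < 1" "0 \<le> \<tau> * c" using c \<tau> by auto
  then show "(case (\<tau>, x) of (\<tau>, x) \<Rightarrow> (fst (f x), snd (f x) + \<tau> * c)) \<noteq> 0"
    using n by (auto simp: power2_eq_1_iff prod_eq_iff)
next
  fix \<tau> :: real assume \<tau>: "\<tau> \<in> {0..1}"
  show "\<exists>d>0. (case (\<tau>, north) of (\<tau>, x) \<Rightarrow> (fst (f x), snd (f x) + \<tau> * c)) = d *\<^sub>R north"
    using f \<tau> c by (intro exI[of _ "1 + \<tau> * c"]) (auto simp: pointed_map_def north_def add_pos_nonneg)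
next
  fix x :: "'a \<times> real" assume "x \<in> sphere 0 1"
  then show "sgn (case (0, x) of (\<tau>, x) \<Rightarrow> (fst (f x), snd (f x) + \<tau> * c)) = f x"
    using pointed_map_in_sphere[OF f, of x] by (simp add: sgn_div_norm)
qed auto

text \<open>Two maps whose values are
  antipodal nowhere are joined by the normalised straight line. Pushing the values upwards, towards
  the north pole, makes everything outside a neighbourhood of the preimage of the south pole land in the
  upper half space, where nothing is antipodal; so only the values near that preimage have to be
  compared, and there only their horizontal directions matter. This criterion does here what
  transversality and framed cobordism do in the usual treatment of the Pontryagin--Thom construction.\<close>

proposition pointed_homotopic_criterion:
  fixes f g :: "'a::euclidean_space \<times> real \<Rightarrow> 'b::euclidean_space \<times> real"
  assumes f: "pointed_map f" and g: "pointed_map g"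
    and same: "\<And>z. z \<in> sphere 0 1 \<Longrightarrow> f z = south \<longleftrightarrow> g z = south"
    and W: "openin (top_of_set (sphere 0 1)) W"
    and sub: "\<And>z. z \<in> sphere 0 1 \<Longrightarrow> f z = south \<Longrightarrow> z \<in> W"
    and dir: "\<And>z k. z \<in> W \<Longrightarrow> k > 0 \<Longrightarrow> fst (f z) = - (k *\<^sub>R fst (g z)) \<Longrightarrow> fst (f z) = 0"
  shows "pointed_homotopic f g"
proof -
  have fs: "\<And>z. z \<in> sphere 0 1 \<Longrightarrow> f z \<in> sphere 0 1" and gs: "\<And>z. z \<in> sphere 0 1 \<Longrightarrow> g z \<in> sphere 0 1"
    using f g by (blast intro: pointed_map_in_sphere)+
  have cf: "continuous_on (sphere 0 1) f" and cg: "continuous_on (sphere 0 1) g"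
    using f g by (auto simp: pointed_map_def)
  have nf: "(norm (fst (f z)))\<^sup>2 + (snd (f z))\<^sup>2 = 1" if "z \<in> sphere 0 1" for z
    using fs[OF that] by (cases "f z") (simp add: norm_Pair)
  have ng: "(norm (fst (g z)))\<^sup>2 + (snd (g z))\<^sup>2 = 1" if "z \<in> sphere 0 1" for z
    using gs[OF that] by (cases "g z") (simp add: norm_Pair)
  define K where "K = sphere 0 1 - W"
  have "compact K"
    unfolding K_def using W by (metis closedin_compact closedin_diff closedin_subtopology_refl compact_sphere topspace_euclidean topspace_euclidean_subtopology closedin_topspace)
  \<comment> \<open>outside \<open>W\<close> both heights stay away from \<open>-1\<close>\<close>
  have "\<exists>c. 0 \<le> c \<and> c < 1 \<and> (\<forall>z\<in>K. - c < snd (f z) \<and> - c < snd (g z))"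
  proof (cases "K = {}")
    case False
    have "continuous_on K (\<lambda>z. min (snd (f z)) (snd (g z)))"
      using cf cg by (auto simp: K_def intro!: continuous_intros elim: continuous_on_subset)
    from continuous_attains_inf[OF \<open>compact K\<close> False this]
    obtain z0 where z0: "z0 \<in> K" "\<And>z. z \<in> K \<Longrightarrow> min (snd (f z0)) (snd (g z0)) \<le> min (snd (f z)) (snd (g z))"
      by blast
    have z0S: "z0 \<in> sphere 0 1" "z0 \<notin> W" using z0 by (auto simp: K_def)
    then have "f z0 \<noteq> south" "g z0 \<noteq> south" using sub same by blast+
    then have "snd (f z0) \<noteq> -1" "snd (g z0) \<noteq> -1"
      using sphere_eq_south_iff(1) fs gs z0S by blast+
    moreover have "-1 \<le> snd (f z0)" "-1 \<le> snd (g z0)"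
      using nf[OF z0S(1)] ng[OF z0S(1)] abs_le_square_iff[of "snd (f z0)" 1] abs_le_square_iff[of "snd (g z0)" 1]
      by (auto simp: abs_le_iff) (smt (verit) zero_le_power2)+
    ultimately have m: "-1 < min (snd (f z0)) (snd (g z0))" by auto
    define m where "m = min (snd (f z0)) (snd (g z0))"
    \<comment> \<open>the midpoint of \<open>-m\<close> and \<open>1\<close>\<close>
    define c where "c = max 0 ((1 - m) / 2)"
    have "0 \<le> c" "c < 1" "- c < m" using m by (auto simp: c_def m_def[symmetric] max_def field_simps)
    moreover have "m \<le> snd (f z) \<and> m \<le> snd (g z)" if "z \<in> K" for z
      using z0(2)[OF that] unfolding m_def by linarith
    ultimately show ?thesis by (intro exI[of _ c]) force
  qed (auto intro: exI[of _ 0])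
  then obtain c where c: "0 \<le> c" "c < 1" "\<And>z. z \<in> K \<Longrightarrow> - c < snd (f z) \<and> - c < snd (g z)" by blast
  define f' where "f' x = (fst (f x), snd (f x) + c)" for x
  define g' where "g' x = (fst (g x), snd (g x) + c)" for x
  have "pointed_homotopic (\<lambda>x. sgn (f' x)) (\<lambda>x. sgn (g' x))"
  proof (rule pointed_homotopic_sgn[where h = "\<lambda>(\<tau>, x). (1 - \<tau>) *\<^sub>R f' x + \<tau> *\<^sub>R g' x"])
    have "continuous_on ({0..1} \<times> sphere 0 1) (\<lambda>z::real \<times> _. f (snd z))"
        "continuous_on ({0..1} \<times> sphere 0 1) (\<lambda>z::real \<times> _. g (snd z))"
      by (rule continuous_on_compose2[where f = snd and t = "sphere 0 1"], rule cf cg; auto intro: continuous_intros)+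
    then show "continuous_on ({0..1} \<times> sphere 0 1) (\<lambda>(\<tau>, x). (1 - \<tau>) *\<^sub>R f' x + \<tau> *\<^sub>R g' x)"
      unfolding case_prod_unfold f'_def g'_def by (intro continuous_intros)
  next
    fix \<tau> :: real and x :: "'a \<times> real" assume \<tau>: "\<tau> \<in> {0..1}" and x: "x \<in> sphere 0 1"
    have ncancel: "fst (f x) = 0 \<and> snd (f x) + c = - (k * (snd (g x) + c)) \<Longrightarrow> fst (g x) = 0 \<Longrightarrow> k > 0 \<Longrightarrow> False" for k
    proof -
      assume a: "fst (f x) = 0 \<and> snd (f x) + c = - (k * (snd (g x) + c))" "fst (g x) = 0" "k > 0"
      then have "snd (f x) = 1 \<or> snd (f x) = -1" "snd (g x) = 1 \<or> snd (g x) = -1"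
        using nf[OF x] ng[OF x] by (auto simp: power2_eq_1_iff)
      moreover have "snd (f x) = -1 \<longleftrightarrow> snd (g x) = -1"
        using same[OF x] sphere_eq_south_iff(1) fs gs x by blast
      moreover have "k * (1 + c) > 0" "k * (c - 1) < 0"
        using a(3) c by (auto simp: mult_less_0_iff)
      moreover have "(1 - c) * (1 + k) > 0" using a(3) c by (intro mult_pos_pos) auto
      ultimately show False using a c by (auto simp: algebra_simps)
    qed
    have "f' x \<noteq> - (k *\<^sub>R g' x)" if "k > 0" for k
    proof
      assume e: "f' x = - (k *\<^sub>R g' x)"
      then have e1: "fst (f x) = - (k *\<^sub>R fst (g x))" and e2: "snd (f x) + c = - (k * (snd (g x) + c))"
        by (auto simp: f'_def g'_def prod_eq_iff)
      show False
      proof (cases "x \<in> W")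
        case True
        then have "fst (f x) = 0" using dir that e1 by blast
        then show False using ncancel[of k] e1 e2 that by auto
      next
        case False
        then have "0 < snd (f x) + c" "0 < snd (g x) + c" using c(3)[of x] x by (auto simp: K_def)
        then show False using e2 that by (smt (verit) mult_pos_pos)
      qed
    qed
    moreover have "f' x \<noteq> 0" "g' x \<noteq> 0"
      using nf[OF x] ng[OF x] c by (auto simp: f'_def g'_def prod_eq_iff power2_eq_1_iff)
    ultimately have "(1 - \<tau>) *\<^sub>R f' x + \<tau> *\<^sub>R g' x \<noteq> 0"
    proof (cases "\<tau> = 0 \<or> \<tau> = 1")
      case False
      then have "\<tau> > 0" "\<tau> < 1" using \<tau> by auto
      show ?thesis
      proof
        assume "(1 - \<tau>) *\<^sub>R f' x + \<tau> *\<^sub>R g' x = 0"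
        then have "(1 - \<tau>) *\<^sub>R f' x = - (\<tau> *\<^sub>R g' x)" by (simp add: eq_neg_iff_add_eq_0)
        then have "inverse (1 - \<tau>) *\<^sub>R ((1 - \<tau>) *\<^sub>R f' x) = inverse (1 - \<tau>) *\<^sub>R (- (\<tau> *\<^sub>R g' x))" by simp
        then have "f' x = - ((\<tau> / (1 - \<tau>)) *\<^sub>R g' x)" using \<open>\<tau> < 1\<close> by (simp add: divide_inverse mult.commute)
        then show False using \<open>\<And>k. k > 0 \<Longrightarrow> f' x \<noteq> - (k *\<^sub>R g' x)\<close>[of "\<tau> / (1 - \<tau>)"] \<open>\<tau> > 0\<close> \<open>\<tau> < 1\<close> by simp
      qed
    qed auto
    then show "(case (\<tau>, x) of (\<tau>, x) \<Rightarrow> (1 - \<tau>) *\<^sub>R f' x + \<tau> *\<^sub>R g' x) \<noteq> 0" by simp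
  next
    fix \<tau> :: real assume \<tau>: "\<tau> \<in> {0..1}"
    have "f' north = (1 + c) *\<^sub>R north" "g' north = (1 + c) *\<^sub>R north"
      using f g by (auto simp: f'_def g'_def pointed_map_def north_def)
    then have "(1 - \<tau>) *\<^sub>R f' north + \<tau> *\<^sub>R g' north = (1 + c) *\<^sub>R north"
      by (simp add: algebra_simps)
    then show "\<exists>d>0. (case (\<tau>, north) of (\<tau>, x) \<Rightarrow> (1 - \<tau>) *\<^sub>R f' x + \<tau> *\<^sub>R g' x) = d *\<^sub>R north"
      using c by (intro exI[of _ "1 + c"]) auto
  qed auto
  then show ?thesis
    using pointed_homotopic_raise[OF f c(1,2)] pointed_homotopic_raise[OF g c(1,2)]
      pointed_homotopic_trans pointed_homotopic_sym unfolding f'_def g'_def by blast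
qed

section \<open>Calculus of smooth maps\<close>

lemma Ck_on_cong:
  assumes "open U" "\<And>x. x \<in> U \<Longrightarrow> f x = g x" "Ck_on n U f"
  shows "Ck_on n U g"
  using assms(2,3)
proof (induction n arbitrary: f g)
  case 0 then show ?case using continuous_on_eq by auto
next
  case (Suc n)
  have D: "f differentiable (at x)" if "x \<in> U" for x using Suc.prems that by simp
  have Dg: "g differentiable (at x)" "frechet_derivative g (at x) = frechet_derivative f (at x)" if "x \<in> U" for x
  proof -
    have "(f has_derivative frechet_derivative f (at x)) (at x)"
      using D[OF that] by (simp add: frechet_derivative_works)
    then have "(g has_derivative frechet_derivative f (at x)) (at x)"
      by (rule has_derivative_transform_within_open[OF _ assms(1) that]) (use Suc.prems in auto)
    then show "g differentiable (at x)" "frechet_derivative g (at x) = frechet_derivative f (at x)"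
      by (auto simp: differentiable_def dest: frechet_derivative_at)
  qed
  have "Ck_on n U (\<lambda>x. frechet_derivative g (at x) v)" for v
    by (rule Suc.IH[of "\<lambda>x. frechet_derivative f (at x) v"]) (use Dg Suc.prems in auto)
  then show ?case using Dg by simp
qed

text \<open>An explicit formula for the derivative on \<open>U\<close> takes the place of \<^const>\<open>frechet_derivative\<close>,
  which is defined by choice.\<close>

lemma Ck_on_SucI:
  assumes "open U" "\<And>x. x \<in> U \<Longrightarrow> (f has_derivative D x) (at x)" "\<And>v. Ck_on n U (\<lambda>x. D x v)"
  shows "Ck_on (Suc n) U f"
proof -
  have e: "frechet_derivative f (at x) = D x" if "x \<in> U" for x
    using assms(2)[OF that] frechet_derivative_at by metis
  have "Ck_on n U (\<lambda>x. frechet_derivative f (at x) v)" for v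
    by (rule Ck_on_cong[OF assms(1) _ assms(3)[of v]]) (simp add: e)
  then show ?thesis using assms(2) by (auto simp: differentiable_def)
qed

lemma Ck_on_SucD:
  assumes "Ck_on (Suc n) U f"
  shows "x \<in> U \<Longrightarrow> (f has_derivative frechet_derivative f (at x)) (at x)"
    and "Ck_on n U (\<lambda>x. frechet_derivative f (at x) v)"
  using assms by (auto simp: frechet_derivative_works[symmetric])

lemma Ck_on_Suc_imp: "Ck_on (Suc n) U f \<Longrightarrow> Ck_on n U f"
proof (induction n arbitrary: f)
  case 0
  then show ?case
    by (auto intro!: continuous_at_imp_continuous_on differentiable_imp_continuous_within)
next
  case (Suc n)
  then show ?case by (metis Ck_on.simps(2))
qed

lemma Ck_on_continuous: "Ck_on n U f \<Longrightarrow> continuous_on U f"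
  by (induction n) (auto dest: Ck_on_Suc_imp simp del: Ck_on.simps(2))

lemma Ck_on_subset: "Ck_on n U f \<Longrightarrow> V \<subseteq> U \<Longrightarrow> Ck_on n V f"
  by (induction n arbitrary: f) (auto intro: continuous_on_subset)

lemma Ck_on_const: "open U \<Longrightarrow> Ck_on n U (\<lambda>x. c)"
proof (induction n arbitrary: c)
  case (Suc n)
  then show ?case by (intro Ck_on_SucI[where D = "\<lambda>x v. 0"]) (auto intro!: derivative_eq_intros)
qed auto

lemma Ck_on_bounded_linear: "open U \<Longrightarrow> bounded_linear f \<Longrightarrow> Ck_on n U f"
proof (cases n)
  case (Suc m)
  assume "open U" "bounded_linear f"
  then show ?thesis unfolding Suc
    by (intro Ck_on_SucI[where D = "\<lambda>x. f"] bounded_linear_imp_has_derivative Ck_on_const)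
qed (auto intro: linear_continuous_on)

lemma Ck_on_linear_compose:
  assumes "open U" "bounded_linear h"
  shows "Ck_on n U f \<Longrightarrow> Ck_on n U (\<lambda>x. h (f x))"
proof (induction n arbitrary: f)
  case 0 then show ?case
    using assms by (auto intro: continuous_on_compose2[OF linear_continuous_on])
next
  case (Suc n)
  show ?case
    by (rule Ck_on_SucI[OF assms(1), where D = "\<lambda>x v. h (frechet_derivative f (at x) v)"])
      (auto intro!: Suc.IH Ck_on_SucD(2)[OF Suc.prems]
          bounded_linear.has_derivative[OF assms(2)] Ck_on_SucD(1)[OF Suc.prems])
qed

lemma Ck_on_add:
  assumes "open U"
  shows "Ck_on n U f \<Longrightarrow> Ck_on n U g \<Longrightarrow> Ck_on n U (\<lambda>x. f x + g x)"
proof (induction n arbitrary: f g)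
  case (Suc n)
  show ?case
    by (rule Ck_on_SucI[OF assms(1), where D = "\<lambda>x v. frechet_derivative f (at x) v + frechet_derivative g (at x) v"])
      (auto intro!: Suc.IH Ck_on_SucD[OF Suc.prems(1)] Ck_on_SucD[OF Suc.prems(2)] has_derivative_add)
qed (auto intro: continuous_intros)

lemma Ck_on_sum:
  assumes "open U" "\<And>i. i \<in> I \<Longrightarrow> Ck_on n U (f i)"
  shows "Ck_on n U (\<lambda>x. \<Sum>i\<in>I. f i x)"
  using assms(2) by (induction I rule: infinite_finite_induct) (auto intro: Ck_on_const Ck_on_add assms(1))

lemma Ck_on_bilinear:
  assumes "open U" "bounded_bilinear h"
  shows "Ck_on n U f \<Longrightarrow> Ck_on n U g \<Longrightarrow> Ck_on n U (\<lambda>x. h (f x) (g x))"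
proof (induction n arbitrary: f g)
  case 0 then show ?case using bounded_bilinear.continuous_on[OF assms(2)] by auto
next
  case (Suc n)
  show ?case
    by (rule Ck_on_SucI[OF assms(1), where D = "\<lambda>x v. h (f x) (frechet_derivative g (at x) v) + h (frechet_derivative f (at x) v) (g x)"])
      (auto intro!: Suc.IH Ck_on_add[OF assms(1)] Ck_on_SucD[OF Suc.prems(1)] Ck_on_SucD[OF Suc.prems(2)]
         Ck_on_Suc_imp[OF Suc.prems(1)] Ck_on_Suc_imp[OF Suc.prems(2)]
         bounded_bilinear.FDERIV[OF assms(2)])
qed

lemmas Ck_on_scaleR = Ck_on_bilinear[OF _ bounded_bilinear_scaleR]
lemmas Ck_on_mult = Ck_on_bilinear[OF _ bounded_bilinear_mult]
lemmas Ck_on_inner = Ck_on_bilinear[OF _ bounded_bilinear_inner]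

lemma Ck_on_minus: "open U \<Longrightarrow> Ck_on n U f \<Longrightarrow> Ck_on n U (\<lambda>x. - f x)"
  by (rule Ck_on_linear_compose[OF _ bounded_linear_minus[OF bounded_linear_ident]])

lemma Ck_on_diff: "open U \<Longrightarrow> Ck_on n U f \<Longrightarrow> Ck_on n U g \<Longrightarrow> Ck_on n U (\<lambda>x. f x - g x)"
  using Ck_on_add[of U n f "\<lambda>x. - g x"] Ck_on_minus by fastforce

lemma Ck_on_ident: "open U \<Longrightarrow> Ck_on n U (\<lambda>x. x)"
  by (rule Ck_on_bounded_linear) auto

lemma Ck_on_prod:
  fixes f :: "'i \<Rightarrow> 'a::real_normed_vector \<Rightarrow> real"
  assumes "open U" "\<And>i. i \<in> I \<Longrightarrow> Ck_on n U (f i)"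
  shows "Ck_on n U (\<lambda>x. \<Prod>i\<in>I. f i x)"
  using assms(2) by (induction I rule: infinite_finite_induct) (auto intro: Ck_on_const Ck_on_mult assms(1))

lemma Ck_on_inverse:
  fixes f :: "'a::real_normed_vector \<Rightarrow> real"
  assumes "open U" "\<And>x. x \<in> U \<Longrightarrow> f x \<noteq> 0"
  shows "Ck_on n U f \<Longrightarrow> Ck_on n U (\<lambda>x. inverse (f x))"
proof (induction n)
  case 0 then show ?case using assms by (auto intro!: continuous_on_inverse)
next
  case (Suc n)
  show ?case
    by (rule Ck_on_SucI[OF assms(1), where D = "\<lambda>x v. - (inverse (f x) * frechet_derivative f (at x) v * inverse (f x))"])
      (auto intro!: Suc.IH Ck_on_minus[OF assms(1)] Ck_on_mult[OF assms(1)] Ck_on_SucD[OF Suc.prems]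
         Ck_on_Suc_imp[OF Suc.prems] Deriv.has_derivative_inverse assms)
qed

lemma Ck_on_sqrt:
  fixes f :: "'a::real_normed_vector \<Rightarrow> real"
  assumes "open U" "\<And>x. x \<in> U \<Longrightarrow> f x > 0"
  shows "Ck_on n U f \<Longrightarrow> Ck_on n U (\<lambda>x. sqrt (f x))"
proof (induction n)
  case 0 then show ?case using assms by (auto intro!: continuous_intros)
next
  case (Suc n)
  show ?case
  proof (rule Ck_on_SucI[OF assms(1), where D = "\<lambda>x v. frechet_derivative f (at x) v * (inverse (sqrt (f x)) * (1/2))"])
    fix x assume x: "x \<in> U"
    show "((\<lambda>x. sqrt (f x)) has_derivative (\<lambda>v. frechet_derivative f (at x) v * (inverse (sqrt (f x)) * (1/2)))) (at x)"
      using assms(2)[OF x] Ck_on_SucD(1)[OF Suc.prems x]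
      by (auto intro!: derivative_eq_intros simp: field_simps)
  next
    fix v
    have "Ck_on n U (\<lambda>x. inverse (sqrt (f x)))"
      by (rule Ck_on_inverse[OF assms(1) _ Suc.IH[OF Ck_on_Suc_imp[OF Suc.prems]]]) (use assms(2) in fastforce)
    then show "Ck_on n U (\<lambda>x. frechet_derivative f (at x) v * (inverse (sqrt (f x)) * (1/2)))"
      by (intro Ck_on_mult[OF assms(1)] Ck_on_const[OF assms(1)] Ck_on_SucD[OF Suc.prems])
  qed
qed

lemma Ck_on_cis:
  fixes f :: "'a::real_normed_vector \<Rightarrow> real"
  assumes "open U"
  shows "Ck_on n U f \<Longrightarrow> Ck_on n U (\<lambda>x. cis (f x))"
proof (induction n)
  case 0 then show ?case by (auto intro!: continuous_intros)
next
  case (Suc n)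
  show ?case
  proof (rule Ck_on_SucI[OF assms(1), where D = "\<lambda>x v. frechet_derivative f (at x) v *\<^sub>R (\<i> * cis (f x))"])
    fix x assume x: "x \<in> U"
    show "((\<lambda>x. cis (f x)) has_derivative (\<lambda>v. frechet_derivative f (at x) v *\<^sub>R (\<i> * cis (f x)))) (at x)"
      by (rule has_derivative_cis[OF Ck_on_SucD(1)[OF Suc.prems x]])
  qed (intro Ck_on_scaleR[OF assms] Ck_on_mult[OF assms] Ck_on_const[OF assms] Ck_on_SucD[OF Suc.prems]
        Suc.IH Ck_on_Suc_imp[OF Suc.prems])
qed

text \<open>The definition differentiates in fixed directions, whereas the chain rule evaluates the derivative
  of \<open>g\<close> in the moving direction \<open>Df(x) v\<close>. Expanding that direction in the
  basis leaves sums of products of functions that the induction hypothesis covers.\<close>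

lemma Ck_on_compose:
  fixes f :: "'a::real_normed_vector \<Rightarrow> 'b::euclidean_space"
  assumes "open U" "open V" "f ` U \<subseteq> V"
  shows "Ck_on n U f \<Longrightarrow> Ck_on n V g \<Longrightarrow> Ck_on n U (\<lambda>x. g (f x))"
proof (induction n arbitrary: g)
  case 0 then show ?case using assms by (auto intro: continuous_on_compose2)
next
  case (Suc n)
  have Df: "(f has_derivative frechet_derivative f (at x)) (at x)" if "x \<in> U" for x
    using Ck_on_SucD(1)[OF Suc.prems(1) that] .
  have Dg: "(g has_derivative frechet_derivative g (at (f x))) (at (f x))" if "x \<in> U" for x
    using Ck_on_SucD(1)[OF Suc.prems(2)] that assms by blast
  have eq: "frechet_derivative g (at (f x)) w = (\<Sum>b\<in>Basis. (w \<bullet> b) *\<^sub>R frechet_derivative g (at (f x)) b)"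
    if "x \<in> U" for x w
  proof -
    have l: "linear (frechet_derivative g (at (f x)))" using Dg[OF that] has_derivative_linear by blast
    have "frechet_derivative g (at (f x)) w = frechet_derivative g (at (f x)) (\<Sum>b\<in>Basis. (w \<bullet> b) *\<^sub>R b)"
      by (simp add: euclidean_representation)
    also have "\<dots> = (\<Sum>b\<in>Basis. (w \<bullet> b) *\<^sub>R frechet_derivative g (at (f x)) b)"
      using l by (simp add: linear_sum linear_cmul)
    finally show ?thesis .
  qed
  show ?case
  proof (rule Ck_on_SucI[OF assms(1), where D = "\<lambda>x v. \<Sum>b\<in>Basis. (frechet_derivative f (at x) v \<bullet> b) *\<^sub>R frechet_derivative g (at (f x)) b"])
    fix x assume x: "x \<in> U"
    have "((\<lambda>x. g (f x)) has_derivative (\<lambda>v. frechet_derivative g (at (f x)) (frechet_derivative f (at x) v))) (at x)"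
      using has_derivative_compose[OF Df[OF x] Dg[OF x]] .
    then show "((\<lambda>x. g (f x)) has_derivative (\<lambda>v. \<Sum>b\<in>Basis. (frechet_derivative f (at x) v \<bullet> b) *\<^sub>R frechet_derivative g (at (f x)) b)) (at x)"
      by (subst (asm) eq[OF x])
  next
    fix v
    show "Ck_on n U (\<lambda>x. \<Sum>b\<in>Basis. (frechet_derivative f (at x) v \<bullet> b) *\<^sub>R frechet_derivative g (at (f x)) b)"
      by (intro Ck_on_sum Ck_on_scaleR Ck_on_inner Ck_on_const assms Ck_on_SucD[OF Suc.prems(1)]
          Suc.IH Ck_on_SucD(2)[OF Suc.prems(2)] Ck_on_Suc_imp[OF Suc.prems(1)])
  qed
qed

lemma smooth_onD: "smooth_on U f \<Longrightarrow> x \<in> U \<Longrightarrow> (f has_derivative frechet_derivative f (at x)) (at x)"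
  unfolding smooth_on_def using Ck_on_SucD(1) by metis

lemma smooth_on_derivative: "smooth_on U f \<Longrightarrow> smooth_on U (\<lambda>x. frechet_derivative f (at x) v)"
  unfolding smooth_on_def using Ck_on_SucD(2) by metis

lemma smooth_on_continuous: "smooth_on U f \<Longrightarrow> continuous_on U f"
  unfolding smooth_on_def using Ck_on_continuous by metis

lemma smooth_on_subset: "smooth_on U f \<Longrightarrow> V \<subseteq> U \<Longrightarrow> smooth_on V f"
  unfolding smooth_on_def using Ck_on_subset by metis

lemma smooth_on_cong:
  "open U \<Longrightarrow> (\<And>x. x \<in> U \<Longrightarrow> f x = g x) \<Longrightarrow> smooth_on U f \<Longrightarrow> smooth_on U g"
  unfolding smooth_on_def using Ck_on_cong by metis

named_theorems smooth_intros

lemma smooth_on_const [smooth_intros]: "open U \<Longrightarrow> smooth_on U (\<lambda>x. c)"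
  unfolding smooth_on_def by (simp add: Ck_on_const)

lemma smooth_on_ident [smooth_intros]: "open U \<Longrightarrow> smooth_on U (\<lambda>x. x)"
  unfolding smooth_on_def by (simp add: Ck_on_ident)

lemma smooth_on_bounded_linear: "open U \<Longrightarrow> bounded_linear h \<Longrightarrow> smooth_on U h"
  unfolding smooth_on_def by (simp add: Ck_on_bounded_linear)

lemma smooth_on_linear_compose: "open U \<Longrightarrow> bounded_linear h \<Longrightarrow> smooth_on U f \<Longrightarrow> smooth_on U (\<lambda>x. h (f x))"
  unfolding smooth_on_def by (simp add: Ck_on_linear_compose)

lemma smooth_on_add [smooth_intros]: "open U \<Longrightarrow> smooth_on U f \<Longrightarrow> smooth_on U g \<Longrightarrow> smooth_on U (\<lambda>x. f x + g x)"
  unfolding smooth_on_def by (simp add: Ck_on_add)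

lemma smooth_on_diff [smooth_intros]: "open U \<Longrightarrow> smooth_on U f \<Longrightarrow> smooth_on U g \<Longrightarrow> smooth_on U (\<lambda>x. f x - g x)"
  unfolding smooth_on_def by (simp add: Ck_on_diff)

lemma smooth_on_scaleR [smooth_intros]: "open U \<Longrightarrow> smooth_on U f \<Longrightarrow> smooth_on U g \<Longrightarrow> smooth_on U (\<lambda>x. f x *\<^sub>R g x)"
  unfolding smooth_on_def by (simp add: Ck_on_scaleR)

lemma smooth_on_inner [smooth_intros]: "open U \<Longrightarrow> smooth_on U f \<Longrightarrow> smooth_on U g \<Longrightarrow> smooth_on U (\<lambda>x. f x \<bullet> g x)"
  unfolding smooth_on_def by (simp add: Ck_on_inner)

lemma smooth_on_mult [smooth_intros]: "open U \<Longrightarrow> smooth_on U f \<Longrightarrow> smooth_on U g \<Longrightarrow> smooth_on U (\<lambda>x. f x * g x :: 'b::real_normed_algebra)"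
  unfolding smooth_on_def by (simp add: Ck_on_mult)

lemma smooth_on_minus [smooth_intros]: "open U \<Longrightarrow> smooth_on U f \<Longrightarrow> smooth_on U (\<lambda>x. - f x)"
  unfolding smooth_on_def by (simp add: Ck_on_minus)

lemma smooth_on_inverse [smooth_intros]: "open U \<Longrightarrow> (\<And>x. x \<in> U \<Longrightarrow> f x \<noteq> 0) \<Longrightarrow> smooth_on U f \<Longrightarrow> smooth_on U (\<lambda>x. inverse (f x :: real))"
  unfolding smooth_on_def by (simp add: Ck_on_inverse)

lemma smooth_on_sqrt [smooth_intros]: "open U \<Longrightarrow> (\<And>x. x \<in> U \<Longrightarrow> f x > 0) \<Longrightarrow> smooth_on U f \<Longrightarrow> smooth_on U (\<lambda>x. sqrt (f x))"
  unfolding smooth_on_def by (simp add: Ck_on_sqrt)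

lemma smooth_on_cis [smooth_intros]: "open U \<Longrightarrow> smooth_on U f \<Longrightarrow> smooth_on U (\<lambda>x. cis (f x))"
  unfolding smooth_on_def by (simp add: Ck_on_cis)

lemma smooth_on_sum [smooth_intros]: "open U \<Longrightarrow> (\<And>i. i \<in> I \<Longrightarrow> smooth_on U (f i)) \<Longrightarrow> smooth_on U (\<lambda>x. \<Sum>i\<in>I. f i x)"
  unfolding smooth_on_def by (simp add: Ck_on_sum)

lemma smooth_on_prod [smooth_intros]: "open U \<Longrightarrow> (\<And>i. i \<in> I \<Longrightarrow> smooth_on U (f i)) \<Longrightarrow> smooth_on U (\<lambda>x. \<Prod>i\<in>I. f i x :: real)"
  unfolding smooth_on_def by (simp add: Ck_on_prod)

lemma smooth_on_compose:
  fixes f :: "'a::real_normed_vector \<Rightarrow> 'b::euclidean_space"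
  shows "open U \<Longrightarrow> open V \<Longrightarrow> f ` U \<subseteq> V \<Longrightarrow> smooth_on U f \<Longrightarrow> smooth_on V g \<Longrightarrow> smooth_on U (\<lambda>x. g (f x))"
  unfolding smooth_on_def using Ck_on_compose by metis

lemma smooth_on_componentwise:
  fixes f :: "'a::real_normed_vector \<Rightarrow> 'b::euclidean_space"
  assumes "open U" "\<And>b. b \<in> Basis \<Longrightarrow> smooth_on U (\<lambda>x. f x \<bullet> b)"
  shows "smooth_on U f"
proof (rule smooth_on_cong[OF assms(1)])
  show "smooth_on U (\<lambda>x. \<Sum>b\<in>Basis. (f x \<bullet> b) *\<^sub>R b)"
    by (intro smooth_on_sum smooth_on_scaleR smooth_on_const assms)
qed (simp add: euclidean_representation)

lemma smooth_on_vec: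
  fixes f :: "'i::finite \<Rightarrow> 'a::real_normed_vector \<Rightarrow> real"
  assumes "open U" "\<And>i. smooth_on U (f i)"
  shows "smooth_on U (\<lambda>x. \<chi> i. f i x :: real ^ 'i::finite)"
  by (rule smooth_on_componentwise[OF assms(1)]) (auto simp: Basis_vec_def inner_axis intro: assms)

lemma smooth_on_nth [smooth_intros]: "open U \<Longrightarrow> smooth_on U f \<Longrightarrow> smooth_on U (\<lambda>x. f x $ i)"
  by (rule smooth_on_linear_compose[OF _ bounded_linear_vec_nth])

section \<open>The smooth inverse function theorem\<close>

text \<open>Cramer's rule writes the inverse of the derivative as a rational expression in its entries, so
  the inverse map gains one degree of smoothness at a time.\<close>

lemma smooth_on_inverse_map:
  fixes f g :: "real ^ 'n \<Rightarrow> real ^ 'n"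
  assumes U: "open U" and V: "open V" and hom: "homeomorphism U V f g"
    and f: "smooth_on U f"
    and inj: "\<And>x v. x \<in> U \<Longrightarrow> frechet_derivative f (at x) v = 0 \<Longrightarrow> v = 0"
  shows "smooth_on V g"
proof -
  define A where "A x = matrix (frechet_derivative f (at x))" for x
  have lin: "linear (frechet_derivative f (at x))" if "x \<in> U" for x
    using smooth_onD[OF f that] has_derivative_linear by blast
  have AD: "A x *v v = frechet_derivative f (at x) v" if "x \<in> U" for x v
    unfolding A_def using lin[OF that] by (simp add: matrix_works)
  have det: "det (A x) \<noteq> 0" if "x \<in> U" for x
    using inj[OF that] AD[OF that] by (metis invertible_det_nz invertible_left_inverse matrix_left_invertible_ker)
  define B where "B x b = (\<chi> k. det(\<chi> i j. if j=k then b$i else A x$i$j) / det (A x))" for x and b :: "real ^ 'n"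
  have B: "A x *v B x b = b" if "x \<in> U" for x b
    using cramer[OF det[OF that]] unfolding B_def by blast
  have smA: "smooth_on U (\<lambda>x. A x $ i $ j)" for i j
    unfolding A_def matrix_def by (simp, intro smooth_intros U smooth_on_derivative f)
  have smdet: "smooth_on U (\<lambda>x. det (A x))"
    unfolding det_def by (intro smooth_intros U smA)
  have smdet2: "smooth_on U (\<lambda>x. det(\<chi> i j. if j=k then b$i else A x$i$j))" for k and b :: "real ^ 'n"
  proof -
    have "smooth_on U (\<lambda>x. if j = k then b $ i else A x $ i $ j)" for i j
      by (cases "j = k") (auto intro: smooth_on_const[OF U] smA)
    then show ?thesis unfolding det_def by (simp, intro smooth_intros U)
  qed
  have smB: "smooth_on U (\<lambda>x. B x b)" for b
    unfolding B_def divide_inverse by (intro smooth_on_vec smooth_intros U smdet smdet2 det)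
  have cg: "continuous_on V g" "\<And>y. y \<in> V \<Longrightarrow> g y \<in> U" "\<And>y. y \<in> V \<Longrightarrow> f (g y) = y"
    "\<And>x. x \<in> U \<Longrightarrow> g (f x) = x"
    using hom by (auto simp: homeomorphism_def)
  have Dg: "(g has_derivative B (g y)) (at y)" if "y \<in> V" for y
  proof -
    have "(g has_derivative B (g y)) (at (f (g y)))"
    proof (rule has_derivative_inverse_strong[OF U cg(2)[OF that] smooth_on_continuous[OF f] _ smooth_onD[OF f cg(2)[OF that]]])
      show "frechet_derivative f (at (g y)) \<circ> B (g y) = id"
        using B AD cg(2)[OF that] by (auto simp: fun_eq_iff)
    qed (use cg in auto)
    then show ?thesis using cg(3)[OF that] by simp
  qed
  have "Ck_on n V g" for n
  proof (induction n)
    case 0 then show ?case using cg(1) by simp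
  next
    case (Suc n)
    show ?case
    proof (rule Ck_on_SucI[OF V Dg])
      show "Ck_on n V (\<lambda>y. B (g y) v)" for v
        by (rule Ck_on_compose[OF V U _ Suc]) (use cg smB in \<open>auto simp: smooth_on_def\<close>)
    qed
  qed
  then show ?thesis by (simp add: smooth_on_def)
qed

proposition smooth_inverse_function_theorem:
  fixes f :: "real ^ 'n \<Rightarrow> real ^ 'n"
  assumes W: "open W" and f: "smooth_on W f" and p: "p \<in> W"
    and inj: "\<And>v. frechet_derivative f (at p) v = 0 \<Longrightarrow> v = 0"
  obtains U V g where "open U" "p \<in> U" "U \<subseteq> W" "open V" "homeomorphism U V f g"
    "smooth_on U f" "smooth_on V g"
proof -
  have bl: "bounded_linear (frechet_derivative f (at x))" if "x \<in> W" for x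
    using smooth_onD[OF f that] has_derivative_bounded_linear by blast
  define f' where "f' x = Blinfun (frechet_derivative f (at x))" for x
  have f': "blinfun_apply (f' x) = frechet_derivative f (at x)" if "x \<in> W" for x
    unfolding f'_def using bl[OF that] by (simp add: bounded_linear_Blinfun_apply)
  have cont: "continuous_on W f'"
  proof (rule continuous_on_blinfun_componentwise)
    fix i :: "real ^ 'n" assume "i \<in> Basis"
    show "continuous_on W (\<lambda>x. blinfun_apply (f' x) i)"
      using smooth_on_continuous[OF smooth_on_derivative[OF f, of i]]
      by (rule continuous_on_eq) (simp add: f')
  qed
  have linp: "linear (frechet_derivative f (at p))" using bl[OF p] bounded_linear.linear by blast
  have injp: "inj (frechet_derivative f (at p))"
    using inj linp by (simp add: linear_injective_0)
  then obtain h where h: "linear h" "h \<circ> frechet_derivative f (at p) = id"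
    using linear_injective_left_inverse[OF linp] by blast
  have hb: "bounded_linear h" using h(1) by (simp add: linear_conv_bounded_linear)
  have inv: "Blinfun h o\<^sub>L f' p = id_blinfun"
    by (rule blinfun_eqI) (use h(2) in \<open>simp add: bounded_linear_Blinfun_apply[OF hb] f'[OF p] fun_eq_iff\<close>)
  obtain U V g g' where UV: "open U" "U \<subseteq> W" "p \<in> U" "open V" "f p \<in> V" "homeomorphism U V f g"
    "\<And>y. y \<in> V \<Longrightarrow> (g has_derivative (g' y)) (at y)"
    "\<And>y. y \<in> V \<Longrightarrow> g' y = inv (blinfun_apply (f'(g y)))"
    "\<And>y. y \<in> V \<Longrightarrow> bij (blinfun_apply (f'(g y)))"
    using inverse_function_theorem[OF W _ cont p inv] smooth_onD[OF f] f' by metis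
  have fU: "smooth_on U f" using f UV(2) smooth_on_subset by blast
  have "smooth_on V g"
  proof (rule smooth_on_inverse_map[OF UV(1,4,6) fU])
    fix x v assume x: "x \<in> U" and v: "frechet_derivative f (at x) v = 0"
    have "f x \<in> V" "g (f x) = x" using UV(6) x by (auto simp: homeomorphism_def)
    then have "bij (frechet_derivative f (at x))" using UV(9)[of "f x"] f' x UV(2) by auto
    moreover have "linear (frechet_derivative f (at x))" using bl x UV(2) bounded_linear.linear by blast
    ultimately show "v = 0" using v by (metis bij_is_inj linear_injective_0)
  qed
  with that UV fU show ?thesis by blast
qed

section \<open>Submanifolds: tangent and normal spaces\<close>

definition slice_chart ::
  "'a::euclidean_space set \<Rightarrow> 'a set \<Rightarrow> 'a set \<Rightarrow> ('a \<Rightarrow> 'a) \<Rightarrow> ('a \<Rightarrow> 'a) \<Rightarrow> 'a set \<Rightarrow> bool" where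
  "slice_chart N U V \<phi> \<psi> L \<longleftrightarrow> open U \<and> open V \<and> homeomorphism U V \<phi> \<psi> \<and>
     smooth_on U \<phi> \<and> smooth_on V \<psi> \<and> subspace L \<and> \<phi> ` (N \<inter> U) = V \<inter> L"

lemma closed_submanifold_iff:
  "closed_submanifold k (N :: 'a::euclidean_space set) \<longleftrightarrow> compact N \<and>
     (\<forall>p\<in>N. \<exists>U V \<phi> \<psi> L. p \<in> U \<and> slice_chart N U V \<phi> \<psi> L \<and> dim L + k = DIM('a))"
  unfolding closed_submanifold_def slice_chart_def by (rule conj_cong[OF refl], rule ball_cong[OF refl]) blast

lemma slice_chartD:
  assumes "slice_chart N U V \<phi> \<psi> L"
  shows "open U" "open V" "smooth_on U \<phi>" "smooth_on V \<psi>" "subspace L"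
    "x \<in> U \<Longrightarrow> \<phi> x \<in> V" "x \<in> U \<Longrightarrow> \<psi> (\<phi> x) = x" "y \<in> V \<Longrightarrow> \<psi> y \<in> U" "y \<in> V \<Longrightarrow> \<phi> (\<psi> y) = y"
    "x \<in> U \<Longrightarrow> \<phi> x \<in> L \<longleftrightarrow> x \<in> N" "y \<in> V \<Longrightarrow> \<psi> y \<in> N \<longleftrightarrow> y \<in> L"
    "continuous_on U \<phi>" "continuous_on V \<psi>"
proof -
  show *: "open U" "open V" "smooth_on U \<phi>" "smooth_on V \<psi>" "subspace L"
    and A: "\<And>x. x \<in> U \<Longrightarrow> \<phi> x \<in> V" "\<And>x. x \<in> U \<Longrightarrow> \<psi> (\<phi> x) = x" "\<And>y. y \<in> V \<Longrightarrow> \<psi> y \<in> U" "\<And>y. y \<in> V \<Longrightarrow> \<phi> (\<psi> y) = y"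
    using assms by (auto simp: slice_chart_def homeomorphism_def)
  have im: "\<phi> ` (N \<inter> U) = V \<inter> L" using assms by (simp add: slice_chart_def)
  show B: "\<phi> x \<in> L \<longleftrightarrow> x \<in> N" if hx: "x \<in> U" for x
  proof
    assume "\<phi> x \<in> L"
    then have "\<phi> x \<in> \<phi> ` (N \<inter> U)" using im A(1)[OF hx] by blast
    then obtain x' where "x' \<in> N" "x' \<in> U" "\<phi> x' = \<phi> x" by auto
    then show "x \<in> N" using A(2) hx by metis
  qed (use im hx in auto)
  show "\<psi> y \<in> N \<longleftrightarrow> y \<in> L" if "y \<in> V" for y using B[of "\<psi> y"] A that by metis
  show "continuous_on U \<phi>" "continuous_on V \<psi>" using * smooth_on_continuous by blast+
qed

lemma slice_chart_derivatives:
  assumes "slice_chart N U V \<phi> \<psi> L" "x \<in> U"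
  shows "frechet_derivative \<psi> (at (\<phi> x)) (frechet_derivative \<phi> (at x) v) = v"
    and "frechet_derivative \<phi> (at x) (frechet_derivative \<psi> (at (\<phi> x)) w) = w"
proof -
  note c = slice_chartD[OF assms(1)]
  have p: "(\<phi> has_derivative frechet_derivative \<phi> (at x)) (at x)"
    using smooth_onD[OF c(3) assms(2)] .
  have q: "(\<psi> has_derivative frechet_derivative \<psi> (at (\<phi> x))) (at (\<phi> x))"
    using smooth_onD[OF c(4) c(6)[OF assms(2)]] .
  have "((\<lambda>x. \<psi> (\<phi> x)) has_derivative (\<lambda>v. frechet_derivative \<psi> (at (\<phi> x)) (frechet_derivative \<phi> (at x) v))) (at x)"
    by (rule has_derivative_compose[OF p q])
  moreover have "((\<lambda>x. \<psi> (\<phi> x)) has_derivative (\<lambda>v. v)) (at x)"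
    by (rule has_derivative_transform_within_open[OF has_derivative_ident c(1) assms(2)]) (use c in auto)
  ultimately show "frechet_derivative \<psi> (at (\<phi> x)) (frechet_derivative \<phi> (at x) v) = v"
    using has_derivative_unique by (metis (no_types))
  have "(\<phi> has_derivative frechet_derivative \<phi> (at x)) (at (\<psi> (\<phi> x)))" using p c(7) assms(2) by simp
  from has_derivative_compose[OF q this]
  have "((\<lambda>y. \<phi> (\<psi> y)) has_derivative (\<lambda>v. frechet_derivative \<phi> (at x) (frechet_derivative \<psi> (at (\<phi> x)) v))) (at (\<phi> x))" .
  moreover have "((\<lambda>y. \<phi> (\<psi> y)) has_derivative (\<lambda>v. v)) (at (\<phi> x))"
    by (rule has_derivative_transform_within_open[OF has_derivative_ident c(2) c(6)[OF assms(2)]]) (use c in auto)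
  ultimately show "frechet_derivative \<phi> (at x) (frechet_derivative \<psi> (at (\<phi> x)) w) = w"
    using has_derivative_unique by (metis (no_types))
qed

lemma has_vector_derivative_subspace:
  fixes f :: "real \<Rightarrow> 'a::euclidean_space"
  assumes "(f has_vector_derivative w) (at 0)" "subspace L" "e > 0" "\<And>t. \<bar>t\<bar> < e \<Longrightarrow> f t \<in> L"
  shows "w \<in> L"
proof -
  have "u \<bullet> w = 0" if "u \<in> orthogonal_comp L" for u
  proof -
    have 1: "((\<lambda>t. u \<bullet> f t) has_vector_derivative u \<bullet> w) (at 0)"
      using assms(1) unfolding has_vector_derivative_def
      by (auto intro!: derivative_eq_intros)
    have "((\<lambda>t. u \<bullet> f t) has_vector_derivative 0) (at 0)"
    proof (rule has_vector_derivative_transform_within_open[where S = "ball 0 e"])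
      show "((\<lambda>t::real. 0::real) has_vector_derivative 0) (at 0)" by simp
      show "0 = u \<bullet> f t" if "t \<in> ball 0 e" for t
        using assms(4)[of t] \<open>u \<in> orthogonal_comp L\<close> that
        by (auto simp: orthogonal_comp_def orthogonal_def inner_commute)
    qed (use assms in auto)
    then show ?thesis using 1 vector_derivative_unique_at by blast
  qed
  then have "w \<in> orthogonal_comp (orthogonal_comp L)"
    by (auto simp: orthogonal_comp_def orthogonal_def)
  then show ?thesis using orthogonal_comp_self[OF assms(2)] by simp
qed

lemma smooth_curve_atD:
  assumes "smooth_curve_at N p v \<gamma>" "open U" "p \<in> U"
  obtains e where "e > 0" "smooth_on {-e<..<e} \<gamma>" "\<And>t. \<bar>t\<bar> < e \<Longrightarrow> \<gamma> t \<in> N \<inter> U"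
    "\<gamma> 0 = p" "(\<gamma> has_vector_derivative v) (at 0)"
proof -
  from assms obtain e where e: "e > 0" "smooth_on {-e<..<e} \<gamma>" "\<gamma> ` {-e<..<e} \<subseteq> N"
    "\<gamma> 0 = p" "(\<gamma> has_vector_derivative v) (at 0)" by (auto simp: smooth_curve_at_def)
  then have "isCont \<gamma> 0" using has_vector_derivative_continuous by blast
  then have "\<forall>\<^sub>F t in at 0. \<gamma> t \<in> U"
    using assms(2,3) e(4) by (auto simp: isCont_def intro: topological_tendstoD)
  then obtain d where d: "d > 0" "\<And>t. t \<noteq> 0 \<Longrightarrow> dist t 0 < d \<Longrightarrow> \<gamma> t \<in> U"
    by (auto simp: eventually_at)
  show ?thesis
  proof (rule that[of "min e d"])
    show "smooth_on {- min e d<..<min e d} \<gamma>" by (rule smooth_on_subset[OF e(2)]) auto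
    show "\<gamma> t \<in> N \<inter> U" if "\<bar>t\<bar> < min e d" for t using e(3,4) d(2)[of t] assms(3) that by (cases "t = 0") (auto simp: dist_norm image_subset_iff abs_less_iff)
  qed (use e d in auto)
qed

lemma smooth_curve_at_mono:
  assumes "smooth_curve_at N p v \<gamma>" "open U" "p \<in> U" "N \<inter> U \<subseteq> N'"
  shows "smooth_curve_at N' p v \<gamma>"
proof -
  obtain e where "e > 0" "smooth_on {-e<..<e} \<gamma>" "\<And>t. \<bar>t\<bar> < e \<Longrightarrow> \<gamma> t \<in> N \<inter> U"
    "\<gamma> 0 = p" "(\<gamma> has_vector_derivative v) (at 0)" using smooth_curve_atD[OF assms(1-3)] by metis
  then show ?thesis unfolding smooth_curve_at_def using assms(4)
    by (intro conjI exI[of _ e]) (auto simp: image_subset_iff abs_less_iff)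
qed

lemma tangent_space_local:
  assumes "open U" "p \<in> U" "N \<inter> U = N' \<inter> U"
  shows "tangent_space N p = tangent_space N' p"
proof -
  have "N \<inter> U \<subseteq> N'" "N' \<inter> U \<subseteq> N" using assms by auto
  then show ?thesis unfolding tangent_space_def using smooth_curve_at_mono[OF _ assms(1,2)] by blast
qed

lemma smooth_curve_at_compose:
  fixes f :: "'a::euclidean_space \<Rightarrow> 'b::real_normed_vector"
  assumes "smooth_curve_at N p v \<gamma>" "open U" "p \<in> U" "smooth_on U f" "f ` (N \<inter> U) \<subseteq> N'"
  shows "smooth_curve_at N' (f p) (frechet_derivative f (at p) v) (\<lambda>t. f (\<gamma> t))"
proof -
  obtain e where e: "e > 0" "smooth_on {-e<..<e} \<gamma>" "\<And>t. \<bar>t\<bar> < e \<Longrightarrow> \<gamma> t \<in> N \<inter> U"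
    "\<gamma> 0 = p" "(\<gamma> has_vector_derivative v) (at 0)" using smooth_curve_atD[OF assms(1-3)] by metis
  have D: "(f has_derivative frechet_derivative f (at p)) (at (\<gamma> 0))" using smooth_onD[OF assms(4,3)] e(4) by simp
  have l: "linear (frechet_derivative f (at p))" using D has_derivative_linear by blast
  have "((\<lambda>t. f (\<gamma> t)) has_vector_derivative frechet_derivative f (at p) v) (at 0)"
    using has_derivative_compose[OF e(5)[unfolded has_vector_derivative_def] D]
    unfolding has_vector_derivative_def by (simp add: linear_cmul[OF l])
  moreover have "smooth_on {-e<..<e} (\<lambda>t. f (\<gamma> t))"
    by (rule smooth_on_compose[OF _ assms(2) _ e(2) assms(4)]) (use e(3) in \<open>auto simp: abs_less_iff\<close>)
  ultimately show ?thesis unfolding smooth_curve_at_def using e assms(5)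
    by (intro conjI exI[of _ e]) (auto simp: image_subset_iff abs_less_iff)
qed

lemma tangent_space_slice_chart:
  assumes "slice_chart N U V \<phi> \<psi> L" "p \<in> N" "p \<in> U"
  shows "tangent_space N p = frechet_derivative \<psi> (at (\<phi> p)) ` L"
    and "v \<in> tangent_space N p \<longleftrightarrow> frechet_derivative \<phi> (at p) v \<in> L"
proof -
  note c = slice_chartD[OF assms(1)]
  have A: "frechet_derivative \<phi> (at p) v \<in> L" if v: "v \<in> tangent_space N p" for v
  proof -
    obtain \<gamma> where g: "smooth_curve_at N p v \<gamma>" using v by (auto simp: tangent_space_def)
    have "smooth_curve_at L (\<phi> p) (frechet_derivative \<phi> (at p) v) (\<lambda>t. \<phi> (\<gamma> t))"
      by (rule smooth_curve_at_compose[OF g c(1) assms(3) c(3)]) (use c(10) in auto)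
    then show ?thesis using has_vector_derivative_subspace[OF _ c(5)]
      by (auto simp: smooth_curve_at_def image_subset_iff abs_less_iff)
  qed
  have B: "frechet_derivative \<psi> (at (\<phi> p)) l \<in> tangent_space N p" if l: "l \<in> L" for l
  proof -
    have pL: "\<phi> p \<in> L" using c(10) assms by auto
    have sc: "smooth_curve_at L (\<phi> p) l (\<lambda>t. \<phi> p + t *\<^sub>R l)"
      unfolding smooth_curve_at_def
    proof (intro conjI exI[of _ 1])
      show "((\<lambda>t. \<phi> p + t *\<^sub>R l) has_vector_derivative l) (at 0)"
        by (auto intro!: derivative_eq_intros)
      show "smooth_on {- 1<..<1} (\<lambda>t. \<phi> p + t *\<^sub>R l)"
        by (intro smooth_on_add smooth_on_scaleR smooth_on_const smooth_on_ident) auto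
      show "(\<lambda>t. \<phi> p + t *\<^sub>R l) ` {- 1<..<1} \<subseteq> L"
        using pL l c(5) by (auto intro: subspace_add subspace_scale)
    qed auto
    have "smooth_curve_at N (\<psi> (\<phi> p)) (frechet_derivative \<psi> (at (\<phi> p)) l) (\<lambda>t. \<psi> (\<phi> p + t *\<^sub>R l))"
      by (rule smooth_curve_at_compose[OF sc c(2) c(6)[OF assms(3)] c(4)]) (use c(11) in auto)
    then show ?thesis using c(7)[OF assms(3)] unfolding tangent_space_def by auto
  qed
  show "tangent_space N p = frechet_derivative \<psi> (at (\<phi> p)) ` L"
    using A B slice_chart_derivatives(1)[OF assms(1,3)] by (metis (no_types, lifting) image_eqI subsetI subset_antisym image_subsetI)
  show "v \<in> tangent_space N p \<longleftrightarrow> frechet_derivative \<phi> (at p) v \<in> L"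
    using A B slice_chart_derivatives(1)[OF assms(1,3)] by metis
qed

lemma
  fixes N :: "'a::euclidean_space set"
  assumes "closed_submanifold k N" "p \<in> N"
  shows subspace_tangent_space: "subspace (tangent_space N p)"
    and dim_tangent_space: "dim (tangent_space N p) + k = DIM('a)"
proof -
  obtain U V \<phi> \<psi> L where c: "p \<in> U" "slice_chart N U V \<phi> \<psi> L" "dim L + k = DIM('a)"
    using assms unfolding closed_submanifold_iff by blast
  have T: "tangent_space N p = frechet_derivative \<psi> (at (\<phi> p)) ` L"
    by (rule tangent_space_slice_chart[OF c(2) assms(2) c(1)])
  have l: "linear (frechet_derivative \<psi> (at (\<phi> p)))"
    using smooth_onD[OF slice_chartD(4)[OF c(2)]] slice_chartD(6)[OF c(2)] c(1) has_derivative_linear by blast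
  show "subspace (tangent_space N p)" unfolding T using l slice_chartD(5)[OF c(2)] linear_subspace_image by blast
  have "inj_on (frechet_derivative \<psi> (at (\<phi> p))) (span L)"
    using slice_chart_derivatives(2)[OF c(2,1)] by (metis inj_onI)
  then show "dim (tangent_space N p) + k = DIM('a)" unfolding T using c(3) dim_image_eq[OF l] by auto
qed

lemma subspace_normal_space: "subspace (normal_space N p)"
  by (simp add: normal_space_def subspace_orthogonal_comp)

lemma normal_space_orthogonal: "n \<in> normal_space N p \<Longrightarrow> v \<in> tangent_space N p \<Longrightarrow> n \<bullet> v = 0"
  by (auto simp: normal_space_def orthogonal_comp_def orthogonal_def inner_commute)

lemma normal_spaceI: "(\<And>v. v \<in> tangent_space N p \<Longrightarrow> n \<bullet> v = 0) \<Longrightarrow> n \<in> normal_space N p"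
  by (auto simp: normal_space_def orthogonal_comp_def orthogonal_def inner_commute)

lemma tangent_spaceI:
  assumes "closed_submanifold k N" "p \<in> N" "\<And>n. n \<in> normal_space N p \<Longrightarrow> n \<bullet> v = 0"
  shows "v \<in> tangent_space N p"
proof -
  have "v \<in> orthogonal_comp (normal_space N p)"
    using assms(3) by (auto simp: orthogonal_comp_def orthogonal_def)
  then show ?thesis
    using orthogonal_comp_self[OF subspace_tangent_space[OF assms(1,2)]] by (simp add: normal_space_def)
qed

lemma dim_normal_space:
  fixes N :: "'a::euclidean_space set"
  assumes "closed_submanifold k N" "p \<in> N"
  shows "dim (normal_space N p) = k"
proof -
  have "normal_space N p = {y \<in> UNIV. \<forall>x\<in>tangent_space N p. orthogonal x y}"
    by (auto simp: normal_space_def orthogonal_comp_def orthogonal_commute)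
  then have "dim (normal_space N p) + dim (tangent_space N p) = DIM('a)"
    using dim_subspace_orthogonal_to_vectors[OF subspace_tangent_space[OF assms] subspace_UNIV] by simp
  then show ?thesis using dim_tangent_space[OF assms] by simp
qed

lemma closest_point_subspace:
  fixes S :: "'a::euclidean_space set"
  assumes "subspace S"
  shows closest_point_subspace_in: "closest_point S x \<in> S"
    and closest_point_subspace_orthogonal: "y \<in> S \<Longrightarrow> y \<bullet> (x - closest_point S x) = 0"
proof -
  have cl: "closed S" "convex S" "S \<noteq> {}"
    using assms closed_subspace subspace_imp_convex subspace_0 by blast+
  show A: "closest_point S x \<in> S" by (rule closest_point_in_set[OF cl(1,3)])
  show "y \<bullet> (x - closest_point S x) = 0" if "y \<in> S"
  proof -
    have "closest_point S x + y \<in> S" "closest_point S x - y \<in> S"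
      using A that assms by (auto intro: subspace_add subspace_diff)
    from this[THEN closest_point_dot[OF cl(2,1), of _ x]]
    show ?thesis by (simp add: inner_commute)
  qed
qed

section \<open>Quadratic estimates on compact submanifolds\<close>

text \<open>A Lebesgue number of the cover by the balls of \<open>loc\<close> separates two regimes: closer pairs of
  points lie in a common ball, and for the remaining pairs the distance is bounded below.\<close>

lemma compact_local_to_global:
  fixes Q :: "real \<Rightarrow> 'a::metric_space \<Rightarrow> 'a \<Rightarrow> bool"
  assumes K: "compact K"
    and mono: "\<And>C C' x y. Q C x y \<Longrightarrow> C \<le> C' \<Longrightarrow> Q C' x y"
    and loc: "\<And>p. p \<in> K \<Longrightarrow> \<exists>r>0. \<exists>C. \<forall>x\<in>K \<inter> ball p r. \<forall>y\<in>K \<inter> ball p r. Q C x y"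
    and far: "\<And>d. d > 0 \<Longrightarrow> \<exists>C. \<forall>x\<in>K. \<forall>y\<in>K. d \<le> dist x y \<longrightarrow> Q C x y"
  shows "\<exists>C\<ge>0. \<forall>x\<in>K. \<forall>y\<in>K. Q C x y"
proof -
  obtain r C where rC: "\<And>p. p \<in> K \<Longrightarrow> r p > (0::real)"
    "\<And>p x y. p \<in> K \<Longrightarrow> x \<in> K \<inter> ball p (r p) \<Longrightarrow> y \<in> K \<inter> ball p (r p) \<Longrightarrow> Q (C p) x y"
    using loc by metis
  have "K \<subseteq> (\<Union>p\<in>K. ball p (r p / 2))" using rC(1) by force
  then obtain P where P: "P \<subseteq> K" "finite P" "K \<subseteq> (\<Union>p\<in>P. ball p (r p / 2))"
    using compactE_image[OF K, of K "\<lambda>p. ball p (r p / 2)"] by auto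
  define d where "d = Min (insert 1 ((\<lambda>p. r p / 2) ` P))"
  have d: "d > 0" using P rC(1) by (auto simp: d_def)
  have dle: "d \<le> r p / 2" if "p \<in> P" for p unfolding d_def by (rule Min_le) (use P that in auto)
  obtain C' where C': "\<And>x y. x \<in> K \<Longrightarrow> y \<in> K \<Longrightarrow> d \<le> dist x y \<Longrightarrow> Q C' x y" using far[OF d] by blast
  define D where "D = Max (insert 0 (insert C' (C ` P)))"
  have D: "0 \<le> D" "C' \<le> D" "\<And>p. p \<in> P \<Longrightarrow> C p \<le> D"
    unfolding D_def by (rule Max_ge; use P(2) in auto)+
  show ?thesis
  proof (rule exI[of _ D], intro conjI ballI)
    fix x y assume xy: "x \<in> K" "y \<in> K"
    show "Q D x y"
    proof (cases "d \<le> dist x y")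
      case True then show ?thesis using C'[OF xy] mono D by blast
    next
      case False
      obtain p where p: "p \<in> P" "dist p x < r p / 2" using P(3) xy by auto
      then have "dist p y < r p" using dle[OF p(1)] False dist_triangle[of p y x] by linarith
      moreover have "dist p x < r p" using p rC(1) P(1) by force
      ultimately have "Q (C p) x y" using rC(2)[of p x y] p P(1) xy by auto
      then show ?thesis using mono D(3) p by blast
    qed
  qed (use D in auto)
qed

lemma smooth_on_derivative_bound:
  fixes f :: "'a::euclidean_space \<Rightarrow> 'b::real_normed_vector"
  assumes "smooth_on U f" "cball p r \<subseteq> U"
  obtains C where "C \<ge> 0" "\<And>x v. x \<in> cball p r \<Longrightarrow> norm (frechet_derivative f (at x) v) \<le> C * norm v"
    "\<And>x y. x \<in> cball p r \<Longrightarrow> y \<in> cball p r \<Longrightarrow> norm (f x - f y) \<le> C * norm (x - y)"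
proof -
  define s where "s x = (\<Sum>b\<in>Basis. norm (frechet_derivative f (at x) b))" for x
  have "continuous_on (cball p r) s" unfolding s_def
    by (intro continuous_intros continuous_on_subset[OF smooth_on_continuous[OF smooth_on_derivative[OF assms(1)]] assms(2)])
  then have "bounded (s ` cball p r)" by (intro compact_imp_bounded compact_continuous_image) auto
  then obtain C where C: "\<And>x. x \<in> cball p r \<Longrightarrow> s x \<le> C" "C > 0"
    unfolding bounded_pos by (metis abs_le_D1 imageI real_norm_def)
  have D: "(f has_derivative frechet_derivative f (at x)) (at x)" if "x \<in> cball p r" for x
    using smooth_onD[OF assms(1)] that assms(2) by blast
  have A: "norm (frechet_derivative f (at x) v) \<le> C * norm v" if x: "x \<in> cball p r" for x v
  proof -
    have l: "linear (frechet_derivative f (at x))" using D[OF x] has_derivative_linear by blast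
    have "frechet_derivative f (at x) v = frechet_derivative f (at x) (\<Sum>b\<in>Basis. (v \<bullet> b) *\<^sub>R b)"
      by (simp add: euclidean_representation)
    also have "\<dots> = (\<Sum>b\<in>Basis. (v \<bullet> b) *\<^sub>R frechet_derivative f (at x) b)"
      using l by (simp add: linear_sum linear_cmul)
    also have "norm \<dots> \<le> (\<Sum>b\<in>Basis. norm v * norm (frechet_derivative f (at x) b))"
      by (rule sum_norm_le)
        (auto intro!: mult_right_mono simp: Basis_le_norm)
    also have "\<dots> = s x * norm v" by (simp add: s_def sum_distrib_left mult.commute)
    also have "\<dots> \<le> C * norm v" using C(1)[OF x] by (simp add: mult_right_mono)
    finally show ?thesis .
  qed
  have "norm (f x - f y) \<le> C * norm (x - y)" if "x \<in> cball p r" "y \<in> cball p r" for x y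
  proof (rule differentiable_bound[OF convex_cball _ _ that])
    show "(f has_derivative frechet_derivative f (at z)) (at z within cball p r)" if "z \<in> cball p r" for z
      using D[OF that] has_derivative_at_withinI by blast
    show "onorm (frechet_derivative f (at z)) \<le> C" if "z \<in> cball p r" for z
      using A[OF that] C(2) by (intro onorm_bound) auto
  qed
  then show ?thesis using that[of C] A C(2) by (metis less_eq_real_def)
qed

text \<open>The partial derivatives are Lipschitz on the ball; the second estimate is the mean value
  inequality for \<open>f\<close> minus its linearisation at \<open>x\<close>.\<close>

lemma smooth_on_second_order_bound:
  fixes f :: "'a::euclidean_space \<Rightarrow> 'b::real_normed_vector"
  assumes f: "smooth_on U f" and sub: "cball p r \<subseteq> U"
  obtains C where "C \<ge> 0"
    "\<And>x y v. x \<in> cball p r \<Longrightarrow> y \<in> cball p r \<Longrightarrow>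
       norm (frechet_derivative f (at x) v - frechet_derivative f (at y) v) \<le> C * norm (x - y) * norm v"
    "\<And>x y. x \<in> cball p r \<Longrightarrow> y \<in> cball p r \<Longrightarrow>
       norm (f y - f x - frechet_derivative f (at x) (y - x)) \<le> C * (norm (y - x))\<^sup>2"
proof -
  have "\<exists>C. C \<ge> 0 \<and> (\<forall>x\<in>cball p r. \<forall>y\<in>cball p r.
      norm (frechet_derivative f (at x) b - frechet_derivative f (at y) b) \<le> C * norm (x - y))" for b
    using smooth_on_derivative_bound[OF smooth_on_derivative[OF f] sub, of b] by metis
  then obtain c where c: "\<And>b. c b \<ge> 0" "\<And>b x y. x \<in> cball p r \<Longrightarrow> y \<in> cball p r \<Longrightarrow>
      norm (frechet_derivative f (at x) b - frechet_derivative f (at y) b) \<le> c b * norm (x - y)" by metis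
  define C where "C = sum c Basis"
  have C0: "C \<ge> 0" unfolding C_def using c(1) by (intro sum_nonneg) auto
  have D: "(f has_derivative frechet_derivative f (at x)) (at x)" if "x \<in> cball p r" for x
    using smooth_onD[OF f] that sub by blast
  have A: "norm (frechet_derivative f (at x) v - frechet_derivative f (at y) v) \<le> C * norm (x - y) * norm v"
    if x: "x \<in> cball p r" and y: "y \<in> cball p r" for x y v
  proof -
    have l: "linear (frechet_derivative f (at x))" "linear (frechet_derivative f (at y))"
      using D x y has_derivative_linear by blast+
    have e: "frechet_derivative f (at z) v = (\<Sum>b\<in>Basis. (v \<bullet> b) *\<^sub>R frechet_derivative f (at z) b)"
      if "linear (frechet_derivative f (at z))" for z
    proof -
      have "frechet_derivative f (at z) v = frechet_derivative f (at z) (\<Sum>b\<in>Basis. (v \<bullet> b) *\<^sub>R b)"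
        by (simp add: euclidean_representation)
      also have "\<dots> = (\<Sum>b\<in>Basis. (v \<bullet> b) *\<^sub>R frechet_derivative f (at z) b)"
        using that by (simp add: linear_sum linear_cmul)
      finally show ?thesis .
    qed
    have "frechet_derivative f (at x) v - frechet_derivative f (at y) v
        = (\<Sum>b\<in>Basis. (v \<bullet> b) *\<^sub>R (frechet_derivative f (at x) b - frechet_derivative f (at y) b))"
      using e[OF l(1)] e[OF l(2)] by (simp add: sum_subtractf scaleR_right_diff_distrib)
    also have "norm \<dots> \<le> (\<Sum>b\<in>Basis. norm v * (c b * norm (x - y)))"
      by (rule sum_norm_le) (use c x y in \<open>auto intro!: mult_mono simp: Basis_le_norm\<close>)
    also have "\<dots> = C * norm (x - y) * norm v"
      by (simp add: C_def sum_distrib_left sum_distrib_right mult_ac)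
    finally show ?thesis .
  qed
  have B: "norm (f y - f x - frechet_derivative f (at x) (y - x)) \<le> C * (norm (y - x))\<^sup>2"
    if x: "x \<in> cball p r" and y: "y \<in> cball p r" for x y
  proof -
    have seg: "closed_segment x y \<subseteq> cball p r" using x y convex_cball closed_segment_subset by blast
    have "norm (f y - f x - frechet_derivative f (at x) (y - x)) \<le> norm (y - x) * (C * norm (y - x))"
    proof (rule differentiable_bound_linearization[where S = "closed_segment x y" and f' = "\<lambda>z. frechet_derivative f (at z)"])
      show "x + t *\<^sub>R (y - x) \<in> closed_segment x y" if "t \<in> {0..1}" for t
        using that by (auto simp: closed_segment_def algebra_simps intro!: exI[of _ t])
      show "(f has_derivative frechet_derivative f (at z)) (at z within closed_segment x y)"
        if "z \<in> closed_segment x y" for z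
        using D seg that has_derivative_at_withinI by blast
      show "onorm (frechet_derivative f (at z) - frechet_derivative f (at x)) \<le> C * norm (y - x)"
        if "z \<in> closed_segment x y" for z
      proof (rule onorm_bound)
        fix v
        have "norm (frechet_derivative f (at z) v - frechet_derivative f (at x) v) \<le> C * norm (z - x) * norm v"
          using A seg that x by blast
        also have "\<dots> \<le> C * norm (y - x) * norm v"
          using segment_bound(1)[OF that] C0 by (intro mult_mono) auto
        finally show "norm ((frechet_derivative f (at z) - frechet_derivative f (at x)) v) \<le> C * norm (y - x) * norm v"
          by simp
      qed (use C0 in auto)
    qed auto
    then show ?thesis by (simp add: power2_eq_square mult_ac)
  qed
  show ?thesis using that[OF C0 A B] .
qed

text \<open>The submanifold leaves its tangent plane only to second order, and its normal
  spaces rotate at a bounded rate. These two bounds are all the curvature information that is used below;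
  they hold near each point by a chart and then on the whole compact manifold.\<close>

lemma submanifold_local_estimates:
  assumes N: "slice_chart N U V \<phi> \<psi> L" and p: "p0 \<in> N" "p0 \<in> U"
  shows "\<exists>r>0. \<exists>C. \<forall>p\<in>N \<inter> ball p0 r. \<forall>q\<in>N \<inter> ball p0 r. \<forall>n\<in>normal_space N p.
     \<bar>n \<bullet> (q - p)\<bar> \<le> C * norm n * (norm (q - p))\<^sup>2 \<and>
     (\<forall>v\<in>tangent_space N q. \<bar>n \<bullet> v\<bar> \<le> C * norm n * norm v * norm (q - p))"
proof -
  note c = slice_chartD[OF N]
  obtain \<rho> where \<rho>: "\<rho> > 0" "cball (\<phi> p0) \<rho> \<subseteq> V"
    using c(2) c(6)[OF p(2)] open_contains_cball by blast
  have "open (U \<inter> \<phi> -` ball (\<phi> p0) \<rho>)" by (rule continuous_open_preimage[OF c(12,1)]) auto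
  moreover have "p0 \<in> U \<inter> \<phi> -` ball (\<phi> p0) \<rho>" using p(2) \<rho>(1) by auto
  ultimately obtain r where r: "r > 0" "cball p0 r \<subseteq> U \<inter> \<phi> -` ball (\<phi> p0) \<rho>"
    using open_contains_cball by blast
  obtain C1 where C1: "C1 \<ge> 0"
    "\<And>x y v. x \<in> cball (\<phi> p0) \<rho> \<Longrightarrow> y \<in> cball (\<phi> p0) \<rho> \<Longrightarrow>
       norm (frechet_derivative \<psi> (at x) v - frechet_derivative \<psi> (at y) v) \<le> C1 * norm (x - y) * norm v"
    "\<And>x y. x \<in> cball (\<phi> p0) \<rho> \<Longrightarrow> y \<in> cball (\<phi> p0) \<rho> \<Longrightarrow>
       norm (\<psi> y - \<psi> x - frechet_derivative \<psi> (at x) (y - x)) \<le> C1 * (norm (y - x))\<^sup>2"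
    using smooth_on_second_order_bound[OF c(4) \<rho>(2)] by metis
  have "cball p0 r \<subseteq> U" using r by auto
  then obtain C2 where C2: "C2 \<ge> 0"
    "\<And>x v. x \<in> cball p0 r \<Longrightarrow> norm (frechet_derivative \<phi> (at x) v) \<le> C2 * norm v"
    "\<And>x y. x \<in> cball p0 r \<Longrightarrow> y \<in> cball p0 r \<Longrightarrow> norm (\<phi> x - \<phi> y) \<le> C2 * norm (x - y)"
    using smooth_on_derivative_bound[OF c(3)] by metis
  define C where "C = C1 * C2\<^sup>2"
  show ?thesis
  proof (rule exI[of _ r], intro conjI, rule r(1), rule exI[of _ C], intro ballI conjI)
    fix p q n assume pq: "p \<in> N \<inter> ball p0 r" "q \<in> N \<inter> ball p0 r" and n: "n \<in> normal_space N p"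
    have cb: "p \<in> cball p0 r" "q \<in> cball p0 r" "p \<in> U" "q \<in> U" using pq r by auto
    have ab: "\<phi> p \<in> cball (\<phi> p0) \<rho>" "\<phi> q \<in> cball (\<phi> p0) \<rho>" "\<phi> p \<in> L" "\<phi> q \<in> L"
    proof -
      have "\<phi> p \<in> ball (\<phi> p0) \<rho>" "\<phi> q \<in> ball (\<phi> p0) \<rho>" using r(2) cb by blast+
      then show "\<phi> p \<in> cball (\<phi> p0) \<rho>" "\<phi> q \<in> cball (\<phi> p0) \<rho>" by auto
      show "\<phi> p \<in> L" "\<phi> q \<in> L" using c(10) cb pq by auto
    qed
    have T: "tangent_space N p = frechet_derivative \<psi> (at (\<phi> p)) ` L"
      by (rule tangent_space_slice_chart[OF N]) (use pq cb in auto)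
    have "\<phi> q - \<phi> p \<in> L" using ab c(5) subspace_diff by blast
    then have z: "n \<bullet> frechet_derivative \<psi> (at (\<phi> p)) (\<phi> q - \<phi> p) = 0"
      using normal_space_orthogonal[OF n] T by blast
    have "\<bar>n \<bullet> (q - p)\<bar> = \<bar>n \<bullet> (\<psi> (\<phi> q) - \<psi> (\<phi> p) - frechet_derivative \<psi> (at (\<phi> p)) (\<phi> q - \<phi> p))\<bar>"
      using z c(7)[OF cb(3)] c(7)[OF cb(4)] by (simp add: inner_diff_right)
    also have "\<dots> \<le> norm n * (C1 * (norm (\<phi> q - \<phi> p))\<^sup>2)"
      by (rule order_trans[OF Cauchy_Schwarz_ineq2]) (intro mult_left_mono C1(3) ab norm_ge_zero)
    also have "\<dots> \<le> norm n * (C1 * (C2 * norm (q - p))\<^sup>2)"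
      by (intro mult_left_mono power_mono C2(3) cb C1(1) norm_ge_zero)
    finally show "\<bar>n \<bullet> (q - p)\<bar> \<le> C * norm n * (norm (q - p))\<^sup>2" by (simp add: C_def power_mult_distrib mult_ac)
    fix v assume v: "v \<in> tangent_space N q"
    define l where "l = frechet_derivative \<phi> (at q) v"
    have l: "l \<in> L" unfolding l_def using tangent_space_slice_chart(2)[OF N _ cb(4)] pq v by auto
    have vl: "v = frechet_derivative \<psi> (at (\<phi> q)) l"
      unfolding l_def using slice_chart_derivatives(1)[OF N cb(4)] by simp
    have z: "n \<bullet> frechet_derivative \<psi> (at (\<phi> p)) l = 0"
      using normal_space_orthogonal[OF n] T l by blast
    have "\<bar>n \<bullet> v\<bar> = \<bar>n \<bullet> (frechet_derivative \<psi> (at (\<phi> q)) l - frechet_derivative \<psi> (at (\<phi> p)) l)\<bar>"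
      using z vl by (simp add: inner_diff_right)
    also have "\<dots> \<le> norm n * (C1 * norm (\<phi> q - \<phi> p) * norm l)"
      by (rule order_trans[OF Cauchy_Schwarz_ineq2]) (intro mult_left_mono C1(2) ab norm_ge_zero)
    also have "\<dots> \<le> norm n * (C1 * (C2 * norm (q - p)) * (C2 * norm v))"
      unfolding l_def by (intro mult_left_mono mult_mono C2 cb C1(1) norm_ge_zero mult_nonneg_nonneg)
    finally show "\<bar>n \<bullet> v\<bar> \<le> C * norm n * norm v * norm (q - p)"
      by (simp add: C_def power2_eq_square mult_ac)
  qed
qed

lemma submanifold_estimates:
  assumes N: "closed_submanifold k N"
  obtains C where "C \<ge> 0"
    "\<And>p q n. p \<in> N \<Longrightarrow> q \<in> N \<Longrightarrow> n \<in> normal_space N p \<Longrightarrow> \<bar>n \<bullet> (q - p)\<bar> \<le> C * norm n * (norm (q - p))\<^sup>2"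
    "\<And>p q n v. p \<in> N \<Longrightarrow> q \<in> N \<Longrightarrow> n \<in> normal_space N p \<Longrightarrow> v \<in> tangent_space N q \<Longrightarrow>
       \<bar>n \<bullet> v\<bar> \<le> C * norm n * norm v * norm (q - p)"
proof -
  define Q where "Q C p q \<longleftrightarrow> (\<forall>n\<in>normal_space N p.
     \<bar>n \<bullet> (q - p)\<bar> \<le> C * norm n * (norm (q - p))\<^sup>2 \<and>
     (\<forall>v\<in>tangent_space N q. \<bar>n \<bullet> v\<bar> \<le> C * norm n * norm v * norm (q - p)))" for C p q
  have Q1: "\<exists>C. \<forall>x\<in>N. \<forall>y\<in>N. d \<le> dist x y \<longrightarrow> Q C x y" if d: "d > 0" for d
  proof (intro exI[of _ "1/d"] ballI impI)
    fix x y assume "x \<in> N" "y \<in> N" "d \<le> dist x y"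
    then have 1: "1 \<le> 1/d * norm (y - x)" using d by (simp add: dist_norm norm_minus_commute field_simps)
    show "Q (1/d) x y" unfolding Q_def
    proof (intro ballI conjI)
      fix n v
      have m: "A \<le> 1/d * norm (y - x) * A" if "A \<ge> 0" for A
        using mult_right_mono[OF 1 that] by simp
      have "\<bar>n \<bullet> (y - x)\<bar> \<le> norm n * norm (y - x)" by (rule Cauchy_Schwarz_ineq2)
      also have "\<dots> \<le> 1/d * norm (y - x) * (norm n * norm (y - x))" by (rule m) auto
      finally show "\<bar>n \<bullet> (y - x)\<bar> \<le> 1/d * norm n * (norm (y - x))\<^sup>2"
        by (simp add: power2_eq_square mult_ac)
      have "\<bar>n \<bullet> v\<bar> \<le> norm n * norm v" by (rule Cauchy_Schwarz_ineq2)
      also have "\<dots> \<le> 1/d * norm (y - x) * (norm n * norm v)" by (rule m) auto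
      finally show "\<bar>n \<bullet> v\<bar> \<le> 1/d * norm n * norm v * norm (y - x)"
        by (simp add: mult_ac)
    qed
  qed
  have Q2: "\<exists>r>0. \<exists>C. \<forall>x\<in>N \<inter> ball p r. \<forall>y\<in>N \<inter> ball p r. Q C x y" if "p \<in> N" for p
  proof -
    obtain U V \<phi> \<psi> L where c: "p \<in> U" "slice_chart N U V \<phi> \<psi> L"
      using N \<open>p \<in> N\<close> unfolding closed_submanifold_iff by blast
    from submanifold_local_estimates[OF c(2) \<open>p \<in> N\<close> c(1)] show ?thesis unfolding Q_def .
  qed
  have Q3: "Q C' x y" if "Q C x y" "C \<le> C'" for C C' x y
  proof -
    show ?thesis unfolding Q_def
    proof (intro ballI conjI)
      fix n assume n: "n \<in> normal_space N x"
      have "\<bar>n \<bullet> (y - x)\<bar> \<le> C * norm n * (norm (y - x))\<^sup>2" using that(1) n unfolding Q_def by blast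
      also have "\<dots> \<le> C' * norm n * (norm (y - x))\<^sup>2" using that(2) by (intro mult_right_mono) auto
      finally show "\<bar>n \<bullet> (y - x)\<bar> \<le> C' * norm n * (norm (y - x))\<^sup>2" .
      fix v assume v: "v \<in> tangent_space N y"
      have "\<bar>n \<bullet> v\<bar> \<le> C * norm n * norm v * norm (y - x)" using that(1) n v unfolding Q_def by blast
      also have "\<dots> \<le> C' * norm n * norm v * norm (y - x)" using that(2) by (intro mult_right_mono) auto
      finally show "\<bar>n \<bullet> v\<bar> \<le> C' * norm n * norm v * norm (y - x)" .
    qed
  qed
  have "compact N" using N by (simp add: closed_submanifold_def)
  have "\<exists>C\<ge>0. \<forall>x\<in>N. \<forall>y\<in>N. Q C x y"
  proof (rule compact_local_to_global[where Q = Q and K = N])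
    show "Q C' x y" if "Q C x y" "C \<le> C'" for C C' x y by (rule Q3[OF that])
    show "\<exists>r>0. \<exists>C. \<forall>x\<in>N \<inter> ball p r. \<forall>y\<in>N \<inter> ball p r. Q C x y" if "p \<in> N" for p by (rule Q2[OF that])
    show "\<exists>C. \<forall>x\<in>N. \<forall>y\<in>N. d \<le> dist x y \<longrightarrow> Q C x y" if "d > 0" for d by (rule Q1[OF that])
  qed fact
  then obtain C where C: "C \<ge> 0" "\<forall>x\<in>N. \<forall>y\<in>N. Q C x y" by auto
  show ?thesis by (rule that[OF C(1)]) (use C(2) in \<open>auto simp: Q_def\<close>)
qed

lemma smooth_map_onE:
  assumes "smooth_map_on N f" "p \<in> N"
  obtains U g where "open U" "p \<in> U" "smooth_on U g" "\<forall>x\<in>N \<inter> U. f x = g x"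
proof -
  have "\<exists>U g. open U \<and> p \<in> U \<and> smooth_on U g \<and> (\<forall>x\<in>N \<inter> U. f x = g x)"
    using assms unfolding smooth_map_on_def by simp
  then show ?thesis
  proof (elim exE conjE)
    fix U g assume "open U" "p \<in> U" "smooth_on U g" "\<forall>x\<in>N \<inter> U. f x = g x"
    then show ?thesis by (intro that[of U g]) auto
  qed
qed

lemma smooth_map_on_Lipschitz:
  fixes f :: "'a::euclidean_space \<Rightarrow> 'b::real_normed_vector"
  assumes N: "compact N" and f: "smooth_map_on N f"
  obtains C where "C \<ge> 0" "\<And>x y. x \<in> N \<Longrightarrow> y \<in> N \<Longrightarrow> norm (f x - f y) \<le> C * norm (x - y)"
proof -
  have loc: "\<exists>r>0. \<exists>C. \<forall>x\<in>N \<inter> ball p r. \<forall>y\<in>N \<inter> ball p r. norm (f x - f y) \<le> C * norm (x - y)" if p: "p \<in> N" for p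
  proof -
    obtain U g where U: "open U" "p \<in> U" "smooth_on U g" "\<forall>x\<in>N \<inter> U. f x = g x"
      by (rule smooth_map_onE[OF f p])
    then obtain r where r: "r > 0" "cball p r \<subseteq> U" using open_contains_cball by blast
    obtain C where C: "\<And>x y. x \<in> cball p r \<Longrightarrow> y \<in> cball p r \<Longrightarrow> norm (g x - g y) \<le> C * norm (x - y)"
      using smooth_on_derivative_bound[OF U(3) r(2)] by metis
    have "norm (f x - f y) \<le> C * norm (x - y)" if xy: "x \<in> N \<inter> ball p r" "y \<in> N \<inter> ball p r" for x y
    proof -
      have "x \<in> cball p r" "y \<in> cball p r" using xy by auto
      moreover from this have "f x = g x" "f y = g y" using U(4) r(2) xy by blast+
      ultimately show ?thesis using C by simp
    qed
    then have "\<exists>C. \<forall>x\<in>N \<inter> ball p r. \<forall>y\<in>N \<inter> ball p r. norm (f x - f y) \<le> C * norm (x - y)" by blast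
    then show ?thesis using r(1) by blast
  qed
  have cont: "continuous_on N f"
    unfolding continuous_on_eq_continuous_within
  proof
    fix p assume p: "p \<in> N"
    obtain U g where U: "open U" "p \<in> U" "smooth_on U g" "\<forall>x\<in>N \<inter> U. f x = g x"
      by (rule smooth_map_onE[OF f p])
    have c1: "continuous (at p within N) g"
      using smooth_on_continuous[OF U(3)] U(1,2) continuous_on_eq_continuous_at continuous_at_imp_continuous_at_within by blast
    obtain r where r: "r > 0" "ball p r \<subseteq> U" using U open_contains_ball by meson
    show "continuous (at p within N) f"
    proof (rule continuous_transform_within[OF c1 r(1) p])
      fix x assume "x \<in> N" "dist x p < r"
      then have "x \<in> N \<inter> U" using r(2) by (auto simp: dist_commute subset_eq)
      then show "g x = f x" using U(4) by simp
    qed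
  qed
  then obtain B where B: "\<And>x. x \<in> N \<Longrightarrow> norm (f x) \<le> B"
    using compact_imp_bounded[OF compact_continuous_image[OF cont N]] unfolding bounded_iff by blast
  have far: "\<exists>C. \<forall>x\<in>N. \<forall>y\<in>N. d \<le> dist x y \<longrightarrow> norm (f x - f y) \<le> C * norm (x - y)" if d: "d > 0" for d
  proof (intro exI[of _ "2 * B / d"] ballI impI)
    fix x y assume xy: "x \<in> N" "y \<in> N" "d \<le> dist x y"
    have "norm (f x - f y) \<le> 2 * B" using B[OF xy(1)] B[OF xy(2)] norm_triangle_ineq4[of "f x" "f y"] by linarith
    also have "2 * B \<le> 2 * B / d * norm (x - y)"
    proof -
      have "0 \<le> B" by (rule order_trans[OF norm_ge_zero B[OF xy(1)]])
      then have "2 * B / d * d \<le> 2 * B / d * norm (x - y)"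
        using xy(3) d by (intro mult_left_mono) (auto simp: dist_norm)
      then show ?thesis using d by simp
    qed
    finally show "norm (f x - f y) \<le> 2 * B / d * norm (x - y)" .
  qed
  define Q where "Q C x y \<longleftrightarrow> norm (f x - f y) \<le> C * norm (x - y)" for C x y
  have "\<exists>C\<ge>0. \<forall>x\<in>N. \<forall>y\<in>N. Q C x y"
  proof (rule compact_local_to_global[where Q = Q and K = N, OF N])
    fix C C' x y assume "Q C x y" "C \<le> C'"
    then show "Q C' x y" unfolding Q_def
      using mult_right_mono[of C C' "norm (x - y)"] by simp
  next
    fix p assume "p \<in> N"
    from loc[OF this] show "\<exists>r>0. \<exists>C. \<forall>x\<in>N \<inter> ball p r. \<forall>y\<in>N \<inter> ball p r. Q C x y"
      unfolding Q_def .
  next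
    fix d :: real assume "d > 0"
    from far[OF this] show "\<exists>C. \<forall>x\<in>N. \<forall>y\<in>N. d \<le> dist x y \<longrightarrow> Q C x y" unfolding Q_def .
  qed
  then obtain C where C: "C \<ge> 0" "\<forall>x\<in>N. \<forall>y\<in>N. Q C x y" by auto
  show ?thesis by (rule that[OF C(1)]) (use C(2) in \<open>auto simp: Q_def\<close>)
qed

lemma smooth_map_on_continuous:
  fixes f :: "'a::euclidean_space \<Rightarrow> 'b::real_normed_vector"
  assumes "compact N" "smooth_map_on N f" shows "continuous_on N f"
proof -
  obtain C where "C \<ge> 0" "\<And>x y. x \<in> N \<Longrightarrow> y \<in> N \<Longrightarrow> norm (f x - f y) \<le> C * norm (x - y)"
    using smooth_map_on_Lipschitz[OF assms] by metis
  then have "C-lipschitz_on N f" by (auto simp: lipschitz_on_def dist_norm)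
  then show ?thesis by (rule lipschitz_on_continuous_on)
qed

text \<open>The squared norm of the difference of the projections of \<open>c\<close> to the normal spaces at two points expands into
  pairings of a normal vector at one point with a tangent vector at the other. Such pairings are
  bounded by the distance, so the projections depend on the point in a Hoelder continuous way.\<close>

lemma continuous_on_normal_projection:
  assumes N: "closed_submanifold k N" and S: "S \<subseteq> N" and f: "continuous_on S f"
  shows "continuous_on S (\<lambda>q. closest_point (normal_space N q) (f q))"
proof -
  obtain C where C: "C \<ge> 0" "\<And>p q n v. p \<in> N \<Longrightarrow> q \<in> N \<Longrightarrow> n \<in> normal_space N p \<Longrightarrow> v \<in> tangent_space N q \<Longrightarrow>
       \<bar>n \<bullet> v\<bar> \<le> C * norm n * norm v * norm (q - p)"
    using submanifold_estimates[OF N] by metis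
  define \<pi> where "\<pi> q c = closest_point (normal_space N q) c" for q c
  have in_N: "\<pi> q c \<in> normal_space N q" for q c
    unfolding \<pi>_def by (rule closest_point_subspace_in[OF subspace_normal_space])
  have orth: "n \<bullet> (c - \<pi> q c) = 0" if "n \<in> normal_space N q" for n q c
    unfolding \<pi>_def by (rule closest_point_subspace_orthogonal[OF subspace_normal_space that])
  have tan: "c - \<pi> q c \<in> tangent_space N q" if "q \<in> N" for q c
    by (rule tangent_spaceI[OF N that orth])
  have pyth: "norm (\<pi> q c) \<le> norm c \<and> norm (c - \<pi> q c) \<le> norm c" for q c
  proof -
    have "(norm c)\<^sup>2 = (norm (\<pi> q c + (c - \<pi> q c)))\<^sup>2" by simp
    also have "\<dots> = (norm (\<pi> q c))\<^sup>2 + (norm (c - \<pi> q c))\<^sup>2"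
      using orth[OF in_N, of q c c] by (subst norm_add_Pythagorean) (auto simp: orthogonal_def)
    finally show ?thesis by (metis le_add_same_cancel1 le_add_same_cancel2 norm_ge_zero power2_le_imp_le zero_le_power2)
  qed
  have hol: "(norm (\<pi> q c - \<pi> p c))\<^sup>2 \<le> 2 * C * (norm c)\<^sup>2 * norm (q - p)" if "p \<in> N" "q \<in> N" for p q c
  proof -
    have b: "x * y \<le> norm c * norm c" if "x \<le> norm c" "y \<le> norm c" "0 \<le> x" "0 \<le> y" for x y
      using that by (intro mult_mono) auto
    have "(norm (\<pi> q c - \<pi> p c))\<^sup>2 = \<pi> q c \<bullet> (c - \<pi> p c) + \<pi> p c \<bullet> (c - \<pi> q c)"
      using orth[OF in_N, of q c c] orth[OF in_N, of p c c]
      by (simp add: power2_norm_eq_inner inner_diff_left inner_diff_right inner_commute algebra_simps)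
    also have "\<dots> \<le> C * norm (\<pi> q c) * norm (c - \<pi> p c) * norm (p - q) + C * norm (\<pi> p c) * norm (c - \<pi> q c) * norm (q - p)"
      using C(2)[OF that(2,1) in_N tan[OF that(1)], of c c] C(2)[OF that in_N tan[OF that(2)], of c c] by linarith
    also have "\<dots> = C * norm (q - p) * (norm (\<pi> q c) * norm (c - \<pi> p c) + norm (\<pi> p c) * norm (c - \<pi> q c))"
      by (simp add: norm_minus_commute algebra_simps)
    also have "\<dots> \<le> C * norm (q - p) * (norm c * norm c + norm c * norm c)"
      using pyth b C(1) by (intro mult_left_mono add_mono) auto
    finally show ?thesis by (simp add: power2_eq_square algebra_simps)
  qed
  have "continuous (at p within S) (\<lambda>q. \<pi> q (f q))" if pS: "p \<in> S" for p
  proof -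
    have p: "p \<in> N" using S pS by auto
    have lim0: "((\<lambda>q. (norm (\<pi> q (f p) - \<pi> p (f p)))\<^sup>2) \<longlongrightarrow> 0) (at p within S)"
    proof (rule tendsto_sandwich[OF _ _ tendsto_const])
      show "((\<lambda>q. 2 * C * (norm (f p))\<^sup>2 * norm (q - p)) \<longlongrightarrow> 0) (at p within S)"
        by (auto intro!: tendsto_eq_intros)
      show "\<forall>\<^sub>F q in at p within S. (norm (\<pi> q (f p) - \<pi> p (f p)))\<^sup>2 \<le> 2 * C * (norm (f p))\<^sup>2 * norm (q - p)"
        using hol[OF p] S by (auto simp: eventually_at_filter intro!: always_eventually)
    qed auto
    have lim1: "((\<lambda>q. norm (\<pi> q (f p) - \<pi> p (f p))) \<longlongrightarrow> 0) (at p within S)"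
      using tendsto_real_sqrt[OF lim0] by simp
    have "(f \<longlongrightarrow> f p) (at p within S)" using f pS by (simp add: continuous_on)
    then have lim2: "((\<lambda>q. norm (f q - f p)) \<longlongrightarrow> 0) (at p within S)"
      by (simp add: LIM_zero tendsto_norm_zero)
    have "((\<lambda>q. norm (\<pi> q (f q) - \<pi> p (f p))) \<longlongrightarrow> 0) (at p within S)"
    proof (rule tendsto_sandwich[OF _ _ tendsto_const tendsto_add_zero[OF lim2 lim1]])
      show "\<forall>\<^sub>F q in at p within S. norm (\<pi> q (f q) - \<pi> p (f p)) \<le> norm (f q - f p) + norm (\<pi> q (f p) - \<pi> p (f p))"
      proof (rule always_eventually, rule allI)
        fix q
        have "convex (normal_space N q)" "closed (normal_space N q)" "normal_space N q \<noteq> {}"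
          using subspace_normal_space[of N q] subspace_imp_convex closed_subspace subspace_0 by blast+
        then have "norm (\<pi> q (f q) - \<pi> q (f p)) \<le> norm (f q - f p)"
          using closest_point_lipschitz[of "normal_space N q" "f q" "f p"] by (simp add: \<pi>_def dist_norm)
        then show "norm (\<pi> q (f q) - \<pi> p (f p)) \<le> norm (f q - f p) + norm (\<pi> q (f p) - \<pi> p (f p))"
          using norm_triangle_ineq[of "\<pi> q (f q) - \<pi> q (f p)" "\<pi> q (f p) - \<pi> p (f p)"] by simp
      qed
    qed auto
    then show ?thesis unfolding continuous_within by (simp add: Lim_null[of _ "\<pi> p (f p)"] tendsto_norm_zero_iff)
  qed
  then show ?thesis by (simp add: continuous_on_eq_continuous_within \<pi>_def)
qed

section \<open>Stereographic projection\<close>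

lemma stereo_stereo_inv [simp]: "stereo (stereo_inv x) = x"
proof -
  define a where "a = (norm x)\<^sup>2 + 1"
  have a: "a > 0" by (simp add: a_def add_nonneg_pos)
  have "1 - ((norm x)\<^sup>2 - 1) / a = 2 / a" using a by (simp add: a_def field_simps)
  then have "stereo (stereo_inv x) = inverse (2 / a) *\<^sub>R ((2 / a) *\<^sub>R x)"
    by (simp add: stereo_def stereo_inv_def a_def)
  also have "\<dots> = x" using a by (simp only: scaleR_scaleR) simp
  finally show ?thesis .
qed

lemma norm_stereo_inv [simp]: "norm (stereo_inv x) = 1"
proof -
  define a where "a = (norm x)\<^sup>2"
  have a: "a + 1 > 0" by (simp add: a_def add_nonneg_pos)
  have "(norm (stereo_inv x))\<^sup>2 = (2 / (a + 1))\<^sup>2 * a + ((a - 1) / (a + 1))\<^sup>2"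
    by (simp add: stereo_inv_def norm_Pair a_def power_mult_distrib power_divide)
  also have "\<dots> = (4 * a + (a - 1)\<^sup>2) / (a + 1)\<^sup>2"
    by (simp add: power_divide add_divide_distrib)
  also have "4 * a + (a - 1)\<^sup>2 = (a + 1)\<^sup>2" by algebra
  also have "(a + 1)\<^sup>2 / (a + 1)\<^sup>2 = 1" using a by simp
  finally show ?thesis by (metis norm_ge_zero one_power2 power2_eq_imp_eq zero_le_one)
qed

lemma stereo_inv_neq_north [simp]: "stereo_inv x \<noteq> north"
proof
  assume "stereo_inv x = north"
  then have "((norm x)\<^sup>2 - 1) / ((norm x)\<^sup>2 + 1) = 1" by (simp add: stereo_inv_def north_def)
  moreover have "(norm x)\<^sup>2 + 1 > 0" by (simp add: add_nonneg_pos)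
  ultimately show False by (simp add: field_simps)
qed

lemma sphere_snd_neq_1:
  assumes "z \<in> sphere 0 1" "z \<noteq> north" shows "snd z \<noteq> 1"
proof
  assume "snd z = 1"
  then have "(norm (fst z))\<^sup>2 = 0" using assms(1) by (cases z) (simp add: norm_Pair)
  then show False using assms(2) \<open>snd z = 1\<close> by (cases z) (simp add: north_def)
qed

lemma stereo_inv_stereo:
  assumes "z \<in> sphere 0 1" "z \<noteq> north" shows "stereo_inv (stereo z) = z"
proof -
  define k where "k = 1 - snd z"
  define y where "y = fst z"
  have z: "z = (y, 1 - k)" by (simp add: y_def k_def)
  have k: "k \<noteq> 0" using sphere_snd_neq_1[OF assms] by (simp add: k_def)
  have "(norm y)\<^sup>2 + (1 - k)\<^sup>2 = 1"
    using assms(1) by (simp add: z norm_Pair)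
  then have n: "(norm y)\<^sup>2 = k * (2 - k)" by (simp add: power2_eq_square algebra_simps)
  have "norm (stereo z) = norm y / \<bar>k\<bar>" by (simp add: z stereo_def divide_inverse_commute)
  then have "(norm (stereo z))\<^sup>2 = (norm y)\<^sup>2 / k\<^sup>2" by (simp add: power_divide)
  also have "\<dots> = 2 / k - 1" unfolding n using k by (simp add: power2_eq_square diff_divide_distrib)
  finally have s: "(norm (stereo z))\<^sup>2 + 1 = 2 / k" "(norm (stereo z))\<^sup>2 - 1 = 2 / k - 2" by auto
  have "(2 / k - 2) / (2 / k) = 1 - k" using k by (simp add: diff_divide_distrib left_diff_distrib)
  moreover have "(2 / (2 / k)) *\<^sub>R stereo z = (k * inverse k) *\<^sub>R y" by (simp add: z stereo_def)
  ultimately show ?thesis unfolding stereo_inv_def s using k by (simp add: z)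
qed

lemma continuous_on_stereo_inv: "continuous_on S stereo_inv"
proof -
  have "(norm x)\<^sup>2 + 1 \<noteq> 0" for x :: 'a by (metis add_nonneg_pos less_irrefl zero_le_power2 zero_less_one)
  then show ?thesis unfolding stereo_inv_def by (intro continuous_intros) auto
qed

lemma continuous_on_stereo: "continuous_on (sphere 0 1 - {north}) stereo"
proof -
  have "1 - snd z \<noteq> 0" if "z \<in> sphere 0 1 - {north}" for z :: "'a \<times> real"
    using sphere_snd_neq_1[of z] that by auto
  then show ?thesis unfolding stereo_def by (intro continuous_intros) auto
qed

lemma openin_stereo_preimage:
  assumes "open T"
  shows "openin (top_of_set (sphere 0 1)) {z \<in> sphere 0 1. z \<noteq> north \<and> stereo z \<in> T}"
proof -
  have 1: "openin (top_of_set (sphere 0 1 - {north})) ((sphere 0 1 - {north}) \<inter> stereo -` T)"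
    by (rule continuous_openin_preimage_gen[OF continuous_on_stereo assms])
  have 2: "openin (top_of_set (sphere 0 1)) (sphere 0 1 - {north :: 'a \<times> real})"
    by (simp add: openin_delete)
  have 3: "{z \<in> sphere 0 1. z \<noteq> north \<and> stereo z \<in> T} = (sphere 0 1 - {north}) \<inter> stereo -` T" by auto
  show ?thesis unfolding 3 by (rule openin_trans[OF 1 2])
qed

section \<open>Tubes around framed submanifolds\<close>

definition frame_comb :: "'a::real_vector ^ 'k \<Rightarrow> real ^ 'k \<Rightarrow> 'a" where
  "frame_comb v c = (\<Sum>i\<in>UNIV. (c $ i) *\<^sub>R (v $ i))"

lemma tubular_map_eq: "tubular_map g (p, t) = p + frame_comb (g p) t"
  by (simp add: tubular_map_def frame_comb_def)

lemma frame_comb_scaleR: "frame_comb v (a *\<^sub>R c) = a *\<^sub>R frame_comb v c"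
  and frame_comb_add: "frame_comb v (c + d) = frame_comb v c + frame_comb v d"
  and frame_comb_diff: "frame_comb v (c - d) = frame_comb v c - frame_comb v d"
  and frame_comb_zero [simp]: "frame_comb v 0 = 0"
  and frame_comb_diff_left: "frame_comb (v - w) c = frame_comb v c - frame_comb w c"
  by (simp_all add: frame_comb_def scaleR_sum_right scaleR_left_distrib scaleR_left_diff_distrib
      scaleR_right_diff_distrib sum.distrib sum_subtractf sum_negf)

lemma norm_frame_comb_le:
  fixes v :: "'a::real_normed_vector ^ 'k"
  shows "norm (frame_comb v c) \<le> CARD('k) * norm v * norm c"
proof -
  have "norm (frame_comb v c) \<le> (\<Sum>i\<in>(UNIV::'k set). norm c * norm v)"
    unfolding frame_comb_def
    by (rule sum_norm_le) (auto intro!: mult_mono simp: Finite_Cartesian_Product.norm_nth_le component_le_norm_cart)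
  then show ?thesis by (simp add: mult_ac)
qed

lemma continuous_on_frame_comb [continuous_intros]:
  fixes v :: "'b::topological_space \<Rightarrow> 'a::real_normed_vector ^ 'k"
  assumes "continuous_on S v" "continuous_on S c"
  shows "continuous_on S (\<lambda>x. frame_comb (v x) (c x))"
  unfolding frame_comb_def
  by (intro continuous_on_sum continuous_on_scaleR bounded_linear.continuous_on[OF bounded_linear_vec_nth] assms)

lemma frame_comb_normal:
  assumes "framing N g" "p \<in> N" shows "frame_comb (g p) c \<in> normal_space N p"
  unfolding frame_comb_def using assms
  by (intro subspace_sum subspace_scale subspace_normal_space) (auto simp: framing_def)

lemma framing_frame_comb_eq_0: "framing N g \<Longrightarrow> p \<in> N \<Longrightarrow> frame_comb (g p) c = 0 \<Longrightarrow> c = 0"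
  by (auto simp: framing_def frame_comb_def)

text \<open>The lower bound is the minimum over the product of \<open>N\<close> with the unit sphere, which is compact.\<close>

lemma frame_bounds:
  fixes g :: "'a::euclidean_space \<Rightarrow> 'a ^ 'k"
  assumes N: "compact N" and cont: "continuous_on N g"
    and indep: "\<And>p c. p \<in> N \<Longrightarrow> frame_comb (g p) c = 0 \<Longrightarrow> c = 0"
  obtains B \<delta> where "B > 0" "\<delta> > 0" "\<forall>p\<in>N. \<forall>c. norm (frame_comb (g p) c) \<le> B * norm c"
    "\<forall>p\<in>N. \<forall>c. \<delta> * norm c \<le> norm (frame_comb (g p) c)"
proof -
  obtain B0 where B0: "\<And>p. p \<in> N \<Longrightarrow> norm (g p) \<le> B0" "B0 > 0"
    using compact_imp_bounded[OF compact_continuous_image[OF cont N]] unfolding bounded_pos by auto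
  have up: "norm (frame_comb (g p) c) \<le> (CARD('k) * B0) * norm c" if "p \<in> N" for p c
    by (rule order_trans[OF norm_frame_comb_le]) (intro mult_right_mono mult_left_mono B0 that; simp)
  have "\<exists>\<delta>>0. \<forall>p\<in>N. \<forall>c. norm c = 1 \<longrightarrow> \<delta> \<le> norm (frame_comb (g p) c)"
  proof (cases "N = {}")
    case False
    let ?K = "N \<times> sphere (0::real^'k) 1"
    have "sphere (0::real^'k) 1 \<noteq> {}" by simp
    then have ne: "?K \<noteq> {}" using False by blast
    have "continuous_on ?K (\<lambda>x. norm (frame_comb (g (fst x)) (snd x)))"
      by (intro continuous_intros continuous_on_compose2[OF cont]) auto
    from continuous_attains_inf[OF compact_Times[OF N compact_sphere] ne this]
    obtain x where x: "x \<in> ?K" "\<forall>y\<in>?K. norm (frame_comb (g (fst x)) (snd x)) \<le> norm (frame_comb (g (fst y)) (snd y))"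
      by blast
    have "frame_comb (g (fst x)) (snd x) \<noteq> 0" using indep[of "fst x" "snd x"] x(1) by auto
    then show ?thesis using x(2) by (intro exI[of _ "norm (frame_comb (g (fst x)) (snd x))"]) auto
  qed (auto intro: exI[of _ 1])
  then obtain \<delta> where d: "\<delta> > 0" "\<And>p c. p \<in> N \<Longrightarrow> norm c = 1 \<Longrightarrow> \<delta> \<le> norm (frame_comb (g p) c)" by blast
  have low: "\<delta> * norm c \<le> norm (frame_comb (g p) c)" if p: "p \<in> N" for p c
  proof (cases "c = 0")
    case False
    have "\<delta> \<le> norm (frame_comb (g p) (c /\<^sub>R norm c))" by (rule d(2)[OF p]) (use False in simp)
    then show ?thesis using False by (simp add: frame_comb_scaleR field_simps)
  qed simp
  show ?thesis by (rule that[of "CARD('k) * B0" \<delta>]) (use B0 d(1) up low in auto)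
qed

text \<open>Two short normals that meet at \<open>x\<close> have different
  feet only if the foot of each is strictly closer to \<open>x\<close> than the other foot is, because
  of the quadratic contact of the submanifold with its tangent planes; and both cannot be closer.\<close>

lemma tubular_radius_exists:
  assumes "framed_closed_submanifold N g"
  obtains r where "tubular_radius N g r"
proof -
  have N: "closed_submanifold CARD('b) N" and fr: "framing N g"
    using assms by (auto simp: framed_closed_submanifold_def)
  have cN: "compact N" using N by (simp add: closed_submanifold_def)
  obtain C where C: "C \<ge> 0" "\<And>p q n. p \<in> N \<Longrightarrow> q \<in> N \<Longrightarrow> n \<in> normal_space N p \<Longrightarrow> \<bar>n \<bullet> (q - p)\<bar> \<le> C * norm n * (norm (q - p))\<^sup>2"
    using submanifold_estimates[OF N] by metis
  have cg: "continuous_on N g" using fr by (simp add: framing_def)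
  obtain B \<delta> where B: "B > 0" "\<delta> > 0" "\<forall>p\<in>N. \<forall>c. norm (frame_comb (g p) c) \<le> B * norm c"
    "\<forall>p\<in>N. \<forall>c. \<delta> * norm c \<le> norm (frame_comb (g p) c)"
    by (rule frame_bounds[OF cN cg framing_frame_comb_eq_0[OF fr]])
  \<comment> \<open>the normals with coordinates in this ball are shorter than \<open>1 / (2 C)\<close>\<close>
  define r where "r = 1 / (2 * (C + 1) * B)"
  have r: "r > 0" using B C by (simp add: r_def)
  have small: "2 * C * norm (frame_comb (g p) t) < 1" if "p \<in> N" "t \<in> ball 0 r" for p t
  proof -
    have "norm (frame_comb (g p) t) \<le> B * norm t" using B(3) that by blast
    also have "\<dots> \<le> B * r" using that B(1) by (intro mult_left_mono) auto
    also have "\<dots> = 1 / (2 * (C + 1))" using B(1) C(1) by (simp add: r_def)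
    finally have "2 * C * norm (frame_comb (g p) t) \<le> 2 * C * (1 / (2 * (C + 1)))"
      using C(1) by (intro mult_left_mono) auto
    also have "\<dots> < 1" using C(1) by simp
    finally show ?thesis .
  qed
  have key: "(norm n)\<^sup>2 < (norm n')\<^sup>2"
    if p: "p \<in> N" "q \<in> N" "p \<noteq> q" and n: "n \<in> normal_space N p" "2 * C * norm n < 1" and e: "p + n = q + n'" for p q n n'
  proof -
    have "n' = n - (q - p)" using e by (simp add: algebra_simps)
    then have "(norm n')\<^sup>2 = (norm n)\<^sup>2 - 2 * (n \<bullet> (q - p)) + (norm (q - p))\<^sup>2"
      using dot_norm_neg[of n "q - p"] by simp
    moreover have "\<bar>n \<bullet> (q - p)\<bar> \<le> C * norm n * (norm (q - p))\<^sup>2" by (rule C(2)[OF p(1,2) n(1)])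
    moreover have "2 * C * norm n * (norm (q - p))\<^sup>2 < 1 * (norm (q - p))\<^sup>2"
      using n(2) p(3) by (intro mult_strict_right_mono) auto
    ultimately show ?thesis by (simp add: mult_ac)
  qed
  have "inj_on (tubular_map g) (N \<times> ball 0 r)"
  proof (rule inj_onI, clarify)
    fix p t q u assume A: "p \<in> N" "q \<in> N" "t \<in> ball 0 r" "u \<in> ball 0 r" and "tubular_map g (p, t) = tubular_map g (q, u)"
    then have e: "p + frame_comb (g p) t = q + frame_comb (g q) u" by (simp add: tubular_map_eq)
    have "p = q"
    proof (rule ccontr)
      assume "p \<noteq> q"
      then have "q \<noteq> p" by simp
      have "(norm (frame_comb (g p) t))\<^sup>2 < (norm (frame_comb (g q) u))\<^sup>2"
        by (rule key[OF A(1,2) \<open>p \<noteq> q\<close> frame_comb_normal[OF fr A(1)] small[OF A(1,3)] e])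
      moreover have "(norm (frame_comb (g q) u))\<^sup>2 < (norm (frame_comb (g p) t))\<^sup>2"
        by (rule key[OF A(2,1) \<open>q \<noteq> p\<close> frame_comb_normal[OF fr A(2)] small[OF A(2,4)] e[symmetric]])
      ultimately show False by simp
    qed
    then have "frame_comb (g p) (t - u) = 0" using e by (simp add: frame_comb_diff)
    from framing_frame_comb_eq_0[OF fr A(1) this] show "p = q \<and> t = u" using \<open>p = q\<close> by simp
  qed
  then have "tubular_radius N g r" using r by (simp add: tubular_radius_def)
  then show ?thesis by (rule that)
qed

lemma tubular_radius_mono: "tubular_radius N g r \<Longrightarrow> 0 < r' \<Longrightarrow> r' \<le> r \<Longrightarrow> tubular_radius N g r'"
  unfolding tubular_radius_def using inj_on_subset[OF _ Sigma_mono[OF order_refl subset_ball]] by simp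

lemma continuous_on_tubular_map:
  assumes "continuous_on N g"
  shows "continuous_on (N \<times> T) (tubular_map g)"
proof -
  have "continuous_on (N \<times> T) (\<lambda>x. fst x + frame_comb (g (fst x)) (snd x))"
    by (intro continuous_intros continuous_on_compose2[OF assms]) auto
  then show ?thesis by (rule continuous_on_eq) (auto simp: tubular_map_eq)
qed

text \<open>The framing is only continuous, so the inverse function theorem does not apply to the tube map. It is
  however injective and continuous between manifolds of the same dimension, and hence open by
  invariance of domain.\<close>

lemma open_tubular_image:
  fixes g :: "'a::euclidean_space \<Rightarrow> 'a ^ 'k"
  assumes F: "framed_closed_submanifold N g" and r: "tubular_radius N g r"
    and O: "openin (top_of_set (N \<times> ball 0 r)) O'"
  shows "open (tubular_map g ` O')"
proof (subst open_subopen, clarify)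
  fix p t assume pt: "(p, t) \<in> O'"
  have N: "closed_submanifold CARD('k) N" and cg: "continuous_on N g"
    using F by (auto simp: framed_closed_submanifold_def framing_def)
  obtain T where T: "open T" "O' = (N \<times> ball 0 r) \<inter> T" using O by (auto simp: openin_open)
  have p: "p \<in> N" "t \<in> ball 0 r" using pt T by auto
  obtain U V \<phi> \<psi> L where c: "p \<in> U" "slice_chart N U V \<phi> \<psi> L" "dim L + CARD('k) = DIM('a)"
    using N p(1) unfolding closed_submanifold_iff by blast
  note cD = slice_chartD[OF c(2)]
  define f where "f x = tubular_map g (\<psi> (fst x), snd x)" for x
  define S where "S = (L \<times> UNIV) \<inter> ((V \<times> ball 0 r) \<inter> (\<lambda>x. (\<psi> (fst x), snd x)) -` T)"
  have "continuous_on (V \<times> ball (0::real^'k) r) (\<lambda>x. (\<psi> (fst x), snd x))"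
    by (intro continuous_intros continuous_on_compose2[OF cD(13)]) auto
  then have "open ((V \<times> ball 0 r) \<inter> (\<lambda>x. (\<psi> (fst x), snd x)) -` T)"
    using T(1) cD(2) by (intro continuous_open_preimage open_Times) auto
  then have op: "openin (top_of_set (L \<times> UNIV)) S" unfolding S_def by (rule openin_open_Int)
  have Sin: "(\<psi> (fst x), snd x) \<in> O'" if "x \<in> S" for x
    using that cD(11) by (auto simp: S_def T(2))
  have "open (f ` S)"
  proof -
    have "openin (top_of_set UNIV) (f ` S)"
    proof (rule invariance_of_domain_subspaces[OF op])
      show "subspace (L \<times> (UNIV :: (real^'k) set))" using cD(5) by (intro subspace_Times) auto
      show "dim (UNIV :: 'a set) \<le> dim (L \<times> (UNIV :: (real^'k) set))"
        using c(3) cD(5) by (simp add: dim_Times)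
      show "continuous_on S f" unfolding f_def
        by (rule continuous_on_compose2[OF continuous_on_tubular_map[OF cg, of "ball 0 r"]])
          (use Sin T(2) in \<open>auto simp: S_def intro!: continuous_intros continuous_on_compose2[OF cD(13)]\<close>)
      show "inj_on f S"
      proof (rule inj_onI)
        fix x y assume xy: "x \<in> S" "y \<in> S" "f x = f y"
        then have "(\<psi> (fst x), snd x) = (\<psi> (fst y), snd y)"
          using r Sin T(2) unfolding tubular_radius_def f_def by (metis IntD1 inj_onD)
        then have "fst x = fst y" "snd x = snd y"
          using cD(9)[of "fst x"] cD(9)[of "fst y"] xy by (auto simp: S_def)
        then show "x = y" by (simp add: prod_eq_iff)
      qed
    qed auto
    then show ?thesis by simp
  qed
  moreover have "tubular_map g (p, t) \<in> f ` S"
  proof (rule image_eqI)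
    show "tubular_map g (p, t) = f (\<phi> p, t)" using cD(7)[OF c(1)] by (simp add: f_def)
    show "(\<phi> p, t) \<in> S" using p pt c(1) cD(6,7,10) by (auto simp: S_def T(2))
  qed
  moreover have "f ` S \<subseteq> tubular_map g ` O'" using Sin by (auto simp: f_def)
  ultimately show "\<exists>T. open T \<and> tubular_map g (p, t) \<in> T \<and> T \<subseteq> tubular_map g ` O'" by blast
qed

lemma continuous_on_tubular_inverse:
  assumes F: "framed_closed_submanifold N g" and r: "tubular_radius N g r"
  shows "continuous_on (tubular_map g ` (N \<times> ball 0 r)) (inv_into (N \<times> ball 0 r) (tubular_map g))"
proof (rule continuous_on_inverse_open_map[where S = "N \<times> ball 0 r" and f = "tubular_map g"])
  have "continuous_on N g" using F by (auto simp: framed_closed_submanifold_def framing_def)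
  then show "continuous_on (N \<times> ball 0 r) (tubular_map g)" by (rule continuous_on_tubular_map)
next
  show "inv_into (N \<times> ball 0 r) (tubular_map g) (tubular_map g x) = x" if "x \<in> N \<times> ball 0 r" for x :: "'a \<times> (real ^ 'b)"
    using r that by (simp add: tubular_radius_def)
next
  fix O' :: "('a \<times> (real ^ 'b)) set" assume "openin (top_of_set (N \<times> ball 0 r)) O'"
  moreover from this have "tubular_map g ` O' \<subseteq> tubular_map g ` (N \<times> ball 0 r)"
    by (meson image_mono openin_imp_subset)
  ultimately show "openin (top_of_set (tubular_map g ` (N \<times> ball 0 r))) (tubular_map g ` O')"
    using open_tubular_image[OF F r] by (simp add: open_subset)
qed simp

section \<open>Collapse maps\<close>

text \<open>Maps that are prescribed in the coordinates of a tube and send its complement to infinity. The collapse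
  maps are of this form, and so is the lift constructed below.\<close>

definition tube_extend ::
  "'a::euclidean_space set \<Rightarrow> ('a \<Rightarrow> 'a ^ 'k) \<Rightarrow> real \<Rightarrow> ('a \<times> (real ^ 'k) \<Rightarrow> 'b::euclidean_space \<times> real) \<Rightarrow> 'a \<times> real \<Rightarrow> 'b \<times> real" where
  "tube_extend N g r h z =
     (if z \<noteq> north \<and> stereo z \<in> tubular_map g ` (N \<times> ball 0 r)
      then h (inv_into (N \<times> ball 0 r) (tubular_map g) (stereo z)) else north)"

lemma tube_extend_eval:
  assumes "tubular_radius N g r" "p \<in> N" "t \<in> ball 0 r" "z \<noteq> north" "stereo z = tubular_map g (p, t)"
  shows "tube_extend N g r h z = h (p, t)"
  using assms by (simp add: tube_extend_def tubular_radius_def inv_into_f_f)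

lemma tube_extend_cases:
  assumes "tubular_radius N g r"
  obtains p t where "p \<in> N" "t \<in> ball 0 r" "z \<noteq> north" "stereo z = tubular_map g (p, t)" "tube_extend N g r h z = h (p, t)"
  | "\<not> (z \<noteq> north \<and> stereo z \<in> tubular_map g ` (N \<times> ball 0 r))" "tube_extend N g r h z = north"
proof (cases "z \<noteq> north \<and> stereo z \<in> tubular_map g ` (N \<times> ball 0 r)")
  case True
  then obtain p t where "p \<in> N" "t \<in> ball 0 r" "stereo z = tubular_map g (p, t)" by auto
  moreover from this have "tube_extend N g r h z = h (p, t)" using tube_extend_eval[OF assms] True by blast
  ultimately show ?thesis using that(1)[of p t] True by blast
next
  case False
  then have "tube_extend N g r h z = north" by (auto simp: tube_extend_def)
  then show ?thesis by (rule that(2)[OF False])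
qed

text \<open>Continuity is in question only outside the open tube. As \<open>h\<close> tends to the north pole at the boundary of
  the tube, its values off a given neighbourhood of the north pole come from a compact part of the open tube, and
  the image of that part is closed in the sphere. The parameter \<open>\<tau>\<close> serves homotopies.\<close>

lemma continuous_on_tube_extend:
  fixes g :: "'a::euclidean_space \<Rightarrow> 'a ^ 'k" and h :: "real \<times> 'a \<times> (real ^ 'k) \<Rightarrow> 'b::euclidean_space \<times> real"
  assumes F: "framed_closed_submanifold N g" and r: "tubular_radius N g r"
    and h: "continuous_on ({0..1} \<times> N \<times> cball 0 r) h"
    and bd: "\<And>\<tau> p t. \<tau> \<in> {0..1} \<Longrightarrow> p \<in> N \<Longrightarrow> norm t = r \<Longrightarrow> h (\<tau>, p, t) = north"
  shows "continuous_on ({0..1} \<times> sphere 0 1) (\<lambda>(\<tau>, z). tube_extend N g r (\<lambda>x. h (\<tau>, x)) z)"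
    (is "continuous_on ?S ?f")
proof -
  define D where "D = N \<times> ball (0::real^'k) r"
  define E where "E = tubular_map g"
  define G where "G = inv_into D E"
  have N: "compact N" and cg: "continuous_on N g"
    using F by (auto simp: framed_closed_submanifold_def framing_def closed_submanifold_def)
  have injE: "inj_on E D" using r by (simp add: tubular_radius_def D_def E_def)
  have opE: "open (E ` D)" unfolding D_def E_def by (rule open_tubular_image[OF F r]) simp
  have cG: "continuous_on (E ` D) G" unfolding D_def E_def G_def by (rule continuous_on_tubular_inverse[OF F r])
  have GE: "G (E x) = x" if "x \<in> D" for x using injE that by (simp add: G_def)
  have f: "tube_extend N g r (\<lambda>x. h (\<tau>, x)) z = (if z \<noteq> north \<and> stereo z \<in> E ` D then h (\<tau>, G (stereo z)) else north)" for \<tau> z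
    by (simp add: tube_extend_def D_def E_def G_def)
  have cE: "continuous_on (N \<times> cball 0 r) E" unfolding E_def by (rule continuous_on_tubular_map[OF cg])
  define A where "A = {z \<in> sphere 0 1. z \<noteq> north \<and> stereo z \<in> E ` D}"
  have opA: "openin (top_of_set (sphere 0 1)) A" unfolding A_def by (rule openin_stereo_preimage[OF opE])
  have inA: "continuous_on ({0..1} \<times> A) ?f"
  proof (rule continuous_on_eq)
    have "continuous_on A stereo"
      by (rule continuous_on_subset[OF continuous_on_stereo]) (auto simp: A_def)
    then have "continuous_on A (\<lambda>z. G (stereo z))"
      by (rule continuous_on_compose2[OF cG]) (auto simp: A_def)
    then have "continuous_on ({0..1::real} \<times> A) (\<lambda>x. (fst x, G (stereo (snd x))))"
      by (intro continuous_intros continuous_on_compose2[where g = "\<lambda>z. G (stereo z)" and f = snd]) auto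
    then show "continuous_on ({0..1} \<times> A) (\<lambda>x. h (fst x, G (stereo (snd x))))"
      by (rule continuous_on_compose2[OF h]) (auto simp: A_def GE D_def less_imp_le)
  qed (auto simp: f A_def)
  show ?thesis
    unfolding continuous_on_topological
  proof (intro ballI allI impI)
    fix x B assume x: "x \<in> ?S" and B: "open B" "?f x \<in> B"
    obtain \<tau>0 z0 where xz: "x = (\<tau>0, z0)" "\<tau>0 \<in> {0..1}" "z0 \<in> sphere 0 1" using x by auto
    show "\<exists>T. open T \<and> x \<in> T \<and> (\<forall>y\<in>?S. y \<in> T \<longrightarrow> ?f y \<in> B)"
    proof (cases "z0 \<in> A")
      case True
      have "x \<in> {0..1} \<times> A" using xz True by simp
      from inA[unfolded continuous_on_topological, rule_format, OF this B]
      obtain T where T: "open T" "x \<in> T" "\<forall>y\<in>{0..1} \<times> A. y \<in> T \<longrightarrow> ?f y \<in> B" by (elim exE conjE)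
      obtain A' where A': "open A'" "A = sphere 0 1 \<inter> A'" using opA by (auto simp: openin_open)
      show ?thesis
      proof (intro exI[of _ "T \<inter> (UNIV \<times> A')"] conjI ballI impI)
        show "open (T \<inter> UNIV \<times> A')" by (intro open_Int open_Times T(1) A'(1) open_UNIV)
        show "x \<in> T \<inter> UNIV \<times> A'" using T(2) A'(2) xz True by simp
        fix y assume "y \<in> ?S" "y \<in> T \<inter> UNIV \<times> A'"
        then have "y \<in> {0..1} \<times> A" "y \<in> T" using A'(2) by (auto simp: mem_Times_iff)
        then show "?f y \<in> B" using T(3) by blast
      qed
    next
      case False
      then have "?f x = north" using xz by (auto simp: f A_def)
      then obtain e where e: "e > 0" "ball north e \<subseteq> B" using B open_contains_ball by metis
      \<comment> \<open>the values away from the base point come from a compact part of the open tube\<close>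
      define S0 where "S0 = {0..1::real} \<times> N \<times> cball (0::real^'k) r"
      have cS0: "compact S0" unfolding S0_def by (intro compact_Times N) auto
      define K where "K = S0 \<inter> h -` (- ball north e)"
      have "closed K" unfolding K_def
        by (rule continuous_closed_preimage) (use h cS0 in \<open>auto simp: S0_def[symmetric] compact_imp_closed\<close>)
      then have "compact (S0 \<inter> K)" using cS0 by (rule compact_Int_closed[rotated])
      then have cK: "compact K" by (simp add: K_def Int_absorb1 Int_assoc[symmetric])
      have KD: "snd y \<in> D" if "y \<in> K" for y
      proof -
        obtain \<tau> p t where y: "y = (\<tau>, p, t)" by (cases y)
        have "norm t \<noteq> r" using that bd[of \<tau> p t] e(1) by (auto simp: K_def S0_def y)
        then show ?thesis using that by (auto simp: K_def S0_def D_def y)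
      qed
      define K' where "K' = stereo_inv ` E ` snd ` K"
      have "continuous_on (snd ` K) E" by (rule continuous_on_subset[OF cE]) (auto simp: K_def S0_def)
      then have "compact K'" unfolding K'_def
        using cK by (intro compact_continuous_image continuous_on_stereo_inv continuous_intros)
      then have "closed K'" by (rule compact_imp_closed)
      have "z0 \<notin> K'"
      proof
        assume "z0 \<in> K'"
        then have "z0 \<in> A" using KD by (auto simp: K'_def A_def)
        then show False using False by simp
      qed
      have "?f (\<tau>, z) \<in> B" if "\<tau> \<in> {0..1}" "z \<in> sphere 0 1" "z \<notin> K'" for \<tau> z
      proof (cases "z \<in> A")
        case True
        then obtain y where y: "y \<in> D" "stereo z = E y" by (auto simp: A_def)
        have "z = stereo_inv (E y)"
          using stereo_inv_stereo[OF that(2)] True y(2) by (simp add: A_def)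
        then have "(\<tau>, y) \<notin> K"
          using that(3) unfolding K'_def by (metis image_eqI snd_conv)
        then have "h (\<tau>, y) \<in> ball north e" using that(1) y(1) by (auto simp: K_def S0_def D_def less_imp_le)
        then show ?thesis using True y GE e(2) by (auto simp: f A_def)
      next
        case False
        then show ?thesis using that e by (auto simp: f A_def)
      qed
      then have val: "\<And>\<tau> z. \<tau> \<in> {0..1} \<Longrightarrow> z \<in> sphere 0 1 \<Longrightarrow> z \<notin> K' \<Longrightarrow> ?f (\<tau>, z) \<in> B" .
      show ?thesis
      proof (intro exI[of _ "UNIV \<times> (- K')"] conjI ballI impI)
        show "open (UNIV \<times> (- K'))" using \<open>closed K'\<close> by (intro open_Times) auto
        show "x \<in> UNIV \<times> (- K')" using \<open>z0 \<notin> K'\<close> xz by simp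
        fix y assume "y \<in> ?S" "y \<in> UNIV \<times> (- K')"
        then show "?f y \<in> B" using val[of "fst y" "snd y"] by (simp add: mem_Times_iff)
      qed
    qed
  qed
qed

text \<open>The collapse on one fibre, cleared of the denominator \<open>r - norm t\<close>. In this form it is defined and
  continuous on the closed ball.\<close>

definition collapse_fibre :: "real \<Rightarrow> real ^ 'k \<Rightarrow> (real ^ 'k) \<times> real" where
  "collapse_fibre r t = (1 / ((norm t)\<^sup>2 + (r - norm t)\<^sup>2)) *\<^sub>R ((2 * (r - norm t)) *\<^sub>R t, (norm t)\<^sup>2 - (r - norm t)\<^sup>2)"

lemma collapse_fibre_denominator: "r > 0 \<Longrightarrow> (norm t)\<^sup>2 + (r - norm t)\<^sup>2 > 0"
proof -
  assume "r > 0"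
  then have "norm t \<noteq> 0 \<or> r - norm t \<noteq> 0" by auto
  then show ?thesis by (metis add_pos_nonneg add_nonneg_pos zero_le_power2 zero_less_power2)
qed

lemma collapse_fibre_eq:
  assumes "r > 0" "norm t < r"
  shows "stereo_inv (t /\<^sub>R (r - norm t)) = collapse_fibre r t"
proof -
  define q a where "q = r - norm t" and "a = (norm t)\<^sup>2"
  have q: "q > 0" using assms by (simp add: q_def)
  have d: "a + q\<^sup>2 > 0" using collapse_fibre_denominator[OF assms(1), of t] by (simp add: a_def q_def)
  have n: "(norm (t /\<^sub>R q))\<^sup>2 = a / q\<^sup>2" using q by (simp add: a_def power_mult_distrib divide_inverse power_inverse mult.commute)
  have p: "a / q\<^sup>2 + 1 = (a + q\<^sup>2) / q\<^sup>2" "a / q\<^sup>2 - 1 = (a - q\<^sup>2) / q\<^sup>2"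
    using q by (simp_all add: add_divide_distrib diff_divide_distrib)
  have "(2 / ((a + q\<^sup>2) / q\<^sup>2)) *\<^sub>R (t /\<^sub>R q) = (1 / (a + q\<^sup>2)) *\<^sub>R ((2 * q) *\<^sub>R t)"
    using q d by (simp add: power2_eq_square)
  moreover have "((a - q\<^sup>2) / q\<^sup>2) / ((a + q\<^sup>2) / q\<^sup>2) = 1 / (a + q\<^sup>2) * (a - q\<^sup>2)"
    using q d by simp
  ultimately show ?thesis
    unfolding stereo_inv_def collapse_fibre_def q_def[symmetric] a_def[symmetric] n p by simp
qed

lemma collapse_fibre_boundary: "r > 0 \<Longrightarrow> norm t = r \<Longrightarrow> collapse_fibre r t = north"
  by (simp add: collapse_fibre_def north_def)

lemma continuous_on_collapse_fibre: "r > 0 \<Longrightarrow> continuous_on S (collapse_fibre r)"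
  unfolding collapse_fibre_def
  by (intro continuous_intros) (use collapse_fibre_denominator in \<open>fastforce\<close>)

text \<open>The collapse keeps the direction of the fibre coordinate.\<close>

lemma fst_stereo_inv_fibre:
  assumes "norm t < r"
  obtains c where "c > 0" "fst (stereo_inv (t /\<^sub>R (r - norm t))) = c *\<^sub>R t"
proof -
  have 1: "(norm (t /\<^sub>R (r - norm t)))\<^sup>2 + 1 > 0" by (simp add: add_nonneg_pos)
  show ?thesis
    by (rule that[of "2 / ((norm (t /\<^sub>R (r - norm t)))\<^sup>2 + 1) * inverse (r - norm t)"])
      (use 1 assms in \<open>auto simp: stereo_inv_def\<close>)
qed

lemma stereo_inv_eq_south_iff: "stereo_inv x = south \<longleftrightarrow> x = 0"
proof
  assume "stereo_inv x = south"
  then have "stereo (stereo_inv x) = stereo south" by (rule arg_cong)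
  then show "x = 0" unfolding stereo_stereo_inv by (simp add: south_def stereo_def)
qed (simp add: stereo_inv_def south_def)

lemma north_neq_south: "north \<noteq> south"
  by (simp add: north_def south_def)

lemma tube_extend_cong:
  assumes "\<And>p t. p \<in> N \<Longrightarrow> t \<in> ball 0 r \<Longrightarrow> h (p, t) = h' (p, t)"
  shows "tube_extend N g r h = tube_extend N g r h'"
proof
  fix z
  show "tube_extend N g r h z = tube_extend N g r h' z"
  proof (cases "z \<noteq> north \<and> stereo z \<in> tubular_map g ` (N \<times> ball 0 r)")
    case True
    then have "inv_into (N \<times> ball 0 r) (tubular_map g) (stereo z) \<in> N \<times> ball 0 r" by (blast intro: inv_into_into)
    then obtain p t where "inv_into (N \<times> ball 0 r) (tubular_map g) (stereo z) = (p, t)" "p \<in> N" "t \<in> ball 0 r" by auto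
    then show ?thesis using True assms by (auto simp: tube_extend_def)
  qed (auto simp: tube_extend_def)
qed

lemma collapse_map_eq_tube_extend:
  "collapse_map N g r = tube_extend N g r (\<lambda>x. stereo_inv (snd x /\<^sub>R (r - norm (snd x))))"
  by (rule ext) (simp add: collapse_map_def tube_extend_def Let_def)

lemma tube_extend_in_sphere:
  assumes "\<And>p t. p \<in> N \<Longrightarrow> t \<in> ball 0 r \<Longrightarrow> norm (h (p, t)) = 1"
  shows "norm (tube_extend N g r h z) = 1"
proof (cases "z \<noteq> north \<and> stereo z \<in> tubular_map g ` (N \<times> ball 0 r)")
  case True
  then have "inv_into (N \<times> ball 0 r) (tubular_map g) (stereo z) \<in> N \<times> ball 0 r" by (blast intro: inv_into_into)
  then obtain p t where "inv_into (N \<times> ball 0 r) (tubular_map g) (stereo z) = (p, t)" "p \<in> N" "t \<in> ball 0 r" by auto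
  then show ?thesis using True assms by (auto simp: tube_extend_def)
qed (auto simp: tube_extend_def)

lemma tube_extend_north [simp]: "tube_extend N g r h north = north"
  by (simp add: tube_extend_def)

lemma pointed_homotopic_tube_extend:
  fixes g :: "'a::euclidean_space \<Rightarrow> 'a ^ 'k" and h :: "real \<times> 'a \<times> (real ^ 'k) \<Rightarrow> 'b::euclidean_space \<times> real"
  assumes F: "framed_closed_submanifold N g" and r: "tubular_radius N g r"
    and h: "continuous_on ({0..1} \<times> N \<times> cball 0 r) h"
    and bd: "\<And>\<tau> p t. \<tau> \<in> {0..1} \<Longrightarrow> p \<in> N \<Longrightarrow> norm t = r \<Longrightarrow> h (\<tau>, p, t) = north"
    and sph: "\<And>\<tau> p t. \<tau> \<in> {0..1} \<Longrightarrow> p \<in> N \<Longrightarrow> t \<in> ball 0 r \<Longrightarrow> norm (h (\<tau>, p, t)) = 1"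
  shows "pointed_homotopic (tube_extend N g r (\<lambda>x. h (0, x))) (tube_extend N g r (\<lambda>x. h (1, x)))"
proof (rule pointed_homotopicI[OF continuous_on_tube_extend[OF F r h bd]])
  fix \<tau> :: real and x :: "'a \<times> real" assume "\<tau> \<in> {0..1}"
  then show "(case (\<tau>, x) of (\<tau>, z) \<Rightarrow> tube_extend N g r (\<lambda>x. h (\<tau>, x)) z) \<in> sphere 0 1"
    using tube_extend_in_sphere[of N r "\<lambda>x. h (\<tau>, x)" g x] sph by simp
qed auto

lemma pointed_map_tube_extend:
  fixes g :: "'a::euclidean_space \<Rightarrow> 'a ^ 'k" and h :: "'a \<times> (real ^ 'k) \<Rightarrow> 'b::euclidean_space \<times> real"
  assumes F: "framed_closed_submanifold N g" and r: "tubular_radius N g r"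
    and h: "continuous_on (N \<times> cball 0 r) h"
    and bd: "\<And>p t. p \<in> N \<Longrightarrow> norm t = r \<Longrightarrow> h (p, t) = north"
    and sph: "\<And>p t. p \<in> N \<Longrightarrow> t \<in> ball 0 r \<Longrightarrow> norm (h (p, t)) = 1"
  shows "pointed_map (tube_extend N g r h)"
proof -
  have "continuous_on ({0..1::real} \<times> N \<times> cball 0 r) (\<lambda>x. h (snd x))"
    by (rule continuous_on_compose2[OF h]) (auto intro: continuous_intros)
  from continuous_on_tube_extend[OF F r this]
  have "continuous_on ({0..1::real} \<times> sphere 0 1) (\<lambda>(\<tau>, z). tube_extend N g r h z)" using bd by simp
  then have "continuous_on (sphere 0 1) (\<lambda>z. (\<lambda>(\<tau>::real, z). tube_extend N g r h z) (0, z))"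
    by (rule continuous_on_compose2) (auto intro: continuous_intros)
  then have "continuous_on (sphere 0 1) (tube_extend N g r h)" by simp
  then show ?thesis using tube_extend_in_sphere[of N r h g, OF sph] by (auto simp: pointed_map_def)
qed

lemma pointed_map_collapse:
  assumes F: "framed_closed_submanifold N g" and r: "tubular_radius N g r"
  shows "pointed_map (collapse_map N g r)"
proof -
  have r0: "r > 0" using r by (simp add: tubular_radius_def)
  have "pointed_map (tube_extend N g r (\<lambda>x. collapse_fibre r (snd x)))"
  proof (rule pointed_map_tube_extend[OF F r])
    show "continuous_on (N \<times> cball 0 r) (\<lambda>x. collapse_fibre r (snd x))"
      by (rule continuous_on_compose2[OF continuous_on_collapse_fibre[OF r0, of UNIV]]) (auto intro: continuous_intros)
    show "norm (collapse_fibre r (snd (p, t))) = 1" if "t \<in> ball 0 r" for p :: 'a and t :: "real ^ 'b"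
    proof -
      have "collapse_fibre r t = stereo_inv (t /\<^sub>R (r - norm t))" using collapse_fibre_eq[OF r0, of t] that by simp
      then show ?thesis by (simp only: snd_conv norm_stereo_inv)
    qed
  qed (simp add: collapse_fibre_boundary[OF r0])
  also have "tube_extend N g r (\<lambda>x. collapse_fibre r (snd x)) = collapse_map N g r"
    unfolding collapse_map_eq_tube_extend by (rule tube_extend_cong) (simp add: collapse_fibre_eq[OF r0])
  finally show ?thesis .
qed

lemma collapse_map_eq_south_iff:
  assumes r: "tubular_radius N g r"
  shows "collapse_map N g r z = south \<longleftrightarrow> z \<noteq> north \<and> stereo z \<in> N"
proof -
  have r0: "r > 0" using r by (simp add: tubular_radius_def)
  show ?thesis
  proof (cases z rule: tube_extend_cases[OF r, where h = "\<lambda>x. stereo_inv (snd x /\<^sub>R (r - norm (snd x)))"])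
    case (1 p t)
    have "stereo z \<in> N \<longleftrightarrow> t = 0"
    proof
      assume "stereo z \<in> N"
      then have "(stereo z, 0) \<in> N \<times> ball 0 r" "tubular_map g (stereo z, 0) = tubular_map g (p, t)"
        using r0 1 by (auto simp: tubular_map_eq)
      moreover have "(p, t) \<in> N \<times> ball 0 r" using 1(1,2) by simp
      ultimately have "(stereo z, 0) = (p, t)"
        using r inj_onD[of "tubular_map g" "N \<times> ball 0 r" "(stereo z, 0)" "(p, t)"] by (simp add: tubular_radius_def)
      then show "t = 0" by simp
    next
      assume "t = 0"
      then show "stereo z \<in> N" using 1(1,4) by (simp add: tubular_map_eq)
    qed
    moreover have "collapse_map N g r z = stereo_inv (t /\<^sub>R (r - norm t))"
      using 1(5) by (simp add: collapse_map_eq_tube_extend)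
    moreover have "t /\<^sub>R (r - norm t) = 0 \<longleftrightarrow> t = 0" using 1(2) by auto
    ultimately show ?thesis using 1(3) stereo_inv_eq_south_iff by metis
  next
    case 2
    have "stereo z \<in> tubular_map g ` (N \<times> ball 0 r)" if "stereo z \<in> N"
      by (rule image_eqI[of _ _ "(stereo z, 0)"]) (use that r0 in \<open>auto simp: tubular_map_eq\<close>)
    moreover have "collapse_map N g r z = north" using 2(2) by (simp add: collapse_map_eq_tube_extend)
    ultimately show ?thesis using 2(1) north_neq_south by metis
  qed
qed

text \<open>The homotopy criterion for a collapse map: near the framed submanifold
  only the direction of the fibre coordinate has to be compared.\<close>

lemma collapse_map_criterion:
  fixes g :: "'a::euclidean_space \<Rightarrow> 'a ^ 'k"
  assumes F: "framed_closed_submanifold N g" and r: "tubular_radius N g r" and f: "pointed_map f"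
    and S: "\<And>z. z \<in> sphere 0 1 \<Longrightarrow> f z = south \<longleftrightarrow> z \<noteq> north \<and> stereo z \<in> N"
    and W: "open W" "N \<subseteq> W"
    and dir: "\<And>y. y \<in> W \<Longrightarrow> \<exists>p\<in>N. \<exists>t\<in>ball 0 r. y = tubular_map g (p, t) \<and>
       (\<forall>k>0. fst (f (stereo_inv y)) = - (k *\<^sub>R t) \<longrightarrow> t = 0)"
  shows "pointed_homotopic f (collapse_map N g r)"
proof (rule pointed_homotopic_criterion[OF f pointed_map_collapse[OF F r] _ openin_stereo_preimage[OF W(1)]])
  show "f z = south \<longleftrightarrow> collapse_map N g r z = south" if "z \<in> sphere 0 1" for z
    using S[OF that] collapse_map_eq_south_iff[OF r] by simp
  show "z \<in> {z \<in> sphere 0 1. z \<noteq> north \<and> stereo z \<in> W}" if "z \<in> sphere 0 1" "f z = south" for z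
    using S[OF that(1)] that W(2) by auto
next
  fix z and k :: real assume z: "z \<in> {z \<in> sphere 0 1. z \<noteq> north \<and> stereo z \<in> W}" and k: "k > 0"
    and e: "fst (f z) = - (k *\<^sub>R fst (collapse_map N g r z))"
  then obtain p t where pt: "p \<in> N" "t \<in> ball 0 r" "stereo z = tubular_map g (p, t)"
    "\<forall>k>0. fst (f (stereo_inv (stereo z))) = - (k *\<^sub>R t) \<longrightarrow> t = 0"
    using dir[of "stereo z"] by blast
  have zz: "stereo_inv (stereo z) = z" using z stereo_inv_stereo by blast
  have "collapse_map N g r z = stereo_inv (t /\<^sub>R (r - norm t))"
    unfolding collapse_map_eq_tube_extend using z by (subst tube_extend_eval[OF r pt(1,2) _ pt(3)]) auto
  moreover obtain c where c: "c > 0" "fst (stereo_inv (t /\<^sub>R (r - norm t))) = c *\<^sub>R t"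
    using fst_stereo_inv_fibre[of t r] pt(2) by auto
  ultimately have e': "fst (f z) = - ((k * c) *\<^sub>R t)" using e by simp
  then have "t = 0" using pt(4) k c(1) zz by (metis mult_pos_pos)
  then show "fst (f z) = 0" using e' by simp
qed

text \<open>In the smaller tube both collapse maps point in the direction of the same fibre coordinate.\<close>

lemma collapse_map_radius_independent:
  fixes g :: "'a::euclidean_space \<Rightarrow> 'a ^ 'k"
  assumes F: "framed_closed_submanifold N g" and r: "tubular_radius N g r" "tubular_radius N g r'"
  shows "pointed_homotopic (collapse_map N g r') (collapse_map N g r)"
proof (rule collapse_map_criterion[OF F r(1) pointed_map_collapse[OF F r(2)]])
  define \<rho> where "\<rho> = min r r'"
  have \<rho>: "\<rho> > 0" "tubular_radius N g \<rho>" using r tubular_radius_mono[OF r(1)] by (auto simp: \<rho>_def tubular_radius_def)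
  show "open (tubular_map g ` (N \<times> ball 0 \<rho>))"
    by (rule open_tubular_image[OF F \<rho>(2)]) simp
  show "N \<subseteq> tubular_map g ` (N \<times> ball 0 \<rho>)"
  proof
    fix p assume "p \<in> N"
    then show "p \<in> tubular_map g ` (N \<times> ball 0 \<rho>)"
      by (intro image_eqI[of _ _ "(p, 0)"]) (use \<rho> in \<open>auto simp: tubular_map_eq\<close>)
  qed
  fix y assume "y \<in> tubular_map g ` (N \<times> ball 0 \<rho>)"
  then obtain p t where pt: "p \<in> N" "t \<in> ball 0 \<rho>" "y = tubular_map g (p, t)" by auto
  then have t: "t \<in> ball 0 r" "t \<in> ball 0 r'" by (auto simp: \<rho>_def)
  have v: "collapse_map N g r' (stereo_inv y) = stereo_inv (t /\<^sub>R (r' - norm t))"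
    unfolding collapse_map_eq_tube_extend by (subst tube_extend_eval[OF r(2) pt(1) t(2)]) (simp_all add: pt(3))
  obtain c where c: "c > 0" "fst (stereo_inv (t /\<^sub>R (r' - norm t))) = c *\<^sub>R t"
    using fst_stereo_inv_fibre[of t r'] t(2) by auto
  have "t = 0" if "k > 0" "c *\<^sub>R t = - (k *\<^sub>R t)" for k
  proof -
    have "(c + k) *\<^sub>R t = 0" using that(2) by (simp add: scaleR_left_distrib)
    then show ?thesis using c(1) that(1) by simp
  qed
  then show "\<exists>p\<in>N. \<exists>t\<in>ball 0 r. y = tubular_map g (p, t) \<and>
      (\<forall>k>0. fst (collapse_map N g r' (stereo_inv y)) = - (k *\<^sub>R t) \<longrightarrow> t = 0)"
    using pt t v c by (intro bexI[of _ p] bexI[of _ t]) auto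
qed (use collapse_map_eq_south_iff[OF r(2)] in auto)

lemma pontryagin_class_eq:
  fixes g :: "'a::euclidean_space \<Rightarrow> 'a ^ 'k"
  assumes F: "framed_closed_submanifold N g" and r: "tubular_radius N g r"
  shows "pontryagin_class N g = homotopy_class (collapse_map N g r)"
  unfolding pontryagin_class_def
proof (rule the_equality)
  show "\<exists>r'. tubular_radius N g r' \<and> homotopy_class (collapse_map N g r) = homotopy_class (collapse_map N g r')"
    using r by blast
  fix c assume "\<exists>r'. tubular_radius N g r' \<and> c = homotopy_class (collapse_map N g r')"
  then show "c = homotopy_class (collapse_map N g r)"
    using homotopy_class_eqI[OF collapse_map_radius_independent[OF F r]] by auto
qed

lemma pontryagin_class_in_group:
  fixes g :: "'a::euclidean_space \<Rightarrow> 'a ^ 'k"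
  assumes F: "framed_closed_submanifold N g"
  shows "pontryagin_class N g \<in> sphere_homotopy_group"
proof -
  obtain r where "tubular_radius N g r" by (rule tubular_radius_exists[OF F])
  then show ?thesis using pointed_map_collapse[OF F] pontryagin_class_eq[OF F]
    unfolding sphere_homotopy_group_def pointed_map_def by blast
qed

section \<open>A lift of the double collapse through the Hopf map\<close>

lemma vector_2_eq: "(vector [a, b] :: 'a::zero ^ 2) = (\<chi> i. if i = 1 then a else b)"
  by (simp add: vec_eq_iff forall_2)

lemma vector_3_eq: "(vector [a, b, c] :: 'a::zero ^ 3) = (\<chi> i. if i = 1 then a else if i = 2 then b else c)"
  by (simp add: vec_eq_iff forall_3)

lemma continuous_on_vector_2 [continuous_intros]:
  fixes a b :: "'s::topological_space \<Rightarrow> 'a::real_normed_vector"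
  assumes "continuous_on S a" "continuous_on S b"
  shows "continuous_on S (\<lambda>x. vector [a x, b x] :: 'a ^ 2)"
  unfolding vector_2_eq
proof (rule continuous_on_vec_lambda)
  show "continuous_on S (\<lambda>x. if i = 1 then a x else b x)" for i :: 2
    using assms by (cases "i = 1") auto
qed

lemma continuous_on_vector_3 [continuous_intros]:
  fixes a b c :: "'s::topological_space \<Rightarrow> 'a::real_normed_vector"
  assumes "continuous_on S a" "continuous_on S b" "continuous_on S c"
  shows "continuous_on S (\<lambda>x. vector [a x, b x, c x] :: 'a ^ 3)"
  unfolding vector_3_eq
proof (rule continuous_on_vec_lambda)
  show "continuous_on S (\<lambda>x. if i = 1 then a x else if i = 2 then b x else c x)" for i :: 3
    using assms by (cases "i = 1"; cases "i = 2") auto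
qed

lemma vec2_eq_iff: "(x :: 'a ^ 2) = y \<longleftrightarrow> x $ 1 = y $ 1 \<and> x $ 2 = y $ 2"
  by (simp add: vec_eq_iff forall_2)

lemma vec3_eq_iff: "(x :: 'a ^ 3) = y \<longleftrightarrow> x $ 1 = y $ 1 \<and> x $ 2 = y $ 2 \<and> x $ 3 = y $ 3"
  by (simp add: vec_eq_iff forall_3)

lemma norm_vec2: "(norm (x :: real ^ 2))\<^sup>2 = (x $ 1)\<^sup>2 + (x $ 2)\<^sup>2"
  unfolding power2_norm_eq_inner inner_vec_def sum_2 by (simp add: power2_eq_square)

lemma norm_vec3: "(norm (x :: real ^ 3))\<^sup>2 = (x $ 1)\<^sup>2 + (x $ 2)\<^sup>2 + (x $ 3)\<^sup>2"
  unfolding power2_norm_eq_inner inner_vec_def sum_3 by (simp add: power2_eq_square)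

definition cplx :: "real ^ 2 \<Rightarrow> complex" where
  "cplx t = Complex (t $ 1) (t $ 2)"

lemma cplx_simps [simp]: "Re (cplx t) = t $ 1" "Im (cplx t) = t $ 2"
  by (simp_all add: cplx_def)

lemma cmod_cplx [simp]: "cmod (cplx t) = norm t"
proof -
  have "(cmod (cplx t))\<^sup>2 = (norm t)\<^sup>2" by (simp add: cmod_power2 norm_vec2)
  then show ?thesis by (simp add: power2_eq_iff_nonneg)
qed

lemma continuous_on_cplx [continuous_intros]:
  "continuous_on S t \<Longrightarrow> continuous_on S (\<lambda>x. cplx (t x))"
proof -
  assume t: "continuous_on S t"
  have "cplx v = of_real (v $ 1) + \<i> * of_real (v $ 2)" for v by (simp add: complex_eq_iff)
  then show ?thesis
    by (simp, intro continuous_intros bounded_linear.continuous_on[OF bounded_linear_vec_nth] t)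
qed

subsection \<open>The Hopf map\<close>

lemma hopf_scaleR: "hopf (a *\<^sub>R v) = a\<^sup>2 *\<^sub>R hopf v"
proof -
  obtain x t where v: "v = (x, t)" by (cases v)
  have "Complex (a * x $ 1) (a * x $ 2) = a *\<^sub>R Complex (x $ 1) (x $ 2)"
    "Complex (a * x $ 3) (a * t) = a *\<^sub>R Complex (x $ 3) t" by (simp_all add: complex_eq_iff)
  then show ?thesis
    by (simp add: v hopf_def Let_def vec2_eq_iff power_mult_distrib power2_eq_square algebra_simps)
qed

lemma norm_hopf: "norm (hopf v) = (norm v)\<^sup>2"
proof -
  obtain x t where v: "v = (x, t)" by (cases v)
  define z w where "z = Complex (x $ 1) (x $ 2)" and "w = Complex (x $ 3) t"
  have n: "(norm v)\<^sup>2 = (cmod z)\<^sup>2 + (cmod w)\<^sup>2"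
    by (simp add: v z_def w_def norm_Pair norm_vec3 cmod_power2)
  have h: "hopf v = (vector [Re (2 * w * cnj z), Im (2 * w * cnj z)], (cmod w)\<^sup>2 - (cmod z)\<^sup>2)"
    by (simp add: v hopf_def Let_def z_def w_def)
  have "(norm (hopf v))\<^sup>2 = (cmod (2 * w * cnj z))\<^sup>2 + ((cmod w)\<^sup>2 - (cmod z)\<^sup>2)\<^sup>2"
    unfolding h by (simp only: norm_Pair real_sqrt_pow2 norm_vec2 cmod_power2 add_nonneg_nonneg zero_le_power2 vector_2 power2_norm_eq_inner real_norm_def power2_abs real_sqrt_pow2[OF add_nonneg_nonneg[OF zero_le_power2 zero_le_power2]])
  also have "\<dots> = ((cmod z)\<^sup>2 + (cmod w)\<^sup>2)\<^sup>2"
    by (simp add: norm_mult power_mult_distrib) algebra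
  finally show ?thesis unfolding n by (simp add: power2_eq_iff_nonneg)
qed

lemma continuous_on_hopf: "continuous_on S hopf"
proof -
  have C: "Complex a b = of_real a + \<i> * of_real b" for a b by (simp add: complex_eq_iff)
  have nth: "continuous_on S (\<lambda>v. fst v $ i)" for i :: 3 and S :: "((real ^ 3) \<times> real) set"
    by (intro bounded_linear.continuous_on[OF bounded_linear_vec_nth] continuous_intros)
  show ?thesis unfolding hopf_def Let_def case_prod_unfold C
    by (intro continuous_intros nth)
qed

lemma pointed_map_hopf: "pointed_map hopf"
proof -
  have "hopf north = north"
    by (simp add: hopf_def north_def Let_def vec2_eq_iff cmod_def)
  then show ?thesis by (auto simp: pointed_map_def continuous_on_hopf norm_hopf)
qed

subsection \<open>The lift\<close>

text \<open>Constantly \<open>1\<close> up to \<open>\<rho> / 2\<close>, constantly \<open>0\<close> from \<open>\<rho>\<close> on, and linear in between.\<close>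

definition cutoff :: "real \<Rightarrow> real \<Rightarrow> real" where
  "cutoff \<rho> x = max 0 (min 1 (2 - 2 * x / \<rho>))"

text \<open>For \<open>cmod u \<le> \<rho> / 2\<close>, this is affine in \<open>Re u\<close> with the value \<open>1\<close> at \<open>-h\<close> and the value \<open>s\<close> at \<open>h\<close>.
  At \<open>u = 0\<close> it is the midpoint of \<open>1\<close> and \<open>s\<close>, which vanishes when \<open>s = -1\<close>.\<close>

definition lift_z :: "real \<Rightarrow> real \<Rightarrow> complex \<Rightarrow> complex \<Rightarrow> complex" where
  "lift_z h \<rho> u s = cutoff \<rho> (cmod u) *\<^sub>R ((1 + s) / 2 - (Re u / (2 * h)) *\<^sub>R (1 - s))"

text \<open>For \<open>cmod u \<le> \<rho> / 2\<close>, this is the product of \<open>cnj (u + of_real h)\<close> and \<open>u - of_real h\<close>. Its zeros are \<open>-h\<close>, where it reverses the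
  orientation, and \<open>h\<close>, where it preserves it. If \<open>h < \<rho>\<close>, it is positive where the cutoff vanishes.\<close>

definition lift_w :: "real \<Rightarrow> real \<Rightarrow> complex \<Rightarrow> complex" where
  "lift_w h \<rho> u = Complex ((cmod u)\<^sup>2 - h\<^sup>2) (2 * h * cutoff \<rho> (cmod u) * Im u)"

text \<open>The pair \<open>(\<i> z, \<i> w)\<close> in real coordinates. The common factor \<open>\<i>\<close> does not change the image under the Hopf
  map; it puts \<open>Re w\<close> into the last coordinate, so that large \<open>u\<close> go to the north pole.\<close>

definition hopf_lift :: "real \<Rightarrow> real \<Rightarrow> complex \<Rightarrow> complex \<Rightarrow> (real ^ 3) \<times> real" where
  "hopf_lift h \<rho> u s = (vector [- Im (lift_z h \<rho> u s), Re (lift_z h \<rho> u s), - Im (lift_w h \<rho> u)], Re (lift_w h \<rho> u))"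

lemma cutoff_simps:
  assumes "\<rho> > 0"
  shows "x \<ge> \<rho> \<Longrightarrow> cutoff \<rho> x = 0" "x < \<rho> \<Longrightarrow> cutoff \<rho> x > 0" "x \<le> \<rho> / 2 \<Longrightarrow> cutoff \<rho> x = 1"
  using assms by (auto simp: cutoff_def max_def min_def field_simps)

lemma lift_w_eq_0_iff:
  assumes "0 < h" "h < \<rho>"
  shows "lift_w h \<rho> u = 0 \<longleftrightarrow> u = of_real h \<or> u = - of_real h"
proof
  assume "lift_w h \<rho> u = 0"
  then have e: "(cmod u)\<^sup>2 = h\<^sup>2" "h * cutoff \<rho> (cmod u) * Im u = 0"
    by (auto simp: lift_w_def complex_eq_iff)
  then have "cmod u = h" using assms by (simp add: power2_eq_iff_nonneg)
  then have "cutoff \<rho> (cmod u) > 0" using assms cutoff_simps(2)[of \<rho> "cmod u"] by simp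
  then have "Im u = 0" using e assms by auto
  then have "(Re u)\<^sup>2 = h\<^sup>2" using e(1) by (simp add: cmod_power2)
  then show "u = of_real h \<or> u = - of_real h" using \<open>Im u = 0\<close> by (auto simp: complex_eq_iff power2_eq_iff)
next
  assume u: "u = of_real h \<or> u = - of_real h"
  then have "cmod u = h" "Im u = 0" using assms(1) by auto
  then show "lift_w h \<rho> u = 0" by (simp add: lift_w_def complex_eq_iff)
qed

text \<open>At the two zeros of \<open>w\<close> the number \<open>z\<close> is a positive multiple of \<open>1\<close>, respectively of \<open>s\<close>.\<close>

lemma hopf_lift_neq_0:
  assumes h: "0 < h" "h < \<rho>" and s: "cmod s = 1"
  shows "hopf_lift h \<rho> u s \<noteq> 0"
proof
  assume "hopf_lift h \<rho> u s = 0"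
  then have "lift_z h \<rho> u s = 0" "lift_w h \<rho> u = 0"
    by (auto simp: hopf_lift_def complex_eq_iff zero_prod_def vec3_eq_iff)
  then have u: "u = of_real h \<or> u = - of_real h" and z: "lift_z h \<rho> u s = 0" using lift_w_eq_0_iff[OF h] by auto
  have "cmod u < \<rho>" using u h by auto
  then have "cutoff \<rho> (cmod u) > 0" using cutoff_simps(2) h by auto
  then have "(1 + s) / 2 - (Re u / (2 * h)) *\<^sub>R (1 - s) = 0" using z by (simp add: lift_z_def)
  moreover have "Re u / (2 * h) = 1/2 \<or> Re u / (2 * h) = -1/2" using u h by auto
  moreover have "(1 + s) / 2 - (1/2) *\<^sub>R (1 - s) = s" "(1 + s) / 2 - (-1/2) *\<^sub>R (1 - s) = 1"
    by (simp_all add: complex_eq_iff field_simps)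
  ultimately have "s = 0 \<or> (1::complex) = 0" by metis
  then show False using s by auto
qed

lemma hopf_lift_outside:
  assumes "0 < h" "h < \<rho>" "cmod u \<ge> \<rho>"
  shows "sgn (hopf_lift h \<rho> u s) = north"
proof -
  have c: "cutoff \<rho> (cmod u) = 0" using assms cutoff_simps(1)[of \<rho> "cmod u"] by simp
  have "h\<^sup>2 < (cmod u)\<^sup>2" using assms by (intro power_strict_mono) auto
  then have p: "(cmod u)\<^sup>2 - h\<^sup>2 > 0" by simp
  have "hopf_lift h \<rho> u s = ((cmod u)\<^sup>2 - h\<^sup>2) *\<^sub>R north"
    by (simp add: hopf_lift_def lift_z_def lift_w_def c north_def vec3_eq_iff)
  then show ?thesis using p by (simp add: sgn_scaleR sgn_div_norm)
qed

lemma continuous_on_hopf_lift [continuous_intros]: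
  assumes u: "continuous_on S u" and s: "continuous_on S s"
  shows "continuous_on S (\<lambda>x. hopf_lift h \<rho> (u x) (s x))"
proof -
  have k: "continuous_on S (\<lambda>x. cutoff \<rho> (cmod (u x)))" unfolding cutoff_def divide_inverse
    by (intro continuous_intros u)
  have z: "continuous_on S (\<lambda>x. lift_z h \<rho> (u x) (s x))" unfolding lift_z_def divide_inverse[of "Re _"]
    by (intro continuous_intros u s k) auto
  show ?thesis unfolding hopf_lift_def lift_w_def complex.sel
    by (intro continuous_intros u s k z)
qed

lemma hopf_hopf_lift:
  "hopf (hopf_lift h \<rho> u s) =
     (vector [Re (2 * lift_w h \<rho> u * cnj (lift_z h \<rho> u s)), Im (2 * lift_w h \<rho> u * cnj (lift_z h \<rho> u s))],
      (cmod (lift_w h \<rho> u))\<^sup>2 - (cmod (lift_z h \<rho> u s))\<^sup>2)"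
  unfolding hopf_lift_def hopf_def by (simp add: Let_def vec2_eq_iff cmod_power2 algebra_simps)

lemma hopf_sgn_hopf_lift:
  assumes h: "0 < h" "h < \<rho>" and s: "cmod s = 1"
  obtains c where "c > 0" "hopf (sgn (hopf_lift h \<rho> u s)) = c *\<^sub>R hopf (hopf_lift h \<rho> u s)"
  by (rule that[of "(inverse (norm (hopf_lift h \<rho> u s)))\<^sup>2"])
    (use hopf_lift_neq_0[OF assms] in \<open>simp_all add: sgn_div_norm hopf_scaleR\<close>)

lemma hopf_lift_eq_south_iff:
  assumes h: "0 < h" "h < \<rho>" and s: "cmod s = 1"
  shows "hopf (sgn (hopf_lift h \<rho> u s)) = south \<longleftrightarrow> u = of_real h \<or> u = - of_real h"
proof -
  let ?z = "lift_z h \<rho> u s" and ?w = "lift_w h \<rho> u"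
  obtain c where c: "c > 0" "hopf (sgn (hopf_lift h \<rho> u s)) = c *\<^sub>R hopf (hopf_lift h \<rho> u s)"
    by (rule hopf_sgn_hopf_lift[OF assms])
  have sp: "hopf (sgn (hopf_lift h \<rho> u s)) \<in> sphere 0 1"
    using hopf_lift_neq_0[OF assms] by (simp add: norm_hopf norm_sgn)
  have "hopf (sgn (hopf_lift h \<rho> u s)) = south \<longleftrightarrow>
      fst (hopf (sgn (hopf_lift h \<rho> u s))) = 0 \<and> snd (hopf (sgn (hopf_lift h \<rho> u s))) < 0"
    by (rule sphere_eq_south_iff(2)[OF sp])
  also have "\<dots> \<longleftrightarrow> fst (hopf (hopf_lift h \<rho> u s)) = 0 \<and> snd (hopf (hopf_lift h \<rho> u s)) < 0"
    unfolding c(2) using c(1) by (auto simp: mult_less_0_iff)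
  also have "\<dots> \<longleftrightarrow> 2 * ?w * cnj ?z = 0 \<and> (cmod ?w)\<^sup>2 < (cmod ?z)\<^sup>2"
    unfolding hopf_hopf_lift complex_eq_iff by (simp only: fst_conv snd_conv vec2_eq_iff vector_2 zero_index zero_complex.sel) simp
  also have "\<dots> \<longleftrightarrow> ?w = 0"
  proof
    assume "2 * ?w * cnj ?z = 0 \<and> (cmod ?w)\<^sup>2 < (cmod ?z)\<^sup>2"
    then show "?w = 0" by auto
  next
    assume w: "?w = 0"
    have "?z \<noteq> 0"
    proof
      assume "?z = 0"
      then have "hopf_lift h \<rho> u s = 0" using w by (simp add: hopf_lift_def zero_prod_def vec3_eq_iff)
      then show False using hopf_lift_neq_0[OF assms] by simp
    qed
    then show "2 * ?w * cnj ?z = 0 \<and> (cmod ?w)\<^sup>2 < (cmod ?z)\<^sup>2" using w by simp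
  qed
  finally show ?thesis using lift_w_eq_0_iff[OF h] by simp
qed

subsection \<open>A rotation of the three-sphere\<close>

text \<open>A rotation of order three that fixes the poles. It brings the derivative of
  \<^const>\<open>hopf_lift\<close> at \<open>u = 0\<close>, \<open>s = -1\<close> into diagonal form with positive entries.\<close>

definition rot3 :: "(real ^ 3) \<times> real \<Rightarrow> (real ^ 3) \<times> real" where
  "rot3 = (\<lambda>(x, t). (vector [- (x $ 2), - (x $ 3), x $ 1], t))"

lemma norm_rot3 [simp]: "norm (rot3 v) = norm v"
proof -
  have "(norm (vector [- (x $ 2), - (x $ 3), x $ 1] :: real ^ 3))\<^sup>2 = (norm x)\<^sup>2" for x :: "real ^ 3"
    by (simp add: norm_vec3)
  then show ?thesis by (cases v) (simp add: rot3_def norm_Pair)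
qed

lemma rot3_scaleR: "rot3 (a *\<^sub>R v) = a *\<^sub>R rot3 v"
  by (cases v) (simp add: rot3_def vec3_eq_iff)

lemma pointed_map_rot3:
  assumes "pointed_map f" shows "pointed_map (\<lambda>z. rot3 (f z))"
proof -
  have cf: "continuous_on (sphere 0 1) f" using assms by (simp add: pointed_map_def)
  have nth: "continuous_on (sphere 0 1) (\<lambda>z. fst (f z) $ i)" for i
    by (intro bounded_linear.continuous_on[OF bounded_linear_vec_nth] continuous_intros cf)
  have "continuous_on (sphere 0 1) (\<lambda>z. rot3 (f z))"
    unfolding rot3_def case_prod_unfold by (intro continuous_intros nth cf)
  moreover have "rot3 north = north" by (simp add: rot3_def north_def vec3_eq_iff)
  ultimately show ?thesis using assms by (auto simp: pointed_map_def)
qed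

text \<open>The eigenvalues of the rotation on the horizontal space are the cube roots of unity; as none of them is
  negative, no horizontal vector is turned into its opposite direction.\<close>

lemma rot3_homotopic:
  assumes f: "pointed_map f"
  shows "pointed_homotopic f (\<lambda>z. rot3 (f z))"
proof (rule pointed_homotopic_criterion[OF f pointed_map_rot3[OF f], where W = "sphere 0 1"])
  fix z :: "'a \<times> real" assume z: "z \<in> sphere 0 1"
  have "snd (rot3 (f z)) = snd (f z)" by (simp add: rot3_def case_prod_unfold)
  then show "f z = south \<longleftrightarrow> rot3 (f z) = south"
    using sphere_eq_south_iff(1)[OF pointed_map_in_sphere[OF f z]]
      sphere_eq_south_iff(1)[OF pointed_map_in_sphere[OF pointed_map_rot3[OF f] z]] by simp
next
  fix z and k :: real assume k: "k > 0" and e: "fst (f z) = - (k *\<^sub>R fst (rot3 (f z)))"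
  define x where "x = fst (f z)"
  have r: "fst (rot3 (f z)) = vector [- (x $ 2), - (x $ 3), x $ 1]"
    by (simp add: rot3_def case_prod_unfold x_def)
  have xi: "x $ i = - (k * fst (rot3 (f z)) $ i)" for i
    using arg_cong[OF e, of "\<lambda>v. v $ i"] by (simp add: x_def)
  have x: "x $ 1 = k * x $ 2" "x $ 2 = k * x $ 3" "x $ 3 = - (k * x $ 1)"
    by (subst xi, simp add: r)+
  have "x $ 1 = k * (k * x $ 3)" by (subst x(1)) (simp only: x(2))
  also have "\<dots> = - (k * k * k * x $ 1)" by (simp add: x(3))
  finally have "x $ 1 = - (k * k * k * x $ 1)" .
  then have "(1 + k * k * k) * x $ 1 = 0" by (simp add: algebra_simps)
  moreover have "1 + k * k * k > 0" using k by (simp add: add_pos_pos)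
  ultimately have "x $ 1 = 0" by simp
  moreover from this have "x $ 3 = 0" using x(3) by simp
  moreover from this have "x $ 2 = 0" using x(2) by simp
  ultimately show "fst (f z) = 0" unfolding x_def[symmetric] vec3_eq_iff by simp
qed auto

lemma rot3_hopf_lift:
  "rot3 (hopf_lift h \<rho> u s) = (vector [- Re (lift_z h \<rho> u s), Im (lift_w h \<rho> u), - Im (lift_z h \<rho> u s)], Re (lift_w h \<rho> u))"
  by (simp add: rot3_def hopf_lift_def vec3_eq_iff)

lemma rot3_hopf_lift_eq_south_iff:
  assumes h: "0 < h" "h < \<rho>" and s: "cmod s = 1"
  shows "rot3 (sgn (hopf_lift h \<rho> u s)) = south \<longleftrightarrow> u = 0 \<and> s = -1"
proof -
  let ?z = "lift_z h \<rho> u s" and ?w = "lift_w h \<rho> u"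
  have n: "norm (hopf_lift h \<rho> u s) > 0" using hopf_lift_neq_0[OF assms] by simp
  have sp: "rot3 (sgn (hopf_lift h \<rho> u s)) \<in> sphere 0 1"
    using hopf_lift_neq_0[OF assms] by (simp add: norm_sgn)
  have "rot3 (sgn (hopf_lift h \<rho> u s)) = inverse (norm (hopf_lift h \<rho> u s)) *\<^sub>R rot3 (hopf_lift h \<rho> u s)"
    by (simp add: sgn_div_norm rot3_scaleR)
  then have "rot3 (sgn (hopf_lift h \<rho> u s)) = south \<longleftrightarrow> ?z = 0 \<and> Im ?w = 0 \<and> Re ?w < 0"
    unfolding sphere_eq_south_iff(2)[OF sp] using n
    by (auto simp: rot3_hopf_lift vec3_eq_iff complex_eq_iff mult_less_0_iff)
  also have "\<dots> \<longleftrightarrow> u = 0 \<and> s = -1"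
  proof
    assume a: "?z = 0 \<and> Im ?w = 0 \<and> Re ?w < 0"
    then have "(cmod u)\<^sup>2 < h\<^sup>2" by (simp add: lift_w_def)
    then have uh: "cmod u < h" using h(1) by (simp add: power2_less_imp_less)
    then have k: "cutoff \<rho> (cmod u) > 0" using cutoff_simps(2) h by auto
    then have iu: "Im u = 0" using a h(1) by (auto simp: lift_w_def)
    define l where "l = Re u / h"
    have l: "\<bar>l\<bar> < 1" using uh h(1) abs_Re_le_cmod[of u] by (simp add: l_def abs_divide field_simps)
    have "(1 + s) / 2 - (Re u / (2 * h)) *\<^sub>R (1 - s) = 0" using a k by (simp add: lift_z_def)
    then have "(1 + s) - l *\<^sub>R (1 - s) = 0" using h(1) by (simp add: l_def complex_eq_iff field_simps)
    then have e: "1 + Re s = l * (1 - Re s)" "Im s * (1 + l) = 0" by (auto simp: complex_eq_iff algebra_simps)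
    then have "Im s = 0" using l by auto
    then have "(Re s)\<^sup>2 = 1" using s by (metis cmod_power2 add.right_neutral one_power2 zero_power2)
    then have "Re s = 1 \<or> Re s = -1" by (simp add: power2_eq_1_iff)
    then have "Re s = -1" using e(1) by auto
    then have "l = 0" using e(1) by simp
    then show "u = 0 \<and> s = -1" using \<open>Re s = -1\<close> \<open>Im s = 0\<close> iu h(1) by (simp add: complex_eq_iff l_def)
  next
    assume "u = 0 \<and> s = -1"
    then show "?z = 0 \<and> Im ?w = 0 \<and> Re ?w < 0" using h by (simp add: lift_z_def lift_w_def)
  qed
  finally show ?thesis .
qed

subsection \<open>Sign conditions near the zeros of the lift\<close>

lemma lift_factorization:
  assumes h: "h > 0" and u: "cmod u \<le> \<rho> / 2" and \<rho>: "\<rho> > 0"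
  shows "lift_w h \<rho> u = cnj (u + of_real h) * (u - of_real h)"
    and "lift_z h \<rho> u s = (1 + s) / 2 - (Re u / (2 * h)) *\<^sub>R (1 - s)"
proof -
  have c: "cutoff \<rho> (cmod u) = 1" by (rule cutoff_simps(3)[OF \<rho> u])
  show "lift_z h \<rho> u s = (1 + s) / 2 - (Re u / (2 * h)) *\<^sub>R (1 - s)" by (simp add: lift_z_def c)
  show "lift_w h \<rho> u = cnj (u + of_real h) * (u - of_real h)"
    unfolding lift_w_def c cmod_power2 by (simp add: complex_eq_iff power2_eq_square algebra_simps)
qed

text \<open>Near a zero of \<open>w\<close>, the product \<open>w * cnj z\<close> is the fibre coordinate, up to a factor of modulus \<open>1\<close>, times such a
  product with \<open>e = 2 h\<close>. The positive real part prevents it from being opposite to the coordinate.\<close>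

lemma perturbed_product_Re_pos:
  fixes e1 e2 :: complex
  assumes "e > 0" "cmod e1 < e / 8" "cmod e2 \<le> 2 * cmod e1 / e"
  shows "Re ((of_real e + e1) * (1 + e2)) > 0"
proof -
  have "2 * cmod e1 / e \<le> 2 * (e / 8) / e" using assms by (intro divide_right_mono) auto
  moreover have "2 * (e / 8) / e = 1 / 4" using assms(1) by simp
  ultimately have e2: "cmod e2 \<le> 1/4" using assms(3) by linarith
  have e2': "e * cmod e2 \<le> 2 * cmod e1" using assms by (simp add: field_simps)
  have "(of_real e + e1) * (1 + e2) = of_real e + (e1 + of_real e * e2 + e1 * e2)" by (simp add: algebra_simps)
  then have "Re ((of_real e + e1) * (1 + e2)) \<ge> e - cmod (e1 + of_real e * e2 + e1 * e2)"
    using complex_Re_le_cmod[of "- (e1 + of_real e * e2 + e1 * e2)"] by (simp add: norm_minus_cancel del: minus_add_distrib)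
  moreover have "cmod (e1 + of_real e * e2 + e1 * e2) \<le> cmod e1 + e * cmod e2 + cmod e1 * cmod e2"
    using norm_triangle_ineq[of "e1 + of_real e * e2" "e1 * e2"] norm_triangle_ineq[of e1 "of_real e * e2"] assms(1)
    by (simp add: norm_mult)
  moreover have "cmod e1 * cmod e2 \<le> cmod e1 * (1/4)" using e2 by (intro mult_left_mono) auto
  ultimately show ?thesis using assms e2' by linarith
qed

lemma hopf_sgn_hopf_lift_fst:
  assumes h: "0 < h" "h < \<rho>" and s: "cmod s = 1" and k: "k > 0"
    and e: "fst (hopf (sgn (hopf_lift h \<rho> u s))) = - (k *\<^sub>R \<tau>)"
  obtains k' where "k' > 0" "lift_w h \<rho> u * cnj (lift_z h \<rho> u s) = - (of_real k' * cplx \<tau>)"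
proof -
  let ?q = "2 * lift_w h \<rho> u * cnj (lift_z h \<rho> u s)"
  obtain c where c: "c > 0" "hopf (sgn (hopf_lift h \<rho> u s)) = c *\<^sub>R hopf (hopf_lift h \<rho> u s)"
    by (rule hopf_sgn_hopf_lift[OF h s])
  have "c *\<^sub>R (vector [Re ?q, Im ?q] :: real ^ 2) = - (k *\<^sub>R \<tau>)" using e unfolding c(2) hopf_hopf_lift by simp
  then have "c * Re ?q = - (k * \<tau> $ 1)" "c * Im ?q = - (k * \<tau> $ 2)" by (simp_all only: vec2_eq_iff) (simp_all)
  then have "of_real (2 * c) * (lift_w h \<rho> u * cnj (lift_z h \<rho> u s)) = - (of_real k * cplx \<tau>)"
    by (simp add: complex_eq_iff algebra_simps)
  then have "lift_w h \<rho> u * cnj (lift_z h \<rho> u s) = - (of_real (k / (2 * c)) * cplx \<tau>)"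
    using c(1) by (simp add: field_simps)
  then show ?thesis using that[of "k / (2 * c)"] k c(1) by simp
qed

text \<open>At the zero \<open>-h\<close> the leading term of \<open>w * cnj z\<close> is \<open>- 2 h * cnj t\<close>: the first coordinate of the fibre is
  reversed, as in the reflected framing. The coordinate \<open>\<tau>\<close> belongs to that framing.\<close>

lemma hopf_lift_near_minus:
  assumes h: "0 < h" "4 * h < \<rho>" and s: "cmod s = 1" and k: "k > 0"
    and t: "cmod t < h / 4" and \<tau>: "t = - cnj (cplx \<tau>)"
    and e: "fst (hopf (sgn (hopf_lift h \<rho> (t - of_real h) s))) = - (k *\<^sub>R \<tau>)"
  shows "\<tau> = 0"
proof -
  let ?u = "t - of_real h"
  obtain k' where k': "k' > 0" "lift_w h \<rho> ?u * cnj (lift_z h \<rho> ?u s) = - (of_real k' * cplx \<tau>)"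
    using hopf_sgn_hopf_lift_fst[OF h(1) _ s k e] h by auto
  have "cmod ?u \<le> cmod t + h" using norm_triangle_ineq4[of t "of_real h"] h(1) by simp
  then have u: "cmod ?u \<le> \<rho> / 2" using t h by linarith
  note f = lift_factorization[OF h(1) u]
  have \<rho>: "\<rho> > 0" using h by simp
  define e2 where "e2 = - (Re t / (2 * h)) *\<^sub>R (1 - cnj s)"
  have z: "cnj (lift_z h \<rho> ?u s) = 1 + e2"
    unfolding f(2)[OF \<rho>] e2_def using h(1) by (simp add: complex_eq_iff field_simps)
  have "cmod (1 - cnj s) \<le> 2" using norm_triangle_ineq4[of 1 "cnj s"] s by simp
  then have "cmod e2 \<le> \<bar>Re t\<bar> / (2 * h) * 2" unfolding e2_def using h(1)
    by (simp add: abs_mult mult_left_mono del: times_divide_eq_left)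
  also have "\<dots> \<le> 2 * cmod (- t) / (2 * h)" using abs_Re_le_cmod[of t] h(1) by (simp add: divide_right_mono)
  finally have "Re ((of_real (2 * h) + (- t)) * (1 + e2)) > 0"
    using h(1) t by (intro perturbed_product_Re_pos) auto
  moreover have "lift_w h \<rho> ?u * cnj (lift_z h \<rho> ?u s) = cplx \<tau> * ((of_real (2 * h) + (- t)) * (1 + e2))"
    unfolding z f(1)[OF \<rho>] by (simp add: \<tau> algebra_simps)
  then have "cplx \<tau> * ((of_real (2 * h) + (- t)) * (1 + e2) + of_real k') = 0"
    using k'(2) by (simp add: algebra_simps)
  moreover have "X \<noteq> 0" if "Re X > 0" for X using that by auto
  ultimately have "cplx \<tau> = 0" using k'(1) by (metis add_pos_pos mult_eq_0_iff plus_complex.sel(1) Re_complex_of_real)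
  then show ?thesis by (simp add: complex_eq_iff vec2_eq_iff)
qed

text \<open>At the zero \<open>h\<close> the leading term of \<open>w * cnj z\<close> is \<open>2 h * cnj s * u\<close>, which is \<open>2 h * \<tau>\<close> for the
  coordinate \<open>\<tau>\<close> with respect to the framing rotated by \<open>s\<close>. The assumption \<open>close\<close> leaves room for an
  error in this coordinate, because the tubes of the two framings have different fibres.\<close>

lemma hopf_lift_near_plus:
  assumes h: "0 < h" "4 * h < \<rho>" and s: "cmod s = 1" and k: "k > 0"
    and u: "cmod u < h / 4" and close: "cmod (s * cplx \<tau> - u) \<le> (norm \<tau> + cmod u) / 4"
    and e: "fst (hopf (sgn (hopf_lift h \<rho> (u + of_real h) s))) = - (k *\<^sub>R \<tau>)"
  shows "\<tau> = 0"
proof -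
  let ?u = "u + of_real h"
  obtain k' where k': "k' > 0" "lift_w h \<rho> ?u * cnj (lift_z h \<rho> ?u s) = - (of_real k' * cplx \<tau>)"
    using hopf_sgn_hopf_lift_fst[OF h(1) _ s k e] h by auto
  have "cmod ?u \<le> cmod u + h" using norm_triangle_ineq[of u "of_real h"] h(1) by simp
  then have uu: "cmod ?u \<le> \<rho> / 2" using u h by linarith
  note f = lift_factorization[OF h(1) uu]
  have \<rho>: "\<rho> > 0" using h by simp
  define a where "a = s * cplx \<tau>"
  have na: "cmod a = norm \<tau>" using s by (simp add: a_def norm_mult)
  define e2 where "e2 = - (Re u / (2 * h)) *\<^sub>R (s - 1)"
  have ss: "s * cnj s = 1" using s complex_norm_square[of s] by simp
  have "cnj (lift_z h \<rho> ?u s) = cnj s - (Re u / (2 * h)) *\<^sub>R (1 - cnj s)"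
    unfolding f(2)[OF \<rho>] using h(1) by (simp add: complex_eq_iff field_simps)
  then have "s * cnj (lift_z h \<rho> ?u s) = s * cnj s - (Re u / (2 * h)) *\<^sub>R (s - s * cnj s)"
    by (simp only: right_diff_distrib mult_scaleR_right mult_1_right)
  then have z: "s * cnj (lift_z h \<rho> ?u s) = 1 + e2" by (simp add: ss e2_def)
  have "cmod (s - 1) \<le> 2" using norm_triangle_ineq4[of s 1] s by simp
  then have "cmod e2 \<le> \<bar>Re u\<bar> / (2 * h) * 2" unfolding e2_def using h(1)
    by (simp add: abs_mult mult_left_mono del: times_divide_eq_left)
  also have "\<dots> \<le> 2 * cmod (cnj u) / (2 * h)" using abs_Re_le_cmod[of u] h(1) by (simp add: divide_right_mono)
  finally have pos: "Re ((of_real (2 * h) + cnj u) * (1 + e2)) > 0"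
    using h(1) u by (intro perturbed_product_Re_pos) auto
  define \<mu> where "\<mu> = (of_real (2 * h) + cnj u) * (1 + e2)"
  have "s * (lift_w h \<rho> ?u * cnj (lift_z h \<rho> ?u s)) = cnj (u + 2 * of_real h) * u * (s * cnj (lift_z h \<rho> ?u s))"
    unfolding f(1)[OF \<rho>] by (simp add: algebra_simps)
  also have "\<dots> = \<mu> * u" unfolding z \<mu>_def by (simp add: algebra_simps)
  finally have "\<mu> * u = - (of_real k' * a)" using k'(2) by (simp add: a_def algebra_simps)
  then have ka: "of_real k' * a = - (\<mu> * u)" by simp
  define X where "X = a * cnj u"
  have "of_real k' * X = - (\<mu> * (u * cnj u))" by (simp add: X_def mult.assoc[symmetric] ka)
  also have "u * cnj u = of_real ((cmod u)\<^sup>2)" using complex_norm_square[of u] by simp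
  finally have "Re (of_real k' * X) = Re (- (\<mu> * of_real ((cmod u)\<^sup>2)))" by (rule arg_cong)
  then have "k' * Re X = - (Re \<mu> * (cmod u)\<^sup>2)" by simp
  moreover have "Re \<mu> * (cmod u)\<^sup>2 \<ge> 0" using pos unfolding \<mu>_def by (intro mult_nonneg_nonneg) auto
  ultimately have "k' * Re X \<le> 0" by simp
  then have "Re X \<le> 0" using k'(1) by (simp add: mult_le_0_iff)
  then have re: "Re a * Re u + Im a * Im u \<le> 0" by (simp add: X_def)
  define A U where "A = (cmod a)\<^sup>2" and "U = (cmod u)\<^sup>2"
  have "(cmod a)\<^sup>2 + (cmod u)\<^sup>2 \<le> (cmod (a - u))\<^sup>2"
    using re unfolding cmod_power2 by (simp add: power2_eq_square algebra_simps)
  also have "\<dots> \<le> ((cmod a + cmod u) / 4)\<^sup>2" using close na by (intro power_mono) (auto simp: a_def)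
  also have "\<dots> \<le> ((cmod a)\<^sup>2 + (cmod u)\<^sup>2) / 8"
    using sum_squares_bound[of "cmod a" "cmod u"] by (simp add: power2_eq_square algebra_simps)
  finally have "A + U \<le> (A + U) / 8" by (simp add: A_def U_def)
  moreover have "A \<ge> 0" "U \<ge> 0" by (simp_all add: A_def U_def)
  ultimately have "A = 0" by (auto simp: field_simps)
  then show ?thesis using na by (simp add: A_def)
qed

text \<open>Near \<open>u = 0\<close>, \<open>s = -1\<close> the rotated lift is to first order a positive diagonal matrix
  in the coordinates \<open>Re u\<close>, \<open>Im u\<close> and \<open>- Im s\<close>. If it points opposite to \<open>T\<close>, then each coordinate of \<open>T\<close> has the
  sign opposite to a quantity that approximates it, and so is of the size of the error.\<close>

lemma rot3_hopf_lift_near: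
  assumes h: "0 < h" "4 * h < \<rho>" "h \<le> 1" and s: "cmod s = 1" "Re s < 0" and k: "k > 0"
    and u: "cmod u < h / 4"
    and close: "\<bar>Re u - T $ 1\<bar> \<le> norm T / 8" "\<bar>Im u - T $ 2\<bar> \<le> norm T / 8" "\<bar>- Im s - T $ 3\<bar> \<le> norm T / 8"
    and e: "fst (rot3 (sgn (hopf_lift h \<rho> u s))) = - (k *\<^sub>R T)"
  shows "T = 0"
proof -
  have hr: "h < \<rho>" "\<rho> > 0" "cmod u \<le> \<rho> / 2" using h u by auto
  have n: "norm (hopf_lift h \<rho> u s) > 0" using hopf_lift_neq_0[OF h(1) hr(1) s(1)] by simp
  define c where "c = inverse (norm (hopf_lift h \<rho> u s))"
  have c: "c > 0" using n by (simp add: c_def)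
  define z w where "z = lift_z h \<rho> u s" and "w = lift_w h \<rho> u"
  have "rot3 (sgn (hopf_lift h \<rho> u s)) = c *\<^sub>R rot3 (hopf_lift h \<rho> u s)" by (simp add: sgn_div_norm rot3_scaleR c_def)
  then have v: "c *\<^sub>R (vector [- Re z, Im w, - Im z] :: real ^ 3) = - (k *\<^sub>R T)"
    using e by (simp add: rot3_hopf_lift z_def w_def)
  have comp: "c * (- Re z) = - (k * T $ 1)" "c * Im w = - (k * T $ 2)" "c * (- Im z) = - (k * T $ 3)"
    using arg_cong[OF v, of "\<lambda>x. x $ 1"] arg_cong[OF v, of "\<lambda>x. x $ 2"] arg_cong[OF v, of "\<lambda>x. x $ 3"] by simp_all
  have sgn: "x * y \<le> 0" if "c * x = - (k * y)" for x y
  proof -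
    have "c * (x * y) = - (k * y\<^sup>2)" using arg_cong[OF that, of "\<lambda>x. x * y"] by (simp add: power2_eq_square mult_ac)
    also have "\<dots> \<le> 0" using k by simp
    finally show ?thesis using c by (simp add: mult_le_0_iff)
  qed
  note f = lift_factorization[OF h(1) hr(3,2)]
  have rz: "2 * h * (- Re z) = Re u * (1 - Re s) - h * (1 + Re s)"
    and iz: "2 * (- Im z) = (- Im s) * (1 + Re u / h)" and iw: "Im w = 2 * h * Im u"
    unfolding z_def w_def f using h(1) by (simp_all add: field_simps)
  define b where "b = - Im s"
  define R where "R = norm T"
  have T3: "b * T $ 3 \<le> 0"
  proof -
    have "\<bar>Re u\<bar> < h" using abs_Re_le_cmod[of u] u h(1) by linarith
    then have "1 + Re u / h > 0" using h(1) by (simp add: field_simps)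
    moreover have "b * (1 + Re u / h) * T $ 3 \<le> 0" using sgn[OF comp(3)] iz by (simp add: b_def[symmetric]) (smt (verit) mult_2 distrib_right)
    ultimately show ?thesis by (metis mult.assoc mult.commute mult_le_0_iff not_less order_less_imp_le zero_less_mult_iff)
  qed
  have T2: "Im u * T $ 2 \<le> 0"
  proof -
    have "2 * h * (Im u * T $ 2) \<le> 0" using sgn[OF comp(2)] iw by (simp add: mult_ac)
    then show ?thesis using h(1) by (simp add: mult_le_0_iff)
  qed
  have T1: "(Re u * (1 - Re s) - h * (1 + Re s)) * T $ 1 \<le> 0"
  proof -
    have "2 * h * (- Re z * T $ 1) \<le> 0" by (rule mult_nonneg_nonpos[OF _ sgn[OF comp(1)]]) (use h(1) in simp)
    then show ?thesis using rz by (metis mult.assoc)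
  qed
  have small: "\<bar>y\<bar> \<le> R / 8" if "x * y \<le> 0" "\<bar>x - y\<bar> \<le> R / 8" for x y :: real
    using that by (cases "y \<ge> 0"; cases "x \<ge> 0") (auto simp: mult_le_0_iff)
  have b3: "\<bar>T $ 3\<bar> \<le> R / 8" using small[OF T3] close(3) by (simp add: b_def R_def)
  have b2: "\<bar>T $ 2\<bar> \<le> R / 8" using small[OF T2] close(2) by (simp add: R_def)
  have bb: "\<bar>b\<bar> \<le> R / 4" using b3 close(3) unfolding b_def R_def by linarith
  have "b\<^sup>2 + (Re s)\<^sup>2 = 1" using s(1) by (simp add: b_def cmod_def)
  then have s1: "(1 + Re s) * (1 - Re s) = b\<^sup>2" by (simp add: power2_eq_square algebra_simps)
  have "b\<^sup>2 \<le> 1" using \<open>b\<^sup>2 + (Re s)\<^sup>2 = 1\<close> zero_le_power2[of "Re s"] by linarith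
  then have "\<bar>b\<bar> \<le> 1" by (simp add: abs_square_le_1)
  have rs: "0 \<le> 1 + Re s" using abs_Re_le_cmod[of s] s(1) by linarith
  have "(1 + Re s) * 1 \<le> (1 + Re s) * (1 - Re s)" using rs s(2) by (intro mult_left_mono) auto
  also have "\<dots> = \<bar>b\<bar> * \<bar>b\<bar>" using s1 by (simp add: power2_eq_square)
  also have "\<dots> \<le> 1 * (R / 4)" using bb \<open>\<bar>b\<bar> \<le> 1\<close> by (intro mult_mono) auto
  finally have hs: "h * (1 + Re s) \<le> 1 * (R / 4)" using h(1,3) rs by (intro mult_mono) auto
  define D where "D = h * (1 + Re s) / (1 - Re s)"
  define A where "A = Re u - D"
  have p: "1 - Re s > 1" using s(2) by simp
  have "A * (1 - Re s) = Re u * (1 - Re s) - h * (1 + Re s)" using p by (simp add: A_def D_def left_diff_distrib)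
  then have "A * T $ 1 * (1 - Re s) \<le> 0" using T1 by (metis mult.assoc mult.commute)
  then have A1: "A * T $ 1 \<le> 0" using p by (simp add: mult_le_0_iff)
  have "0 \<le> h * (1 + Re s)" using h(1) rs by simp
  then have "D \<le> h * (1 + Re s)" "0 \<le> D"
    using p by (auto simp: D_def divide_le_eq mult_le_cancel_left1)
  then have "\<bar>A - T $ 1\<bar> \<le> R / 8 + R / 4" using close(1) hs unfolding A_def R_def by linarith
  then have b1: "\<bar>T $ 1\<bar> \<le> R / 8 + R / 4"
    using A1 by (cases "T $ 1 \<ge> 0"; cases "A \<ge> 0") (auto simp: mult_le_0_iff)
  have "R \<le> \<bar>T $ 1\<bar> + \<bar>T $ 2\<bar> + \<bar>T $ 3\<bar>"
    using norm_le_l1_cart[of T] by (simp add: R_def sum_3)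
  then have "R \<le> 0" using b1 b2 b3 by linarith
  then show ?thesis by (simp add: R_def)
qed

subsection \<open>The lifted collapse\<close>

text \<open>The parameter \<open>a\<close> moves the centre of the lift along the first vector of the framing. For \<open>a = h\<close> the
  zeros of \<open>w\<close> lie on \<open>M\<close> and on its copy at distance \<open>2 * h\<close>; for \<open>a = 0\<close> the centre lies on \<open>M\<close>.\<close>

definition tube_lift ::
  "'a::euclidean_space set \<Rightarrow> ('a \<Rightarrow> 'a ^ 2) \<Rightarrow> real \<Rightarrow> real \<Rightarrow> real \<Rightarrow> ('a \<Rightarrow> complex) \<Rightarrow> real \<Rightarrow> 'a \<times> real \<Rightarrow> (real ^ 3) \<times> real" where
  "tube_lift M F r h \<rho> s a =
     tube_extend M F r (\<lambda>x. sgn (hopf_lift h \<rho> (cplx (snd x) - of_real a) (s (fst x))))"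

text \<open>The centre and the circle-valued map move at the same time. The condition on \<open>a\<close> and \<open>b\<close> keeps the support of the
  lift inside the tube.\<close>

lemma tube_lift_homotopic:
  assumes F: "framed_closed_submanifold M F" and r: "tubular_radius M F r"
    and h: "0 < h" "h < \<rho>" and a: "\<bar>a\<bar> + \<rho> \<le> r" "\<bar>b\<bar> + \<rho> \<le> r"
    and s: "homotopic_with_canon (\<lambda>_. True) M (sphere 0 1) s s'"
  shows "pointed_homotopic (tube_lift M F r h \<rho> s a) (tube_lift M F r h \<rho> s' b)"
proof -
  obtain k where k: "continuous_on ({0..1::real} \<times> M) k" "\<And>x. x \<in> {0..1} \<times> M \<Longrightarrow> cmod (k x) = 1"
    "\<And>x. k (0, x) = s x" "\<And>x. k (1, x) = s' x"
  proof -
    obtain k where "continuous_on ({0..1::real} \<times> M) k" "k ` ({0..1} \<times> M) \<subseteq> sphere 0 1"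
    "\<forall>x. k (0, x) = s x" "\<forall>x. k (1, x) = s' x"
      using s unfolding homotopic_with_def by (auto simp: image_subset_iff_funcset)
    then show ?thesis using that[of k] by (auto simp: image_subset_iff)
  qed
  define c where "c \<tau> = (1 - \<tau>) * a + \<tau> * b" for \<tau>
  have c: "\<bar>c \<tau>\<bar> + \<rho> \<le> r" if "\<tau> \<in> {0..1}" for \<tau>
  proof -
    have "\<bar>c \<tau>\<bar> \<le> (1 - \<tau>) * \<bar>a\<bar> + \<tau> * \<bar>b\<bar>"
      using that abs_triangle_ineq[of "(1 - \<tau>) * a" "\<tau> * b"] by (simp add: c_def abs_mult)
    also have "\<dots> \<le> (1 - \<tau>) * (r - \<rho>) + \<tau> * (r - \<rho>)"
      using that a by (intro add_mono mult_left_mono) auto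
    finally show ?thesis by (simp add: algebra_simps)
  qed
  define H where "H x = sgn (hopf_lift h \<rho> (cplx (snd (snd x)) - of_real (c (fst x))) (k (fst x, fst (snd x))))" for x
  have "pointed_homotopic (tube_extend M F r (\<lambda>x. H (0, x))) (tube_extend M F r (\<lambda>x. H (1, x)))"
  proof (rule pointed_homotopic_tube_extend[OF F r])
    have k2: "continuous_on ({0..1} \<times> M \<times> cball 0 r) (\<lambda>x. k (fst x, fst (snd x)))"
      by (rule continuous_on_compose2[OF k(1)]) (auto intro!: continuous_intros)
    show "continuous_on ({0..1} \<times> M \<times> cball 0 r) H"
    proof -
      have "hopf_lift h \<rho> v (k (\<tau>, p)) \<noteq> 0" if "0 \<le> \<tau>" "\<tau> \<le> 1" "p \<in> M" for v \<tau> p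
        using hopf_lift_neq_0[OF h k(2)] that by simp
      then show ?thesis unfolding H_def c_def by (intro continuous_intros k2) auto
    qed
    show "H (\<tau>, p, t) = north" if "\<tau> \<in> {0..1}" "p \<in> M" "norm t = r" for \<tau> p t
    proof -
      have "r - \<bar>c \<tau>\<bar> \<le> cmod (cplx t - of_real (c \<tau>))"
        using norm_triangle_ineq2[of "cplx t" "of_real (c \<tau>)"] that(3) by simp
      then show ?thesis unfolding H_def using c[OF that(1)] by (simp add: hopf_lift_outside[OF h])
    qed
    show "norm (H (\<tau>, p, t)) = 1" if "\<tau> \<in> {0..1}" "p \<in> M" for \<tau> p t
      using hopf_lift_neq_0[OF h k(2)[of "(\<tau>, p)"]] that by (simp add: H_def norm_sgn)
  qed
  then show ?thesis by (simp add: H_def tube_lift_def c_def k(3,4))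
qed

lemma pointed_map_tube_lift:
  assumes F: "framed_closed_submanifold M F" and r: "tubular_radius M F r"
    and h: "0 < h" "h < \<rho>" and a: "\<bar>a\<bar> + \<rho> \<le> r"
    and s: "continuous_on M s" "s ` M \<subseteq> sphere 0 1"
  shows "pointed_map (tube_lift M F r h \<rho> s a)"
  unfolding tube_lift_def
proof (rule pointed_map_tube_extend[OF F r])
  have s1: "cmod (s p) = 1" if "p \<in> M" for p using s(2) that by auto
  show "continuous_on (M \<times> cball 0 r) (\<lambda>x. sgn (hopf_lift h \<rho> (cplx (snd x) - of_real a) (s (fst x))))"
  proof -
    have "hopf_lift h \<rho> v (s p) \<noteq> 0" if "p \<in> M" for v p
      using hopf_lift_neq_0[OF h s1[OF that]] .
    then show ?thesis by (intro continuous_intros continuous_on_compose2[OF s(1)]) auto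
  qed
  show "norm (sgn (hopf_lift h \<rho> (cplx (snd (p, t)) - of_real a) (s (fst (p, t))))) = 1" if "p \<in> M" for p t
    using hopf_lift_neq_0[OF h s1[OF that]] by (simp add: norm_sgn)
  show "sgn (hopf_lift h \<rho> (cplx (snd (p, t)) - of_real a) (s (fst (p, t)))) = north" if "p \<in> M" "norm t = r" for p t
  proof -
    have "r - \<bar>a\<bar> \<le> cmod (cplx t - of_real a)"
      using norm_triangle_ineq2[of "cplx t" "of_real a"] that(2) by simp
    then show ?thesis using a by (simp add: hopf_lift_outside[OF h])
  qed
qed

section \<open>Comparing fibre coordinates\<close>

text \<open>If a point has the representations \<open>q + \<nu>\<close> and \<open>x + frame_comb (w x) u\<close>, then
  to first order the normal parts of \<open>\<nu>\<close> and of \<open>frame_comb (w q) u\<close> at \<open>q\<close> agree, because the chord from \<open>q\<close> to \<open>x\<close>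
  is tangent up to a quadratic error.\<close>

lemma fibre_comparison:
  fixes w :: "'a::euclidean_space \<Rightarrow> 'a ^ 'k"
  assumes Q: "closed_submanifold m Q" and w: "continuous_on Q w" and \<eta>: "\<eta> > 0"
  obtains \<delta> where "\<delta> > 0" "\<forall>x\<in>Q. \<forall>q\<in>Q. \<forall>u \<nu>. norm u < \<delta> \<longrightarrow> norm \<nu> < \<delta> \<longrightarrow> x + frame_comb (w x) u = q + \<nu> \<longrightarrow>
      norm (x - q) < \<eta> \<and> norm (frame_comb (w x - w q) u) \<le> \<eta> * norm u \<and>
      (\<forall>n\<in>normal_space Q q. \<bar>n \<bullet> (\<nu> - frame_comb (w q) u)\<bar> \<le> \<eta> * norm n * (norm \<nu> + norm u)) \<and>
      (norm (x - q))\<^sup>2 \<le> \<eta> * (norm \<nu> + norm u)"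
proof -
  have cQ: "compact Q" using Q by (simp add: closed_submanifold_def)
  obtain C where C: "C \<ge> 0" "\<And>p q n. p \<in> Q \<Longrightarrow> q \<in> Q \<Longrightarrow> n \<in> normal_space Q p \<Longrightarrow> \<bar>n \<bullet> (q - p)\<bar> \<le> C * norm n * (norm (q - p))\<^sup>2"
    using submanifold_estimates[OF Q] by metis
  obtain B0 where B0: "B0 > 0" "\<And>p. p \<in> Q \<Longrightarrow> norm (w p) \<le> B0"
    using compact_imp_bounded[OF compact_continuous_image[OF w cQ]] unfolding bounded_pos by auto
  define K where "K = real CARD('k)"
  have K: "K \<ge> 1" by (simp add: K_def Suc_leI)
  define B where "B = K * B0"
  have B: "B > 0" "norm (frame_comb (w p) c) \<le> B * norm c" if "p \<in> Q" for p c
  proof -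
    show "B > 0" using K B0 by (simp add: B_def)
    have "K * norm (w p) * norm c \<le> K * B0 * norm c" using K B0(2)[OF that] by (intro mult_right_mono mult_left_mono) auto
    moreover have "norm (frame_comb (w p) c) \<le> K * norm (w p) * norm c"
      unfolding K_def by (rule norm_frame_comb_le)
    ultimately show "norm (frame_comb (w p) c) \<le> B * norm c" unfolding B_def by linarith
  qed
  define \<eta>1 where "\<eta>1 = \<eta> / (2 * K)"
  have "\<eta>1 > 0" using \<eta> K by (simp add: \<eta>1_def)
  then obtain d where d: "d > 0" "\<forall>x\<in>Q. \<forall>q\<in>Q. dist q x < d \<longrightarrow> dist (w q) (w x) < \<eta>1"
    using compact_uniformly_continuous[OF w cQ] unfolding uniformly_continuous_on_def by meson
  define B1 where "B1 = 1 + B"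
  have B1: "B1 \<ge> 1" using K B0 by (simp add: B1_def B_def)
  define \<eta>2 where "\<eta>2 = \<eta> / (2 * (C + 1))"
  have \<eta>2: "\<eta>2 > 0" using \<eta> C by (simp add: \<eta>2_def)
  define \<delta> where "\<delta> = min (min (d / (2 * B1)) (\<eta> / (2 * B1))) (\<eta>2 / (2 * B1\<^sup>2))"
  have \<delta>: "\<delta> > 0" using d \<eta> B1 \<eta>2 by (simp add: \<delta>_def)
  show ?thesis
  proof (rule that[OF \<delta>], intro ballI allI impI)
    fix x q u \<nu> assume x: "x \<in> Q" and q: "q \<in> Q" and s: "norm u < \<delta>" "norm \<nu> < \<delta>"
      and e: "x + frame_comb (w x) u = q + \<nu>"
    define m where "m = norm \<nu> + norm u"
    have m0: "m \<ge> 0" "m < 2 * \<delta>" using s by (auto simp: m_def)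
    have "x - q = \<nu> - frame_comb (w x) u" using e by (simp add: algebra_simps)
    then have "norm (x - q) \<le> norm \<nu> + B * norm u"
      using norm_triangle_ineq4[of \<nu> "frame_comb (w x) u"] B(2)[OF x, of u] by simp
    also have "\<dots> \<le> B1 * m"
    proof -
      have "0 \<le> B * norm \<nu>" using B(1)[OF x] by simp
      moreover have "B1 * m = norm \<nu> + norm u + B * norm \<nu> + B * norm u" by (simp add: B1_def m_def algebra_simps)
      ultimately show ?thesis using norm_ge_zero[of u] by linarith
    qed
    finally have xq: "norm (x - q) \<le> B1 * m" .
    have "B1 * m < B1 * (2 * \<delta>)" using m0 B1 by (intro mult_strict_left_mono) auto
    also have "B1 * (2 * \<delta>) \<le> min d \<eta>"
    proof -
      have "\<delta> \<le> d / (2 * B1)" "\<delta> \<le> \<eta> / (2 * B1)" by (auto simp: \<delta>_def)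
      then show ?thesis using B1 by (simp add: field_simps)
    qed
    finally have xq2: "norm (x - q) < d" "norm (x - q) < \<eta>" using xq by auto
    have "dist (w x) (w q) < \<eta>1" using d(2) x q xq2(1) by (simp add: dist_norm)
    then have "K * norm (w x - w q) * norm u \<le> K * \<eta>1 * norm u"
      using K by (intro mult_right_mono mult_left_mono) (auto simp: dist_norm)
    also have "K * \<eta>1 = \<eta> / 2" using K by (simp add: \<eta>1_def)
    finally have A: "norm (frame_comb (w x - w q) u) \<le> \<eta> / 2 * norm u"
      using norm_frame_comb_le[of "w x - w q" u] by (simp add: K_def)
    have "(norm (x - q))\<^sup>2 \<le> (B1 * m)\<^sup>2" using xq by (intro power_mono) auto
    also have "\<dots> = (B1\<^sup>2 * m) * m" by (simp add: power2_eq_square algebra_simps)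
    also have "B1\<^sup>2 * m \<le> B1\<^sup>2 * (2 * (\<eta>2 / (2 * B1\<^sup>2)))"
      using m0 by (intro mult_left_mono) (auto simp: \<delta>_def)
    also have "\<dots> = \<eta> / (2 * (C + 1))" using B1 by (simp add: \<eta>2_def)
    finally have D: "(norm (x - q))\<^sup>2 \<le> \<eta> / (2 * (C + 1)) * m" using m0(1) by (simp add: mult_right_mono)
    have E: "C * (\<eta> / (2 * (C + 1))) \<le> \<eta> / 2" "\<eta> / (2 * (C + 1)) \<le> \<eta>" using C(1) \<eta> by (auto simp: field_simps)
    have D2: "(norm (x - q))\<^sup>2 \<le> \<eta> * m" using D E(2) m0(1) mult_right_mono order_trans by blast
    have N: "\<bar>n \<bullet> (\<nu> - frame_comb (w q) u)\<bar> \<le> \<eta> * norm n * m" if n: "n \<in> normal_space Q q" for n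
    proof -
      have "\<nu> - frame_comb (w q) u = (x - q) + frame_comb (w x - w q) u"
        using e by (simp add: frame_comb_diff_left algebra_simps)
      then have "\<bar>n \<bullet> (\<nu> - frame_comb (w q) u)\<bar> \<le> \<bar>n \<bullet> (x - q)\<bar> + \<bar>n \<bullet> frame_comb (w x - w q) u\<bar>"
        by (simp add: inner_add_right)
      also have "\<dots> \<le> C * norm n * (norm (x - q))\<^sup>2 + norm n * (\<eta> / 2 * norm u)"
        by (intro add_mono C(2)[OF q x n] order_trans[OF Cauchy_Schwarz_ineq2] mult_left_mono A norm_ge_zero)
      also have "\<dots> \<le> C * norm n * (\<eta> / (2 * (C + 1)) * m) + norm n * (\<eta> / 2 * m)"
        using C(1) \<eta> by (intro add_mono mult_left_mono D) (auto simp: m_def)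
      also have "\<dots> = (C * (\<eta> / (2 * (C + 1)))) * (norm n * m) + \<eta> / 2 * (norm n * m)" by (simp add: algebra_simps)
      also have "\<dots> \<le> \<eta> / 2 * (norm n * m) + \<eta> / 2 * (norm n * m)"
        using m0(1) by (intro add_mono mult_right_mono E(1)) auto
      finally show ?thesis by (simp add: algebra_simps)
    qed
    have A2: "norm (frame_comb (w x - w q) u) \<le> \<eta> * norm u" using A \<eta> by (smt (verit) field_sum_of_halves mult_right_mono norm_ge_zero)
    show "norm (x - q) < \<eta> \<and> norm (frame_comb (w x - w q) u) \<le> \<eta> * norm u \<and>
      (\<forall>n\<in>normal_space Q q. \<bar>n \<bullet> (\<nu> - frame_comb (w q) u)\<bar> \<le> \<eta> * norm n * (norm \<nu> + norm u)) \<and>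
      (norm (x - q))\<^sup>2 \<le> \<eta> * (norm \<nu> + norm u)"
      using xq2(2) A2 N D2 by (simp add: m_def)
  qed
qed

section \<open>The shifted copy\<close>

text \<open>A slice chart of \<open>N\<close> is transported by a local inverse of an extension of \<open>f\<close>. To
  make it a slice chart of the image, the compact image of the rest of \<open>N\<close> is removed from its domain.\<close>

lemma closed_submanifold_diffeo_image:
  fixes N :: "(real ^ 'm) set" and f :: "real ^ 'm \<Rightarrow> real ^ 'm"
  assumes N: "closed_submanifold k N" and cont: "continuous_on N f" and inj: "inj_on f N"
    and loc: "\<And>p. p \<in> N \<Longrightarrow> \<exists>U g. open U \<and> p \<in> U \<and> smooth_on U g \<and> (\<forall>x\<in>N \<inter> U. f x = g x) \<and>
       (\<forall>v. frechet_derivative g (at p) v = 0 \<longrightarrow> v = 0)"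
  shows "closed_submanifold k (f ` N)"
  unfolding closed_submanifold_iff
proof (intro conjI ballI)
  have cN: "compact N" using N by (simp add: closed_submanifold_def)
  then show "compact (f ` N)" by (rule compact_continuous_image[OF cont])
  fix q assume "q \<in> f ` N"
  then obtain p where p: "p \<in> N" "q = f p" by blast
  obtain U0 g where g: "open U0" "p \<in> U0" "smooth_on U0 g" "\<forall>x\<in>N \<inter> U0. f x = g x"
    "\<And>v. frechet_derivative g (at p) v = 0 \<Longrightarrow> v = 0" using loc[OF p(1)] by (elim exE conjE) simp
  obtain U1 V1 g' where U1: "open U1" "p \<in> U1" "U1 \<subseteq> U0" "open V1" "homeomorphism U1 V1 g g'"
    "smooth_on U1 g" "smooth_on V1 g'"
    by (rule smooth_inverse_function_theorem[OF g(1,3,2,5)])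
  obtain U V \<phi> \<psi> L where c: "p \<in> U" "slice_chart N U V \<phi> \<psi> L" "dim L + k = CARD('m)"
    using N p(1) unfolding closed_submanifold_iff by auto
  note cD = slice_chartD[OF c(2)]
  have gD: "x \<in> U1 \<Longrightarrow> g' (g x) = x" "x \<in> U1 \<Longrightarrow> g x \<in> V1" "y \<in> V1 \<Longrightarrow> g (g' y) = y" "y \<in> V1 \<Longrightarrow> g' y \<in> U1" for x y
    using U1(5) by (auto simp: homeomorphism_def)
  define O1 where "O1 = - f ` (N - (U1 \<inter> U))"
  have "compact (N - (U1 \<inter> U))" using cN U1(1) cD(1) by (intro compact_diff) auto
  then have "compact (f ` (N - (U1 \<inter> U)))"
    by (rule compact_continuous_image[OF continuous_on_subset[OF cont], rotated]) auto
  then have oO: "open O1" unfolding O1_def by (simp add: compact_imp_closed open_Compl)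
  have qO: "q \<in> O1" using inj p U1(2) c(1) by (auto simp: O1_def inj_on_def)
  have inO: "x \<in> U1 \<inter> U" if "x \<in> N" "f x \<in> O1" for x using that by (auto simp: O1_def)
  define A where "A = (U1 \<inter> U) \<inter> g -` O1"
  have cg: "continuous_on U1 g" using U1(6) smooth_on_continuous by blast
  have oA: "open A" unfolding A_def
    by (rule continuous_open_preimage[OF continuous_on_subset[OF cg]]) (use U1(1) cD(1) oO in auto)
  have pq: "g p = q" using g(4) p g(2) by auto
  have pA: "p \<in> A" using U1(2) c(1) qO pq by (auto simp: A_def)
  have AU: "A \<subseteq> U1" "A \<subseteq> U" by (auto simp: A_def)
  define U3 where "U3 = V1 \<inter> g' -` A"
  define V3 where "V3 = V \<inter> \<psi> -` A"
  have oU3: "open U3" unfolding U3_def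
    by (rule continuous_open_preimage[OF smooth_on_continuous[OF U1(7)] U1(4) oA])
  have oV3: "open V3" unfolding V3_def
    by (rule continuous_open_preimage[OF cD(13) cD(2) oA])
  have U3: "x \<in> A \<Longrightarrow> g x \<in> U3" "y \<in> U3 \<Longrightarrow> g' y \<in> A" for x y using AU gD by (auto simp: U3_def)
  have V3: "x \<in> A \<Longrightarrow> \<phi> x \<in> V3" "y \<in> V3 \<Longrightarrow> \<psi> y \<in> A" for x y using AU cD(6,7) by (auto simp: V3_def)
  have sm1: "smooth_on U3 (\<lambda>y. \<phi> (g' y))"
    by (rule smooth_on_compose[OF oU3 cD(1) _ _ cD(3)])
      (use U3(2) AU smooth_on_subset[OF U1(7)] in \<open>auto simp: U3_def\<close>)
  have sm2: "smooth_on V3 (\<lambda>y. g (\<psi> y))"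
    by (rule smooth_on_compose[OF oV3 U1(1) _ _ U1(6)])
      (use V3(2) AU smooth_on_subset[OF cD(4)] in \<open>auto simp: V3_def\<close>)
  have hom: "homeomorphism U3 V3 (\<lambda>y. \<phi> (g' y)) (\<lambda>y. g (\<psi> y))"
  proof (rule homeomorphismI)
    show "continuous_on U3 (\<lambda>y. \<phi> (g' y))" "continuous_on V3 (\<lambda>y. g (\<psi> y))"
      using sm1 sm2 smooth_on_continuous by blast+
    show "(\<lambda>y. \<phi> (g' y)) ` U3 \<subseteq> V3" "(\<lambda>y. g (\<psi> y)) ` V3 \<subseteq> U3" using U3 V3 by auto
    show "g (\<psi> (\<phi> (g' y))) = y" if "y \<in> U3" for y
      using that U3(2)[OF that] AU cD(7) gD(3) by (auto simp: U3_def)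
    show "\<phi> (g' (g (\<psi> y))) = y" if "y \<in> V3" for y
      using that V3(2)[OF that] AU cD(9) gD(1) by (auto simp: V3_def)
  qed
  have sl: "(\<lambda>y. \<phi> (g' y)) ` (f ` N \<inter> U3) = V3 \<inter> L"
  proof (intro equalityI subsetI)
    fix z assume "z \<in> (\<lambda>y. \<phi> (g' y)) ` (f ` N \<inter> U3)"
    then obtain x where x: "x \<in> N" "f x \<in> U3" "z = \<phi> (g' (f x))" by auto
    have "g' (f x) \<in> A" "g (g' (f x)) = f x" using U3(2)[OF x(2)] gD(3) x(2) by (auto simp: U3_def)
    then have "f x \<in> O1" by (auto simp: A_def)
    then have xU: "x \<in> U1 \<inter> U" using inO x(1) by blast
    then have "f x = g x" using g(4) x(1) U1(3) by blast
    then have e: "g' (f x) = x" using gD(1) xU by simp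
    then have "\<phi> x \<in> V3" using V3(1) \<open>g' (f x) \<in> A\<close> by simp
    moreover have "\<phi> x \<in> L" using cD(10) xU x(1) by blast
    ultimately show "z \<in> V3 \<inter> L" using x(3) e by simp
  next
    fix z assume z: "z \<in> V3 \<inter> L"
    have A: "\<psi> z \<in> A" using V3(2) z by blast
    have "\<psi> z \<in> N" using cD(11)[of z] z by (auto simp: V3_def)
    then have "f (\<psi> z) = g (\<psi> z)" using g(4) A AU U1(3) by blast
    moreover have "g (\<psi> z) \<in> U3" using U3(1)[OF A] .
    moreover have "\<phi> (g' (g (\<psi> z))) = z" using A AU gD(1)[of "\<psi> z"] cD(9)[of z] z by (auto simp: V3_def)
    moreover have "g (\<psi> z) \<in> f ` N" using \<open>\<psi> z \<in> N\<close> \<open>f (\<psi> z) = g (\<psi> z)\<close> by (metis imageI)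
    ultimately show "z \<in> (\<lambda>y. \<phi> (g' y)) ` (f ` N \<inter> U3)"
      by (intro image_eqI[of _ _ "g (\<psi> z)"]) auto
  qed
  have "slice_chart (f ` N) U3 V3 (\<lambda>y. \<phi> (g' y)) (\<lambda>y. g (\<psi> y)) L"
    unfolding slice_chart_def using oU3 oV3 hom sm1 sm2 cD(5) sl by blast
  moreover have "q \<in> U3" using U3(1)[OF pA] pq by simp
  ultimately show "\<exists>U V \<phi> \<psi> L. q \<in> U \<and> slice_chart (f ` N) U V \<phi> \<psi> L \<and> dim L + k = DIM(real ^ 'm)"
    using c(3) by (intro exI[of _ U3] exI[of _ V3] exI[of _ "\<lambda>y. \<phi> (g' y)"] exI[of _ "\<lambda>y. g (\<psi> y)"] exI[of _ L]) simp
qed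

text \<open>With this bound the derivative of \<open>x + \<epsilon> f(x)\<close> is injective at all points of \<open>N\<close> for the same \<open>\<epsilon>\<close>.\<close>

lemma smooth_map_on_uniform_derivative_bound:
  fixes f :: "'a::euclidean_space \<Rightarrow> 'b::real_normed_vector"
  assumes N: "compact N" and f: "smooth_map_on N f"
  obtains C where "C \<ge> 0" "\<forall>p\<in>N. \<exists>U g. open U \<and> p \<in> U \<and> smooth_on U g \<and> (\<forall>x\<in>N \<inter> U. f x = g x) \<and>
     (\<forall>x\<in>U. \<forall>v. norm (frechet_derivative g (at x) v) \<le> C * norm v)"
proof -
  have "\<exists>U C. open U \<and> p \<in> U \<and> (\<exists>g. smooth_on U g \<and> (\<forall>x\<in>N \<inter> U. f x = g x) \<and>
     (\<forall>x\<in>U. \<forall>v. norm (frechet_derivative g (at x) v) \<le> C * norm v))" if p: "p \<in> N" for p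
  proof -
    obtain U g where U: "open U" "p \<in> U" "smooth_on U g" "\<forall>x\<in>N \<inter> U. f x = g x"
      by (rule smooth_map_onE[OF f p])
    then obtain r where r: "r > 0" "cball p r \<subseteq> U" using open_contains_cball by meson
    obtain C where "\<And>x v. x \<in> cball p r \<Longrightarrow> norm (frechet_derivative g (at x) v) \<le> C * norm v"
      using smooth_on_derivative_bound[OF U(3) r(2)] by metis
    then have 1: "\<forall>x\<in>ball p r. \<forall>v. norm (frechet_derivative g (at x) v) \<le> C * norm v" by simp
    have sub: "ball p r \<subseteq> U" using r(2) ball_subset_cball[of p r] by (rule order_trans[rotated])
    have 2: "smooth_on (ball p r) g" by (rule smooth_on_subset[OF U(3) sub])
    have 3: "\<forall>x\<in>N \<inter> ball p r. f x = g x" using U(4) sub by (meson Int_iff subsetD)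
    show ?thesis
      by (intro exI[of _ "ball p r"] exI[of _ C] conjI exI[of _ g] 1 2 3) (use r in auto)
  qed
  then obtain U C where UC: "\<And>p. p \<in> N \<Longrightarrow> open (U p)" "\<And>p. p \<in> N \<Longrightarrow> p \<in> U p"
    "\<And>p. p \<in> N \<Longrightarrow> \<exists>g. smooth_on (U p) g \<and> (\<forall>x\<in>N \<inter> U p. f x = g x) \<and>
     (\<forall>x\<in>U p. \<forall>v. norm (frechet_derivative g (at x) v) \<le> C p * norm v)"
    by metis
  have "N \<subseteq> (\<Union>p\<in>N. U p)" using UC(2) by auto
  then obtain P where P: "P \<subseteq> N" "finite P" "N \<subseteq> (\<Union>p\<in>P. U p)"
    using compactE_image[OF N, of N U] UC(1) by auto
  define D where "D = Max (insert 0 (C ` P))"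
  have D: "0 \<le> D" "\<And>p. p \<in> P \<Longrightarrow> C p \<le> D" unfolding D_def by (rule Max_ge; use P(2) in auto)+
  show ?thesis
  proof (rule that[OF D(1)], rule ballI)
    fix q assume q: "q \<in> N"
    then obtain p where p: "p \<in> P" "q \<in> U p" using P(3) by auto
    then have pN: "p \<in> N" using P(1) by auto
    obtain g where g: "smooth_on (U p) g" "\<forall>x\<in>N \<inter> U p. f x = g x"
      "\<forall>x\<in>U p. \<forall>v. norm (frechet_derivative g (at x) v) \<le> C p * norm v" using UC(3)[OF pN] by auto
    have "norm (frechet_derivative g (at x) v) \<le> D * norm v" if "x \<in> U p" for x v
    proof -
      have "norm (frechet_derivative g (at x) v) \<le> C p * norm v" using g(3) that by auto
      also have "\<dots> \<le> D * norm v" by (rule mult_right_mono[OF D(2)[OF p(1)] norm_ge_zero])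
      finally show ?thesis .
    qed
    then show "\<exists>U g. open U \<and> q \<in> U \<and> smooth_on U g \<and> (\<forall>x\<in>N \<inter> U. f x = g x) \<and>
     (\<forall>x\<in>U. \<forall>v. norm (frechet_derivative g (at x) v) \<le> D * norm v)"
      using g(1,2) UC(1)[OF pN] p(2) by (intro exI[of _ "U p"] exI[of _ g]) simp
  qed
qed

lemma closed_submanifold_Un:
  fixes A B :: "'a::euclidean_space set"
  assumes A: "closed_submanifold k A" and B: "closed_submanifold k B" and dis: "A \<inter> B = {}"
  shows "closed_submanifold k (A \<union> B)"
proof -
  have cA: "compact A" "compact B" using A B by (auto simp: closed_submanifold_def)
  have *: "\<exists>U V \<phi> \<psi> L. p \<in> U \<and> slice_chart (A \<union> B) U V \<phi> \<psi> L \<and> dim L + k = DIM('a)"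
    if A: "closed_submanifold k A" and cB: "closed B" and dis: "A \<inter> B = {}" and p: "p \<in> A" for A B :: "'a set" and p
  proof -
    obtain U V \<phi> \<psi> L where c: "p \<in> U" "slice_chart A U V \<phi> \<psi> L" "dim L + k = DIM('a)"
      using A p unfolding closed_submanifold_iff by auto
    note cD = slice_chartD[OF c(2)]
    define U' where "U' = U - B"
    define V' where "V' = V \<inter> \<psi> -` U'"
    have oU: "open U'" using cD(1) cB by (auto simp: U'_def open_Diff)
    have oV: "open V'" unfolding V'_def by (rule continuous_open_preimage[OF cD(13) cD(2) oU])
    have m: "x \<in> U' \<Longrightarrow> \<phi> x \<in> V'" "y \<in> V' \<Longrightarrow> \<psi> y \<in> U'" for x y using cD(6,7) by (auto simp: V'_def U'_def)
    have "homeomorphism U' V' \<phi> \<psi>"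
    proof (rule homeomorphismI)
      show "continuous_on U' \<phi>" "continuous_on V' \<psi>"
        by (rule continuous_on_subset[OF cD(12)], auto simp: U'_def) (rule continuous_on_subset[OF cD(13)], auto simp: V'_def)
    qed (use m cD(7,9) in \<open>auto simp: U'_def V'_def\<close>)
    moreover have "\<phi> ` ((A \<union> B) \<inter> U') = V' \<inter> L"
    proof (intro equalityI subsetI)
      fix z assume "z \<in> \<phi> ` ((A \<union> B) \<inter> U')"
      then obtain x where x: "x \<in> A" "x \<in> U'" "z = \<phi> x" by (auto simp: U'_def)
      then show "z \<in> V' \<inter> L" using m(1)[OF x(2)] cD(10)[of x] by (auto simp: U'_def)
    next
      fix z assume z: "z \<in> V' \<inter> L"
      then have "\<psi> z \<in> A" "\<phi> (\<psi> z) = z" using cD(11)[of z] cD(9)[of z] by (auto simp: V'_def)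
      then show "z \<in> \<phi> ` ((A \<union> B) \<inter> U')" using m(2)[of z] z by (intro image_eqI[of _ _ "\<psi> z"]) auto
    qed
    moreover have "smooth_on U' \<phi>" "smooth_on V' \<psi>"
      using smooth_on_subset[OF cD(3)] smooth_on_subset[OF cD(4)] by (auto simp: U'_def V'_def)
    ultimately have "slice_chart (A \<union> B) U' V' \<phi> \<psi> L"
      unfolding slice_chart_def using oU oV cD(5) by simp
    moreover have "p \<in> U'" using c(1) p dis by (auto simp: U'_def)
    ultimately show ?thesis using c(3) by (intro exI[of _ U'] exI[of _ V'] exI[of _ \<phi>] exI[of _ \<psi>] exI[of _ L]) simp
  qed
  have dis': "B \<inter> A = {}" using dis by auto
  show ?thesis unfolding closed_submanifold_iff
  proof (intro conjI ballI)
    show "compact (A \<union> B)" using cA by (rule compact_Un)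
    fix p assume "p \<in> A \<union> B"
    then consider "p \<in> A" | "p \<in> B" by auto
    then show "\<exists>U V \<phi> \<psi> L. p \<in> U \<and> slice_chart (A \<union> B) U V \<phi> \<psi> L \<and> dim L + k = DIM('a)"
    proof cases
      case 1 show ?thesis by (rule *[OF A compact_imp_closed[OF cA(2)] dis 1])
    next
      case 2
      have "\<exists>U V \<phi> \<psi> L. p \<in> U \<and> slice_chart (B \<union> A) U V \<phi> \<psi> L \<and> dim L + k = DIM('a)"
        by (rule *[OF B compact_imp_closed[OF cA(1)] dis' 2])
      then show ?thesis by (simp add: Un_commute)
    qed
  qed
qed

lemma normal_space_Un:
  fixes A B :: "'a::euclidean_space set"
  assumes "closed B" "A \<inter> B = {}" "p \<in> A"
  shows "normal_space (A \<union> B) p = normal_space A p"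
proof -
  have "tangent_space (A \<union> B) p = tangent_space A p"
    by (rule tangent_space_local[of "- B"]) (use assms in \<open>auto simp: open_Compl\<close>)
  then show ?thesis by (simp add: normal_space_def)
qed

lemma framing_Un:
  fixes A B :: "'a::euclidean_space set" and g g' :: "'a \<Rightarrow> 'a ^ 'k"
  assumes A: "framing A g" "closed A" and B: "framing B g'" "closed B" and dis: "A \<inter> B = {}"
  shows "framing (A \<union> B) (union_framing A g g')"
  unfolding framing_def
proof (intro conjI ballI)
  have eA: "union_framing A g g' p = g p" if "p \<in> A" for p using that by (simp add: union_framing_def)
  have eB: "union_framing A g g' p = g' p" if "p \<in> B" for p using that dis by (auto simp: union_framing_def)
  have "continuous_on A (union_framing A g g')"
    by (rule continuous_on_eq[of A g]) (use A eA in \<open>auto simp: framing_def\<close>)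
  moreover have "continuous_on B (union_framing A g g')"
    by (rule continuous_on_eq[of B g']) (use B eB in \<open>auto simp: framing_def\<close>)
  ultimately show "continuous_on (A \<union> B) (union_framing A g g')"
    using A(2) B(2) by (rule continuous_on_closed_Un[rotated 2])
  fix p assume p: "p \<in> A \<union> B"
  have nB: "normal_space (A \<union> B) p = normal_space B p" if "p \<in> B"
    using normal_space_Un[OF A(2), of B p] dis that by (simp add: Un_commute Int_commute)
  have "union_framing A g g' p $ i \<in> normal_space (A \<union> B) p" for i
    using p
  proof
    assume "p \<in> A"
    then show ?thesis using eA normal_space_Un[OF B(2) dis] A(1) by (simp add: framing_def)
  next
    assume "p \<in> B"
    then show ?thesis using eB nB B(1) by (simp add: framing_def)
  qed
  then show "\<forall>i. union_framing A g g' p $ i \<in> normal_space (A \<union> B) p" by simp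
  show "\<forall>c. (\<Sum>i\<in>UNIV. c $ i *\<^sub>R union_framing A g g' p $ i) = 0 \<longrightarrow> c = 0"
    using p
  proof
    assume "p \<in> A"
    then show ?thesis unfolding eA[OF \<open>p \<in> A\<close>] using A(1) unfolding framing_def by blast
  next
    assume "p \<in> B"
    then show ?thesis unfolding eB[OF \<open>p \<in> B\<close>] using B(1) unfolding framing_def by blast
  qed
qed

lemma framingI:
  assumes "continuous_on N g" "\<And>p i. p \<in> N \<Longrightarrow> g p $ i \<in> normal_space N p"
    "\<And>p c. p \<in> N \<Longrightarrow> frame_comb (g p) c = 0 \<Longrightarrow> c = 0"
  shows "framing N g"
  using assms by (simp add: framing_def frame_comb_def)

lemma closest_point_subspace_unique:
  fixes S :: "'a::euclidean_space set"
  assumes S: "subspace S" and a: "a \<in> S" "\<And>y. y \<in> S \<Longrightarrow> y \<bullet> (x - a) = 0"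
  shows "closest_point S x = a"
proof -
  let ?c = "closest_point S x"
  have d: "a - ?c \<in> S" using a(1) closest_point_subspace_in[OF S] S by (simp add: subspace_diff)
  have "(a - ?c) \<bullet> (a - ?c) = (a - ?c) \<bullet> (x - ?c) - (a - ?c) \<bullet> (x - a)"
    by (simp add: inner_diff_right)
  also have "\<dots> = 0" using a(2)[OF d] closest_point_subspace_orthogonal[OF S d] by simp
  finally show ?thesis by simp
qed

lemma closest_point_frame_comb:
  fixes v :: "'a::euclidean_space ^ 'k"
  assumes S: "subspace S"
  shows "frame_comb (\<chi> i. closest_point S (v $ i)) c = closest_point S (frame_comb v c)"
proof (rule closest_point_subspace_unique[OF S, symmetric])
  show "frame_comb (\<chi> i. closest_point S (v $ i)) c \<in> S"
    unfolding frame_comb_def by (intro subspace_sum[OF S] subspace_scale[OF S]) (simp add: closest_point_subspace_in[OF S])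
  fix y assume y: "y \<in> S"
  have "frame_comb v c - frame_comb (\<chi> i. closest_point S (v $ i)) c = (\<Sum>i\<in>UNIV. c $ i *\<^sub>R (v $ i - closest_point S (v $ i)))"
    by (simp add: frame_comb_def sum_subtractf scaleR_right_diff_distrib)
  then show "y \<bullet> (frame_comb v c - frame_comb (\<chi> i. closest_point S (v $ i)) c) = 0"
    using closest_point_subspace_orthogonal[OF S y] by (simp add: inner_sum_right)
qed

subsection \<open>Reframing in complex fibre coordinates\<close>

text \<open>If \<open>c\<close> are the coordinates of a normal vector with respect to the framing rotated by \<open>z\<close>, these are its coordinates with
  respect to the original framing.\<close>

definition rot_coords :: "complex \<Rightarrow> real ^ 2 \<Rightarrow> real ^ 2" where
  "rot_coords z c = vector [Re (z * cplx c), Im (z * cplx c)]"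

lemma cplx_rot_coords [simp]: "cplx (rot_coords z c) = z * cplx c"
  by (simp add: complex_eq_iff rot_coords_def)

lemma frame_comb_2: "frame_comb (v :: 'a::real_vector ^ 2) c = (c $ 1) *\<^sub>R (v $ 1) + (c $ 2) *\<^sub>R (v $ 2)"
  by (simp add: frame_comb_def sum_2)

lemma frame_comb_3: "frame_comb (v :: 'a::real_vector ^ 3) c = (c $ 1) *\<^sub>R (v $ 1) + (c $ 2) *\<^sub>R (v $ 2) + (c $ 3) *\<^sub>R (v $ 3)"
  by (simp add: frame_comb_def sum_3)

lemma frame_comb_reframe: "frame_comb (reframe s F p) c = frame_comb (F p) (rot_coords (s p) c)"
  by (simp add: frame_comb_2 reframe_def rot_coords_def algebra_simps)

lemma frame_comb_reflect: "frame_comb (reflect_framing F p) c = frame_comb (F p) (vector [- (c $ 1), c $ 2])"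
  by (simp add: frame_comb_2 reflect_framing_def)

lemma cplx_eq_0_iff [simp]: "cplx c = 0 \<longleftrightarrow> c = 0"
  by (simp add: complex_eq_iff vec2_eq_iff)

lemma rot_coords_eq_0: "z \<noteq> 0 \<Longrightarrow> rot_coords z c = 0 \<Longrightarrow> c = 0"
  by (metis cplx_rot_coords cplx_eq_0_iff mult_eq_0_iff)

subsection \<open>Normal spaces of the shifted copy\<close>

text \<open>The shift by a small multiple of a Lipschitz field turns the normal spaces only a little. The curve of feet in \<open>M\<close>
  of a curve in the shifted copy may fail to be differentiable, so the estimate is made for
  difference quotients.\<close>

lemma shifted_tangent_normal:
  fixes M :: "'a::euclidean_space set"
  assumes M: "closed_submanifold k M"
    and Lip: "L \<ge> 0" "\<And>x y. x \<in> M \<Longrightarrow> y \<in> M \<Longrightarrow> norm (f x - f y) \<le> L * norm (x - y)" and eL: "e > 0" "e * L \<le> 1/2"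
    and p: "p \<in> M" and n: "n \<in> normal_space M p"
    and w: "w \<in> tangent_space ((\<lambda>x. x + e *\<^sub>R f x) ` M) (p + e *\<^sub>R f p)"
  shows "\<bar>n \<bullet> w\<bar> \<le> 2 * (e * L) * norm n * norm w"
proof -
  define \<sigma> where "\<sigma> x = x + e *\<^sub>R f x" for x
  obtain C where C: "C \<ge> 0" "\<And>p q n. p \<in> M \<Longrightarrow> q \<in> M \<Longrightarrow> n \<in> normal_space M p \<Longrightarrow> \<bar>n \<bullet> (q - p)\<bar> \<le> C * norm n * (norm (q - p))\<^sup>2"
    using submanifold_estimates[OF M] by metis
  obtain \<gamma> where c: "smooth_curve_at (\<sigma> ` M) (\<sigma> p) w \<gamma>"
    using w unfolding tangent_space_def \<sigma>_def by auto
  then obtain d where d: "d > 0" "\<gamma> ` {-d<..<d} \<subseteq> \<sigma> ` M" unfolding smooth_curve_at_def by auto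
  have \<gamma>: "d > 0" "\<And>t. \<bar>t\<bar> < d \<Longrightarrow> \<gamma> t \<in> \<sigma> ` M" "\<gamma> 0 = \<sigma> p" "(\<gamma> has_vector_derivative w) (at 0)"
    using c d unfolding smooth_curve_at_def by (auto simp: abs_less_iff)
  have bd: "\<bar>n \<bullet> (y - \<sigma> p)\<bar> \<le> C * norm n * (4 * (norm (y - \<sigma> p))\<^sup>2) + 2 * (e * L) * norm n * norm (y - \<sigma> p)"
    if y: "y \<in> \<sigma> ` M" for y
  proof -
    obtain x where x: "x \<in> M" "y = \<sigma> x" using y by auto
    have d: "y - \<sigma> p = (x - p) + e *\<^sub>R (f x - f p)" using x by (simp add: \<sigma>_def algebra_simps)
    have f1: "norm (e *\<^sub>R (f x - f p)) \<le> (e * L) * norm (x - p)"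
      using Lip(2)[OF x(1) p] eL(1) by (simp add: mult_left_mono mult.assoc)
    also have "\<dots> \<le> 1/2 * norm (x - p)" by (rule mult_right_mono[OF eL(2)]) simp
    finally have f2: "norm (e *\<^sub>R (f x - f p)) \<le> norm (x - p) / 2" by simp
    have "norm (x - p) \<le> norm (y - \<sigma> p) + norm (e *\<^sub>R (f x - f p))"
      unfolding d using norm_triangle_ineq4[of "(x - p) + e *\<^sub>R (f x - f p)" "e *\<^sub>R (f x - f p)"] by simp
    then have x2: "norm (x - p) \<le> 2 * norm (y - \<sigma> p)" using f2 by linarith
    have "\<bar>n \<bullet> (y - \<sigma> p)\<bar> \<le> \<bar>n \<bullet> (x - p)\<bar> + \<bar>n \<bullet> (e *\<^sub>R (f x - f p))\<bar>" unfolding d by (simp add: inner_add_right)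
    also have "\<dots> \<le> C * norm n * (norm (x - p))\<^sup>2 + norm n * ((e * L) * norm (x - p))"
      by (intro add_mono C(2)[OF p x(1) n] order_trans[OF Cauchy_Schwarz_ineq2] mult_left_mono f1 norm_ge_zero)
    also have "\<dots> \<le> C * norm n * (2 * norm (y - \<sigma> p))\<^sup>2 + norm n * ((e * L) * (2 * norm (y - \<sigma> p)))"
      using C(1) Lip(1) eL(1) by (intro add_mono mult_left_mono power_mono x2) auto
    finally show ?thesis by (simp add: power_mult_distrib mult_ac)
  qed
  define q where "q t = norm (\<gamma> t - \<sigma> p) / \<bar>t\<bar>" for t
  have lim: "((\<lambda>t. (\<gamma> t - \<sigma> p) /\<^sub>R t) \<longlongrightarrow> w) (at 0)"
  proof -
    have "((\<lambda>t. norm (\<gamma> (0 + t) - \<gamma> 0 - t *\<^sub>R w) / norm t) \<longlongrightarrow> 0) (at 0)"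
      using \<gamma>(4) unfolding has_vector_derivative_def has_derivative_at by blast
    moreover have "\<forall>\<^sub>F t in at 0. norm (\<gamma> (0 + t) - \<gamma> 0 - t *\<^sub>R w) / norm t = norm ((\<gamma> t - \<sigma> p) /\<^sub>R t - w)"
    proof (rule eventually_mono[OF eventually_neq_at_within[of 0 0 UNIV]])
      fix t :: real assume t: "t \<noteq> 0"
      have "(\<gamma> t - \<sigma> p) /\<^sub>R t - w = (\<gamma> t - \<sigma> p - t *\<^sub>R w) /\<^sub>R t" using t by (simp add: scaleR_right_diff_distrib)
      then show "norm (\<gamma> (0 + t) - \<gamma> 0 - t *\<^sub>R w) / norm t = norm ((\<gamma> t - \<sigma> p) /\<^sub>R t - w)"
        using \<gamma>(3) by (simp add: divide_inverse_commute)
    qed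
    ultimately have "((\<lambda>t. norm ((\<gamma> t - \<sigma> p) /\<^sub>R t - w)) \<longlongrightarrow> 0) (at 0)"
      by (rule Lim_transform_eventually)
    then show ?thesis by (simp add: tendsto_norm_zero_iff LIM_zero_iff)
  qed
  have limq: "(q \<longlongrightarrow> norm w) (at 0)"
    using tendsto_norm[OF lim] by (simp add: q_def[abs_def] divide_inverse mult.commute)
  have limn: "((\<lambda>t. \<bar>n \<bullet> ((\<gamma> t - \<sigma> p) /\<^sub>R t)\<bar>) \<longlongrightarrow> \<bar>n \<bullet> w\<bar>) (at 0)"
    by (intro tendsto_intros lim)
  have "isCont \<gamma> 0" using \<gamma>(4) has_vector_derivative_continuous by blast
  then have lim0: "((\<lambda>t. norm (\<gamma> t - \<sigma> p)) \<longlongrightarrow> 0) (at 0)"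
    using \<gamma>(3) by (simp add: isCont_def LIM_zero tendsto_norm_zero)
  have limr: "((\<lambda>t. C * norm n * 4 * norm (\<gamma> t - \<sigma> p) * q t + 2 * (e * L) * norm n * q t) \<longlongrightarrow>
      C * norm n * 4 * 0 * norm w + 2 * (e * L) * norm n * norm w) (at 0)"
    by (intro tendsto_intros lim0 limq)
  have "\<bar>n \<bullet> w\<bar> \<le> C * norm n * 4 * 0 * norm w + 2 * (e * L) * norm n * norm w"
  proof (rule tendsto_le[OF _ limr limn])
    have "\<bar>n \<bullet> ((\<gamma> t - \<sigma> p) /\<^sub>R t)\<bar> \<le> C * norm n * 4 * norm (\<gamma> t - \<sigma> p) * q t + 2 * (e * L) * norm n * q t"
      if t: "t \<noteq> 0" "\<bar>t\<bar> < d" for t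
    proof -
      have "\<bar>n \<bullet> ((\<gamma> t - \<sigma> p) /\<^sub>R t)\<bar> = \<bar>n \<bullet> (\<gamma> t - \<sigma> p)\<bar> / \<bar>t\<bar>" by (simp add: abs_mult divide_inverse mult.commute)
      also have "\<dots> \<le> (C * norm n * (4 * (norm (\<gamma> t - \<sigma> p))\<^sup>2) + 2 * (e * L) * norm n * norm (\<gamma> t - \<sigma> p)) / \<bar>t\<bar>"
        using bd[OF \<gamma>(2)[OF t(2)]] by (rule divide_right_mono) simp
      also have "\<dots> = C * norm n * 4 * norm (\<gamma> t - \<sigma> p) * q t + 2 * (e * L) * norm n * q t"
        by (simp add: q_def power2_eq_square add_divide_distrib mult_ac)
      finally show ?thesis .
    qed
    then show "\<forall>\<^sub>F t in at 0. \<bar>n \<bullet> ((\<gamma> t - \<sigma> p) /\<^sub>R t)\<bar> \<le> C * norm n * 4 * norm (\<gamma> t - \<sigma> p) * q t + 2 * (e * L) * norm n * q t"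
      using \<gamma>(1) by (auto simp: eventually_at dist_norm intro!: exI[of _ d])
  qed simp
  then show ?thesis by simp
qed

lemma shifted_normal_projection:
  fixes M :: "'a::euclidean_space set"
  assumes M: "closed_submanifold k M" and Msh: "closed_submanifold k ((\<lambda>x. x + e *\<^sub>R f x) ` M)"
    and Lip: "L \<ge> 0" "\<And>x y. x \<in> M \<Longrightarrow> y \<in> M \<Longrightarrow> norm (f x - f y) \<le> L * norm (x - y)" and eL: "e > 0" "e * L \<le> 1/4"
    and p: "p \<in> M" and n: "n \<in> normal_space M p"
  shows "norm n / 2 \<le> norm (closest_point (normal_space ((\<lambda>x. x + e *\<^sub>R f x) ` M) (p + e *\<^sub>R f p)) n)"
proof -
  define S where "S = normal_space ((\<lambda>x. x + e *\<^sub>R f x) ` M) (p + e *\<^sub>R f p)"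
  have S: "subspace S" unfolding S_def by (rule subspace_normal_space)
  define w where "w = n - closest_point S n"
  have orth: "y \<bullet> w = 0" if "y \<in> S" for y unfolding w_def by (rule closest_point_subspace_orthogonal[OF S that])
  have wT: "w \<in> tangent_space ((\<lambda>x. x + e *\<^sub>R f x) ` M) (p + e *\<^sub>R f p)"
    by (rule tangent_spaceI[OF Msh]) (use p orth S_def in auto)
  have "\<bar>n \<bullet> w\<bar> \<le> 2 * (e * L) * norm n * norm w"
    by (rule shifted_tangent_normal[OF M Lip eL(1) _ p n wT]) (use eL in auto)
  also have "\<dots> \<le> 2 * (1/4) * norm n * norm w" using eL by (intro mult_right_mono mult_left_mono) auto
  finally have "n \<bullet> w \<le> norm n / 2 * norm w" by simp
  moreover have "n \<bullet> w = w \<bullet> w"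
    using orth[OF closest_point_subspace_in[OF S, of n]] by (simp add: w_def inner_diff_left)
  ultimately have "norm w * norm w \<le> norm n / 2 * norm w" by (simp add: power2_norm_eq_inner[symmetric] power2_eq_square)
  then have "norm w \<le> norm n / 2" by (cases "norm w = 0") auto
  moreover have "norm n \<le> norm (closest_point S n) + norm w" using norm_triangle_ineq[of "closest_point S n" w] by (simp add: w_def)
  ultimately show ?thesis by (simp add: S_def)
qed

section \<open>The double of a framed submanifold\<close>

lemma pointed_map_compose:
  assumes f: "pointed_map f" and g: "pointed_map g" shows "pointed_map (g \<circ> f)"
  unfolding pointed_map_def
proof (intro conjI)
  have im: "f ` sphere 0 1 \<subseteq> sphere 0 1" using f unfolding pointed_map_def by blast
  show "continuous_on (sphere 0 1) (g \<circ> f)"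
    by (rule continuous_on_compose) (use f g im in \<open>auto simp: pointed_map_def intro: continuous_on_subset\<close>)
  show "(g \<circ> f) ` sphere 0 1 \<subseteq> sphere 0 1"
    unfolding comp_def by (intro image_subsetI pointed_map_in_sphere[OF g] pointed_map_in_sphere[OF f])
  show "(g \<circ> f) north = north" using f g by (simp add: pointed_map_def)
qed

lemma norm_closest_point_subspace_le:
  fixes S :: "'a::euclidean_space set"
  assumes S: "subspace S" shows "norm (closest_point S x) \<le> norm x"
proof -
  let ?c = "closest_point S x"
  have "?c \<bullet> ?c = ?c \<bullet> x"
    using closest_point_subspace_orthogonal[OF S closest_point_subspace_in[OF S], of x x] by (simp add: inner_diff_right)
  then have "norm ?c * norm ?c \<le> norm ?c * norm x"
    using norm_cauchy_schwarz[of ?c x] by (simp add: power2_norm_eq_inner[symmetric] power2_eq_square)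
  then show ?thesis by (cases "norm ?c = 0") auto
qed

lemma smooth_map_on_linear:
  fixes f :: "'a::euclidean_space \<Rightarrow> 'b::real_normed_vector"
  assumes "smooth_map_on N f" "bounded_linear l"
  shows "smooth_map_on N (\<lambda>x. l (f x))"
  unfolding smooth_map_on_def
proof
  fix p assume "p \<in> N"
  obtain U g where U: "open U" "p \<in> U" "smooth_on U g" "\<forall>x\<in>N \<inter> U. f x = g x"
    by (rule smooth_map_onE[OF assms(1) \<open>p \<in> N\<close>])
  then show "\<exists>U g. open U \<and> p \<in> U \<and> smooth_on U g \<and> (\<forall>x\<in>N \<inter> U. l (f x) = g x)"
    using smooth_on_linear_compose[OF U(1) assms(2) U(3)]
    by (intro exI[of _ U] exI[of _ "\<lambda>x. l (g x)"]) simp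
qed

lemma reflect_framing_is_framing:
  assumes "framing M F" shows "framing M (reflect_framing F)"
proof (rule framingI)
  have cF: "continuous_on M F" using assms by (simp add: framing_def)
  have nth: "continuous_on M (\<lambda>x. F x $ i)" for i
    by (intro bounded_linear.continuous_on[OF bounded_linear_vec_nth] cF)
  show "continuous_on M (reflect_framing F)" unfolding reflect_framing_def
    by (intro continuous_intros nth)
  fix p assume p: "p \<in> M"
  have i: "F p $ i \<in> normal_space M p" for i using assms p by (simp add: framing_def)
  then have "reflect_framing F p $ 1 \<in> normal_space M p" "reflect_framing F p $ 2 \<in> normal_space M p"
    by (simp_all add: reflect_framing_def subspace_neg[OF subspace_normal_space])
  then have "\<forall>i. reflect_framing F p $ i \<in> normal_space M p" unfolding forall_2 by blast
  then show "reflect_framing F p $ i \<in> normal_space M p" for i by blast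
  fix c assume "frame_comb (reflect_framing F p) c = 0"
  then have "vector [- (c $ 1), c $ 2] = (0 :: real ^ 2)"
    unfolding frame_comb_reflect by (rule framing_frame_comb_eq_0[OF assms p])
  then show "c = 0" by (simp add: vec2_eq_iff)
qed

text \<open>The shift is one section of the tube, which gives injectivity and disjointness below the tube radius. The last
  conclusion says that the transport to the normal spaces of the copy at most halves the length of a normal vector; it
  makes the transported framing linearly independent and later controls its fibre coordinates.\<close>

lemma shifted_copy:
  fixes M :: "(real ^ 'm) set" and F :: "real ^ 'm \<Rightarrow> (real ^ 'm) ^ 2"
  assumes F: "framed_closed_submanifold M F" and sm: "smooth_map_on M F"
    and s: "continuous_on M s" "\<And>x. x \<in> M \<Longrightarrow> cmod (s x) = 1"
  obtains e0 where "e0 > 0"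
    "\<And>\<epsilon>. 0 < \<epsilon> \<Longrightarrow> \<epsilon> < e0 \<Longrightarrow> inj_on (shift F \<epsilon>) M \<and> M \<inter> shift F \<epsilon> ` M = {} \<and>
        closed_submanifold 2 (shift F \<epsilon> ` M) \<and>
        framing (shift F \<epsilon> ` M) (transport_framing (shift F \<epsilon>) M (reframe s F)) \<and>
        (\<forall>p\<in>M. \<forall>n\<in>normal_space M p. norm n / 2 \<le> norm (closest_point (normal_space (shift F \<epsilon> ` M) (shift F \<epsilon> p)) n))"
proof -
  have M: "closed_submanifold 2 M" and fr: "framing M F"
    using F by (auto simp: framed_closed_submanifold_def)
  have cM: "compact M" using M by (simp add: closed_submanifold_def)
  have cF: "continuous_on M F" using fr by (simp add: framing_def)
  obtain r where r: "tubular_radius M F r" by (rule tubular_radius_exists[OF F])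
  then have r0: "r > 0" by (simp add: tubular_radius_def)
  define f where "f x = F x $ 1" for x
  have smf: "smooth_map_on M f" unfolding f_def by (rule smooth_map_on_linear[OF sm bounded_linear_vec_nth])
  obtain L where L: "L \<ge> 0" "\<And>x y. x \<in> M \<Longrightarrow> y \<in> M \<Longrightarrow> norm (f x - f y) \<le> L * norm (x - y)"
    using smooth_map_on_Lipschitz[OF cM smf] by metis
  obtain C where C: "C \<ge> 0" "\<forall>p\<in>M. \<exists>U g. open U \<and> p \<in> U \<and> smooth_on U g \<and> (\<forall>x\<in>M \<inter> U. f x = g x) \<and>
     (\<forall>x\<in>U. \<forall>v. norm (frechet_derivative g (at x) v) \<le> C * norm v)"
    by (rule smooth_map_on_uniform_derivative_bound[OF cM smf])
  define e0 where "e0 = min r (min (1 / (4 * (L + 1))) (1 / (C + 1)))"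
  have e0: "e0 > 0" using r0 L C by (simp add: e0_def)
  have main: "inj_on (shift F \<epsilon>) M \<and> M \<inter> shift F \<epsilon> ` M = {} \<and> closed_submanifold 2 (shift F \<epsilon> ` M) \<and>
        framing (shift F \<epsilon> ` M) (transport_framing (shift F \<epsilon>) M (reframe s F)) \<and>
        (\<forall>p\<in>M. \<forall>n\<in>normal_space M p. norm n / 2 \<le> norm (closest_point (normal_space (shift F \<epsilon> ` M) (shift F \<epsilon> p)) n))"
    if e: "0 < \<epsilon>" "\<epsilon> < e0" for \<epsilon>
  proof -
    let ?\<sigma> = "shift F \<epsilon>"
    have \<sigma>: "?\<sigma> = (\<lambda>x. x + \<epsilon> *\<^sub>R f x)" by (simp add: fun_eq_iff shift_def f_def)
    have er: "\<epsilon> < r" using e by (simp add: e0_def)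
    have tub: "?\<sigma> p = tubular_map F (p, vector [\<epsilon>, 0])" for p
      by (simp add: tubular_map_eq frame_comb_2 shift_def)
    have "(norm (vector [\<epsilon>, 0] :: real ^ 2))\<^sup>2 = \<epsilon>\<^sup>2" by (simp add: norm_vec2)
    then have nv: "norm (vector [\<epsilon>, 0] :: real ^ 2) = \<epsilon>" using e(1) by (simp add: power2_eq_iff_nonneg)
    have injt: "inj_on (tubular_map F) (M \<times> ball 0 r)" using r by (simp add: tubular_radius_def)
    have inj: "inj_on ?\<sigma> M"
    proof (rule inj_onI)
      fix x y assume xy: "x \<in> M" "y \<in> M" "?\<sigma> x = ?\<sigma> y"
      have "(x, vector [\<epsilon>, 0]) = (y, vector [\<epsilon>, 0] :: real ^ 2)"
        by (rule inj_onD[OF injt]) (use xy tub nv er in auto)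
      then show "x = y" by simp
    qed
    have dis: "M \<inter> ?\<sigma> ` M = {}"
    proof (rule ccontr)
      assume "M \<inter> ?\<sigma> ` M \<noteq> {}"
      then obtain x y where xy: "x \<in> M" "y \<in> M" "x = ?\<sigma> y" by auto
      have "(x, 0) = (y, vector [\<epsilon>, 0] :: real ^ 2)"
        by (rule inj_onD[OF injt]) (use xy tub nv er r0 in \<open>auto simp: tubular_map_eq\<close>)
      then show False using e(1) by (simp add: vec2_eq_iff)
    qed
    have "\<epsilon> < 1 / (4 * (L + 1))" "\<epsilon> < 1 / (C + 1)" using e by (auto simp: e0_def)
    then have "\<epsilon> * (4 * (L + 1)) < 1" "\<epsilon> * (C + 1) < 1" using L(1) C(1) by (simp_all add: pos_less_divide_eq)
    then have eL: "\<epsilon> * L \<le> 1/4" and eC: "\<epsilon> * C < 1" using e(1) by (simp_all add: algebra_simps)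
    have "continuous_on M f" by (rule smooth_map_on_continuous[OF cM smf])
    then have c\<sigma>: "continuous_on M ?\<sigma>" unfolding \<sigma> by (intro continuous_intros)
    have Msh: "closed_submanifold 2 (?\<sigma> ` M)"
    proof (rule closed_submanifold_diffeo_image[OF M c\<sigma> inj])
      fix p assume "p \<in> M"
      then obtain U g where U: "open U" "p \<in> U" "smooth_on U g" "\<forall>x\<in>M \<inter> U. f x = g x"
        "\<forall>x\<in>U. \<forall>v. norm (frechet_derivative g (at x) v) \<le> C * norm v"
        using bspec[OF C(2) \<open>p \<in> M\<close>] by (elim exE conjE) (rule that)
      define G where "G x = x + \<epsilon> *\<^sub>R g x" for x
      have "smooth_on U G" unfolding G_def
        by (intro smooth_on_add smooth_on_ident smooth_on_scaleR smooth_on_const U)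
      moreover have "\<forall>x\<in>M \<inter> U. ?\<sigma> x = G x" using U(4) by (simp add: \<sigma> G_def)
      moreover have "v = 0" if v: "frechet_derivative G (at p) v = 0" for v
      proof -
        have "(G has_derivative (\<lambda>v. v + \<epsilon> *\<^sub>R frechet_derivative g (at p) v)) (at p)"
          unfolding G_def using smooth_onD[OF U(3,2)] by (auto intro!: derivative_eq_intros)
        then have "frechet_derivative G (at p) v = v + \<epsilon> *\<^sub>R frechet_derivative g (at p) v"
          by (rule fun_cong[OF frechet_derivative_at, symmetric])
        then have "v = - (\<epsilon> *\<^sub>R frechet_derivative g (at p) v)" using v by (simp add: eq_neg_iff_add_eq_0)
        then have "norm v = norm (- (\<epsilon> *\<^sub>R frechet_derivative g (at p) v))" by (rule arg_cong)
        then have "norm v = \<epsilon> * norm (frechet_derivative g (at p) v)" using e(1) by simp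
        also have "\<dots> \<le> \<epsilon> * (C * norm v)" using U(2,5) e(1) by (intro mult_left_mono) auto
        finally have "norm v \<le> (\<epsilon> * C) * norm v" by simp
        then have "(1 - \<epsilon> * C) * norm v \<le> 0" by (simp add: left_diff_distrib)
        then show ?thesis using eC by (simp add: mult_le_0_iff)
      qed
      ultimately show "\<exists>U g. open U \<and> p \<in> U \<and> smooth_on U g \<and> (\<forall>x\<in>M \<inter> U. ?\<sigma> x = g x) \<and>
         (\<forall>v. frechet_derivative g (at p) v = 0 \<longrightarrow> v = 0)"
        using U(1,2) by (intro exI[of _ U] exI[of _ G]) simp
    qed
    have proj: "norm n / 2 \<le> norm (closest_point (normal_space (?\<sigma> ` M) (?\<sigma> p)) n)"
      if "p \<in> M" "n \<in> normal_space M p" for p n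
      unfolding \<sigma> by (rule shifted_normal_projection[OF M Msh[unfolded \<sigma>] L e(1) eL that])
    have inv: "inv_into M ?\<sigma> y \<in> M" "?\<sigma> (inv_into M ?\<sigma> y) = y" if "y \<in> ?\<sigma> ` M" for y
      using that by (auto intro: inv_into_into f_inv_into_f)
    have cinv: "continuous_on (?\<sigma> ` M) (inv_into M ?\<sigma>)"
      by (rule continuous_on_inv[OF c\<sigma> cM]) (use inj in auto)
    have fram: "framing (?\<sigma> ` M) (transport_framing ?\<sigma> M (reframe s F))"
    proof (rule framingI)
      have nth: "continuous_on M (\<lambda>x. F x $ i)" for i
        by (intro bounded_linear.continuous_on[OF bounded_linear_vec_nth] cF)
      have "continuous_on M (reframe s F)" unfolding reframe_def
        by (intro continuous_intros nth s(1))
      then have "continuous_on (?\<sigma> ` M) (\<lambda>y. reframe s F (inv_into M ?\<sigma> y))"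
        by (rule continuous_on_compose2[OF _ cinv]) (use inv in auto)
      then have "continuous_on (?\<sigma> ` M) (\<lambda>y. reframe s F (inv_into M ?\<sigma> y) $ i)" for i
        by (intro bounded_linear.continuous_on[OF bounded_linear_vec_nth])
      then show "continuous_on (?\<sigma> ` M) (transport_framing ?\<sigma> M (reframe s F))"
        unfolding transport_framing_def
        by (intro continuous_on_vec_lambda continuous_on_normal_projection[OF Msh order_refl])
      fix y assume y: "y \<in> ?\<sigma> ` M"
      show "transport_framing ?\<sigma> M (reframe s F) y $ i \<in> normal_space (?\<sigma> ` M) y" for i
        by (simp add: transport_framing_def closest_point_subspace_in[OF subspace_normal_space])
      fix c assume c: "frame_comb (transport_framing ?\<sigma> M (reframe s F) y) c = 0"
      define p where "p = inv_into M ?\<sigma> y"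
      have p: "p \<in> M" "?\<sigma> p = y" using inv[OF y] by (auto simp: p_def)
      have "closest_point (normal_space (?\<sigma> ` M) y) (frame_comb (F p) (rot_coords (s p) c)) = 0"
        using c unfolding transport_framing_def closest_point_frame_comb[OF subspace_normal_space] frame_comb_reframe
        by (simp add: p_def)
      then have "norm (frame_comb (F p) (rot_coords (s p) c)) / 2 \<le> 0"
        using proj[OF p(1) frame_comb_normal[OF fr p(1)]] p(2) by (metis norm_zero)
      then have "frame_comb (F p) (rot_coords (s p) c) = 0" by simp
      then have "rot_coords (s p) c = 0" by (rule framing_frame_comb_eq_0[OF fr p(1)])
      then show "c = 0" by (rule rot_coords_eq_0[rotated]) (use s(2)[OF p(1)] in auto)
    qed
    show ?thesis by (intro conjI ballI inj dis Msh fram proj)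
  qed
  show ?thesis by (rule that[OF e0 main])
qed

text \<open>The lift is centred midway between the two copies. Near \<open>M\<close> the tubes of the reflected and of the original framing have the
  same fibres, and the directions are compared exactly. Near the shifted copy the fibres of the tube of \<open>M\<close>
  are not normal to the copy, and the fibre coordinates agree only to first order.\<close>

proposition double_collapse:
  fixes M :: "'a::euclidean_space set" and F :: "'a \<Rightarrow> 'a ^ 2"
  assumes F: "framed_closed_submanifold M F" and r: "tubular_radius M F r"
    and s: "continuous_on M s" "s ` M \<subseteq> sphere 0 1"
    and h: "0 < h" "4 * h < \<rho>" "h + \<rho> \<le> r"
    and inj: "inj_on (shift F (2 * h)) M" and dis: "M \<inter> shift F (2 * h) ` M = {}"
    and Msh: "closed_submanifold 2 (shift F (2 * h) ` M)"
    and proj: "\<And>p n. p \<in> M \<Longrightarrow> n \<in> normal_space M p \<Longrightarrow>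
       norm n / 2 \<le> norm (closest_point (normal_space (shift F (2 * h) ` M) (shift F (2 * h) p)) n)"
    and N: "N = M \<union> shift F (2 * h) ` M"
    and G: "G = union_framing M (reflect_framing F) (transport_framing (shift F (2 * h)) M (reframe s F))"
    and NG: "framed_closed_submanifold N G" and rN: "tubular_radius N G rN"
  shows "pointed_homotopic (hopf \<circ> tube_lift M F r h \<rho> s h) (collapse_map N G rN)"
proof -
  let ?\<sigma> = "shift F (2 * h)"
  let ?f = "hopf \<circ> tube_lift M F r h \<rho> s h"
  let ?v = "vector [2 * h, 0] :: real ^ 2"
  have M: "closed_submanifold 2 M" and fr: "framing M F"
    using F by (auto simp: framed_closed_submanifold_def)
  have cM: "compact M" using M by (simp add: closed_submanifold_def)
  have cF: "continuous_on M F" using fr by (simp add: framing_def)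
  have s1: "cmod (s p) = 1" if "p \<in> M" for p using s(2) that by auto
  have h': "h < \<rho>" "r > 0" using h by auto
  have tub: "?\<sigma> p = tubular_map F (p, ?v)" for p
    by (simp add: tubular_map_eq frame_comb_2 shift_def)
  have "(norm ?v)\<^sup>2 = (2 * h)\<^sup>2" by (simp add: norm_vec2)
  then have nv: "norm ?v = 2 * h" using h(1) by (subst (asm) power2_eq_iff_nonneg) auto
  have injt: "inj_on (tubular_map F) (M \<times> ball 0 r)" using r by (simp add: tubular_radius_def)
  have pf: "pointed_map ?f"
  proof -
    have "pointed_map (tube_lift M F r h \<rho> s h)"
      by (rule pointed_map_tube_lift[OF F r h(1) h'(1) _ s]) (use h in auto)
    then show ?thesis by (rule pointed_map_compose[OF _ pointed_map_hopf])
  qed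
  have val: "?f z = hopf (sgn (hopf_lift h \<rho> (cplx t - of_real h) (s p)))"
    if "p \<in> M" "t \<in> ball 0 r" "z \<noteq> north" "stereo z = tubular_map F (p, t)" for z p t
    unfolding tube_lift_def comp_def by (subst tube_extend_eval[OF r that]) simp
  have S: "?f z = south \<longleftrightarrow> z \<noteq> north \<and> stereo z \<in> N" for z
  proof (cases z rule: tube_extend_cases[OF r, where h = "\<lambda>x. sgn (hopf_lift h \<rho> (cplx (snd x) - of_real h) (s (fst x)))"])
    case (1 p t)
    have "?f z = south \<longleftrightarrow> cplx t - of_real h = of_real h \<or> cplx t - of_real h = - of_real h"
      unfolding val[OF 1(1-4)] by (rule hopf_lift_eq_south_iff[OF h(1) h'(1) s1[OF 1(1)]])
    also have "\<dots> \<longleftrightarrow> t = 0 \<or> t = ?v" by (auto simp: complex_eq_iff vec2_eq_iff)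
    also have "\<dots> \<longleftrightarrow> stereo z \<in> N"
    proof
      assume "t = 0 \<or> t = ?v"
      then show "stereo z \<in> N" using 1 tub by (auto simp: N tubular_map_eq)
    next
      assume "stereo z \<in> N"
      then consider "stereo z \<in> M" | q where "q \<in> M" "stereo z = ?\<sigma> q" by (auto simp: N)
      then show "t = 0 \<or> t = ?v"
      proof cases
        case 1
        have "(stereo z, 0) = (p, t)"
          by (rule inj_onD[OF injt]) (use 1 \<open>p \<in> M\<close> \<open>t \<in> ball 0 r\<close> \<open>stereo z = tubular_map F (p, t)\<close> h' in \<open>auto simp: tubular_map_eq\<close>)
        then show ?thesis by simp
      next
        case 2
        have "(q, ?v) = (p, t)"
          by (rule inj_onD[OF injt]) (use 2 \<open>p \<in> M\<close> \<open>t \<in> ball 0 r\<close> \<open>stereo z = tubular_map F (p, t)\<close> tub nv h in auto)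
        then show ?thesis by simp
      qed
    qed
    finally show ?thesis using 1(3) by simp
  next
    case 2
    have "tube_lift M F r h \<rho> s h z = north" using 2(2) by (simp add: tube_lift_def)
    then have "?f z = north" using pointed_map_hopf by (simp add: pointed_map_def)
    moreover have "stereo z \<in> tubular_map F ` (M \<times> ball 0 r)" if "stereo z \<in> N"
      using that unfolding N
    proof
      assume "stereo z \<in> M"
      then show ?thesis by (intro image_eqI[of _ _ "(stereo z, 0)"]) (use h' in \<open>auto simp: tubular_map_eq\<close>)
    next
      assume "stereo z \<in> ?\<sigma> ` M"
      then obtain q where "q \<in> M" "stereo z = ?\<sigma> q" by auto
      then show ?thesis by (intro image_eqI[of _ _ "(q, ?v)"]) (use nv h tub in auto)
    qed
    ultimately show ?thesis using 2(1) north_neq_south by metis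
  qed
  have rN0: "rN > 0" using rN by (simp add: tubular_radius_def)
  \<comment> \<open>the neighbourhood of \<open>M\<close>: there the two tubes share their fibres\<close>
  define d1 where "d1 = min (min (h / 4) r) rN"
  have d1: "d1 > 0" "d1 \<le> h / 4" "d1 \<le> r" "d1 \<le> rN" using h h' rN0 by (auto simp: d1_def)
  have GM: "G p = reflect_framing F p" if "p \<in> M" for p using that by (simp add: G union_framing_def)
  have GS: "G q = transport_framing ?\<sigma> M (reframe s F) q" if "q \<in> ?\<sigma> ` M" for q
    using that dis by (auto simp: G union_framing_def)
  define W1 where "W1 = tubular_map G ` (M \<times> ball 0 d1)"
  have cMs: "compact (?\<sigma> ` M)" using Msh by (simp add: closed_submanifold_def)
  have oM: "openin (top_of_set N) M" "openin (top_of_set N) (?\<sigma> ` M)"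
  proof -
    have "openin (top_of_set N) (N \<inter> - ?\<sigma> ` M)" "openin (top_of_set N) (N \<inter> - M)"
      using cM cMs by (auto intro!: openin_open_Int simp: compact_imp_closed open_Compl)
    moreover have "N \<inter> - ?\<sigma> ` M = M" "N \<inter> - M = ?\<sigma> ` M" using dis by (auto simp: N)
    ultimately show "openin (top_of_set N) M" "openin (top_of_set N) (?\<sigma> ` M)" by auto
  qed
  have op: "open (tubular_map G ` (A \<times> ball 0 d))" if A: "openin (top_of_set N) A" and d: "d \<le> rN" for A d
  proof (rule open_tubular_image[OF NG rN])
    have "openin (top_of_set (ball (0::real^2) rN)) (ball 0 d)" using d by (intro open_openin_trans) auto
    then show "openin (top_of_set (N \<times> ball 0 rN)) (A \<times> ball (0::real^2) d)"
      using A by (intro openin_Times)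
  qed
  have oW1: "open W1" unfolding W1_def by (rule op[OF oM(1) d1(4)])
  \<comment> \<open>the neighbourhood of the shifted copy\<close>
  obtain B \<delta>0 where B: "B > 0" "\<delta>0 > 0" "\<forall>p\<in>M. \<forall>c. norm (frame_comb (F p) c) \<le> B * norm c"
    "\<forall>p\<in>M. \<forall>c. \<delta>0 * norm c \<le> norm (frame_comb (F p) c)"
    by (rule frame_bounds[OF cM cF framing_frame_comb_eq_0[OF fr]])
  define w where "w q = F (inv_into M ?\<sigma> q)" for q
  have inv: "inv_into M ?\<sigma> (?\<sigma> p) = p" if "p \<in> M" for p using inj that by simp
  have nth1: "continuous_on M (\<lambda>x. F x $ 1)"
    by (intro bounded_linear.continuous_on[OF bounded_linear_vec_nth] cF)
  have c\<sigma>: "continuous_on M ?\<sigma>" unfolding shift_def[abs_def] by (intro continuous_intros nth1)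
  have cinv: "continuous_on (?\<sigma> ` M) (inv_into M ?\<sigma>)"
    by (rule continuous_on_inv[OF c\<sigma> cM]) (use inv in auto)
  have cw: "continuous_on (?\<sigma> ` M) w" unfolding w_def
    by (rule continuous_on_compose2[OF cF cinv]) (use inv in auto)
  define s' where "s' q = s (inv_into M ?\<sigma> q)" for q
  have cs': "continuous_on (?\<sigma> ` M) s'" unfolding s'_def
    by (rule continuous_on_compose2[OF s(1) cinv]) (use inv in auto)
  obtain \<eta>s where \<eta>s: "\<eta>s > 0" "\<forall>x\<in>?\<sigma> ` M. \<forall>q\<in>?\<sigma> ` M. dist q x < \<eta>s \<longrightarrow> dist (s' q) (s' x) < 1/8"
    using compact_uniformly_continuous[OF cs' cMs] unfolding uniformly_continuous_on_def
    by (metis zero_less_divide_1_iff zero_less_numeral)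
  \<comment> \<open>makes the relative error of the fibre coordinate at most \<open>1/8\<close>; the variation of \<open>s\<close> adds as much\<close>
  define \<eta> where "\<eta> = min \<eta>s (\<delta>0 / (16 * (B + 1)))"
  have \<eta>: "\<eta> > 0" "\<eta> \<le> \<eta>s" "\<eta> \<le> \<delta>0 / (16 * (B + 1))" using B \<eta>s(1) by (auto simp: \<eta>_def)
  obtain \<delta> where \<delta>: "\<delta> > 0" and fc: "\<forall>x\<in>?\<sigma> ` M. \<forall>q\<in>?\<sigma> ` M. \<forall>u \<nu>. norm u < \<delta> \<longrightarrow> norm \<nu> < \<delta> \<longrightarrow> x + frame_comb (w x) u = q + \<nu> \<longrightarrow>
      norm (x - q) < \<eta> \<and> norm (frame_comb (w x - w q) u) \<le> \<eta> * norm u \<and>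
      (\<forall>n\<in>normal_space (?\<sigma> ` M) q. \<bar>n \<bullet> (\<nu> - frame_comb (w q) u)\<bar> \<le> \<eta> * norm n * (norm \<nu> + norm u)) \<and>
      (norm (x - q))\<^sup>2 \<le> \<eta> * (norm \<nu> + norm u)"
    by (rule fibre_comparison[OF Msh cw \<eta>(1)])
  define d2 where "d2 = min (min (h / 4) \<delta>) (min rN (\<delta> / B))"
  have d2: "d2 > 0" using h \<delta> B rN0 by (simp add: d2_def)
  have d2': "d2 \<le> h / 4" "d2 \<le> \<delta>" "d2 \<le> rN" "d2 \<le> \<delta> / B" unfolding d2_def by linarith+
  define W2 where "W2 = tubular_map G ` ((?\<sigma> ` M) \<times> ball 0 d2) \<inter> tubular_map F ` (M \<times> ball ?v d2)"
  have ball_sub: "ball ?v d2 \<subseteq> ball 0 r"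
  proof
    fix t assume "t \<in> ball ?v d2"
    then have "norm (t - ?v) < d2" by (simp add: dist_norm norm_minus_commute)
    then show "t \<in> ball 0 r" using norm_triangle_ineq[of "t - ?v" ?v] nv d2'(1) h by simp
  qed
  have "openin (top_of_set (ball 0 r)) (ball ?v d2)" using ball_sub by (intro open_openin_trans) auto
  then have "openin (top_of_set (M \<times> ball 0 r)) (M \<times> ball ?v d2)" by (intro openin_Times) auto
  then have oW2: "open W2" unfolding W2_def
    by (intro open_Int op[OF oM(2) d2'(3)] open_tubular_image[OF F r])
  show ?thesis
  proof (rule collapse_map_criterion[OF NG rN pf S])
    show "open (W1 \<union> W2)" using oW1 oW2 by (rule open_Un)
    show "N \<subseteq> W1 \<union> W2"
    proof
      fix y assume "y \<in> N"
      then consider "y \<in> M" | p where "p \<in> M" "y = ?\<sigma> p" by (auto simp: N)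
      then show "y \<in> W1 \<union> W2"
      proof cases
        case 1
        then have "y \<in> W1" unfolding W1_def
          by (intro image_eqI[of _ _ "(y, 0)"]) (use d1 in \<open>auto simp: tubular_map_eq\<close>)
        then show ?thesis by simp
      next
        case 2
        have "y \<in> tubular_map G ` ((?\<sigma> ` M) \<times> ball 0 d2)"
          by (rule image_eqI[of _ _ "(y, 0)"]) (use 2 d2 in \<open>auto simp: tubular_map_eq\<close>)
        moreover have "y \<in> tubular_map F ` (M \<times> ball ?v d2)"
          by (rule image_eqI[of _ _ "(p, ?v)"]) (use 2 d2 tub in auto)
        ultimately show ?thesis by (simp add: W2_def)
      qed
    qed
    fix y assume "y \<in> W1 \<union> W2"
    then show "\<exists>p\<in>N. \<exists>t\<in>ball 0 rN. y = tubular_map G (p, t) \<and>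
       (\<forall>k>0. fst (?f (stereo_inv y)) = - (k *\<^sub>R t) \<longrightarrow> t = 0)"
    proof
      assume "y \<in> W1"
      then obtain p \<tau> where p: "p \<in> M" "norm \<tau> < d1" "y = tubular_map G (p, \<tau>)" by (auto simp: W1_def)
      define t where "t = (vector [- (\<tau> $ 1), \<tau> $ 2] :: real ^ 2)"
      have "(norm t)\<^sup>2 = (norm \<tau>)\<^sup>2" by (simp add: norm_vec2 t_def)
      then have nt: "norm t = norm \<tau>" by (simp add: power2_eq_iff_nonneg)
      have yt: "y = tubular_map F (p, t)" using p(3) by (simp add: tubular_map_eq GM[OF p(1)] frame_comb_reflect t_def)
      have fv: "?f (stereo_inv y) = hopf (sgn (hopf_lift h \<rho> (cplx t - of_real h) (s p)))"
        by (rule val[OF p(1)]) (use yt nt p(2) d1 in auto)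
      have "\<tau> = 0" if k: "k > 0" "fst (?f (stereo_inv y)) = - (k *\<^sub>R \<tau>)" for k
      proof (rule hopf_lift_near_minus[OF h(1,2) s1[OF p(1)] k(1), of "cplx t"])
        show "cmod (cplx t) < h / 4" using nt p(2) d1 by simp
        show "cplx t = - cnj (cplx \<tau>)" by (simp add: complex_eq_iff t_def)
      qed (use k(2) fv in simp)
      then show ?thesis using p d1 by (intro bexI[of _ p] bexI[of _ \<tau>]) (auto simp: N)
    next
      assume "y \<in> W2"
      then obtain p \<tau> x t where p: "p \<in> M" "norm \<tau> < d2" "y = tubular_map G (?\<sigma> p, \<tau>)"
        and x: "x \<in> M" "dist ?v t < d2" "y = tubular_map F (x, t)"
        unfolding W2_def by fastforce
      define u where "u = t - ?v"
      have nu: "norm u < d2" using x(2) by (simp add: u_def dist_norm norm_minus_commute)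
      have cu: "cplx t = cplx u + of_real (2 * h)" by (simp add: u_def complex_eq_iff)
      have fv: "?f (stereo_inv y) = hopf (sgn (hopf_lift h \<rho> (cplx u + of_real h) (s x)))"
        using val[OF x(1), of t "stereo_inv y"] x(2,3) ball_sub cu by (auto simp: algebra_simps)
      define \<nu> where "\<nu> = frame_comb (G (?\<sigma> p)) \<tau>"
      define A where "A = frame_comb (F p) (rot_coords (s p) \<tau>)"
      define Nq where "Nq = normal_space (?\<sigma> ` M) (?\<sigma> p)"
      have sNq: "subspace Nq" unfolding Nq_def by (rule subspace_normal_space)
      have \<nu>A: "\<nu> = closest_point Nq A"
        unfolding \<nu>_def A_def GS[OF imageI[OF p(1)]] transport_framing_def Nq_def
          closest_point_frame_comb[OF subspace_normal_space] inv[OF p(1)] frame_comb_reframe ..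
      have nr: "norm (rot_coords (s p) \<tau>) = norm \<tau>"
        using s1[OF p(1)] by (metis cmod_cplx cplx_rot_coords mult_1 norm_mult)
      have "norm \<nu> \<le> norm A" unfolding \<nu>A by (rule norm_closest_point_subspace_le[OF sNq])
      also have "\<dots> \<le> B * norm \<tau>" using B(3) p(1) nr unfolding A_def by metis
      finally have n\<nu>: "norm \<nu> \<le> B * norm \<tau>" .
      also have "\<dots> < B * (\<delta> / B)" using p(2) d2'(4) B(1) by (intro mult_strict_left_mono) auto
      finally have n\<nu>': "norm \<nu> < \<delta>" using B(1) by simp
      have "y = x + frame_comb (F x) (?v + u)" using x(3) by (simp add: tubular_map_eq u_def)
      then have "y = ?\<sigma> x + frame_comb (F x) u" by (simp add: frame_comb_add tub tubular_map_eq)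
      moreover have "y = ?\<sigma> p + \<nu>" using p(3) by (simp add: tubular_map_eq \<nu>_def)
      ultimately have e: "?\<sigma> x + frame_comb (w (?\<sigma> x)) u = ?\<sigma> p + \<nu>" by (simp add: w_def inv[OF x(1)])
      have fc': "norm (?\<sigma> x - ?\<sigma> p) < \<eta>" "\<And>n. n \<in> Nq \<Longrightarrow> \<bar>n \<bullet> (\<nu> - frame_comb (F p) u)\<bar> \<le> \<eta> * norm n * (norm \<nu> + norm u)"
        using fc[rule_format, OF imageI[OF x(1)] imageI[OF p(1)] _ n\<nu>' e] nu d2'(2)
        by (auto simp: Nq_def w_def inv[OF p(1)])
      have "dist (s' (?\<sigma> p)) (s' (?\<sigma> x)) < 1/8"
        using \<eta>s(2) x(1) p(1) fc'(1) \<eta>(2) by (simp add: dist_norm norm_minus_commute)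
      then have sx: "cmod (s x - s p) \<le> 1/8" by (simp add: s'_def inv x(1) p(1) dist_norm norm_minus_commute)
      define c where "c = rot_coords (s p) \<tau> - u"
      define m where "m = frame_comb (F p) c"
      define n where "n = closest_point Nq m"
      have nN: "n \<in> Nq" unfolding n_def by (rule closest_point_subspace_in[OF sNq])
      have mN: "m \<in> normal_space M p" unfolding m_def by (rule frame_comb_normal[OF fr p(1)])
      have "n \<bullet> (\<nu> - frame_comb (F p) u) = n \<bullet> m - n \<bullet> (A - \<nu>)"
        by (simp add: m_def c_def A_def frame_comb_diff inner_diff_right)
      also have "n \<bullet> (A - \<nu>) = 0" unfolding \<nu>A by (rule closest_point_subspace_orthogonal[OF sNq nN])
      also have "n \<bullet> m = n \<bullet> n"
        using closest_point_subspace_orthogonal[OF sNq nN, of m] by (simp add: n_def[symmetric] inner_diff_right)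
      finally have nn: "n \<bullet> (\<nu> - frame_comb (F p) u) = n \<bullet> n" by simp
      have "norm n * norm n \<le> \<eta> * norm n * (norm \<nu> + norm u)"
        using fc'(2)[OF nN] unfolding nn by (simp add: power2_norm_eq_inner[symmetric] power2_eq_square)
      then have n1: "norm n \<le> \<eta> * (norm \<nu> + norm u)"
        using \<eta>(1) by (cases "norm n = 0") (auto simp: mult.assoc mult.left_commute)
      have "norm \<nu> + norm u \<le> (B + 1) * (norm \<tau> + norm u)"
      proof -
        have "0 \<le> B * norm u" using B(1) by simp
        moreover have "(B + 1) * (norm \<tau> + norm u) = B * norm \<tau> + norm \<tau> + B * norm u + norm u" by (simp add: algebra_simps)
        ultimately show ?thesis using n\<nu> norm_ge_zero[of \<tau>] by linarith
      qed
      then have "\<eta> * (norm \<nu> + norm u) \<le> \<delta>0 / (16 * (B + 1)) * ((B + 1) * (norm \<tau> + norm u))"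
        using \<eta> B(1,2) by (intro mult_mono) auto
      also have "\<dots> = \<delta>0 / 16 * (norm \<tau> + norm u) * ((B + 1) / (B + 1))" by (simp only: times_divide_eq_left times_divide_eq_right divide_divide_eq_left mult_ac)
      also have "\<dots> = \<delta>0 / 16 * (norm \<tau> + norm u)" using B(1) by simp
      finally have n2: "norm n \<le> \<delta>0 / 16 * (norm \<tau> + norm u)" using n1 by simp
      have "norm m / 2 \<le> norm n" unfolding n_def Nq_def by (rule proj[OF p(1) mN])
      moreover have "\<delta>0 * norm c \<le> norm m" unfolding m_def using B(4) p(1) by blast
      ultimately have "\<delta>0 * norm c \<le> \<delta>0 * ((norm \<tau> + norm u) / 8)" using n2 by simp
      then have nc: "norm c \<le> (norm \<tau> + norm u) / 8" using B(2) by simp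
      have cc: "cplx c = s p * cplx \<tau> - cplx u" by (simp add: c_def complex_eq_iff rot_coords_def)
      have "cmod (s x * cplx \<tau> - cplx u) \<le> cmod ((s x - s p) * cplx \<tau>) + cmod (cplx c)"
        unfolding cc using norm_triangle_ineq[of "(s x - s p) * cplx \<tau>" "s p * cplx \<tau> - cplx u"] by (simp add: algebra_simps)
      also have "\<dots> \<le> 1/8 * norm \<tau> + (norm \<tau> + norm u) / 8"
      proof -
        have "cmod ((s x - s p) * cplx \<tau>) \<le> 1/8 * norm \<tau>"
          unfolding norm_mult cmod_cplx by (rule mult_right_mono[OF sx norm_ge_zero])
        then show ?thesis using nc by (simp add: add_divide_distrib)
      qed
      also have "\<dots> \<le> (norm \<tau> + norm u) / 4" using norm_ge_zero[of u] by (simp add: field_simps)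
      finally have close: "cmod (s x * cplx \<tau> - cplx u) \<le> (norm \<tau> + cmod (cplx u)) / 4" by simp
      have "\<tau> = 0" if k: "k > 0" "fst (?f (stereo_inv y)) = - (k *\<^sub>R \<tau>)" for k
        by (rule hopf_lift_near_plus[OF h(1,2) s1[OF x(1)] k(1) _ close]) (use k(2) fv nu d2'(1) in auto)
      then show ?thesis using p d2'(3) by (intro bexI[of _ "?\<sigma> p"] bexI[of _ \<tau>]) (auto simp: N)
    qed
  qed
qed

section \<open>Tangential gradients\<close>

lemma differential_eq:
  fixes f g :: "'a::euclidean_space \<Rightarrow> 'b::real_normed_vector"
  assumes U: "open U" "p \<in> U" "smooth_on U g" "\<forall>x\<in>N \<inter> U. f x = g x"
    and v: "v \<in> tangent_space N p"
  shows "differential N f p v = frechet_derivative g (at p) v"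
proof -
  have D: "((f \<circ> \<gamma>) has_vector_derivative frechet_derivative g (at p) v) (at 0)"
    if \<gamma>: "smooth_curve_at N p v \<gamma>" for \<gamma>
  proof -
    obtain e where e: "e > 0" "smooth_on {-e<..<e} \<gamma>" "\<And>t. \<bar>t\<bar> < e \<Longrightarrow> \<gamma> t \<in> N \<inter> U"
      "\<gamma> 0 = p" "(\<gamma> has_vector_derivative v) (at 0)" using smooth_curve_atD[OF \<gamma> U(1,2)] by metis
    have "smooth_curve_at UNIV (g p) (frechet_derivative g (at p) v) (\<lambda>t. g (\<gamma> t))"
      by (rule smooth_curve_at_compose[OF \<gamma> U(1-3)]) auto
    then have "((\<lambda>t. g (\<gamma> t)) has_vector_derivative frechet_derivative g (at p) v) (at 0)"
      by (simp add: smooth_curve_at_def)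
    then show ?thesis
    proof (rule has_vector_derivative_transform_within_open[where S = "ball 0 e"])
      show "g (\<gamma> t) = (f \<circ> \<gamma>) t" if "t \<in> ball 0 e" for t using e(3)[of t] U(4) that by auto
    qed (use e in auto)
  qed
  obtain \<gamma>0 where \<gamma>0: "smooth_curve_at N p v \<gamma>0" using v by (auto simp: tangent_space_def)
  show ?thesis unfolding differential_def
  proof (rule the_equality)
    show "\<forall>\<gamma>. smooth_curve_at N p v \<gamma> \<longrightarrow> ((f \<circ> \<gamma>) has_vector_derivative frechet_derivative g (at p) v) (at 0)"
      using D by blast
    fix w assume "\<forall>\<gamma>. smooth_curve_at N p v \<gamma> \<longrightarrow> ((f \<circ> \<gamma>) has_vector_derivative w) (at 0)"
    then have "((f \<circ> \<gamma>0) has_vector_derivative w) (at 0)" using \<gamma>0 by blast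
    then show "w = frechet_derivative g (at p) v" using D[OF \<gamma>0] by (rule vector_derivative_unique_at)
  qed
qed

definition gradient :: "('a::euclidean_space \<Rightarrow> real) \<Rightarrow> 'a \<Rightarrow> 'a" where
  "gradient g p = (\<Sum>b\<in>Basis. frechet_derivative g (at p) b *\<^sub>R b)"

lemma gradient_inner:
  assumes "(g has_derivative frechet_derivative g (at p)) (at p)"
  shows "gradient g p \<bullet> v = frechet_derivative g (at p) v"
proof -
  have l: "linear (frechet_derivative g (at p))" using assms has_derivative_linear by blast
  have "frechet_derivative g (at p) v = frechet_derivative g (at p) (\<Sum>b\<in>Basis. (v \<bullet> b) *\<^sub>R b)"
    by (simp add: euclidean_representation)
  also have "\<dots> = (\<Sum>b\<in>Basis. (v \<bullet> b) *\<^sub>R frechet_derivative g (at p) b)"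
    using l by (simp add: linear_sum linear_cmul)
  also have "\<dots> = gradient g p \<bullet> v"
    unfolding gradient_def inner_sum_left inner_scaleR_left by (simp add: inner_commute mult.commute)
  finally show ?thesis by simp
qed

lemma continuous_on_gradient: "smooth_on U g \<Longrightarrow> continuous_on U (gradient g)"
  unfolding gradient_def
  by (intro continuous_intros smooth_on_continuous[OF smooth_on_derivative])

definition tangential_gradient :: "'a::euclidean_space set \<Rightarrow> ('a \<Rightarrow> real) \<Rightarrow> 'a \<Rightarrow> 'a" where
  "tangential_gradient N f p = (THE u. u \<in> tangent_space N p \<and> (\<forall>v\<in>tangent_space N p. differential N f p v = u \<bullet> v))"

lemma tangential_gradient_eq:
  fixes f :: "'a::euclidean_space \<Rightarrow> real"
  assumes N: "closed_submanifold k N" and p: "p \<in> N"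
    and U: "open U" "p \<in> U" "smooth_on U g" "\<forall>x\<in>N \<inter> U. f x = g x"
  shows "tangential_gradient N f p = gradient g p - closest_point (normal_space N p) (gradient g p)"
    and "gradient g p - closest_point (normal_space N p) (gradient g p) \<in> tangent_space N p"
    and "v \<in> tangent_space N p \<Longrightarrow>
      differential N f p v = (gradient g p - closest_point (normal_space N p) (gradient g p)) \<bullet> v"
proof -
  let ?u = "gradient g p - closest_point (normal_space N p) (gradient g p)"
  note nS = subspace_normal_space[of N p]
  show T: "?u \<in> tangent_space N p"
    by (rule tangent_spaceI[OF N p]) (rule closest_point_subspace_orthogonal[OF nS])
  show d: "differential N f p v = ?u \<bullet> v" if v: "v \<in> tangent_space N p" for v
  proof -
    have "closest_point (normal_space N p) (gradient g p) \<bullet> v = 0"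
      by (rule normal_space_orthogonal[OF closest_point_subspace_in[OF nS] v])
    then show ?thesis
      using differential_eq[OF U v] gradient_inner[OF smooth_onD[OF U(3,2)], of v] by (simp add: inner_diff_left)
  qed
  show "tangential_gradient N f p = ?u" unfolding tangential_gradient_def
  proof (rule the_equality)
    show "?u \<in> tangent_space N p \<and> (\<forall>v\<in>tangent_space N p. differential N f p v = ?u \<bullet> v)" using T d by blast
    fix u assume u: "u \<in> tangent_space N p \<and> (\<forall>v\<in>tangent_space N p. differential N f p v = u \<bullet> v)"
    then have "u - ?u \<in> tangent_space N p" using T subspace_tangent_space[OF N p] subspace_diff by blast
    then have "differential N f p (u - ?u) = u \<bullet> (u - ?u)" "differential N f p (u - ?u) = ?u \<bullet> (u - ?u)"
      using u d[of "u - ?u"] by blast+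
    then have "(u - ?u) \<bullet> (u - ?u) = 0" by (simp only: inner_diff_left[of u ?u])
    then show "u = ?u" by simp
  qed
qed

lemma tangential_gradient_props:
  fixes f :: "'a::euclidean_space \<Rightarrow> real"
  assumes N: "closed_submanifold k N" and p: "p \<in> N" and f: "smooth_map_on N f"
  shows "tangential_gradient N f p \<in> tangent_space N p"
    and "v \<in> tangent_space N p \<Longrightarrow> differential N f p v = tangential_gradient N f p \<bullet> v"
proof -
  obtain U g where U: "open U" "p \<in> U" "smooth_on U g" "\<forall>x\<in>N \<inter> U. f x = g x"
    by (rule smooth_map_onE[OF f p])
  note e = tangential_gradient_eq[OF N p U]
  show "tangential_gradient N f p \<in> tangent_space N p" unfolding e(1) by (rule e(2))
  show "v \<in> tangent_space N p \<Longrightarrow> differential N f p v = tangential_gradient N f p \<bullet> v" unfolding e(1) by (rule e(3))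
qed

lemma continuous_on_tangential_gradient:
  fixes f :: "'a::euclidean_space \<Rightarrow> real"
  assumes N: "closed_submanifold k N" and f: "smooth_map_on N f"
  shows "continuous_on N (tangential_gradient N f)"
proof -
  have "continuous (at p within N) (tangential_gradient N f)" if p: "p \<in> N" for p
  proof -
    obtain U g where U: "open U" "p \<in> U" "smooth_on U g" "\<forall>x\<in>N \<inter> U. f x = g x"
      by (rule smooth_map_onE[OF f p])
    have cg: "continuous_on (N \<inter> U) (gradient g)"
      by (rule continuous_on_subset[OF continuous_on_gradient[OF U(3)]]) auto
    have "continuous_on (N \<inter> U) (\<lambda>q. gradient g q - closest_point (normal_space N q) (gradient g q))"
      by (intro continuous_intros continuous_on_normal_projection[OF N _ cg] cg) auto
    then have "continuous_on (N \<inter> U) (tangential_gradient N f)"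
      by (rule continuous_on_eq) (use tangential_gradient_eq(1)[OF N _ U(1) _ U(3,4)] in auto)
    then have "continuous (at p within N \<inter> U) (tangential_gradient N f)"
      using p U(2) by (simp add: continuous_on_eq_continuous_within)
    moreover have "at p within N \<inter> U = at p within N"
      by (rule at_within_nhd[OF U(2,1)]) auto
    ultimately show ?thesis by simp
  qed
  then show ?thesis by (simp add: continuous_on_eq_continuous_within)
qed

text \<open>On the submanifold a smooth function is approximated to second order by its tangential gradient alone,
  since the normal part of the gradient meets the chord only to second order.\<close>

lemma tangential_gradient_estimate:
  fixes f :: "'a::euclidean_space \<Rightarrow> real"
  assumes N: "closed_submanifold k N" and f: "smooth_map_on N f"
  obtains C where "C \<ge> 0" "\<forall>p\<in>N. \<forall>x\<in>N. \<bar>f x - f p - tangential_gradient N f p \<bullet> (x - p)\<bar> \<le> C * (norm (x - p))\<^sup>2"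
proof -
  have cN: "compact N" using N by (simp add: closed_submanifold_def)
  define Q where "Q C p x \<longleftrightarrow> \<bar>f x - f p - tangential_gradient N f p \<bullet> (x - p)\<bar> \<le> C * (norm (x - p))\<^sup>2" for C p x
  obtain C2 where C2: "C2 \<ge> 0" "\<And>p q n. p \<in> N \<Longrightarrow> q \<in> N \<Longrightarrow> n \<in> normal_space N p \<Longrightarrow> \<bar>n \<bullet> (q - p)\<bar> \<le> C2 * norm n * (norm (q - p))\<^sup>2"
    using submanifold_estimates[OF N] by metis
  have "\<exists>C\<ge>0. \<forall>p\<in>N. \<forall>x\<in>N. Q C p x"
  proof (rule compact_local_to_global[where Q = Q and K = N, OF cN])
    fix C C' p x assume "Q C p x" "C \<le> C'"
    then show "Q C' p x" unfolding Q_def using mult_right_mono[of C C' "(norm (x - p))\<^sup>2"] by simp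
  next
    fix p0 assume p0: "p0 \<in> N"
    obtain U g where U: "open U" "p0 \<in> U" "smooth_on U g" "\<forall>x\<in>N \<inter> U. f x = g x"
      by (rule smooth_map_onE[OF f p0])
    then obtain r where r: "r > 0" "cball p0 r \<subseteq> U" using open_contains_cball by meson
    obtain C1 where C1: "\<And>x y. x \<in> cball p0 r \<Longrightarrow> y \<in> cball p0 r \<Longrightarrow>
       norm (g y - g x - frechet_derivative g (at x) (y - x)) \<le> C1 * (norm (y - x))\<^sup>2"
      using smooth_on_second_order_bound[OF U(3) r(2)] by metis
    have "compact (gradient g ` cball p0 r)"
      by (intro compact_continuous_image continuous_on_subset[OF continuous_on_gradient[OF U(3)] r(2)]) auto
    from compact_imp_bounded[OF this]
    obtain B where B: "B > 0" "\<And>x. x \<in> cball p0 r \<Longrightarrow> norm (gradient g x) \<le> B"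
      unfolding bounded_pos by auto
    have "Q (C1 + C2 * B) p x" if px: "p \<in> N \<inter> ball p0 r" "x \<in> N \<inter> ball p0 r" for p x
    proof -
      have cb: "p \<in> cball p0 r" "x \<in> cball p0 r" "p \<in> N" "x \<in> N" using px by auto
      have inU: "p \<in> U" "x \<in> U" using cb r(2) by auto
      have fe: "f p = g p" "f x = g x" using U(4) cb inU by auto
      define n where "n = closest_point (normal_space N p) (gradient g p)"
      have n: "n \<in> normal_space N p" unfolding n_def by (rule closest_point_subspace_in[OF subspace_normal_space])
      have nn: "norm n \<le> B" unfolding n_def
        by (rule order_trans[OF norm_closest_point_subspace_le[OF subspace_normal_space] B(2)[OF cb(1)]])
      have tg: "tangential_gradient N f p = gradient g p - n"
        unfolding n_def by (rule tangential_gradient_eq(1)[OF N cb(3) U(1) inU(1) U(3,4)])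
      have gi: "gradient g p \<bullet> (x - p) = frechet_derivative g (at p) (x - p)"
        by (rule gradient_inner[OF smooth_onD[OF U(3) inU(1)]])
      have "f x - f p - tangential_gradient N f p \<bullet> (x - p) = (g x - g p - frechet_derivative g (at p) (x - p)) + n \<bullet> (x - p)"
        unfolding tg fe by (simp add: inner_diff_left gi)
      moreover have "\<bar>g x - g p - frechet_derivative g (at p) (x - p)\<bar> \<le> C1 * (norm (x - p))\<^sup>2"
        using C1[OF cb(1,2)] by simp
      moreover have "\<bar>n \<bullet> (x - p)\<bar> \<le> C2 * B * (norm (x - p))\<^sup>2"
        by (rule order_trans[OF C2(2)[OF cb(3,4) n]]) (intro mult_right_mono mult_left_mono nn C2(1) zero_le_power2)
      ultimately show ?thesis unfolding Q_def by (simp add: distrib_right)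
    qed
    then have "\<exists>C. \<forall>p\<in>N \<inter> ball p0 r. \<forall>x\<in>N \<inter> ball p0 r. Q C p x" by blast
    then show "\<exists>r>0. \<exists>C. \<forall>x\<in>N \<inter> ball p0 r. \<forall>y\<in>N \<inter> ball p0 r. Q C x y" using r(1) by blast
  next
    fix d :: real assume d: "d > 0"
    obtain B where B: "\<And>x. x \<in> N \<Longrightarrow> norm (f x) \<le> B"
      using compact_imp_bounded[OF compact_continuous_image[OF smooth_map_on_continuous[OF cN f] cN]] unfolding bounded_iff by auto
    obtain B' where B': "\<And>x. x \<in> N \<Longrightarrow> norm (tangential_gradient N f x) \<le> B'"
      using compact_imp_bounded[OF compact_continuous_image[OF continuous_on_tangential_gradient[OF N f] cN]] unfolding bounded_iff by auto
    have "Q (2 * B / d\<^sup>2 + B' / d) p x" if px: "p \<in> N" "x \<in> N" "d \<le> dist p x" for p x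
    proof -
      define l where "l = norm (x - p)"
      have l: "d \<le> l" using px(3) by (simp add: l_def dist_norm norm_minus_commute)
      have BB: "0 \<le> B" "0 \<le> B'" using order_trans[OF norm_ge_zero B[OF px(1)]] order_trans[OF norm_ge_zero B'[OF px(1)]] by auto
      have "\<bar>f x - f p - tangential_gradient N f p \<bullet> (x - p)\<bar> \<le> 2 * B + \<bar>tangential_gradient N f p \<bullet> (x - p)\<bar>"
        using B[OF px(1)] B[OF px(2)] unfolding real_norm_def by linarith
      also have "\<bar>tangential_gradient N f p \<bullet> (x - p)\<bar> \<le> B' * l"
        unfolding l_def by (rule order_trans[OF Cauchy_Schwarz_ineq2 mult_right_mono[OF B'[OF px(1)] norm_ge_zero]])
      also have "2 * B \<le> 2 * B / d\<^sup>2 * l\<^sup>2"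
      proof -
        have "2 * B / d\<^sup>2 * d\<^sup>2 \<le> 2 * B / d\<^sup>2 * l\<^sup>2" using l d BB by (intro mult_left_mono power_mono) auto
        then show ?thesis using d by simp
      qed
      also have "B' * l \<le> B' / d * l\<^sup>2"
      proof -
        have "B' / d * l * d \<le> B' / d * l * l" using l d BB by (intro mult_left_mono) auto
        then show ?thesis using d by (simp add: power2_eq_square)
      qed
      finally show ?thesis unfolding Q_def l_def by (simp add: distrib_right)
    qed
    then show "\<exists>C. \<forall>x\<in>N. \<forall>y\<in>N. d \<le> dist x y \<longrightarrow> Q C x y" by blast
  qed
  then obtain C where "C \<ge> 0" "\<forall>p\<in>N. \<forall>x\<in>N. Q C p x" by auto
  then show ?thesis unfolding Q_def by (rule that)
qed

section \<open>Regular level sets\<close>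

text \<open>The defining function replaces one coordinate of the
  slice: \<open>y + (\<beta> y - y \<bullet> e) e\<close> has \<open>\<beta> y\<close> as its coordinate in the direction \<open>e\<close> and leaves the others
  unchanged, where \<open>\<beta>\<close> is the defining function in the chart and \<open>e\<close> is a direction in which it varies.\<close>

lemma closed_submanifold_level_set:
  fixes N Z :: "(real ^ 'm) set"
  assumes N: "closed_submanifold k N" and Z: "compact Z" "Z \<subseteq> N"
    and loc: "\<And>p. p \<in> Z \<Longrightarrow> \<exists>U b. open U \<and> p \<in> U \<and> smooth_on U b \<and> (\<forall>x\<in>N \<inter> U. x \<in> Z \<longleftrightarrow> b x = (0::real)) \<and>
       (\<exists>v\<in>tangent_space N p. frechet_derivative b (at p) v \<noteq> 0)"
  shows "closed_submanifold (k + 1) Z"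
  unfolding closed_submanifold_iff
proof (intro conjI ballI Z(1))
  fix p assume pZ: "p \<in> Z"
  then have pN: "p \<in> N" using Z by auto
  obtain U b v where U: "open U" "p \<in> U" "smooth_on U b" "\<forall>x\<in>N \<inter> U. x \<in> Z \<longleftrightarrow> b x = (0::real)"
    and v: "v \<in> tangent_space N p" "frechet_derivative b (at p) v \<noteq> 0"
    using loc[OF pZ] by (elim exE conjE bexE) (rule that)
  obtain U0 V0 \<phi> \<psi> L where c: "p \<in> U0" "slice_chart N U0 V0 \<phi> \<psi> L" "dim L + k = CARD('m)"
    using N pN unfolding closed_submanifold_iff by auto
  note cD = slice_chartD[OF c(2)]
  define V where "V = V0 \<inter> \<psi> -` U"
  have oV: "open V" unfolding V_def by (rule continuous_open_preimage[OF cD(13,2) U(1)])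
  have pV: "\<phi> p \<in> V" using cD(6,7)[OF c(1)] U(2) by (simp add: V_def)
  have V: "y \<in> V \<Longrightarrow> y \<in> V0" "y \<in> V \<Longrightarrow> \<psi> y \<in> U" for y by (auto simp: V_def)
  have s\<psi>: "smooth_on V \<psi>" by (rule smooth_on_subset[OF cD(4)]) (auto simp: V_def)
  define \<beta> where "\<beta> y = b (\<psi> y)" for y
  have s\<beta>: "smooth_on V \<beta>" unfolding \<beta>_def
    by (rule smooth_on_compose[OF oV U(1) _ s\<psi> U(3)]) (use V in auto)
  define w where "w = frechet_derivative \<phi> (at p) v"
  have wL: "w \<in> L" unfolding w_def using tangent_space_slice_chart(2)[OF c(2) pN c(1)] v(1) by blast
  have D\<beta>: "(\<beta> has_derivative (\<lambda>w. frechet_derivative b (at p) (frechet_derivative \<psi> (at (\<phi> p)) w))) (at (\<phi> p))"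
    unfolding \<beta>_def
    by (rule has_derivative_compose[OF smooth_onD[OF s\<psi> pV]]) (use smooth_onD[OF U(3,2)] cD(7)[OF c(1)] in simp)
  then have D\<beta>': "frechet_derivative \<beta> (at (\<phi> p)) = (\<lambda>w. frechet_derivative b (at p) (frechet_derivative \<psi> (at (\<phi> p)) w))"
    by (rule frechet_derivative_at[symmetric])
  have D\<beta>w: "frechet_derivative \<beta> (at (\<phi> p)) w \<noteq> 0"
    unfolding D\<beta>' w_def using slice_chart_derivatives(1)[OF c(2,1)] v(2) by simp
  have lin: "linear (frechet_derivative \<beta> (at (\<phi> p)))" using smooth_onD[OF s\<beta> pV] has_derivative_linear by blast
  have "w \<noteq> 0" using D\<beta>w linear_0[OF lin] by metis
  define e where "e = sgn w"
  have e1: "e \<bullet> e = 1" using \<open>w \<noteq> 0\<close> by (simp add: e_def norm_sgn power2_norm_eq_inner[symmetric])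
  have eL: "e \<in> L" unfolding e_def sgn_div_norm using wL cD(5) by (simp add: subspace_scale)
  have De: "frechet_derivative \<beta> (at (\<phi> p)) e \<noteq> 0"
    using D\<beta>w \<open>w \<noteq> 0\<close> unfolding e_def sgn_div_norm linear_cmul[OF lin] by simp
  define \<Xi> where "\<Xi> y = y + (\<beta> y - y \<bullet> e) *\<^sub>R e" for y
  have s\<Xi>: "smooth_on V \<Xi>" unfolding \<Xi>_def
    by (intro smooth_on_add smooth_on_ident smooth_on_scaleR smooth_on_const smooth_on_diff smooth_on_inner s\<beta> oV)
  have inj: "u = 0" if u: "frechet_derivative \<Xi> (at (\<phi> p)) u = 0" for u
  proof -
    have "(\<Xi> has_derivative (\<lambda>u. u + (frechet_derivative \<beta> (at (\<phi> p)) u - u \<bullet> e) *\<^sub>R e)) (at (\<phi> p))"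
      unfolding \<Xi>_def using smooth_onD[OF s\<beta> pV] by (auto intro!: derivative_eq_intros)
    then have "frechet_derivative \<Xi> (at (\<phi> p)) = (\<lambda>u. u + (frechet_derivative \<beta> (at (\<phi> p)) u - u \<bullet> e) *\<^sub>R e)"
      by (rule frechet_derivative_at[symmetric])
    then have 0: "u + (frechet_derivative \<beta> (at (\<phi> p)) u - u \<bullet> e) *\<^sub>R e = 0" using u by simp
    define a where "a = - (frechet_derivative \<beta> (at (\<phi> p)) u - u \<bullet> e)"
    have ua: "u = a *\<^sub>R e" unfolding a_def scaleR_minus_left using 0 by (rule eq_neg_iff_add_eq_0[THEN iffD2])
    have "a *\<^sub>R e + (a * frechet_derivative \<beta> (at (\<phi> p)) e - a) *\<^sub>R e = 0"
      using 0 unfolding ua by (simp add: linear_cmul[OF lin] e1)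
    then have "(a * frechet_derivative \<beta> (at (\<phi> p)) e) *\<^sub>R e = 0" by (simp add: scaleR_left_diff_distrib)
    then have "a = 0" using De e1 by auto
    then show ?thesis using ua by simp
  qed
  obtain V1 V2 \<Xi>' where x: "open V1" "\<phi> p \<in> V1" "V1 \<subseteq> V" "open V2" "homeomorphism V1 V2 \<Xi> \<Xi>'" "smooth_on V1 \<Xi>" "smooth_on V2 \<Xi>'"
    by (rule smooth_inverse_function_theorem[OF oV s\<Xi> pV inj])
  have xD: "y \<in> V1 \<Longrightarrow> \<Xi>' (\<Xi> y) = y" "y \<in> V1 \<Longrightarrow> \<Xi> y \<in> V2" "z \<in> V2 \<Longrightarrow> \<Xi> (\<Xi>' z) = z" "z \<in> V2 \<Longrightarrow> \<Xi>' z \<in> V1" for y z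
    using x(5) by (auto simp: homeomorphism_def)
  have \<Xi>e: "\<Xi> y \<bullet> e = \<beta> y" for y by (simp add: \<Xi>_def inner_add_left e1)
  have \<Xi>L: "\<Xi> y \<in> L \<longleftrightarrow> y \<in> L" for y
  proof
    assume "\<Xi> y \<in> L"
    then have "\<Xi> y - (\<beta> y - y \<bullet> e) *\<^sub>R e \<in> L" using eL cD(5) by (simp add: subspace_diff subspace_scale)
    then show "y \<in> L" by (simp add: \<Xi>_def)
  qed (use eL cD(5) in \<open>simp add: \<Xi>_def subspace_add subspace_scale\<close>)
  define U3 where "U3 = U0 \<inter> \<phi> -` V1"
  have oU3: "open U3" unfolding U3_def by (rule continuous_open_preimage[OF cD(12,1) x(1)])
  have m: "x \<in> U3 \<Longrightarrow> \<phi> x \<in> V1" "x \<in> U3 \<Longrightarrow> x \<in> U0" "y \<in> V1 \<Longrightarrow> \<psi> y \<in> U3" for x y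
    using x(3) V cD(8,9) by (auto simp: U3_def)
  have V10: "y \<in> V1 \<Longrightarrow> y \<in> V0" for y using x(3) V by auto
  have sm1: "smooth_on U3 (\<lambda>x. \<Xi> (\<phi> x))"
    by (rule smooth_on_compose[OF oU3 x(1) _ _ x(6)]) (use m smooth_on_subset[OF cD(3)] in \<open>auto simp: U3_def\<close>)
  have sm2: "smooth_on V2 (\<lambda>z. \<psi> (\<Xi>' z))"
    by (rule smooth_on_compose[OF x(4) oV _ x(7) s\<psi>]) (use xD x(3) in auto)
  have hom: "homeomorphism U3 V2 (\<lambda>x. \<Xi> (\<phi> x)) (\<lambda>z. \<psi> (\<Xi>' z))"
  proof (rule homeomorphismI)
    show "continuous_on U3 (\<lambda>x. \<Xi> (\<phi> x))" "continuous_on V2 (\<lambda>z. \<psi> (\<Xi>' z))"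
      using sm1 sm2 smooth_on_continuous by blast+
    show "(\<lambda>x. \<Xi> (\<phi> x)) ` U3 \<subseteq> V2" "(\<lambda>z. \<psi> (\<Xi>' z)) ` V2 \<subseteq> U3" using m xD by auto
    show "\<psi> (\<Xi>' (\<Xi> (\<phi> x))) = x" if "x \<in> U3" for x using xD(1)[OF m(1)[OF that]] cD(7)[OF m(2)[OF that]] by simp
    show "\<Xi> (\<phi> (\<psi> (\<Xi>' z))) = z" if "z \<in> V2" for z using xD(3,4)[OF that] cD(9)[OF V10] by simp
  qed
  define L' where "L' = {y \<in> L. e \<bullet> y = 0}"
  have sL': "subspace L'" unfolding L'_def using cD(5)
    by (auto simp: subspace_def inner_add_right)
  have dL': "dim L' + 1 = dim L"
  proof -
    have "L' = {y \<in> L. \<forall>x\<in>span {e}. orthogonal x y}"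
      by (auto simp: L'_def span_singleton orthogonal_def intro: span_base)
    then have "dim L' + dim (span {e}) = dim L"
      using dim_subspace_orthogonal_to_vectors[of "span {e}" L] cD(5) eL span_minimal[of "{e}" L] by simp
    moreover have "dim {e} = 1" using e1 by (subst dim_singleton) auto
    ultimately show ?thesis by (simp add: dim_span)
  qed
  have im: "(\<lambda>x. \<Xi> (\<phi> x)) ` (Z \<inter> U3) = V2 \<inter> L'"
  proof (intro equalityI subsetI)
    fix z assume "z \<in> (\<lambda>x. \<Xi> (\<phi> x)) ` (Z \<inter> U3)"
    then obtain x where x: "x \<in> Z" "x \<in> U3" "z = \<Xi> (\<phi> x)" by auto
    have xU: "x \<in> U" using V(2)[of "\<phi> x"] x(2) m(1,2) \<open>V1 \<subseteq> V\<close> cD(7) by force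
    have "b x = 0" using U(4) xU x(1) Z(2) by blast
    then have "\<beta> (\<phi> x) = 0" using cD(7)[OF m(2)[OF x(2)]] by (simp add: \<beta>_def)
    moreover have "\<phi> x \<in> L" using cD(10)[OF m(2)[OF x(2)]] x(1) Z(2) by auto
    ultimately show "z \<in> V2 \<inter> L'" using x(3) \<Xi>e[of "\<phi> x"] \<Xi>L xD(2)[OF m(1)[OF x(2)]] by (simp add: L'_def inner_commute)
  next
    fix z assume z: "z \<in> V2 \<inter> L'"
    define y where "y = \<Xi>' z"
    have y: "y \<in> V1" "\<Xi> y = z" using xD z by (auto simp: y_def)
    have "y \<in> L" "\<beta> y = 0" using z y(2) \<Xi>L[of y] \<Xi>e[of y] by (auto simp: L'_def inner_commute)
    then have "\<psi> y \<in> N" "b (\<psi> y) = 0" using cD(11)[OF V10[OF y(1)]] by (auto simp: \<beta>_def)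
    then have "\<psi> y \<in> Z" using U(4) V(2)[of y] y(1) x(3) by auto
    moreover have "z = \<Xi> (\<phi> (\<psi> y))" using y(2) cD(9)[OF V10[OF y(1)]] by simp
    ultimately show "z \<in> (\<lambda>x. \<Xi> (\<phi> x)) ` (Z \<inter> U3)" using m(3)[OF y(1)] by blast
  qed
  have "slice_chart Z U3 V2 (\<lambda>x. \<Xi> (\<phi> x)) (\<lambda>z. \<psi> (\<Xi>' z)) L'"
    unfolding slice_chart_def using oU3 x(4) hom sm1 sm2 sL' im by simp
  moreover have "p \<in> U3" using c(1) x(2) by (simp add: U3_def)
  ultimately show "\<exists>U V \<phi> \<psi> L. p \<in> U \<and> slice_chart Z U V \<phi> \<psi> L \<and> dim L + (k + 1) = DIM(real ^ 'm)"
    using c(3) dL' by (intro exI[of _ U3] exI[of _ V2] exI[of _ "\<lambda>x. \<Xi> (\<phi> x)"] exI[of _ "\<lambda>z. \<psi> (\<Xi>' z)"] exI[of _ L']) simp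
qed

section \<open>The preimage of a regular value\<close>

lemma tangent_space_circle: "tangent_space (sphere (0::complex) 1) (-1) = {z. Re z = 0}"
proof (intro equalityI subsetI)
  fix v assume "v \<in> tangent_space (sphere (0::complex) 1) (-1)"
  then obtain \<gamma> e where \<gamma>: "\<gamma> 0 = -1" "(\<gamma> has_vector_derivative v) (at 0)" "e > 0" "\<gamma> ` {-e<..<e} \<subseteq> sphere 0 1"
    unfolding tangent_space_def smooth_curve_at_def by auto
  have "((\<lambda>t. \<gamma> t \<bullet> \<gamma> t) has_vector_derivative (2 * (\<gamma> 0 \<bullet> v))) (at 0)"
    using \<gamma>(2) unfolding has_vector_derivative_def
    by (auto intro!: derivative_eq_intros simp: inner_commute)
  moreover have "((\<lambda>t. \<gamma> t \<bullet> \<gamma> t) has_vector_derivative 0) (at 0)"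
  proof (rule has_vector_derivative_transform_within_open[where S = "ball 0 e"])
    show "((\<lambda>t::real. 1::real) has_vector_derivative 0) (at 0)" by simp
    show "1 = \<gamma> t \<bullet> \<gamma> t" if "t \<in> ball 0 e" for t
    proof -
      have "norm (\<gamma> t) = 1" using \<gamma>(4) that by (auto simp: image_subset_iff abs_less_iff)
      then show ?thesis by (simp add: power2_norm_eq_inner[symmetric])
    qed
  qed (use \<gamma> in auto)
  ultimately have "2 * (\<gamma> 0 \<bullet> v) = 0" by (rule vector_derivative_unique_at)
  then show "v \<in> {z. Re z = 0}" using \<gamma>(1) by (simp add: inner_complex_def)
next
  fix v :: complex assume "v \<in> {z. Re z = 0}"
  then have v: "v = \<i> * of_real (Im v)" by (simp add: complex_eq_iff)
  define \<gamma> where "\<gamma> t = - cis (- (t * Im v))" for t :: real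
  have "smooth_curve_at (sphere 0 1) (-1) v \<gamma>"
    unfolding smooth_curve_at_def
  proof (intro conjI exI[of _ "1::real"])
    show "\<gamma> 0 = -1" by (simp add: \<gamma>_def)
    show "(\<gamma> has_vector_derivative v) (at 0)"
      unfolding \<gamma>_def has_vector_derivative_def
      by (auto intro!: derivative_eq_intros simp: fun_eq_iff complex_eq_iff) (use v in \<open>auto simp: complex_eq_iff\<close>)
    show "smooth_on {- 1<..<1} \<gamma>" unfolding \<gamma>_def
      by (intro smooth_on_minus smooth_on_cis smooth_on_mult smooth_on_ident smooth_on_const) auto
  qed (auto simp: \<gamma>_def)
  then show "v \<in> tangent_space (sphere 0 1) (-1)" by (auto simp: tangent_space_def)
qed

locale regular_circle_map =
  fixes M :: "(real ^ 'm) set" and F :: "real ^ 'm \<Rightarrow> (real ^ 'm) ^ 2" and s :: "real ^ 'm \<Rightarrow> complex"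
  assumes framed: "framed_closed_submanifold M F"
    and smooth: "smooth_map_on M s"
    and unit: "\<And>x. x \<in> M \<Longrightarrow> cmod (s x) = 1"
    and regular: "\<And>x. x \<in> M \<Longrightarrow> s x = -1 \<Longrightarrow>
      differential M s x ` tangent_space M x = tangent_space (sphere 0 1) (-1)"
begin

text \<open>The sine of \<open>\<theta>\<close> for \<open>s = - cis \<theta>\<close>: a coordinate of the circle at \<open>-1\<close> that increases counterclockwise.\<close>

definition angle :: "real ^ 'm \<Rightarrow> real" where
  "angle x = - Im (s x)"

definition grad :: "real ^ 'm \<Rightarrow> real ^ 'm" where
  "grad = tangential_gradient M angle"

abbreviation Z where "Z \<equiv> preimage_of_minus_one M s"

lemma submanifold: "closed_submanifold 2 M" and framing_M: "framing M F" and compact_M: "compact M"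
  using framed by (auto simp: framed_closed_submanifold_def closed_submanifold_def)

lemma continuous_s: "continuous_on M s"
  by (rule smooth_map_on_continuous[OF compact_M smooth])

lemma smooth_angle: "smooth_map_on M angle"
proof -
  have "bounded_linear (\<lambda>z. - Im z)" by (intro bounded_linear_minus bounded_linear_Im)
  from smooth_map_on_linear[OF smooth this] show ?thesis by (simp add: angle_def[abs_def])
qed

lemma Z_subset: "Z \<subseteq> M" by (auto simp: preimage_of_minus_one_def)

lemma compact_Z: "compact Z"
proof -
  have "closed (M \<inter> s -` {-1})" by (rule continuous_closed_preimage[OF continuous_s]) (auto simp: compact_M compact_imp_closed)
  then have "compact (M \<inter> (M \<inter> s -` {-1}))" by (rule compact_Int_closed[OF compact_M])
  moreover have "M \<inter> (M \<inter> s -` {-1}) = Z" by (auto simp: preimage_of_minus_one_def)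
  ultimately show ?thesis by simp
qed

lemma Z_iff: "x \<in> M \<Longrightarrow> Re (s x) < 0 \<Longrightarrow> x \<in> Z \<longleftrightarrow> angle x = 0"
proof -
  assume x: "x \<in> M" "Re (s x) < 0"
  have "(Re (s x))\<^sup>2 + (Im (s x))\<^sup>2 = 1" using unit[OF x(1)] by (metis cmod_power2 one_power2)
  then have "Im (s x) = 0 \<Longrightarrow> Re (s x) = -1" using x(2) by (auto simp: power2_eq_1_iff)
  then show ?thesis using x by (auto simp: preimage_of_minus_one_def angle_def complex_eq_iff)
qed

lemma differential_s:
  assumes p: "p \<in> Z" and v: "v \<in> tangent_space M p"
  shows "differential M s p v = - (\<i> * of_real (grad p \<bullet> v))"
proof -
  have pM: "p \<in> M" and sp: "s p = -1" using p by (auto simp: preimage_of_minus_one_def)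
  obtain U g where U: "open U" "p \<in> U" "smooth_on U g" "\<forall>x\<in>M \<inter> U. s x = g x"
    by (rule smooth_map_onE[OF smooth pM])
  have ds: "differential M s p v = frechet_derivative g (at p) v" by (rule differential_eq[OF U v])
  have Dg: "(g has_derivative frechet_derivative g (at p)) (at p)" by (rule smooth_onD[OF U(3,2)])
  have smi: "smooth_on U (\<lambda>x. - Im (g x))"
    by (rule smooth_on_linear_compose[OF U(1) bounded_linear_minus[OF bounded_linear_Im] U(3)])
  have "((\<lambda>x. - Im (g x)) has_derivative (\<lambda>v. - Im (frechet_derivative g (at p) v))) (at p)"
    using Dg by (auto intro!: derivative_eq_intros)
  then have "frechet_derivative (\<lambda>x. - Im (g x)) (at p) = (\<lambda>v. - Im (frechet_derivative g (at p) v))"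
    by (rule frechet_derivative_at[symmetric])
  moreover have "differential M angle p v = frechet_derivative (\<lambda>x. - Im (g x)) (at p) v"
    by (rule differential_eq[OF U(1,2) smi _ v]) (use U(4) in \<open>simp add: angle_def\<close>)
  ultimately have im: "grad p \<bullet> v = - Im (frechet_derivative g (at p) v)"
    using tangential_gradient_props(2)[OF submanifold pM smooth_angle v] by (simp add: grad_def)
  obtain \<gamma> where \<gamma>: "smooth_curve_at M p v \<gamma>" using v by (auto simp: tangent_space_def)
  have "smooth_curve_at (sphere 0 1) (g p) (frechet_derivative g (at p) v) (\<lambda>t. g (\<gamma> t))"
    by (rule smooth_curve_at_compose[OF \<gamma> U(1-3)]) (use U(4) unit in \<open>auto simp: image_subset_iff\<close>, metis IntI)
  moreover have "g p = -1" using U(2,4) pM sp by auto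
  ultimately have "frechet_derivative g (at p) v \<in> tangent_space (sphere 0 1) (-1)" by (auto simp: tangent_space_def)
  then have "Re (frechet_derivative g (at p) v) = 0" by (simp add: tangent_space_circle)
  then show ?thesis using im ds by (simp add: complex_eq_iff)
qed

lemma grad_tangent: "p \<in> M \<Longrightarrow> grad p \<in> tangent_space M p"
  unfolding grad_def by (rule tangential_gradient_props(1)[OF submanifold _ smooth_angle])

lemma grad_nonzero: "p \<in> Z \<Longrightarrow> grad p \<noteq> 0"
proof
  assume p: "p \<in> Z" and 0: "grad p = 0"
  have "\<i> \<in> tangent_space (sphere 0 1) (-1)" by (simp add: tangent_space_circle)
  also have "\<dots> = differential M s p ` tangent_space M p" using regular p by (auto simp: preimage_of_minus_one_def)
  finally obtain v where "v \<in> tangent_space M p" "\<i> = differential M s p v" by auto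
  then show False using differential_s[OF p] 0 by simp
qed

lemma submanifold_Z: "closed_submanifold 3 Z"
proof -
  have "closed_submanifold (2 + 1) Z"
  proof (rule closed_submanifold_level_set[OF submanifold compact_Z Z_subset])
    fix p assume p: "p \<in> Z"
    then have pM: "p \<in> M" and sp: "s p = -1" by (auto simp: preimage_of_minus_one_def)
    obtain U g where U: "open U" "p \<in> U" "smooth_on U g" "\<forall>x\<in>M \<inter> U. s x = g x"
      by (rule smooth_map_onE[OF smooth pM])
    have gp: "g p = -1" using U(2,4) pM sp by auto
    define U' where "U' = U \<inter> (\<lambda>x. Re (g x)) -` {..<0}"
    have A1: "open U'" unfolding U'_def
      by (rule continuous_open_preimage) (use U(1) smooth_on_continuous[OF U(3)] in \<open>auto intro: continuous_intros\<close>)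
    have A2: "p \<in> U'" using U(2) gp by (simp add: U'_def)
    have smi: "smooth_on U' (\<lambda>x. - Im (g x))"
      by (rule smooth_on_subset[OF smooth_on_linear_compose[OF U(1) bounded_linear_minus[OF bounded_linear_Im] U(3)]])
        (auto simp: U'_def)
    have A4: "\<forall>x\<in>M \<inter> U'. x \<in> Z \<longleftrightarrow> - Im (g x) = 0"
      using Z_iff U(4) by (auto simp: U'_def angle_def)
    have A5: "frechet_derivative (\<lambda>x. - Im (g x)) (at p) (grad p) \<noteq> 0"
    proof -
      have "differential M angle p (grad p) = frechet_derivative (\<lambda>x. - Im (g x)) (at p) (grad p)"
        by (rule differential_eq[OF A1 A2 smi _ grad_tangent[OF pM]])
          (use U(4) in \<open>auto simp: angle_def U'_def\<close>)
      also have "differential M angle p (grad p) = grad p \<bullet> grad p"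
        using tangential_gradient_props(2)[OF submanifold pM smooth_angle grad_tangent[OF pM]] by (simp add: grad_def)
      finally show ?thesis using grad_nonzero[OF p] by (metis inner_eq_zero_iff)
    qed
    show "\<exists>U b. open U \<and> p \<in> U \<and> smooth_on U b \<and> (\<forall>x\<in>M \<inter> U. x \<in> Z \<longleftrightarrow> b x = (0::real)) \<and>
       (\<exists>v\<in>tangent_space M p. frechet_derivative b (at p) v \<noteq> 0)"
      by (rule exI[of _ U'], rule exI[of _ "\<lambda>x. - Im (g x)"])
        (intro conjI bexI[of _ "grad p"] A1 A2 smi A4 A5 grad_tangent[OF pM])
  qed
  then show ?thesis by simp
qed

text \<open>Curves give one inclusion, and the dimensions are equal.\<close>

lemma tangent_space_Z:
  assumes p: "p \<in> Z"
  shows "tangent_space Z p = {v \<in> tangent_space M p. grad p \<bullet> v = 0}"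
proof -
  have pM: "p \<in> M" using p Z_subset by auto
  let ?K = "{v \<in> tangent_space M p. grad p \<bullet> v = 0}"
  have sub: "tangent_space Z p \<subseteq> ?K"
  proof
    fix v assume "v \<in> tangent_space Z p"
    then obtain \<gamma> where \<gamma>: "smooth_curve_at Z p v \<gamma>" by (auto simp: tangent_space_def)
    have \<gamma>M: "smooth_curve_at M p v \<gamma>" by (rule smooth_curve_at_mono[OF \<gamma>, of UNIV]) (use Z_subset in auto)
    then have v: "v \<in> tangent_space M p" by (auto simp: tangent_space_def)
    obtain U g where U: "open U" "p \<in> U" "smooth_on U g" "\<forall>x\<in>M \<inter> U. s x = g x"
      by (rule smooth_map_onE[OF smooth pM])
    have "smooth_curve_at {-1} (g p) (frechet_derivative g (at p) v) (\<lambda>t. g (\<gamma> t))"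
      by (rule smooth_curve_at_compose[OF \<gamma> U(1-3)])
        (use U(4) in \<open>auto simp: preimage_of_minus_one_def image_subset_iff\<close>)
    then obtain e where e: "e > 0" "\<And>t. \<bar>t\<bar> < e \<Longrightarrow> g (\<gamma> t) = -1" "((\<lambda>t. g (\<gamma> t)) has_vector_derivative frechet_derivative g (at p) v) (at 0)"
      by (auto simp: smooth_curve_at_def image_subset_iff abs_less_iff)
    have "((\<lambda>t. g (\<gamma> t)) has_vector_derivative 0) (at 0)"
      by (rule has_vector_derivative_transform_within_open[where S = "ball 0 e" and f = "\<lambda>t. -1"]) (use e in auto)
    then have "frechet_derivative g (at p) v = 0" using e(3) by (rule vector_derivative_unique_at[symmetric])
    then have "differential M s p v = 0" using differential_eq[OF U v] by simp
    then show "v \<in> ?K" using differential_s[OF p v] v by simp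
  qed
  have "?K = {v \<in> tangent_space M p. \<forall>x\<in>span {grad p}. orthogonal x v}"
    by (auto simp: span_singleton orthogonal_def intro: span_base)
  then have "dim ?K + dim (span {grad p}) = dim (tangent_space M p)"
    using dim_subspace_orthogonal_to_vectors[of "span {grad p}" "tangent_space M p"]
      subspace_tangent_space[OF submanifold pM] grad_tangent[OF pM] span_minimal[of "{grad p}" "tangent_space M p"] by simp
  moreover have "dim {grad p} = 1" using grad_nonzero[OF p] by (subst dim_singleton) auto
  ultimately have "dim ?K \<le> dim (tangent_space Z p)"
    using dim_tangent_space[OF submanifold pM] dim_tangent_space[OF submanifold_Z p] by (simp add: dim_span)
  moreover have "subspace ?K" using subspace_tangent_space[OF submanifold pM]
    by (auto simp: subspace_def inner_add_right)
  ultimately show ?thesis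
    using subspace_dim_equal[OF subspace_tangent_space[OF submanifold_Z p] _ sub] by blast
qed

lemma circle_normal_eq:
  assumes p: "p \<in> Z"
  shows "circle_normal M s p = grad p /\<^sub>R (grad p \<bullet> grad p)"
  unfolding circle_normal_def
proof (rule the_equality)
  have pM: "p \<in> M" and sp: "s p = -1" using p by (auto simp: preimage_of_minus_one_def)
  have gg: "grad p \<bullet> grad p \<noteq> 0" using grad_nonzero[OF p] by simp
  let ?v = "grad p /\<^sub>R (grad p \<bullet> grad p)"
  have vT: "?v \<in> tangent_space M p"
    using grad_tangent[OF pM] subspace_tangent_space[OF submanifold pM] by (simp add: subspace_scale)
  have "?v \<in> normal_space Z p"
    by (rule normal_spaceI) (simp add: tangent_space_Z[OF p])
  then show "?v \<in> tangent_space M p \<and> ?v \<in> normal_space Z p \<and> differential M s p ?v = \<i> * s p"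
    using vT differential_s[OF p vT] gg sp by simp
  fix v assume v: "v \<in> tangent_space M p \<and> v \<in> normal_space Z p \<and> differential M s p v = \<i> * s p"
  then have gv: "grad p \<bullet> v = 1" using differential_s[OF p, of v] sp by (simp add: complex_eq_iff)
  define w where "w = v - ?v"
  have "w \<in> tangent_space M p" unfolding w_def using v vT subspace_tangent_space[OF submanifold pM] by (simp add: subspace_diff)
  moreover have gw: "grad p \<bullet> w = 0" using gv gg by (simp add: w_def inner_diff_right)
  ultimately have "w \<in> tangent_space Z p" by (simp add: tangent_space_Z[OF p])
  then have "v \<bullet> w = 0" using v normal_space_orthogonal by blast
  moreover have "?v \<bullet> w = 0" using gw by simp
  ultimately have "w \<bullet> w = 0" by (simp only: w_def inner_diff_left)
  then show "v = ?v" by (simp add: w_def)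
qed

definition frame_Z :: "real ^ 'm \<Rightarrow> (real ^ 'm) ^ 3" where
  "frame_Z x = vector [F x $ 1, F x $ 2, circle_normal M s x]"

definition first_two :: "real ^ 3 \<Rightarrow> real ^ 2" where
  "first_two T = vector [T $ 1, T $ 2]"

lemma frame_comb_frame_Z:
  "frame_comb (frame_Z p) T = frame_comb (F p) (first_two T) + (T $ 3) *\<^sub>R circle_normal M s p"
  by (simp add: frame_comb_2 frame_comb_3 frame_Z_def first_two_def)

lemma norm_first_two_le: "norm (first_two T) \<le> norm T"
proof -
  have "(norm (first_two T))\<^sup>2 \<le> (norm T)\<^sup>2" by (simp add: norm_vec2 norm_vec3 first_two_def)
  then show ?thesis by (rule power2_le_imp_le) simp
qed

lemma framed_Z: "framed_closed_submanifold Z frame_Z"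
proof -
  have fr: "framing Z frame_Z"
  proof (rule framingI)
    have cF: "continuous_on Z F" using framing_M Z_subset by (auto simp: framing_def intro: continuous_on_subset)
    have nth: "continuous_on Z (\<lambda>x. F x $ i)" for i
      by (intro bounded_linear.continuous_on[OF bounded_linear_vec_nth] cF)
    have cg: "continuous_on Z grad" unfolding grad_def
      by (rule continuous_on_subset[OF continuous_on_tangential_gradient[OF submanifold smooth_angle] Z_subset])
    have "continuous_on Z (\<lambda>p. grad p /\<^sub>R (grad p \<bullet> grad p))"
      by (intro continuous_intros cg) (use grad_nonzero in simp)
    then have cn: "continuous_on Z (circle_normal M s)"
      by (rule continuous_on_eq) (simp add: circle_normal_eq)
    show "continuous_on Z frame_Z" unfolding frame_Z_def
      by (intro continuous_on_vector_3 nth cn)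
    fix p assume p: "p \<in> Z"
    then have pM: "p \<in> M" using Z_subset by auto
    have Fn: "F p $ i \<in> normal_space M p" for i using framing_M pM by (simp add: framing_def)
    have FZ: "F p $ i \<in> normal_space Z p" for i
      by (rule normal_spaceI) (use normal_space_orthogonal[OF Fn] in \<open>simp add: tangent_space_Z[OF p]\<close>)
    have cZ: "circle_normal M s p \<in> normal_space Z p"
      by (rule normal_spaceI) (simp add: circle_normal_eq[OF p] tangent_space_Z[OF p])
    have "\<forall>i. frame_Z p $ i \<in> normal_space Z p"
      unfolding forall_3 by (simp add: frame_Z_def FZ cZ)
    then show "frame_Z p $ i \<in> normal_space Z p" for i by blast
    fix c assume c: "frame_comb (frame_Z p) c = 0"
    have n: "frame_comb (F p) (first_two c) \<bullet> grad p = 0"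
      by (rule normal_space_orthogonal[OF frame_comb_normal[OF framing_M pM] grad_tangent[OF pM]])
    have "(frame_comb (F p) (first_two c) + (c $ 3) *\<^sub>R circle_normal M s p) \<bullet> grad p = 0"
      using c by (simp add: frame_comb_frame_Z)
    then have c3: "c $ 3 = 0" using n grad_nonzero[OF p] by (simp add: inner_add_left circle_normal_eq[OF p])
    then have "frame_comb (F p) (first_two c) = 0" using c by (simp add: frame_comb_frame_Z)
    then have "first_two c = 0" by (rule framing_frame_comb_eq_0[OF framing_M pM])
    then show "c = 0" using c3 by (simp add: first_two_def vec2_eq_iff vec3_eq_iff)
  qed
  then show ?thesis using submanifold_Z by (simp add: framed_closed_submanifold_def)
qed

text \<open>After the rotation the lift is compared with the collapse of \<open>(v\<^sub>1, v\<^sub>2, v\<^sub>3)\<close> near the preimage. The first two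
  fibre coordinates agree to first order with those of the tube of \<open>M\<close>. The third one agrees to first order with the angle
  at the foot in \<open>M\<close>, because the inner product with the gradient of the angle vanishes on \<open>v\<^sub>1\<close> and \<open>v\<^sub>2\<close> and is \<open>1\<close> on \<open>v\<^sub>3\<close>.\<close>

proposition level_set_collapse:
  assumes r: "tubular_radius M F r" and h: "0 < h" "4 * h < \<rho>" "h \<le> 1" "\<rho> \<le> r"
    and rZ: "tubular_radius Z frame_Z rZ"
  shows "pointed_homotopic (tube_lift M F r h \<rho> s 0) (collapse_map Z frame_Z rZ)"
proof -
  let ?f = "\<lambda>z. rot3 (tube_lift M F r h \<rho> s 0 z)"
  have s2: "s ` M \<subseteq> sphere 0 1" using unit by auto
  have h': "h < \<rho>" "r > 0" using h by auto
  have pl: "pointed_map (tube_lift M F r h \<rho> s 0)"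
    by (rule pointed_map_tube_lift[OF framed r h(1) h'(1) _ continuous_s s2]) (use h in auto)
  have pf: "pointed_map ?f" by (rule pointed_map_rot3[OF pl])
  have injt: "inj_on (tubular_map F) (M \<times> ball 0 r)" using r by (simp add: tubular_radius_def)
  have val: "?f z = rot3 (sgn (hopf_lift h \<rho> (cplx t) (s p)))"
    if "p \<in> M" "t \<in> ball 0 r" "z \<noteq> north" "stereo z = tubular_map F (p, t)" for z p t
    unfolding tube_lift_def by (subst tube_extend_eval[OF r that]) simp
  have S: "?f z = south \<longleftrightarrow> z \<noteq> north \<and> stereo z \<in> Z" for z
  proof (cases z rule: tube_extend_cases[OF r, where h = "\<lambda>x. sgn (hopf_lift h \<rho> (cplx (snd x) - of_real 0) (s (fst x)))"])
    case (1 p t)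
    have "?f z = south \<longleftrightarrow> cplx t = 0 \<and> s p = -1"
      unfolding val[OF 1(1-4)] by (rule rot3_hopf_lift_eq_south_iff[OF h(1) h'(1) unit[OF 1(1)]])
    also have "\<dots> \<longleftrightarrow> stereo z \<in> Z"
    proof
      assume "cplx t = 0 \<and> s p = -1"
      then show "stereo z \<in> Z" using 1(1,4) by (simp add: tubular_map_eq preimage_of_minus_one_def)
    next
      assume z: "stereo z \<in> Z"
      have "(stereo z, 0) = (p, t)"
        by (rule inj_onD[OF injt]) (use z Z_subset 1 h' in \<open>auto simp: tubular_map_eq\<close>)
      then show "cplx t = 0 \<and> s p = -1" using z by (auto simp: preimage_of_minus_one_def)
    qed
    finally show ?thesis using 1(3) by simp
  next
    case 2
    have "?f z = north" using 2(2) by (simp add: tube_lift_def rot3_def north_def vec3_eq_iff)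
    moreover have "stereo z \<in> tubular_map F ` (M \<times> ball 0 r)" if "stereo z \<in> Z"
      by (rule image_eqI[of _ _ "(stereo z, 0)"]) (use that Z_subset h' in \<open>auto simp: tubular_map_eq\<close>)
    ultimately show ?thesis using 2(1) north_neq_south by metis
  qed
  have cF: "continuous_on M F" using framing_M by (simp add: framing_def)
  obtain B \<delta>0 where B: "B > 0" "\<delta>0 > 0" "\<forall>p\<in>M. \<forall>c. norm (frame_comb (F p) c) \<le> B * norm c"
    "\<forall>p\<in>M. \<forall>c. \<delta>0 * norm c \<le> norm (frame_comb (F p) c)"
    by (rule frame_bounds[OF compact_M cF framing_frame_comb_eq_0[OF framing_M]])
  have fZ: "framing Z frame_Z" using framed_Z by (simp add: framed_closed_submanifold_def)
  have cfZ: "continuous_on Z frame_Z" using fZ by (simp add: framing_def)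
  obtain BZ \<delta>Z where BZ: "BZ > 0" "\<delta>Z > 0" "\<forall>p\<in>Z. \<forall>c. norm (frame_comb (frame_Z p) c) \<le> BZ * norm c"
    "\<forall>p\<in>Z. \<forall>c. \<delta>Z * norm c \<le> norm (frame_comb (frame_Z p) c)"
    by (rule frame_bounds[OF compact_Z cfZ framing_frame_comb_eq_0[OF fZ]])
  obtain C where C: "C \<ge> 0" "\<forall>p\<in>M. \<forall>x\<in>M. \<bar>angle x - angle p - grad p \<bullet> (x - p)\<bar> \<le> C * (norm (x - p))\<^sup>2"
    unfolding grad_def by (rule tangential_gradient_estimate[OF submanifold smooth_angle])
  have cg: "continuous_on M grad" unfolding grad_def by (rule continuous_on_tangential_gradient[OF submanifold smooth_angle])
  obtain Bg where Bg: "Bg > 0" "\<And>p. p \<in> M \<Longrightarrow> norm (grad p) \<le> Bg"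
    using compact_imp_bounded[OF compact_continuous_image[OF cg compact_M]] unfolding bounded_pos by auto
  define K where "K = (BZ + 1) / \<delta>0 + C * (BZ + 1) + Bg"
  have K: "K > 0" "(BZ + 1) / \<delta>0 \<le> K" "C * (BZ + 1) + Bg \<le> K"
    using B(2) BZ(1) C(1) Bg(1) by (auto simp: K_def add_pos_pos add_pos_nonneg)
  \<comment> \<open>\<open>K\<close> collects the factors of all errors; with \<open>m \<le> 3 * norm T\<close> below, an error of \<open>m / 24\<close> is at most \<open>norm T / 8\<close>\<close>
  define \<eta> where "\<eta> = 1 / (24 * K)"
  have \<eta>: "\<eta> > 0" "\<eta> * K = 1/24" using K(1) by (auto simp: \<eta>_def)
  obtain \<delta> where \<delta>: "\<delta> > 0" and fc: "\<forall>x\<in>M. \<forall>q\<in>M. \<forall>u \<nu>. norm u < \<delta> \<longrightarrow> norm \<nu> < \<delta> \<longrightarrow> x + frame_comb (F x) u = q + \<nu> \<longrightarrow>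
      norm (x - q) < \<eta> \<and> norm (frame_comb (F x - F q) u) \<le> \<eta> * norm u \<and>
      (\<forall>n\<in>normal_space M q. \<bar>n \<bullet> (\<nu> - frame_comb (F q) u)\<bar> \<le> \<eta> * norm n * (norm \<nu> + norm u)) \<and>
      (norm (x - q))\<^sup>2 \<le> \<eta> * (norm \<nu> + norm u)"
    by (rule fibre_comparison[OF submanifold cF \<eta>(1)])
  have rZ0: "rZ > 0" using rZ by (simp add: tubular_radius_def)
  define d where "d = min (min (h / 4) r) (min \<delta> (min rZ (\<delta> / BZ)))"
  have d: "d > 0" using h h' \<delta> rZ0 BZ(1) by (simp add: d_def)
  have d': "d \<le> h / 4" "d \<le> r" "d \<le> \<delta>" "d \<le> rZ" "d \<le> \<delta> / BZ" unfolding d_def by linarith+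
  define M' where "M' = {x \<in> M. Re (s x) < 0}"
  define W where "W = tubular_map frame_Z ` (Z \<times> ball 0 d) \<inter> tubular_map F ` (M' \<times> ball 0 d)"
  have oM': "openin (top_of_set M) M'"
  proof -
    have "openin (top_of_set M) (M \<inter> (\<lambda>x. Re (s x)) -` {..<0})"
      by (rule continuous_openin_preimage_gen) (auto intro!: continuous_intros continuous_s)
    moreover have "M \<inter> (\<lambda>x. Re (s x)) -` {..<0} = M'" by (auto simp: M'_def)
    ultimately show ?thesis by simp
  qed
  have "openin (top_of_set (ball (0::real^2) r)) (ball 0 d)" "openin (top_of_set (ball (0::real^3) rZ)) (ball 0 d)"
    using d' by (auto intro!: open_openin_trans)
  then have oW: "open W" unfolding W_def
    by (intro open_Int open_tubular_image[OF framed_Z rZ] open_tubular_image[OF framed r] openin_Times oM') auto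
  have "pointed_homotopic ?f (collapse_map Z frame_Z rZ)"
  proof (rule collapse_map_criterion[OF framed_Z rZ pf S oW])
    show "Z \<subseteq> W"
    proof
      fix y assume y: "y \<in> Z"
      have "y \<in> tubular_map frame_Z ` (Z \<times> ball 0 d)"
        by (rule image_eqI[of _ _ "(y, 0)"]) (use y d in \<open>auto simp: tubular_map_eq\<close>)
      moreover have "y \<in> tubular_map F ` (M' \<times> ball 0 d)"
        by (rule image_eqI[of _ _ "(y, 0)"]) (use y d in \<open>auto simp: tubular_map_eq M'_def preimage_of_minus_one_def\<close>)
      ultimately show "y \<in> W" by (simp add: W_def)
    qed
    fix y assume "y \<in> W"
    then obtain p T x t where p: "p \<in> Z" "norm T < d" "y = tubular_map frame_Z (p, T)"
      and x: "x \<in> M" "Re (s x) < 0" "norm t < d" "y = tubular_map F (x, t)"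
      unfolding W_def M'_def by fastforce
    have pM: "p \<in> M" using p(1) Z_subset by auto
    define \<nu> where "\<nu> = frame_comb (frame_Z p) T"
    define c where "c = first_two T - t"
    define m where "m = norm T + norm t"
    have n\<nu>: "norm \<nu> \<le> BZ * norm T" unfolding \<nu>_def using BZ(3) p(1) by blast
    also have "\<dots> < BZ * (\<delta> / BZ)" using p(2) d'(5) BZ(1) by (intro mult_strict_left_mono) auto
    finally have n\<nu>': "norm \<nu> < \<delta>" using BZ(1) by simp
    have nm: "norm \<nu> + norm t \<le> (BZ + 1) * m"
    proof -
      have "0 \<le> BZ * norm t" using BZ(1) by simp
      moreover have "(BZ + 1) * m = BZ * norm T + norm T + BZ * norm t + norm t" by (simp add: m_def algebra_simps)
      ultimately show ?thesis using n\<nu> norm_ge_zero[of T] by linarith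
    qed
    have e: "x + frame_comb (F x) t = p + \<nu>" using p(3) x(4) by (simp add: tubular_map_eq \<nu>_def)
    have ntd: "norm t < \<delta>" using x(3) d'(3) by simp
    have fc': "norm (frame_comb (F x - F p) t) \<le> \<eta> * norm t" "(norm (x - p))\<^sup>2 \<le> \<eta> * (norm \<nu> + norm t)"
      "\<And>n. n \<in> normal_space M p \<Longrightarrow> \<bar>n \<bullet> (\<nu> - frame_comb (F p) t)\<bar> \<le> \<eta> * norm n * (norm \<nu> + norm t)"
      using fc[rule_format, OF x(1) pM ntd n\<nu>' e] by auto
    have v3: "circle_normal M s p = grad p /\<^sub>R (grad p \<bullet> grad p)" by (rule circle_normal_eq[OF p(1)])
    have gg: "grad p \<bullet> grad p \<noteq> 0" using grad_nonzero[OF p(1)] by simp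
    \<comment> \<open>\<open>n\<close> is orthogonal to \<open>v\<^sub>3\<close>, so pairing with it isolates the first two coordinates\<close>
    define n where "n = frame_comb (F p) c"
    have nN: "n \<in> normal_space M p" unfolding n_def by (rule frame_comb_normal[OF framing_M pM])
    have ng: "n \<bullet> grad p = 0" by (rule normal_space_orthogonal[OF nN grad_tangent[OF pM]])
    have split: "\<nu> - frame_comb (F p) t = n + (T $ 3) *\<^sub>R circle_normal M s p"
      by (simp add: \<nu>_def n_def c_def frame_comb_frame_Z frame_comb_diff)
    have "n \<bullet> (\<nu> - frame_comb (F p) t) = n \<bullet> n" unfolding split v3 using ng by (simp add: inner_add_right)
    then have "norm n * norm n \<le> \<eta> * norm n * (norm \<nu> + norm t)"
      using fc'(3)[OF nN] by (simp add: power2_norm_eq_inner[symmetric] power2_eq_square)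
    then have "norm n \<le> \<eta> * (norm \<nu> + norm t)"
      using \<eta>(1) by (cases "norm n = 0") (auto simp: mult.assoc mult.left_commute)
    also have "\<dots> \<le> \<eta> * ((BZ + 1) * m)" by (rule mult_left_mono[OF nm]) (use \<eta>(1) in simp)
    finally have n1: "norm n \<le> \<eta> * ((BZ + 1) * m)" .
    have m0: "0 \<le> m" by (simp add: m_def)
    have "\<delta>0 * norm c \<le> norm n" unfolding n_def using B(4) pM by blast
    then have "norm c \<le> \<eta> * ((BZ + 1) * m) / \<delta>0" using n1 B(2) by (simp add: field_simps)
    also have "\<dots> = ((BZ + 1) / \<delta>0) * (\<eta> * m)" by simp
    also have "\<dots> \<le> K * (\<eta> * m)" by (rule mult_right_mono[OF K(2)]) (use \<eta>(1) m0 in simp)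
    also have "\<dots> = (\<eta> * K) * m" by simp
    finally have nc: "norm c \<le> m / 24" unfolding \<eta>(2) by simp
    \<comment> \<open>pairing with the gradient isolates the third coordinate\<close>
    have xp: "x - p = n + (T $ 3) *\<^sub>R circle_normal M s p - frame_comb (F x - F p) t"
      using e split by (simp add: frame_comb_diff_left algebra_simps)
    have "grad p \<bullet> (x - p) = T $ 3 - grad p \<bullet> frame_comb (F x - F p) t"
      unfolding xp v3 using ng gg by (simp add: inner_add_right inner_diff_right inner_commute)
    moreover have "angle p = 0" using p(1) by (simp add: preimage_of_minus_one_def angle_def)
    ultimately have "\<bar>angle x - T $ 3\<bar> \<le> \<bar>angle x - angle p - grad p \<bullet> (x - p)\<bar> + \<bar>grad p \<bullet> frame_comb (F x - F p) t\<bar>"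
      by linarith
    also have "\<dots> \<le> C * (norm (x - p))\<^sup>2 + norm (grad p) * norm (frame_comb (F x - F p) t)"
      using C(2) x(1) pM by (intro add_mono Cauchy_Schwarz_ineq2) auto
    also have "\<dots> \<le> C * (\<eta> * ((BZ + 1) * m)) + Bg * (\<eta> * m)"
    proof (intro add_mono mult_left_mono mult_mono C(1))
      show "(norm (x - p))\<^sup>2 \<le> \<eta> * ((BZ + 1) * m)"
        by (rule order_trans[OF fc'(2) mult_left_mono[OF nm]]) (use \<eta>(1) in simp)
      show "norm (grad p) \<le> Bg" by (rule Bg(2)[OF pM])
      have "\<eta> * norm t \<le> \<eta> * m" using \<eta>(1) by (intro mult_left_mono) (auto simp: m_def)
      then show "norm (frame_comb (F x - F p) t) \<le> \<eta> * m" using fc'(1) by simp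
    qed (use Bg in auto)
    also have "\<dots> = (C * (BZ + 1) + Bg) * (\<eta> * m)" by (simp add: algebra_simps)
    also have "\<dots> \<le> K * (\<eta> * m)" by (rule mult_right_mono[OF K(3)]) (use \<eta>(1) m0 in simp)
    also have "\<dots> = (\<eta> * K) * m" by simp
    finally have na: "\<bar>angle x - T $ 3\<bar> \<le> m / 24" unfolding \<eta>(2) by simp
    have "norm t \<le> norm (first_two T) + norm c" using norm_triangle_ineq4[of "first_two T" c] by (simp add: c_def)
    moreover have "norm c \<le> norm T / 24 + norm t / 24" using nc by (simp add: m_def add_divide_distrib)
    ultimately have mT: "m \<le> 3 * norm T" using norm_first_two_le[of T] norm_ge_zero[of T] unfolding m_def by linarith
    have c12: "\<bar>Re (cplx t) - T $ 1\<bar> \<le> norm c" "\<bar>Im (cplx t) - T $ 2\<bar> \<le> norm c"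
      using component_le_norm_cart[of c 1] component_le_norm_cart[of c 2] by (simp_all add: c_def first_two_def abs_minus_commute)
    have fv: "?f (stereo_inv y) = rot3 (sgn (hopf_lift h \<rho> (cplx t) (s x)))"
      by (rule val[OF x(1)]) (use x(3,4) d'(2) in auto)
    have "T = 0" if k: "k > 0" "fst (?f (stereo_inv y)) = - (k *\<^sub>R T)" for k
    proof (rule rot3_hopf_lift_near[OF h(1,2,3) unit[OF x(1)] x(2) k(1), of "cplx t"])
      show "cmod (cplx t) < h / 4" using x(3) d'(1) by simp
      show "\<bar>Re (cplx t) - T $ 1\<bar> \<le> norm T / 8" "\<bar>Im (cplx t) - T $ 2\<bar> \<le> norm T / 8"
        using c12 nc mT by linarith+
      show "\<bar>- Im (s x) - T $ 3\<bar> \<le> norm T / 8" using na mT unfolding angle_def by linarith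
      show "fst (rot3 (sgn (hopf_lift h \<rho> (cplx t) (s x)))) = - (k *\<^sub>R T)" using k(2) fv by simp
    qed
    then show "\<exists>p\<in>Z. \<exists>t\<in>ball 0 rZ. y = tubular_map frame_Z (p, t) \<and>
       (\<forall>k>0. fst (?f (stereo_inv y)) = - (k *\<^sub>R t) \<longrightarrow> t = 0)"
      using p d'(4) by (intro bexI[of _ p] bexI[of _ T]) auto
  qed
  then show ?thesis using rot3_homotopic[OF pl] pointed_homotopic_trans by blast
qed

end

section \<open>Existence of regular representatives\<close>

lemma smooth_on_real_polynomial:
  assumes "real_polynomial_function p" shows "smooth_on UNIV p"
  using assms
  by induction (auto intro: smooth_on_bounded_linear smooth_on_const smooth_on_add smooth_on_mult)

lemma smooth_on_polynomial:
  fixes p :: "'a::real_normed_vector \<Rightarrow> 'b::euclidean_space"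
  assumes "polynomial_function p" shows "smooth_on UNIV p"
proof (rule smooth_on_componentwise[OF open_UNIV])
  fix b :: 'b
  have "real_polynomial_function ((\<lambda>z. z \<bullet> b) \<circ> p)"
    using assms bounded_linear_inner_left unfolding polynomial_function_def by blast
  from smooth_on_real_polynomial[OF this] show "smooth_on UNIV (\<lambda>x. p x \<bullet> b)" by (simp add: comp_def)
qed

lemma smooth_on_Pair:
  fixes f :: "'a::real_normed_vector \<Rightarrow> 'b::real_normed_vector" and g :: "'a \<Rightarrow> 'c::real_normed_vector"
  assumes "open U" "smooth_on U f" "smooth_on U g"
  shows "smooth_on U (\<lambda>x. (f x, g x))"
proof -
  have b: "bounded_linear (\<lambda>x. (x, 0) :: 'b \<times> 'c)" "bounded_linear (\<lambda>x. (0, x) :: 'b \<times> 'c)"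
    by (intro bounded_linear_Pair bounded_linear_ident bounded_linear_zero)+
  have "smooth_on U (\<lambda>x. (f x, 0) + (0, g x))"
    by (intro smooth_on_add assms(1) smooth_on_linear_compose[OF assms(1) b(1) assms(2)]
        smooth_on_linear_compose[OF assms(1) b(2) assms(3)])
  then show ?thesis by simp
qed

lemma normal_space_frame_comb:
  fixes F :: "'a::euclidean_space \<Rightarrow> 'a ^ 'k"
  assumes F: "framed_closed_submanifold N F" and p: "p \<in> N" and n: "n \<in> normal_space N p"
  obtains c where "n = frame_comb (F p) c"
proof -
  have N: "closed_submanifold CARD('k) N" and fr: "framing N F" using F by (auto simp: framed_closed_submanifold_def)
  have lin: "linear (frame_comb (F p))"
    by (rule linearI) (simp_all add: frame_comb_add frame_comb_scaleR)
  have inj: "inj (frame_comb (F p))"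
    unfolding linear_injective_0[OF lin] using framing_frame_comb_eq_0[OF fr p] by blast
  have "dim (range (frame_comb (F p))) = CARD('k)"
    using dim_image_eq[OF lin, of UNIV] inj by simp
  then have "range (frame_comb (F p)) = normal_space N p"
    using dim_normal_space[OF N p] frame_comb_normal[OF fr p]
    by (intro subspace_dim_equal linear_subspace_image[OF lin] subspace_normal_space) auto
  then show ?thesis using n that by blast
qed

text \<open>A family of perturbations of \<open>S\<close>. The second parameter enters by its direction only, but with its
  modulus the parameters form an open subset of a Euclidean space, in which negligible sets are available.\<close>

definition circle_twist :: "('a::euclidean_space \<Rightarrow> complex) \<Rightarrow> 'a \<times> complex \<Rightarrow> 'a \<Rightarrow> complex" where
  "circle_twist S ac x = S x * cis (fst ac \<bullet> x) * sgn (snd ac)"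

text \<open>In the application \<open>g\<close> is the gradient of the argument of \<open>S\<close>, so that \<open>g x + a\<close> is the gradient of the argument of the
  twist, and the twist is critical at \<open>x\<close> if this vector is normal. The critical twists are thus parametrised by a point \<open>x\<close> of the
  submanifold, a normal vector and a modulus, which is one dimension less than the space of all twists. The unit
  normal \<open>e\<close> of the slice stores the modulus.\<close>

lemma critical_twists_locally_negligible:
  fixes M :: "(real ^ 'm) set" and F :: "real ^ 'm \<Rightarrow> (real ^ 'm) ^ 2"
  assumes F: "framed_closed_submanifold M F" and sm: "smooth_map_on M F"
    and U0: "open U0" "smooth_on U0 S" "smooth_on U0 g" "\<And>x. x \<in> U0 \<Longrightarrow> cmod (S x) = 1"
    and p: "p \<in> M" "p \<in> U0"
  shows "\<exists>O'. open O' \<and> p \<in> O' \<and> negligible {ac. snd ac \<noteq> 0 \<and> (\<exists>x\<in>M \<inter> O'. circle_twist S ac x = -1 \<and> g x + fst ac \<in> normal_space M x)}"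
proof -
  have M: "closed_submanifold 2 M" using F by (simp add: framed_closed_submanifold_def)
  obtain U V \<phi> \<psi> L where c: "p \<in> U" "slice_chart M U V \<phi> \<psi> L" "dim L + 2 = CARD('m)"
    using M p(1) unfolding closed_submanifold_iff by auto
  note cD = slice_chartD[OF c(2)]
  obtain U' Ft where U': "open U'" "p \<in> U'" "smooth_on U' Ft" "\<forall>x\<in>M \<inter> U'. F x = Ft x"
    by (rule smooth_map_onE[OF sm p(1)])
  define O' where "O' = U \<inter> U' \<inter> U0"
  have oO: "open O'" unfolding O'_def by (intro open_Int cD(1) U'(1) U0(1))
  have pO: "p \<in> O'" using c(1) U'(2) p(2) by (simp add: O'_def)
  define V' where "V' = V \<inter> \<psi> -` O'"
  have oV': "open V'" unfolding V'_def by (rule continuous_open_preimage[OF cD(13,2) oO])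
  have s\<psi>: "smooth_on V' \<psi>" by (rule smooth_on_subset[OF cD(4)]) (auto simp: V'_def)
  have dL: "dim L < DIM(real ^ 'm)" using c(3) by simp
  obtain e' where e': "e' \<noteq> 0" "\<And>y. y \<in> span L \<Longrightarrow> orthogonal e' y"
    using orthogonal_to_subspace_exists[OF dL] by metis
  define e where "e = sgn e'"
  have e1: "e \<bullet> e = 1" using e'(1) by (simp add: e_def norm_sgn power2_norm_eq_inner[symmetric])
  have eL: "y \<bullet> e = 0" if "y \<in> L" for y
    using e'(2)[OF span_base[OF that]] by (simp add: e_def sgn_div_norm orthogonal_def inner_commute)
  define q where "q y = y - (y \<bullet> e) *\<^sub>R e" for y
  define D where "D = {z :: (real ^ 'm) \<times> (real ^ 2). q (fst z) \<in> V'}"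
  have cq: "continuous_on UNIV (\<lambda>z :: (real ^ 'm) \<times> (real ^ 2). q (fst z))"
    unfolding q_def by (intro continuous_intros)
  have oD: "open D" using open_vimage[OF oV' cq] by (simp add: D_def vimage_def)
  define X where "X z = \<psi> (q (fst z))" for z :: "(real ^ 'm) \<times> (real ^ 2)"
  have sq: "smooth_on D (\<lambda>z. q (fst z))" unfolding q_def
    by (intro smooth_on_diff smooth_on_scaleR smooth_on_inner smooth_on_const smooth_on_bounded_linear bounded_linear_fst oD)
  have sX: "smooth_on D X" unfolding X_def
    by (rule smooth_on_compose[OF oD oV' _ sq s\<psi>]) (auto simp: D_def)
  have XO: "X z \<in> O'" if "z \<in> D" for z using that by (simp add: D_def V'_def X_def)
  have comp: "smooth_on D (\<lambda>z. h (X z))" if "smooth_on O' h" for h :: "real ^ 'm \<Rightarrow> 'c::real_normed_vector"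
    by (rule smooth_on_compose[OF oD oO _ sX that]) (use XO in auto)
  have sO: "smooth_on O' Ft" "smooth_on O' S" "smooth_on O' g"
    by (rule smooth_on_subset[OF U'(3)] smooth_on_subset[OF U0(2)] smooth_on_subset[OF U0(3)]; auto simp: O'_def)+
  define A where "A z = - g (X z) + frame_comb (Ft (X z)) (snd z)" for z
  have sA: "smooth_on D A" unfolding A_def frame_comb_def
    by (intro smooth_on_add smooth_on_minus smooth_on_sum smooth_on_scaleR smooth_on_nth comp sO oD
        smooth_on_bounded_linear bounded_linear_snd)
  define f where "f z = (A z, - ((fst z \<bullet> e) *\<^sub>R (cnj (S (X z)) * cis (- (A z \<bullet> X z)))))" for z
  have sf: "smooth_on D f" unfolding f_def
    by (intro smooth_on_Pair smooth_on_minus smooth_on_scaleR smooth_on_mult smooth_on_cis smooth_on_inner sA sX oD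
        smooth_on_const smooth_on_linear_compose[OF oD bounded_linear_cnj] comp sO smooth_on_bounded_linear bounded_linear_fst)
  define H where "H = span (insert e L) \<times> (UNIV :: (real ^ 2) set)"
  have "dim (span (insert e L)) \<le> dim L + 1" by (simp add: dim_insert)
  then have "dim H < DIM((real ^ 'm) \<times> (real ^ 2))"
    unfolding H_def using c(3) by (simp add: dim_Times)
  then have "negligible H" by (rule negligible_lowdim)
  then have "negligible (H \<inter> D)" by (rule negligible_subset) auto
  moreover have "f differentiable_on (H \<inter> D)"
    unfolding differentiable_on_def
    using smooth_onD[OF sf] by (auto simp: differentiable_def intro: has_derivative_at_withinI)
  ultimately have neg: "negligible (f ` (H \<inter> D))"
    by (intro negligible_differentiable_image_negligible) auto
  have "{ac. snd ac \<noteq> 0 \<and> (\<exists>x\<in>M \<inter> O'. circle_twist S ac x = -1 \<and> g x + fst ac \<in> normal_space M x)} \<subseteq> f ` (H \<inter> D)"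
  proof clarsimp
    fix a and cc :: complex and x
    assume cc: "cc \<noteq> 0" and x: "x \<in> M" "x \<in> O'" and tw: "circle_twist S (a, cc) x = -1" and no: "g x + a \<in> normal_space M x"
    obtain n where n: "g x + a = frame_comb (F x) n" by (rule normal_space_frame_comb[OF F x(1) no])
    have xU: "x \<in> U" "x \<in> U'" "x \<in> U0" using x(2) by (auto simp: O'_def)
    define y where "y = \<phi> x"
    have y: "y \<in> V" "\<psi> y = x" "y \<in> L" using cD(6,7,10) xU(1) x(1) by (auto simp: y_def)
    define z where "z = (y + cmod cc *\<^sub>R e, n)"
    have ze: "fst z \<bullet> e = cmod cc" using eL[OF y(3)] e1 by (simp add: z_def inner_add_left)
    then have qz: "q (fst z) = y" by (simp add: q_def z_def)
    have Xz: "X z = x" using qz y(2) by (simp add: X_def)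
    have zD: "z \<in> D" using qz y x(2) by (simp add: D_def V'_def)
    have "y + cmod cc *\<^sub>R e \<in> span (insert e L)"
      using y(3) by (intro span_add span_scale span_base) auto
    then have zH: "z \<in> H" by (simp add: H_def z_def)
    have "Ft x = F x" using U'(4) x(1) xU(2) by auto
    then have Az: "A z = a" using n by (simp add: A_def Xz) (simp add: z_def algebra_simps)
    have S1: "cnj (S x) * S x = 1" using U0(4)[OF xU(3)] complex_norm_square[of "S x"] by (simp add: mult.commute)
    have ci: "cis (- (a \<bullet> x)) * cis (a \<bullet> x) = 1" by (simp add: cis_mult)
    have tw': "S x * cis (a \<bullet> x) * sgn cc = -1" using tw by (simp add: circle_twist_def)
    have "cnj (S x) * cis (- (a \<bullet> x)) * (S x * cis (a \<bullet> x) * sgn cc) = (cnj (S x) * S x) * (cis (- (a \<bullet> x)) * cis (a \<bullet> x)) * sgn cc"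
      by (simp only: mult_ac)
    then have "sgn cc = - (cnj (S x) * cis (- (a \<bullet> x)))" unfolding tw' S1 ci by simp
    moreover have "cc = cmod cc *\<^sub>R sgn cc" using cc by (simp add: sgn_div_norm)
    ultimately have "cc = - (cmod cc *\<^sub>R (cnj (S x) * cis (- (a \<bullet> x))))" by (metis scaleR_minus_right)
    then have "f z = (a, cc)" unfolding f_def Az Xz ze by simp
    then show "(a, cc) \<in> f ` (H \<inter> D)" using zH zD by (metis IntI imageI)
  qed
  then have "negligible {ac. snd ac \<noteq> 0 \<and> (\<exists>x\<in>M \<inter> O'. circle_twist S ac x = -1 \<and> g x + fst ac \<in> normal_space M x)}"
    by (rule negligible_subset[OF neg])
  then show ?thesis using oO pO by blast
qed

lemma homotopic_circle_maps_close:
  fixes s s' :: "'a::euclidean_space \<Rightarrow> complex"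
  assumes s: "continuous_on M s" "\<And>x. x \<in> M \<Longrightarrow> cmod (s x) = 1"
    and s': "continuous_on M s'" "\<And>x. x \<in> M \<Longrightarrow> cmod (s' x) = 1"
    and close: "\<And>x. x \<in> M \<Longrightarrow> cmod (s' x - s x) < 1"
  shows "homotopic_with_canon (\<lambda>_. True) M (sphere 0 1) s s'"
proof (subst homotopic_with)
  define h where "h z = sgn (s (snd z) + fst z *\<^sub>R (s' (snd z) - s (snd z)))" for z :: "real \<times> 'a"
  have nz: "s x + \<tau> *\<^sub>R (s' x - s x) \<noteq> 0" if "x \<in> M" "\<tau> \<in> {0..1}" for x \<tau>
  proof
    assume "s x + \<tau> *\<^sub>R (s' x - s x) = 0"
    then have "s x = - (\<tau> *\<^sub>R (s' x - s x))" by (simp add: eq_neg_iff_add_eq_0)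
    then have "cmod (s x) = \<bar>\<tau>\<bar> * cmod (s' x - s x)" by (metis norm_minus_cancel norm_scaleR)
    also have "\<dots> \<le> 1 * cmod (s' x - s x)" using that by (intro mult_right_mono) auto
    finally show False using close[OF that(1)] s(2)[OF that(1)] by simp
  qed
  have c: "continuous_on ({0..1} \<times> M) h" unfolding h_def
    by (intro continuous_intros continuous_on_compose2[OF s(1)] continuous_on_compose2[OF s'(1)]) (use nz in auto)
  have n: "norm (h z) = 1" if "z \<in> {0..1} \<times> M" for z
    using nz[of "snd z" "fst z"] that by (auto simp: h_def norm_sgn)
  have "sgn v = v" if "cmod v = 1" for v using that by (simp add: sgn_div_norm)
  then have e: "h (0, x) = s x" "h (1, x) = s' x" if "x \<in> M" for x
    using that s(2) s'(2) by (auto simp: h_def)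
  show "\<exists>h. continuous_map (prod_topology (top_of_set {0..1::real}) (top_of_set M)) (top_of_set (sphere 0 1)) h \<and>
        (\<forall>x\<in>topspace (top_of_set M). h (0, x) = s x) \<and>
        (\<forall>x\<in>topspace (top_of_set M). h (1, x) = s' x) \<and> (\<forall>t\<in>{0..1}. True)"
    by (rule exI[of _ h]) (use c n e in \<open>simp add: image_subset_iff Pi_iff\<close>)
qed simp

lemma norm_cis_minus_one_le: "cmod (cis t - 1) \<le> \<bar>t\<bar>"
proof -
  have "(cmod (cis t - 1))\<^sup>2 = (cos t - 1)\<^sup>2 + (sin t)\<^sup>2" by (simp add: cmod_power2)
  also have "\<dots> = 2 - 2 * cos t" using sin_cos_squared_add[of t] by (simp add: power2_eq_square algebra_simps)
  also have "\<dots> = (2 * sin (t / 2))\<^sup>2" using cos_double_sin[of "t / 2"] by (simp add: power_mult_distrib)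
  also have "\<dots> \<le> \<bar>t\<bar>\<^sup>2"
    using abs_sin_x_le_abs_x[of "t / 2"] by (subst abs_le_square_iff[symmetric]) (simp add: abs_mult)
  finally show ?thesis by (rule power2_le_imp_le) simp
qed

text \<open>A polynomial approximation of \<open>s\<close>, divided by its modulus, is smooth near \<open>M\<close>. By compactness the critical twists of it form a
  negligible set, so some twist close to the identity is regular; it is close to \<open>s\<close> and hence homotopic to it.\<close>

lemma regular_representative_exists:
  fixes M :: "(real ^ 'm) set" and F :: "real ^ 'm \<Rightarrow> (real ^ 'm) ^ 2"
  assumes F: "framed_closed_submanifold M F" and sm: "smooth_map_on M F"
    and s: "continuous_on M s" "\<And>x. x \<in> M \<Longrightarrow> cmod (s x) = 1"
  obtains s' where "regular_representative M s s'"
proof -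
  have M: "closed_submanifold 2 M" using F by (simp add: framed_closed_submanifold_def)
  then have cM: "compact M" by (simp add: closed_submanifold_def)
  obtain p where p: "polynomial_function p" "\<And>x. x \<in> M \<Longrightarrow> cmod (s x - p x) < 1/4"
    using Stone_Weierstrass_polynomial_function[OF cM s(1), of "1/4"] by auto
  have sp: "smooth_on UNIV p" by (rule smooth_on_polynomial[OF p(1)])
  define U0 where "U0 = p -` (- {0})"
  have oU0: "open U0" unfolding U0_def by (rule open_vimage) (use smooth_on_continuous[OF sp] in auto)
  have MU: "x \<in> U0" if "x \<in> M" for x
    using p(2)[OF that] s(2)[OF that] by (auto simp: U0_def)
  have spU: "smooth_on U0 p" by (rule smooth_on_subset[OF sp]) simp
  define S where "S x = inverse (sqrt (p x \<bullet> p x)) *\<^sub>R p x" for x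
  have S_sgn: "S x = sgn (p x)" for x by (simp add: S_def sgn_div_norm norm_eq_sqrt_inner)
  have sS: "smooth_on U0 S" unfolding S_def
    by (intro smooth_on_scaleR smooth_on_inverse smooth_on_sqrt smooth_on_inner spU oU0) (auto simp: U0_def)
  have S1: "cmod (S x) = 1" if "x \<in> U0" for x using that by (simp add: S_sgn norm_sgn U0_def)
  define g where "g x = (\<Sum>b\<in>Basis. ((\<i> * S x) \<bullet> frechet_derivative S (at x) b) *\<^sub>R b)" for x
  have sg: "smooth_on U0 g" unfolding g_def
    by (intro smooth_on_sum smooth_on_scaleR smooth_on_inner smooth_on_mult smooth_on_const smooth_on_derivative sS oU0)
  have DS: "frechet_derivative S (at x) v = \<i> * S x * of_real (g x \<bullet> v)" if x: "x \<in> U0" for x v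
  proof -
    let ?D = "frechet_derivative S (at x)"
    have D: "(S has_derivative ?D) (at x)" by (rule smooth_onD[OF sS x])
    have l: "linear ?D" using D has_derivative_linear by blast
    have "((\<lambda>x. S x \<bullet> S x) has_derivative (\<lambda>v. 2 * (S x \<bullet> ?D v))) (at x)"
      using D by (auto intro!: derivative_eq_intros simp: inner_commute)
    moreover have "((\<lambda>x. S x \<bullet> S x) has_derivative (\<lambda>v. 0)) (at x)"
    proof (rule has_derivative_transform_within_open[OF _ oU0 x])
      show "((\<lambda>x. 1::real) has_derivative (\<lambda>v. 0)) (at x)" by simp
      show "1 = S y \<bullet> S y" if "y \<in> U0" for y using S1[OF that] by (simp add: power2_norm_eq_inner[symmetric])
    qed
    ultimately have "(\<lambda>v. 2 * (S x \<bullet> ?D v)) = (\<lambda>v. 0)" by (rule has_derivative_unique)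
    then have orth: "S x \<bullet> ?D v = 0" for v by (metis mult_eq_0_iff zero_neq_numeral)
    have "?D v = (\<Sum>b\<in>Basis. (v \<bullet> b) *\<^sub>R ?D b)"
    proof -
      have "?D v = ?D (\<Sum>b\<in>Basis. (v \<bullet> b) *\<^sub>R b)" by (simp add: euclidean_representation)
      then show ?thesis using l by (simp add: linear_sum linear_cmul)
    qed
    then have "(\<i> * S x) \<bullet> ?D v = (\<Sum>b\<in>Basis. (v \<bullet> b) * ((\<i> * S x) \<bullet> ?D b))"
      by (simp only: inner_sum_right inner_scaleR_right)
    also have "\<dots> = g x \<bullet> v" unfolding g_def inner_sum_left inner_scaleR_left by (simp add: inner_commute mult.commute)
    finally have i: "(\<i> * S x) \<bullet> ?D v = g x \<bullet> v" .
    define w where "w = ?D v"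
    have n1: "(Re (S x))\<^sup>2 + (Im (S x))\<^sup>2 = 1" using S1[OF x] by (metis cmod_power2 one_power2)
    have o: "Re (S x) * Re w + Im (S x) * Im w = 0" using orth[of v] by (simp add: w_def inner_complex_def)
    have i': "- Im (S x) * Re w + Re (S x) * Im w = g x \<bullet> v" using i by (simp add: w_def inner_complex_def)
    have "Re w = ((Re (S x))\<^sup>2 + (Im (S x))\<^sup>2) * Re w" by (simp add: n1)
    also have "\<dots> = Re (S x) * (Re (S x) * Re w + Im (S x) * Im w) - Im (S x) * (- Im (S x) * Re w + Re (S x) * Im w)"
      by (simp add: power2_eq_square algebra_simps)
    finally have r: "Re w = - Im (S x) * (g x \<bullet> v)" unfolding o i' by simp
    have "Im w = ((Re (S x))\<^sup>2 + (Im (S x))\<^sup>2) * Im w" by (simp add: n1)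
    also have "\<dots> = Im (S x) * (Re (S x) * Re w + Im (S x) * Im w) + Re (S x) * (- Im (S x) * Re w + Re (S x) * Im w)"
      by (simp add: power2_eq_square algebra_simps)
    finally have "Im w = Re (S x) * (g x \<bullet> v)" unfolding o i' by simp
    then show ?thesis using r by (simp add: w_def[symmetric] complex_eq_iff)
  qed
  define Bad where "Bad O' = {ac :: (real ^ 'm) \<times> complex. snd ac \<noteq> 0 \<and> (\<exists>x\<in>M \<inter> O'. circle_twist S ac x = -1 \<and> g x + fst ac \<in> normal_space M x)}" for O'
  have "\<exists>O'. open O' \<and> p \<in> O' \<and> negligible (Bad O')" if "p \<in> M" for p
    unfolding Bad_def by (rule critical_twists_locally_negligible[OF F sm oU0 sS sg S1 that MU[OF that]])
  then obtain N where N: "\<And>p. p \<in> M \<Longrightarrow> open (N p)" "\<And>p. p \<in> M \<Longrightarrow> p \<in> N p" "\<And>p. p \<in> M \<Longrightarrow> negligible (Bad (N p))"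
    by metis
  have "M \<subseteq> (\<Union>p\<in>M. N p)" using N(2) by auto
  then obtain P where P: "P \<subseteq> M" "finite P" "M \<subseteq> (\<Union>p\<in>P. N p)"
    using compactE_image[OF cM, of M N] N(1) by auto
  have "Bad UNIV \<subseteq> (\<Union>p\<in>P. Bad (N p))" using P(3) unfolding Bad_def by blast
  moreover have "negligible (\<Union>p\<in>P. Bad (N p))"
    using P N(3) by (intro negligible_Union) auto
  ultimately have negB: "negligible (Bad UNIV)" using negligible_subset by blast
  obtain R where R: "R > 0" "\<And>x. x \<in> M \<Longrightarrow> norm x \<le> R"
    using compact_imp_bounded[OF cM] unfolding bounded_pos by auto
  have "isCont sgn (1::complex)" by (intro continuous_sgn continuous_ident) simp
  then obtain d where d: "d > 0" "\<And>c. dist c 1 < d \<Longrightarrow> dist (sgn c) (sgn (1::complex)) < 1/4"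
    unfolding continuous_at_eps_delta by (metis zero_less_divide_1_iff zero_less_numeral)
  define B where "B = ball (0 :: real ^ 'm) (1 / (4 * R)) \<times> ball (1::complex) (min d 1)"
  have oB: "open B" unfolding B_def by (intro open_Times) auto
  have "(0, 1) \<in> B" using R(1) d(1) by (simp add: B_def)
  then have "\<not> negligible B" using oB open_not_negligible by blast
  then have "\<not> B \<subseteq> Bad UNIV" using negB negligible_subset by blast
  then obtain a c where ac: "(a, c) \<in> B" "(a, c) \<notin> Bad UNIV" by auto
  have c0: "c \<noteq> 0" using ac(1) by (auto simp: B_def dist_norm)
  define s' where "s' = circle_twist S (a, c)"
  have s'eq: "s' x = S x * cis (a \<bullet> x) * sgn c" for x by (simp add: s'_def circle_twist_def)
  have ss': "smooth_on U0 s'" unfolding s'eq[abs_def]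
    by (intro smooth_on_mult smooth_on_cis smooth_on_inner smooth_on_const smooth_on_ident sS oU0)
  have s'1: "cmod (s' x) = 1" if "x \<in> U0" for x using S1[OF that] c0 by (simp add: s'eq norm_mult norm_sgn)
  have close: "cmod (s' x - s x) < 1" if x: "x \<in> M" for x
  proof -
    have "cmod (S x - p x) = \<bar>1 - cmod (p x)\<bar>"
    proof -
      have "cmod (p x) *\<^sub>R S x = p x" using MU[OF x] by (simp add: S_sgn sgn_div_norm U0_def)
      then have "S x - p x = (1 - cmod (p x)) *\<^sub>R S x" by (simp add: scaleR_left_diff_distrib)
      then show ?thesis using S1[OF MU[OF x]] by simp
    qed
    also have "\<dots> \<le> cmod (s x - p x)" using norm_triangle_ineq3[of "s x" "p x"] s(2)[OF x] by simp
    finally have 1: "cmod (S x - s x) < 1/2"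
      using p(2)[OF x] norm_triangle_ineq[of "S x - p x" "p x - s x"] by (simp add: norm_minus_commute)
    have "\<bar>a \<bullet> x\<bar> \<le> norm a * norm x" by (rule Cauchy_Schwarz_ineq2)
    also have "\<dots> \<le> 1 / (4 * R) * R" using ac(1) R(1) R(2)[OF x] by (intro mult_mono) (auto simp: B_def less_imp_le)
    finally have ax: "\<bar>a \<bullet> x\<bar> \<le> 1/4" using R(1) by simp
    have "cmod (cis (a \<bullet> x) - 1) \<le> \<bar>a \<bullet> x\<bar>" by (rule norm_cis_minus_one_le)
    then have 2: "cmod (cis (a \<bullet> x) - 1) \<le> 1/4" using ax by simp
    have 3: "cmod (sgn c - 1) < 1/4" using d(2)[of c] ac(1) by (simp add: B_def dist_norm norm_minus_commute)
    have "s' x - S x = S x * ((cis (a \<bullet> x) - 1) * sgn c + (sgn c - 1))" by (simp add: s'eq algebra_simps)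
    then have "cmod (s' x - S x) = cmod ((cis (a \<bullet> x) - 1) * sgn c + (sgn c - 1))"
      using S1[OF MU[OF x]] by (simp add: norm_mult)
    also have "\<dots> \<le> cmod (cis (a \<bullet> x) - 1) + cmod (sgn c - 1)"
      using norm_triangle_ineq[of "(cis (a \<bullet> x) - 1) * sgn c" "sgn c - 1"] c0 by (simp add: norm_mult norm_sgn)
    finally have "cmod (s' x - S x) < 1/2" using 2 3 by simp
    then show ?thesis using 1 norm_triangle_ineq[of "s' x - S x" "S x - s x"] by simp
  qed
  have "regular_representative M s s'"
    unfolding regular_representative_def
  proof (intro conjI ballI impI)
    show "smooth_map_on M s'"
      unfolding smooth_map_on_def using ss' oU0 MU by blast
    then have cs': "continuous_on M s'" by (rule smooth_map_on_continuous[OF cM])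
    show "homotopic_with_canon (\<lambda>_. True) M (sphere 0 1) s s'"
      by (rule homotopic_circle_maps_close[OF s cs' s'1[OF MU] close])
    fix x assume x: "x \<in> M" "s' x = -1"
    define u where "u = g x + a"
    have ds: "differential M s' x v = - (\<i> * of_real (u \<bullet> v))" if v: "v \<in> tangent_space M x" for v
    proof -
      have "(s' has_derivative (\<lambda>v. (\<i> * S x * of_real (g x \<bullet> v)) * cis (a \<bullet> x) * sgn c + S x * ((a \<bullet> v) *\<^sub>R (\<i> * cis (a \<bullet> x))) * sgn c)) (at x)"
        unfolding s'eq[abs_def] using smooth_onD[OF sS MU[OF x(1)]]
        by (auto intro!: derivative_eq_intros simp: fun_eq_iff DS[OF MU[OF x(1)]] algebra_simps)
      then have "frechet_derivative s' (at x) v = (\<i> * S x * of_real (g x \<bullet> v)) * cis (a \<bullet> x) * sgn c + S x * ((a \<bullet> v) *\<^sub>R (\<i> * cis (a \<bullet> x))) * sgn c"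
        by (rule fun_cong[OF frechet_derivative_at, symmetric])
      also have "\<dots> = \<i> * s' x * of_real (u \<bullet> v)"
        by (simp add: s'eq u_def scaleR_conv_of_real inner_add_left algebra_simps)
      finally show ?thesis using differential_eq[OF oU0 MU[OF x(1)] ss' _ v] x(2) by simp
    qed
    have "u \<notin> normal_space M x" using ac(2) c0 x unfolding Bad_def u_def s'_def by auto
    then obtain v0 where v0: "v0 \<in> tangent_space M x" "u \<bullet> v0 \<noteq> 0" using normal_spaceI by blast
    show "differential M s' x ` tangent_space M x = tangent_space (sphere 0 1) (-1)"
      unfolding tangent_space_circle
    proof (intro equalityI subsetI)
      fix w assume "w \<in> differential M s' x ` tangent_space M x"
      then show "w \<in> {z. Re z = 0}" using ds by auto
    next
      fix w :: complex assume w: "w \<in> {z. Re z = 0}"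
      define v where "v = (- Im w / (u \<bullet> v0)) *\<^sub>R v0"
      have v: "v \<in> tangent_space M x"
        unfolding v_def by (rule subspace_scale[OF subspace_tangent_space[OF M x(1)] v0(1)])
      have "differential M s' x v = w" unfolding ds[OF v] using w v0(2) by (simp add: v_def complex_eq_iff)
      then show "w \<in> differential M s' x ` tangent_space M x" using v by blast
    qed
  qed
  then show ?thesis by (rule that)
qed

section \<open>The class of the level set\<close>

lemma regular_representative_imp:
  assumes F: "framed_closed_submanifold M F" and s': "regular_representative M s s'"
  shows "regular_circle_map M F s'"
proof
  have "s' \<in> M \<rightarrow> sphere 0 1"
    using s' homotopic_with_imp_subset2 unfolding regular_representative_def by blast
  then show "cmod (s' x) = 1" if "x \<in> M" for x using that by auto
qed (use assms in \<open>auto simp: regular_representative_def\<close>)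

text \<open>The right-hand side depends only on the homotopy class of \<open>s\<close>, and for a regular representative it is the
  class of the framed level set.\<close>

lemma circle_class_eq:
  fixes M :: "(real ^ 'm) set" and F :: "real ^ 'm \<Rightarrow> (real ^ 'm) ^ 2"
  assumes F: "framed_closed_submanifold M F" and sm: "smooth_map_on M F"
    and s: "continuous_on M s" "s ` M \<subseteq> sphere 0 1"
    and r: "tubular_radius M F r" and h: "0 < h" "4 * h < \<rho>" "h \<le> 1" "\<rho> \<le> r"
  shows "circle_class M F s = homotopy_class (tube_lift M F r h \<rho> s 0)"
proof -
  have class_value: "pontryagin_class (preimage_of_minus_one M s') (\<lambda>x. vector [F x $ 1, F x $ 2, circle_normal M s' x])
      = homotopy_class (tube_lift M F r h \<rho> s 0)" if s': "regular_representative M s s'" for s'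
  proof -
    interpret regular_circle_map M F s' by (rule regular_representative_imp[OF F s'])
    obtain rZ where rZ: "tubular_radius Z frame_Z rZ" by (rule tubular_radius_exists[OF framed_Z])
    have "pontryagin_class Z frame_Z = homotopy_class (collapse_map Z frame_Z rZ)"
      by (rule pontryagin_class_eq[OF framed_Z rZ])
    also have "\<dots> = homotopy_class (tube_lift M F r h \<rho> s' 0)"
      by (rule homotopy_class_eqI[OF level_set_collapse[OF r h rZ], symmetric])
    also have "\<dots> = homotopy_class (tube_lift M F r h \<rho> s 0)"
    proof (rule homotopy_class_eqI[OF tube_lift_homotopic[OF F r h(1)], symmetric])
      show "homotopic_with_canon (\<lambda>_. True) M (sphere 0 1) s s'" using s' by (simp add: regular_representative_def)
    qed (use h in auto)
    finally show ?thesis by (simp add: frame_Z_def[abs_def])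
  qed
  have s1: "cmod (s x) = 1" if "x \<in> M" for x using s(2) that by auto
  obtain s0 where s0: "regular_representative M s s0" by (rule regular_representative_exists[OF F sm s(1) s1])
  show ?thesis unfolding circle_class_def
  proof (rule the_equality)
    show "\<exists>s'. regular_representative M s s' \<and> homotopy_class (tube_lift M F r h \<rho> s 0) =
        pontryagin_class (preimage_of_minus_one M s') (\<lambda>x. vector [F x $ 1, F x $ 2, circle_normal M s' x])"
      using s0 class_value[OF s0] by (intro exI[of _ s0]) simp
  qed (use class_value in auto)
qed

section \<open>The class of the double\<close>

theorem proposition2p1:
  fixes M :: "(real ^ 'm) set"
    and F :: "real ^ 'm \<Rightarrow> (real ^ 'm) ^ 2"
    and s :: "real ^ 'm \<Rightarrow> complex"
  assumes "CARD('m) \<ge> 3"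
    and "framed_closed_submanifold M F"
    and "smooth_map_on M F"
    and "continuous_on M s" and "s ` M \<subseteq> sphere 0 1"
  shows "\<forall>\<^sub>F \<epsilon> in at_right 0.
    (let Msh = shift F \<epsilon> ` M;
         N = M \<union> Msh;
         G = union_framing M (reflect_framing F)
               (transport_framing (shift F \<epsilon>) M (reframe s F))
     in inj_on (shift F \<epsilon>) M \<and> M \<inter> Msh = {} \<and> framed_closed_submanifold N G \<and>
        pontryagin_class N G = induced_map hopf (circle_class M F s) \<and>
        pontryagin_class N G \<in> sphere_homotopy_group)"
proof -
  note F = assms(2) and sm = assms(3) and s = assms(4,5)
  have M: "closed_submanifold 2 M" and fr: "framing M F"
    using F by (auto simp: framed_closed_submanifold_def)
  have s1: "cmod (s x) = 1" if "x \<in> M" for x using s(2) that by auto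
  obtain r where r: "tubular_radius M F r" by (rule tubular_radius_exists[OF F])
  have r0: "r > 0" using r by (simp add: tubular_radius_def)
  obtain e0 where e0: "e0 > 0" and sh:
    "\<And>\<epsilon>. 0 < \<epsilon> \<Longrightarrow> \<epsilon> < e0 \<Longrightarrow> inj_on (shift F \<epsilon>) M \<and> M \<inter> shift F \<epsilon> ` M = {} \<and>
        closed_submanifold 2 (shift F \<epsilon> ` M) \<and>
        framing (shift F \<epsilon> ` M) (transport_framing (shift F \<epsilon>) M (reframe s F)) \<and>
        (\<forall>p\<in>M. \<forall>n\<in>normal_space M p. norm n / 2 \<le> norm (closest_point (normal_space (shift F \<epsilon> ` M) (shift F \<epsilon> p)) n))"
    using shifted_copy[OF F sm s(1) s1] by metis
  define e1 where "e1 = min e0 (min (r / 5) 1)"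
  have e1: "e1 > 0" using e0 r0 by (simp add: e1_def)
  show ?thesis
  proof (rule eventually_at_rightI[OF _ e1])
    fix \<epsilon> assume "\<epsilon> \<in> {0<..<e1}"
    then have \<epsilon>: "0 < \<epsilon>" "\<epsilon> < e0" "\<epsilon> < r / 5" "\<epsilon> < 1" by (auto simp: e1_def)
    \<comment> \<open>half the distance of the copies; the support of radius \<open>\<rho>\<close> around the centre \<open>h\<close> just fits into the tube\<close>
    define h where "h = \<epsilon> / 2"
    define \<rho> where "\<rho> = r - h"
    have h: "0 < h" "4 * h < \<rho>" "h + \<rho> \<le> r" "h \<le> 1" "\<rho> \<le> r" and h2: "2 * h = \<epsilon>"
      using \<epsilon> by (auto simp: h_def \<rho>_def)
    define Msh where "Msh = shift F \<epsilon> ` M"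
    define N where "N = M \<union> Msh"
    define G where "G = union_framing M (reflect_framing F) (transport_framing (shift F \<epsilon>) M (reframe s F))"
    note S = sh[OF \<epsilon>(1,2), folded Msh_def]
    have inj: "inj_on (shift F \<epsilon>) M" and dis: "M \<inter> Msh = {}" and cMsh: "closed_submanifold 2 Msh"
      and frs: "framing Msh (transport_framing (shift F \<epsilon>) M (reframe s F))" using S by auto
    have "closed M" "closed Msh" using M cMsh by (auto simp: closed_submanifold_def compact_imp_closed)
    then have NG: "framed_closed_submanifold N G"
      unfolding framed_closed_submanifold_def N_def G_def
      using closed_submanifold_Un[OF M cMsh dis] framing_Un[OF reflect_framing_is_framing[OF fr] _ frs _ dis] by simp
    obtain rN where rN: "tubular_radius N G rN" by (rule tubular_radius_exists[OF NG])
    have pl: "pointed_map (tube_lift M F r h \<rho> s 0)"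
      by (rule pointed_map_tube_lift[OF F r h(1) _ _ s]) (use h in auto)
    have hom: "homotopic_with_canon (\<lambda>_. True) M (sphere 0 1) s s" using s by (simp add: image_subset_iff_funcset)
    have "pontryagin_class N G = homotopy_class (collapse_map N G rN)" by (rule pontryagin_class_eq[OF NG rN])
    also have "\<dots> = homotopy_class (hopf \<circ> tube_lift M F r h \<rho> s h)"
    proof (rule homotopy_class_eqI[OF double_collapse[OF F r s h(1,2,3)], symmetric, unfolded h2])
      show "tubular_radius N G rN" by (rule rN)
    qed (use S NG in \<open>simp_all add: N_def G_def Msh_def\<close>)
    also have "\<dots> = homotopy_class (hopf \<circ> tube_lift M F r h \<rho> s 0)"
      by (rule homotopy_class_eqI[OF pointed_homotopic_compose_left[OF tube_lift_homotopic[OF F r h(1) _ _ _ hom] pointed_map_hopf]])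
        (use h in auto)
    also have "\<dots> = induced_map hopf (homotopy_class (tube_lift M F r h \<rho> s 0))"
      by (rule induced_map_homotopy_class[OF pl pointed_map_hopf, symmetric])
    also have "homotopy_class (tube_lift M F r h \<rho> s 0) = circle_class M F s"
      by (rule circle_class_eq[OF F sm s r h(1,2,4,5), symmetric])
    finally show "let Msh = shift F \<epsilon> ` M; N = M \<union> Msh;
         G = union_framing M (reflect_framing F) (transport_framing (shift F \<epsilon>) M (reframe s F))
     in inj_on (shift F \<epsilon>) M \<and> M \<inter> Msh = {} \<and> framed_closed_submanifold N G \<and>
        pontryagin_class N G = induced_map hopf (circle_class M F s) \<and>
        pontryagin_class N G \<in> sphere_homotopy_group"
      using inj dis NG pontryagin_class_in_group[OF NG] unfolding Let_def N_def G_def Msh_def by simp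
  qed
qed

end
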